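(* Let $K\ge2$ be sufficiently large. Then for any $\varepsilon>0$ and any real $t$ with $|t|\ll K^{1-\varepsilon}$, $$\frac1K\sum_{K<k\le 2K}\left|L\left(\tfrac12+it,\phi_k\right)\right|^2\ll_{q,\varepsilon}K^{\varepsilon}.$$
   Context: Fix a prime $q>8$ with $q\equiv 1 \pmod 4$ such that the real quadratic field $F=\mathbb{Q}(\sqrt q)$ (of discriminant $q$) has narrow class number $1$. Let $\mathcal{O}$ be its ring of integers, $\epsilon_q>1$ its fundamental unit, $\tilde\alpha$ the Galois conjugate of $\alpha$. For an integer $k\ge1$ let $\Xi_k$ be the Hecke Grössencharacter given on nonzero ideals $(\alpha)\subset\mathcal{O}$ by $$\Xi_k((\alpha))=\left|\frac{\alpha}{\tilde\alpha}\right|^{\frac{\pi i k}{\log\epsilon_q}} .$$ $L(s,\phi_k)$ denotes the Hecke $L$-function of $\Xi_k$ (equivalently, of the dihedral Maass form $\phi_k$ attached to $\Xi_k$): it is the analytic continuation to $\mathbb{C}$ of $$\sum_{0\ne\mathfrak a\subset\mathcal{O}}\frac{\Xi_k(\mathfrak a)}{\mathrm{N}(\mathfrak a)^s}=\sum_{n\ge1}\frac{a_k(n)}{n^s},\quad \Re(s)>1,\qquad a_k(n)=\sum_{\mathrm{N}(\mathfrak a)=n}\Xi_k(\mathfrak a),$$ where $\mathfrak a$ runs over integral ideals. The sum in the claim is over integers $k$. As is conventional, $\varepsilon$ denotes an arbitrarily small positive number. *)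

theory Defs
  imports "HOL-Complex_Analysis.Complex_Analysis" "HOL-Algebra.QuotRing"
begin

definition quad_field :: "nat \<Rightarrow> real set" where
  "quad_field q = {a + b * sqrt (real q) | a b. a \<in> \<rat> \<and> b \<in> \<rat>}"

text \<open>The Galois conjugation; well defined whenever \<open>q\<close> is not a perfect square.\<close>

definition conjugate :: "nat \<Rightarrow> real \<Rightarrow> real" where
  "conjugate q x = (THE y. \<exists>a b. a \<in> \<rat> \<and> b \<in> \<rat> \<and>
      x = a + b * sqrt (real q) \<and> y = a - b * sqrt (real q))"

definition integer_ring :: "nat \<Rightarrow> real ring" where
  "integer_ring q = \<lparr>carrier = {x \<in> quad_field q. algebraic_int x},
     monoid.mult = (*), one = 1, zero = 0, add = (+)\<rparr>"

definition nonzero_ideals :: "nat \<Rightarrow> real set set" where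
  "nonzero_ideals q = {I. ideal I (integer_ring q) \<and> I \<noteq> {0}}"

definition ideal_norm :: "nat \<Rightarrow> real set \<Rightarrow> nat" where
  "ideal_norm q I = card (carrier (integer_ring q Quot I))"

definition fractional_ideals :: "nat \<Rightarrow> real set set" where
  "fractional_ideals q =
     {(\<lambda>x. c * x) ` I | c I. c \<in> quad_field q \<and> c \<noteq> 0 \<and> I \<in> nonzero_ideals q}"

definition totally_positive :: "nat \<Rightarrow> real \<Rightarrow> bool" where
  "totally_positive q x \<longleftrightarrow> x \<in> quad_field q \<and> x > 0 \<and> conjugate q x > 0"

text \<open>The classes of this relation are the cosets, in the group of fractional ideals, of the
  subgroup of principal fractional ideals having a totally positive generator.\<close>

definition narrow_equiv :: "nat \<Rightarrow> (real set \<times> real set) set" where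
  "narrow_equiv q = {(I, J). I \<in> fractional_ideals q \<and> J \<in> fractional_ideals q \<and>
     (\<exists>c. totally_positive q c \<and> J = (\<lambda>x. c * x) ` I)}"

definition narrow_class_number :: "nat \<Rightarrow> nat" where
  "narrow_class_number q = card (fractional_ideals q // narrow_equiv q)"

definition fundamental_unit :: "nat \<Rightarrow> real" where
  "fundamental_unit q = (THE u. u > 1 \<and>
     Units (integer_ring q) = {s * u powi n | s n. s \<in> {1, -1}})"

text \<open>The value does not depend on the chosen generator: replacing \<open>\<alpha>\<close> by \<open>\<plusminus> u ^ n \<alpha>\<close>, where \<open>u\<close> is the
  fundamental unit, multiplies the absolute value by \<open>u ^ (2 n)\<close>, hence the result by
  \<open>exp (2 \<pi> i k n) = 1\<close>.\<close>

definition hecke_char :: "nat \<Rightarrow> nat \<Rightarrow> real set \<Rightarrow> complex" where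
  "hecke_char q k I =
     (let \<alpha> = (SOME \<alpha>. \<alpha> \<in> carrier (integer_ring q) \<and> I = PIdl\<^bsub>integer_ring q\<^esub> \<alpha>)
      in complex_of_real \<bar>\<alpha> / conjugate q \<alpha>\<bar> powr
           (complex_of_real (pi * real k / ln (fundamental_unit q)) * \<i>))"

text \<open>The unique entire function given by the Dirichlet series over ideals on the half plane of
  absolute convergence.\<close>

definition hecke_L :: "nat \<Rightarrow> nat \<Rightarrow> complex \<Rightarrow> complex" where
  "hecke_L q k = (THE f. f holomorphic_on UNIV \<and>
     (\<forall>s. Re s > 1 \<longrightarrow>
        ((\<lambda>I. hecke_char q k I / of_nat (ideal_norm q I) powr s) has_sum f s) (nonzero_ideals q)))"

end

theory Submission
  imports Defs "HOL-Probability.Probability" "HOL-Real_Asymp.Real_Asymp"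
begin


text \<open>Every ideal is principal with a generator that is unique in a fundamental domain of the units, so
  the Dirichlet series is a sum over lattice points. Two-dimensional theta inversion and a Mellin
  transform continue it and give the functional equation. The coefficients over the lattice points of
  norm about \<open>2 ^ j\<close> are exponentials \<open>exp (2 \<pi> i k \<theta>)\<close>, so their mean square over \<open>k\<close> is controlled by
  counting pairs with nearby \<open>\<theta>\<close>; such pairs have a small integer determinant. In place of a smooth
  approximate functional equation with Stirling asymptotics, the error of the sharp one (length
  \<open>X = 2 ^ J\<close> of the order of \<open>K\<close>) is bounded by the maximum modulus principle: multiplied by
  \<open>X ^ w exp (w^2)\<close> and shifted to \<open>Re w = 1\<close> and \<open>Re w = - 1\<close>, it involves only tails of the absolutely
  convergent series and short sums, where gamma quotients have exactly computable absolute value.\<close>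

section \<open>Arithmetic of the maximal order\<close>

text \<open>The size of the family fixes the lengths. For \<open>t\<close> small against
  \<open>K\<close> the analytic conductor at \<open>1/2 + it\<close> is of order \<open>K^2\<close>,
  so each sum has length about \<open>K\<close>, as many terms as there are characters; the large
  sieve then loses only powers of a logarithm, which \<open>K powr \<epsilon>\<close> absorbs. The
  restriction on \<open>t\<close> enters through \<open>shift_quad\<close>: for
  \<open>|t| <= hecke_freq k / 2\<close> it is at least a constant times \<open>k^2\<close>, which
  makes the gamma quotients comparable for all \<open>k\<close> of the family. The cut is at a power
  of two, so that both the sums and the tails consist of whole norm blocks. The edge bounds are
  bounds for the mean square over \<open>k\<close>, far stronger than what is available for an
  individual \<open>k\<close>; therefore the maximum principle has to be applied to the whole vector
  of values and not to one \<open>k\<close> at a time. Positivity of \<open>k\<close> removes the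
  poles: the constant term of the theta function is orthogonal to a nontrivial character of the unit
  circle group. Constants may depend on \<open>q\<close>, hence on the fundamental unit, so the
  fundamental domain counts as a region of bounded shape, in which the norm controls the
  coordinates.\<close>

lemma Ints_if_bounded_denominator_powers:
  fixes y :: real
  assumes "y \<in> \<rat>" "d > 0" and pow: "\<And>j. of_int d * y ^ j \<in> \<int>"
  shows "y \<in> \<int>"
proof -
  from \<open>y \<in> \<rat>\<close> obtain a b where ab: "b > 0" "Rings.coprime a b" "y = of_int a / of_int b"
    by (auto elim: Rats_cases')
  have dvd: "b ^ j dvd d" for j
  proof -
    from pow[of j] obtain m where "of_int d * y ^ j = real_of_int m" by (auto elim: Ints_cases)
    then have "of_int d * of_int a ^ j = real_of_int m * of_int b ^ j"
      using ab by (simp add: power_divide field_simps)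
    then have "d * a ^ j = m * b ^ j"
      by (metis of_int_eq_iff of_int_mult of_int_power)
    then have "b ^ j dvd d * a ^ j" by simp
    moreover have "Rings.coprime (b ^ j) (a ^ j)"
      using ab(2) by (simp add: coprime_commute)
    ultimately show ?thesis
      using coprime_dvd_mult_left_iff by blast
  qed
  \<comment> \<open>Every power of \<open>b\<close> divides the fixed \<open>d\<close>. If
    \<open>b >= 2\<close>, the power with exponent \<open>d\<close> already exceeds
    \<open>d\<close>, because \<open>d < 2 ^ d\<close>.\<close>
  have "b = 1"
  proof (rule ccontr)
    assume "b \<noteq> 1"
    then have "b \<ge> 2" using ab by simp
    have "int n < 2 ^ n" for n :: nat by (metis of_nat_less_two_power)
    then have "d < 2 ^ nat d" using \<open>d > 0\<close> by (metis nat_0_le order_less_imp_le)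
    also have "(2::int) ^ nat d \<le> b ^ nat d" using \<open>b \<ge> 2\<close> by (intro power_mono) auto
    also have "\<dots> \<le> d" using dvd[of "nat d"] \<open>d > 0\<close> by (rule zdvd_imp_le)
    finally show False by simp
  qed
  with ab show ?thesis by simp
qed

text \<open>For \<open>q = 1\<close> modulo 4 the maximal order is spanned by \<open>1\<close> and
  \<open>om\<close>, a root of \<open>x^2 - x - q div 4\<close>. Elements are pairs of integer
  coordinates; \<open>val\<close> and \<open>con\<close> are the two real embeddings, and
  \<open>qmul\<close> and \<open>qnorm\<close> are dictated by that polynomial. Pairs keep gcds,
  determinants and counting inside the integers.\<close>

definition om :: "nat \<Rightarrow> real" where "om q = (1 + sqrt (real q)) / 2"
definition omc :: "nat \<Rightarrow> real" where "omc q = (1 - sqrt (real q)) / 2"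

definition val :: "nat \<Rightarrow> int \<times> int \<Rightarrow> real" where
  "val q z = of_int (fst z) + of_int (snd z) * om q"
definition con :: "nat \<Rightarrow> int \<times> int \<Rightarrow> real" where
  "con q z = of_int (fst z) + of_int (snd z) * omc q"

definition qmul :: "nat \<Rightarrow> int \<times> int \<Rightarrow> int \<times> int \<Rightarrow> int \<times> int" where
  "qmul q z w = (fst z * fst w + int (q div 4) * snd z * snd w,
     fst z * snd w + snd z * fst w + snd z * snd w)"

definition qnorm :: "nat \<Rightarrow> int \<times> int \<Rightarrow> int" where
  "qnorm q z = fst z * fst z + fst z * snd z - int (q div 4) * snd z * snd z"

locale real_quad =
  fixes q :: nat
  assumes prime_q: "prime q" and q_mod_4: "q mod 4 = 1"
begin

lemma q_ge_5: "q \<ge> 5"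
  using prime_q q_mod_4 prime_ge_2_nat[OF prime_q] by (cases "q = 2 \<or> q = 3 \<or> q = 4") auto

lemma sqrt_q_sq [simp]: "sqrt (real q) * sqrt (real q) = real q"
  by simp

lemma sqrt_q_gt_2: "sqrt (real q) > 2"
  using q_ge_5 real_less_rsqrt[of 2 "real q"] by simp

lemma q_div_4: "real q = 4 * real (q div 4) + 1"
  using q_mod_4 by (metis add.commute mult.commute of_nat_1 of_nat_add of_nat_mult of_nat_numeral mult_div_mod_eq)

lemma om_sq: "om q * om q = om q + real (q div 4)" "omc q * omc q = omc q + real (q div 4)"
  "om q * omc q = - real (q div 4)" "om q + omc q = 1" "om q - omc q = sqrt (real q)"
  using q_div_4 by (auto simp: om_def omc_def field_simps)

lemma val_mul: "val q (qmul q z w) = val q z * val q w"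
proof -
  have "val q z * val q w = of_int (fst z) * of_int (fst w)
    + (of_int (fst z) * of_int (snd w) + of_int (snd z) * of_int (fst w)) * om q
    + of_int (snd z) * of_int (snd w) * (om q * om q)"
    by (simp add: val_def algebra_simps)
  then show ?thesis by (simp only: om_sq) (simp add: val_def qmul_def algebra_simps)
qed

lemma con_mul: "con q (qmul q z w) = con q z * con q w"
proof -
  have "con q z * con q w = of_int (fst z) * of_int (fst w)
    + (of_int (fst z) * of_int (snd w) + of_int (snd z) * of_int (fst w)) * omc q
    + of_int (snd z) * of_int (snd w) * (omc q * omc q)"
    by (simp add: con_def algebra_simps)
  then show ?thesis by (simp only: om_sq) (simp add: con_def qmul_def algebra_simps)
qed

lemma val_con: "val q z * con q z = of_int (qnorm q z)"
proof -
  have "val q z * con q z = of_int (fst z) * of_int (fst z)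
    + of_int (fst z) * of_int (snd z) * (om q + omc q)
    + of_int (snd z) * of_int (snd z) * (om q * omc q)"
    by (simp add: con_def val_def algebra_simps)
  then show ?thesis by (simp only: om_sq) (simp add: qnorm_def algebra_simps)
qed

lemma sqrt_q_irrational: "sqrt (real q) \<notin> \<rat>"
proof
  assume "sqrt (real q) \<in> \<rat>"
  then have "sqrt (real q) \<in> \<int>"
    by (intro rational_algebraic_int_is_int) auto
  then obtain m where m: "sqrt (real q) = of_int m" by (auto elim: Ints_cases)
  then have "real q = of_int m * of_int m" by (metis sqrt_q_sq)
  then have "int q = m * m" by (metis of_int_eq_iff of_int_mult of_int_of_nat_eq)
  then have "int q = int (nat \<bar>m\<bar> * nat \<bar>m\<bar>)" by simp
  then have "q = nat \<bar>m\<bar> * nat \<bar>m\<bar>" by (rule of_nat_eq_iff[THEN iffD1])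
  then have "prime (nat \<bar>m\<bar> * nat \<bar>m\<bar>)" using prime_q by simp
  then have "nat \<bar>m\<bar> = 1" by (metis prime_product)
  with \<open>prime (nat \<bar>m\<bar> * nat \<bar>m\<bar>)\<close> show False by simp
qed

lemma quad_unique:
  assumes "a \<in> \<rat>" "b \<in> \<rat>" "a' \<in> \<rat>" "b' \<in> \<rat>"
    "a + b * sqrt (real q) = a' + b' * sqrt (real q)"
  shows "a = a'" "b = b'"
proof -
  show "b = b'"
  proof (rule ccontr)
    assume "b \<noteq> b'"
    then have "sqrt (real q) = (a' - a) / (b - b')" using assms(5) by (simp add: field_simps)
    moreover have "(a' - a) / (b - b') \<in> \<rat>" using assms by auto
    ultimately show False using sqrt_q_irrational by simp
  qed
  with assms show "a = a'" by simp
qed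

lemma conjugate_eq:
  assumes "a \<in> \<rat>" "b \<in> \<rat>"
  shows "conjugate q (a + b * sqrt (real q)) = a - b * sqrt (real q)"
  unfolding conjugate_def
proof (rule the_equality)
  show "\<exists>a' b'. a' \<in> \<rat> \<and> b' \<in> \<rat> \<and> a + b * sqrt (real q) = a' + b' * sqrt (real q) \<and>
     a - b * sqrt (real q) = a' - b' * sqrt (real q)"
    using assms by blast
next
  fix y assume "\<exists>a' b'. a' \<in> \<rat> \<and> b' \<in> \<rat> \<and> a + b * sqrt (real q) = a' + b' * sqrt (real q) \<and>
     y = a' - b' * sqrt (real q)"
  then obtain a' b' where *: "a' \<in> \<rat>" "b' \<in> \<rat>" "a + b * sqrt (real q) = a' + b' * sqrt (real q)"
     "y = a' - b' * sqrt (real q)" by blast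
  from quad_unique[OF assms *(1-3)] *(4) show "y = a - b * sqrt (real q)" by simp
qed

lemma val_eq: "val q z = (of_int (fst z) + of_int (snd z) / 2) + (of_int (snd z) / 2) * sqrt (real q)"
  and con_eq: "con q z = (of_int (fst z) + of_int (snd z) / 2) - (of_int (snd z) / 2) * sqrt (real q)"
  by (auto simp: val_def con_def om_def omc_def field_simps)

lemma half_Rats: "of_int (fst z) + of_int (snd z) / 2 \<in> (\<rat>::real set)"
  "of_int (snd z) / 2 \<in> (\<rat>::real set)"
  by auto

lemma conjugate_val [simp]: "conjugate q (val q z) = con q z"
  unfolding val_eq con_eq by (rule conjugate_eq) (rule half_Rats)+

lemma val_in_quad_field: "val q z \<in> quad_field q"
  unfolding val_eq quad_field_def using half_Rats by blast

lemma val_inj: "val q z = val q w \<longleftrightarrow> z = w"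
proof
  assume "val q z = val q w"
  then have "of_int (fst z) + of_int (snd z) / 2 = of_int (fst w) + (of_int (snd w) / 2 :: real)"
    "of_int (snd z) / 2 = (of_int (snd w) / 2 :: real)"
    unfolding val_eq using quad_unique[OF half_Rats half_Rats] by blast+
  then show "z = w" by (auto simp: prod_eq_iff)
qed simp

lemma algebraic_int_val: "algebraic_int (val q z)"
proof (rule algebraic_int.intros[of "[:of_int (qnorm q z), - of_int (2 * fst z + snd z), 1:]"])
  \<comment> \<open>The witness polynomial has the trace and the norm as coefficients; its roots are
    \<open>val q z\<close> and \<open>con q z\<close>.\<close>
  have "con q z = of_int (2 * fst z + snd z) - val q z" by (simp add: val_eq con_eq)
  then have "val q z * (of_int (2 * fst z + snd z) - val q z) = of_int (qnorm q z)"
    using val_con[of z] by simp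
  then show "poly [:of_int (qnorm q z), - of_int (2 * fst z + snd z), 1:] (val q z) = 0"
    by (simp add: algebra_simps)
qed (auto simp: coeff_pCons split: nat.splits)

text \<open>The order of index two in the maximal order. It serves to measure denominators, since
  membership can be read off the rational coordinates.\<close>

definition zsqrt :: "real set" where
  "zsqrt = {of_int r + of_int s * sqrt (real q) | r s. True}"

lemma zsqrtI: "of_int r + of_int s * sqrt (real q) \<in> zsqrt"
  unfolding zsqrt_def by blast

lemma zsqrt_of_int [simp]: "of_int r \<in> zsqrt"
  using zsqrtI[of r 0] by simp

lemma zsqrt_add: "x \<in> zsqrt \<Longrightarrow> y \<in> zsqrt \<Longrightarrow> x + y \<in> zsqrt"
proof -
  assume "x \<in> zsqrt" "y \<in> zsqrt"
  then obtain a b c d where "x = of_int a + of_int b * sqrt (real q)"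
    "y = of_int c + of_int d * sqrt (real q)" unfolding zsqrt_def by blast
  then have "x + y = of_int (a + c) + of_int (b + d) * sqrt (real q)" by (simp add: algebra_simps)
  then show ?thesis using zsqrtI by metis
qed

lemma zsqrt_mult: "x \<in> zsqrt \<Longrightarrow> y \<in> zsqrt \<Longrightarrow> x * y \<in> zsqrt"
proof -
  assume "x \<in> zsqrt" "y \<in> zsqrt"
  then obtain a b c d where xy: "x = of_int a + of_int b * sqrt (real q)"
    "y = of_int c + of_int d * sqrt (real q)" unfolding zsqrt_def by blast
  have "x * y = of_int a * of_int c + of_int b * of_int d * (sqrt (real q) * sqrt (real q))
     + (of_int a * of_int d + of_int b * of_int c) * sqrt (real q)"
    unfolding xy by (simp only: algebra_simps)
  also have "\<dots> = of_int (a * c + b * d * int q) + of_int (a * d + b * c) * sqrt (real q)" by simp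
  finally show ?thesis using zsqrtI by metis
qed

lemma zsqrt_power: "x \<in> zsqrt \<Longrightarrow> x ^ j \<in> zsqrt"
  using zsqrt_of_int[of 1] by (induction j) (auto intro: zsqrt_mult)

lemma zsqrt_sum: "(\<And>i. i \<in> I \<Longrightarrow> f i \<in> zsqrt) \<Longrightarrow> sum f I \<in> zsqrt"
  using zsqrt_of_int[of 0] by (induction I rule: infinite_finite_induct) (auto intro: zsqrt_add)

lemma zsqrt_Rats: "x \<in> zsqrt \<Longrightarrow> x \<in> \<rat> \<Longrightarrow> x \<in> \<int>"
proof -
  assume "x \<in> zsqrt" "x \<in> \<rat>"
  then obtain a b where "x = of_int a + of_int b * sqrt (real q)" unfolding zsqrt_def by blast
  moreover from this have "x + 0 * sqrt (real q) = of_int a + of_int b * sqrt (real q)" by simp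
  then have "x = of_int a" using \<open>x \<in> \<rat>\<close> quad_unique(1)[of x 0 "of_int a" "of_int b"] by simp
  ultimately show ?thesis by simp
qed

text \<open>Powers below the degree \<open>n\<close> of a monic integral equation have denominator
  dividing \<open>D ^ n\<close>; the equation expresses each higher power through lower ones with
  integer coefficients, so no new denominators appear.\<close>

lemma algebraic_int_common_denominator:
  assumes "algebraic_int x" "of_int D * x \<in> zsqrt" "D > 0"
  shows "\<exists>n. \<forall>j. of_int (D ^ n) * x ^ j \<in> zsqrt"
proof -
  from assms(1) obtain p where p: "lead_coeff p = 1" "\<forall>i. coeff p i \<in> \<int>" "poly p x = 0"
    by (auto simp: algebraic_int.simps)
  define n where "n = degree p"
  have "of_int (D ^ n) * x ^ j \<in> zsqrt" for j
  proof (induction j rule: less_induct)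
    case (less j)
    show ?case
    proof (cases "j < n")
      case True
      then have "D ^ n = D ^ (n - j) * D ^ j" by (simp flip: power_add)
      then have "of_int (D ^ n) * x ^ j = of_int (D ^ (n - j)) * (of_int D * x) ^ j"
        by (simp add: power_mult_distrib)
      then show ?thesis using assms(2) by (auto intro: zsqrt_mult zsqrt_power zsqrt_of_int simp del: of_int_power)
    next
      case False
      have "0 = (\<Sum>i\<le>n. coeff p i * x ^ i)" using p by (simp add: poly_altdef n_def)
      also have "{..n} = insert n {..<n}" by auto
      also have "(\<Sum>i\<in>\<dots>. coeff p i * x ^ i) = x ^ n + (\<Sum>i<n. coeff p i * x ^ i)"
        using p by (simp add: n_def)
      finally have "x ^ n = - (\<Sum>i<n. coeff p i * x ^ i)" by simp
      moreover have "x ^ j = x ^ (j - n) * x ^ n" using False by (simp flip: power_add)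
      ultimately have "x ^ j = - (\<Sum>i<n. coeff p i * x ^ (j - n + i))"
        by (simp add: sum_distrib_left power_add mult_ac)
      then have "of_int (D ^ n) * x ^ j = of_int (-1) * (\<Sum>i<n. coeff p i * (of_int (D ^ n) * x ^ (j - n + i)))"
        by (simp add: sum_distrib_left mult_ac sum_negf)
      moreover have "(\<Sum>i<n. coeff p i * (of_int (D ^ n) * x ^ (j - n + i))) \<in> zsqrt"
      proof (rule zsqrt_sum)
        fix i assume "i \<in> {..<n}"
        then have "j - n + i < j" using False by simp
        from less[OF this] have "of_int (D ^ n) * x ^ (j - n + i) \<in> zsqrt" .
        moreover have "coeff p i \<in> \<int>" using p(2) by blast
        then have "coeff p i \<in> zsqrt" by (auto elim!: Ints_cases)
        ultimately show "coeff p i * (of_int (D ^ n) * x ^ (j - n + i)) \<in> zsqrt" using zsqrt_mult by blast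
      qed
      ultimately show ?thesis using zsqrt_mult[OF zsqrt_of_int] by metis
    qed
  qed
  then show ?thesis by blast
qed

lemma Rats_common_denominator:
  assumes "a \<in> \<rat>" "b \<in> \<rat>"
  shows "\<exists>D::int. D > 0 \<and> of_int D * a \<in> (\<int>::real set) \<and> of_int D * b \<in> (\<int>::real set)"
proof -
  from assms(1) obtain m n where "n > 0" "a = of_int m / of_int n" by (rule Rats_cases')
  moreover from assms(2) obtain r s where "s > 0" "b = of_int r / of_int s" by (rule Rats_cases')
  ultimately have *: "n * s > 0" "of_int (n * s) * a = of_int (m * s)" "of_int (n * s) * b = of_int (r * n)" by auto
  show ?thesis by (intro exI[of _ "n * s"]) (unfold *(2,3), use *(1) in auto)
qed

lemma quad_conj_power:
  assumes "a \<in> \<rat>" "b \<in> \<rat>"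
  shows "\<exists>c\<in>\<rat>. \<exists>d\<in>\<rat>. (a + b * sqrt (real q)) ^ j = c + d * sqrt (real q) \<and>
     (a - b * sqrt (real q)) ^ j = c - d * sqrt (real q)"
proof (induction j)
  case 0
  show ?case by (intro bexI[of _ 1] bexI[of _ 0]) auto
next
  case (Suc j)
  then obtain c d where cd: "c \<in> \<rat>" "d \<in> \<rat>" "(a + b * sqrt (real q)) ^ j = c + d * sqrt (real q)"
     "(a - b * sqrt (real q)) ^ j = c - d * sqrt (real q)" by blast
  have "(a + b * sqrt (real q)) * (c + d * sqrt (real q)) = a * c + b * d * (sqrt (real q) * sqrt (real q)) + (a * d + b * c) * sqrt (real q)"
       "(a - b * sqrt (real q)) * (c - d * sqrt (real q)) = a * c + b * d * (sqrt (real q) * sqrt (real q)) - (a * d + b * c) * sqrt (real q)"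
    by (simp_all only: algebra_simps)
  then have "(a + b * sqrt (real q)) ^ Suc j = (a * c + b * d * real q) + (a * d + b * c) * sqrt (real q)"
       "(a - b * sqrt (real q)) ^ Suc j = (a * c + b * d * real q) - (a * d + b * c) * sqrt (real q)"
    using cd by simp_all
  moreover have "a * c + b * d * real q \<in> \<rat>" "a * d + b * c \<in> \<rat>" using cd assms by auto
  ultimately show ?case by blast
qed

text \<open>The powers of \<open>x\<close>, and by conjugation those of \<open>y\<close>, share a
  denominator \<open>d\<close>; hence all powers of \<open>x + y\<close> and \<open>x * y\<close>
  have denominator \<open>d * d\<close>. A rational number whose powers have bounded denominators is
  an integer.\<close>

lemma algebraic_int_trace_norm:
  assumes "a \<in> \<rat>" "b \<in> \<rat>" "algebraic_int (a + b * sqrt (real q))"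
  shows "2 * a \<in> \<int>" "a\<^sup>2 - real q * b\<^sup>2 \<in> \<int>"
proof -
  define x where "x = a + b * sqrt (real q)"
  define y where "y = a - b * sqrt (real q)"
  obtain D where D: "D > 0" "of_int D * a \<in> \<int>" "of_int D * b \<in> \<int>"
    using Rats_common_denominator[OF assms(1,2)] by blast
  then obtain r s where "of_int D * a = of_int r" "of_int D * b = of_int s" by (auto elim!: Ints_cases)
  then have "of_int D * x = of_int r + of_int s * sqrt (real q)" by (simp add: x_def algebra_simps)
  then have "of_int D * x \<in> zsqrt" by (simp add: zsqrtI)
  then obtain n where n: "\<And>j. of_int (D ^ n) * x ^ j \<in> zsqrt"
    using algebraic_int_common_denominator assms(3) D(1) unfolding x_def by blast
  define d where "d = D ^ n"
  have d: "d > 0" using D by (simp add: d_def)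
  have xj: "of_int d * x ^ j \<in> zsqrt" for j using n by (simp add: d_def)
  have yj: "of_int d * y ^ j \<in> zsqrt" for j
  proof -
    obtain c e where ce: "c \<in> \<rat>" "e \<in> \<rat>" "x ^ j = c + e * sqrt (real q)" "y ^ j = c - e * sqrt (real q)"
      using quad_conj_power[OF assms(1,2)] unfolding x_def y_def by blast
    obtain r s where rs: "of_int d * x ^ j = of_int r + of_int s * sqrt (real q)"
      using xj[of j] unfolding zsqrt_def by blast
    then have "(of_int d * c) + (of_int d * e) * sqrt (real q) = of_int r + of_int s * sqrt (real q)"
      using ce by (simp add: algebra_simps)
    then have "of_int d * c = of_int r" "of_int d * e = of_int s"
      using ce quad_unique[of "of_int d * c" "of_int d * e" "of_int r" "of_int s"] by auto
    moreover have "of_int d * y ^ j = (of_int d * c) - (of_int d * e) * sqrt (real q)"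
      unfolding ce(4) by (simp add: algebra_simps)
    ultimately have "of_int d * y ^ j = of_int r + of_int (- s) * sqrt (real q)" by simp
    then show ?thesis using zsqrtI by metis
  qed
  have d2: "d * d > 0" using d by simp
  have tr: "of_int (d * d) * (x + y) ^ j \<in> zsqrt" for j
  proof -
    have "of_int (d * d) * (x + y) ^ j = (\<Sum>i\<le>j. of_int (int (j choose i)) * ((of_int d * x ^ i) * (of_int d * y ^ (j - i))))"
      unfolding binomial_ring sum_distrib_left by (intro sum.cong) (simp_all add: mult_ac)
    also have "\<dots> \<in> zsqrt" by (rule zsqrt_sum) (rule zsqrt_mult[OF zsqrt_of_int zsqrt_mult[OF xj yj]])
    finally show ?thesis .
  qed
  have xy: "x + y = 2 * a" "x * y = a\<^sup>2 - real q * b\<^sup>2"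
    by (auto simp: x_def y_def algebra_simps power2_eq_square)
  show "2 * a \<in> \<int>"
  proof (rule Ints_if_bounded_denominator_powers[OF _ d2])
    fix j show "of_int (d * d) * (2 * a) ^ j \<in> \<int>"
      using tr[of j] assms(1) by (intro zsqrt_Rats) (auto simp: xy)
  qed (use assms in auto)
  have no: "of_int (d * d) * (x * y) ^ j \<in> zsqrt" for j
  proof -
    have "of_int (d * d) * (x * y) ^ j = (of_int d * x ^ j) * (of_int d * y ^ j)"
      by (simp add: power_mult_distrib)
    then show ?thesis using xj yj zsqrt_mult by metis
  qed
  show "a\<^sup>2 - real q * b\<^sup>2 \<in> \<int>"
  proof (rule Ints_if_bounded_denominator_powers[OF _ d2])
    fix j show "of_int (d * d) * (a\<^sup>2 - real q * b\<^sup>2) ^ j \<in> \<int>"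
      using no[of j] assms by (intro zsqrt_Rats) (auto simp: xy)
  qed (use assms in auto)
qed

text \<open>With integral trace \<open>T\<close> and norm \<open>N\<close> one has
  \<open>T^2 - q * (2 b)^2 = 4 N\<close>. So \<open>q * (2 b)\<close> has an integral square and is
  an integer \<open>r\<close>; primality gives \<open>q dvd r\<close>, hence \<open>2 b\<close> is
  an integer \<open>S\<close>. Since \<open>q\<close> is odd, the equation makes \<open>T\<close>
  and \<open>S\<close> congruent modulo 2, which is the condition for \<open>om\<close>
  coordinates.\<close>

lemma integer_ring_carrier: "carrier (integer_ring q) = range (val q)"
proof (intro equalityI subsetI)
  fix x assume "x \<in> range (val q)"
  then show "x \<in> carrier (integer_ring q)"
    by (auto simp: integer_ring_def val_in_quad_field algebraic_int_val)
next
  fix x assume "x \<in> carrier (integer_ring q)"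
  then obtain a b where ab: "a \<in> \<rat>" "b \<in> \<rat>" "x = a + b * sqrt (real q)" "algebraic_int x"
    by (auto simp: integer_ring_def quad_field_def)
  from ab have "2 * a \<in> \<int>" "a\<^sup>2 - real q * b\<^sup>2 \<in> \<int>" using algebraic_int_trace_norm by auto
  then obtain T N where TN: "2 * a = of_int T" "a\<^sup>2 - real q * b\<^sup>2 = of_int N"
    by (auto elim!: Ints_cases)
  have Teq: "of_int T ^ 2 - real q * (2 * b)\<^sup>2 = 4 * of_int N"
    unfolding TN(2)[symmetric] TN(1)[symmetric] by (simp add: power2_eq_square)
  have "2 * b \<in> \<int>"
  proof -
    have "(real q * (2 * b))\<^sup>2 = real q * (real q * (2 * b)\<^sup>2)" by (simp add: power2_eq_square)
    also have "\<dots> = of_int (int q * (T\<^sup>2 - 4 * N))" using Teq by (simp add: algebra_simps)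
    finally have sq: "(real q * (2 * b))\<^sup>2 = of_int (int q * (T\<^sup>2 - 4 * N))" .
    have "algebraic_int (real q * (2 * b))"
    proof (rule algebraic_int.intros[of "[:- of_int (int q * (T\<^sup>2 - 4 * N)), 0, 1:]"])
      show "poly [:- of_int (int q * (T\<^sup>2 - 4 * N)), 0, 1:] (real q * (2 * b)) = 0"
        using sq by (simp add: power2_eq_square algebra_simps)
    qed (auto simp: coeff_pCons split: nat.splits)
    then have "real q * (2 * b) \<in> \<int>" using ab by (intro rational_algebraic_int_is_int) auto
    then obtain r where r: "real q * (2 * b) = of_int r" by (auto elim: Ints_cases)
    with sq have "real_of_int (r\<^sup>2) = real_of_int (int q * (T\<^sup>2 - 4 * N))" by simp
    then have "r\<^sup>2 = int q * (T\<^sup>2 - 4 * N)" by (rule of_int_eq_iff[THEN iffD1])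
    then have "int q dvd r ^ 2" by simp
    then have "int q dvd r" using prime_q by (meson prime_dvd_power prime_nat_int_transfer)
    then obtain s where "r = int q * s" by blast
    then have "2 * b = of_int s" using r q_ge_5 by simp
    then show ?thesis by simp
  qed
  then obtain S where S: "2 * b = of_int S" by (auto elim: Ints_cases)
  from Teq S have "real_of_int (T\<^sup>2 - int q * S\<^sup>2) = real_of_int (4 * N)" by simp
  then have "T\<^sup>2 - int q * S\<^sup>2 = 4 * N"
    by (rule of_int_eq_iff[THEN iffD1])
  then have "even (T\<^sup>2 - int q * S\<^sup>2)" by simp
  moreover have "odd q" using q_mod_4 by presburger
  ultimately have "even (T - S)" by simp
  then obtain m where "T - S = 2 * m" by (rule dvdE)
  then have m: "T = 2 * m + S" by simp
  have "x = val q (m, S)" using TN(1) S m ab(3) unfolding val_eq by (simp add: field_simps)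
  then show "x \<in> range (val q)" by blast
qed

end


section \<open>Norms of principal ideals\<close>

lemma card_image_cong_kernel:
  assumes "\<And>x y. x \<in> X \<Longrightarrow> y \<in> X \<Longrightarrow> F x = F y \<longleftrightarrow> f x = f y"
  shows "card (F ` X) = card (f ` X)"
proof (rule bij_betw_same_card[of "\<lambda>s. f (inv_into X F s)"])
  show "bij_betw (\<lambda>s. f (inv_into X F s)) (F ` X) (f ` X)"
  proof (rule bij_betwI')
    fix s t assume st: "s \<in> F ` X" "t \<in> F ` X"
    then have "f (inv_into X F s) = f (inv_into X F t) \<longleftrightarrow> F (inv_into X F s) = F (inv_into X F t)"
      using assms[of "inv_into X F s" "inv_into X F t"] by (simp add: inv_into_into)
    then show "f (inv_into X F s) = f (inv_into X F t) \<longleftrightarrow> s = t"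
      using st by (simp add: f_inv_into_f)
  next
    fix s assume "s \<in> F ` X"
    then show "f (inv_into X F s) \<in> f ` X" by (simp add: inv_into_into)
  next
    fix y assume "y \<in> f ` X"
    then obtain x where x: "x \<in> X" "y = f x" by blast
    then have "F (inv_into X F (F x)) = F x" by (simp add: f_inv_into_f)
    then have "f (inv_into X F (F x)) = y"
      using x assms[of "inv_into X F (F x)" x] by (simp add: inv_into_into)
    then show "\<exists>s\<in>F ` X. y = f (inv_into X F s)" using x by blast
  qed
qed

text \<open>Coordinates of the Galois conjugate, from \<open>omc = 1 - om\<close>.\<close>

definition qconj :: "int \<times> int \<Rightarrow> int \<times> int" where
  "qconj z = (fst z + snd z, - snd z)"

context real_quad
begin

lemma val_add: "val q (z + w) = val q z + val q w" and con_add: "con q (z + w) = con q z + con q w"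
  by (simp_all add: val_def con_def algebra_simps)

lemma val_minus: "val q (- z) = - val q z" and con_minus: "con q (- z) = - con q z"
  by (simp_all add: val_def con_def)

lemma val_0 [simp]: "val q 0 = 0" "con q 0 = 0"
  by (simp_all add: val_def con_def)

lemma val_1: "val q (1, 0) = 1" "con q (1, 0) = 1"
  by (simp_all add: val_def con_def)

lemma val_eq_0_iff: "val q z = 0 \<longleftrightarrow> z = 0"
  using val_inj[of z 0] by simp

lemma val_qconj: "val q (qconj z) = con q z" and con_qconj: "con q (qconj z) = val q z"
  by (auto simp: val_def con_def qconj_def om_def omc_def field_simps)

lemma con_eq_0_iff: "con q z = 0 \<longleftrightarrow> z = 0"
  using val_eq_0_iff[of "qconj z"] unfolding val_qconj by (auto simp: qconj_def prod_eq_iff)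

lemma qnorm_eq_0_iff: "qnorm q z = 0 \<longleftrightarrow> z = 0"
  using val_con[of z] val_eq_0_iff[of z] con_eq_0_iff[of z] by auto

lemma qnorm_mul: "qnorm q (qmul q z w) = qnorm q z * qnorm q w"
proof -
  have "real_of_int (qnorm q (qmul q z w)) = real_of_int (qnorm q z * qnorm q w)"
    unfolding of_int_mult val_con[symmetric] by (simp add: val_mul con_mul)
  then show ?thesis by (rule of_int_eq_iff[THEN iffD1])
qed

lemma integer_ring_simps [simp]:
  "mult (integer_ring q) = (*)" "one (integer_ring q) = 1" "zero (integer_ring q) = 0"
  "add (integer_ring q) = (+)"
  by (simp_all add: integer_ring_def)

lemma cring_integer_ring: "cring (integer_ring q)"
proof (rule cringI)
  show "abelian_group (integer_ring q)"
  proof (rule abelian_groupI)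
    show "\<zero>\<^bsub>integer_ring q\<^esub> \<in> carrier (integer_ring q)"
      using val_0(1) by (metis integer_ring_carrier integer_ring_simps(3) rangeI)
    fix x y assume "x \<in> carrier (integer_ring q)" "y \<in> carrier (integer_ring q)"
    then show "x \<oplus>\<^bsub>integer_ring q\<^esub> y \<in> carrier (integer_ring q)"
      by (auto simp: integer_ring_carrier simp flip: val_add)
  next
    fix x assume "x \<in> carrier (integer_ring q)"
    then obtain z where z: "x = val q z" by (auto simp: integer_ring_carrier)
    then have "val q (- z) \<oplus>\<^bsub>integer_ring q\<^esub> x = \<zero>\<^bsub>integer_ring q\<^esub>" by (simp add: val_minus)
    then show "\<exists>y\<in>carrier (integer_ring q). y \<oplus>\<^bsub>integer_ring q\<^esub> x = \<zero>\<^bsub>integer_ring q\<^esub>"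
      by (metis integer_ring_carrier rangeI)
  qed auto
  show "comm_monoid (integer_ring q)"
  proof (rule comm_monoidI)
    show "\<one>\<^bsub>integer_ring q\<^esub> \<in> carrier (integer_ring q)"
      using val_1(1) by (metis integer_ring_carrier integer_ring_simps(2) rangeI)
    fix x y assume "x \<in> carrier (integer_ring q)" "y \<in> carrier (integer_ring q)"
    then show "x \<otimes>\<^bsub>integer_ring q\<^esub> y \<in> carrier (integer_ring q)"
      by (auto simp: integer_ring_carrier simp flip: val_mul)
  qed auto
qed (auto simp: algebra_simps)

sublocale O: cring "integer_ring q"
  by (rule cring_integer_ring)

lemma val_mem [simp]: "val q z \<in> carrier (integer_ring q)"
  by (simp add: integer_ring_carrier)

lemma PIdl_val: "PIdl\<^bsub>integer_ring q\<^esub> (val q z) = {val q (qmul q z w) | w. True}"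
proof -
  have "val q w * val q z = val q (qmul q z w)" for w by (simp add: val_mul)
  then show ?thesis unfolding cgenideal_def integer_ring_carrier integer_ring_simps
    by (metis (mono_tags, lifting) UNIV_I image_iff)
qed

lemma PIdl_eq_zero_iff: "PIdl\<^bsub>integer_ring q\<^esub> (val q z) = {0} \<longleftrightarrow> z = 0"
proof
  assume "PIdl\<^bsub>integer_ring q\<^esub> (val q z) = {0}"
  then have "val q z = 0" using O.cgenideal_self[OF val_mem[of z]] by simp
  then show "z = 0" by (simp add: val_eq_0_iff)
next
  assume "z = 0"
  then have "val q (qmul q z w) = 0" for w by (simp add: val_mul)
  then show "PIdl\<^bsub>integer_ring q\<^esub> (val q z) = {0}" by (simp add: PIdl_val)
qed

lemma PIdl_mem_nonzero_ideals: "z \<noteq> 0 \<Longrightarrow> PIdl\<^bsub>integer_ring q\<^esub> (val q z) \<in> nonzero_ideals q"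
  using O.cgenideal_ideal[OF val_mem[of z]] by (simp add: nonzero_ideals_def PIdl_eq_zero_iff)

text \<open>Hermite normal form of the lattice spanned by a principal ideal.\<close>

lemma PIdl_lattice:
  assumes z: "z \<noteq> 0"
  obtains a b g where "a > 0" "g > 0" "a * g = \<bar>qnorm q z\<bar>"
    "\<And>x y. (\<exists>w. qmul q z w = (x, y)) \<longleftrightarrow> (\<exists>j k. y = j * g \<and> x = j * b + k * a)"
proof -
  define m n c where "m = fst z" "n = snd z" "c = int (q div 4)"
  \<comment> \<open>The ideal is spanned by \<open>(m, n)\<close> and \<open>(c * n, m + n)\<close>,
    the products of \<open>z\<close> with \<open>1\<close> and \<open>om\<close>. Thus
    \<open>g\<close> generates the second coordinates that occur, \<open>(b, g)\<close> is a vector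
    attaining it, and \<open>a0 * g\<close> is the determinant of the two spanning vectors, that is,
    the norm.\<close>
  define g where "g = gcd n (m + n)"
  have "n \<noteq> 0 \<or> m + n \<noteq> 0" using z by (auto simp: m_n_c_def prod_eq_iff)
  then have g: "g > 0" by (auto simp: g_def)
  obtain p r where pr: "p * n + r * (m + n) = g" using bezout_int[of n "m + n"] unfolding g_def by blast
  obtain n' k' where nk: "n = g * n'" "m + n = g * k'"
    unfolding g_def by (meson dvdE gcd_dvd1 gcd_dvd2)
  define N where "N = qnorm q z"
  have "g * (p * n' + r * k') = g * 1" using pr unfolding nk(2) by (subst (asm) nk(1)) (simp add: algebra_simps)
  then have pr': "p * n' + r * k' = 1" using g mult_left_cancel[of g "p * n' + r * k'" 1] by simp
  have Neq: "N = m * (m + n) - c * n * n" unfolding N_def qnorm_def m_n_c_def by (simp add: algebra_simps)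
  define a0 where "a0 = m * k' - c * n * n'"
  have a0: "a0 * g = N" unfolding Neq a0_def nk(2) using nk(1) by (simp add: algebra_simps)
  have mul: "qmul q z w = (m * fst w + c * n * snd w, n * fst w + (m + n) * snd w)" for w
    by (simp add: qmul_def m_n_c_def algebra_simps)
  define b where "b = m * p + c * n * r"
  have key: "(\<exists>w. qmul q z w = (x, y)) \<longleftrightarrow> (\<exists>j k. y = j * g \<and> x = j * b + k * a0)" for x y
  proof
    assume "\<exists>w. qmul q z w = (x, y)"
    then obtain w where w: "x = m * fst w + c * n * snd w" "y = n * fst w + (m + n) * snd w"
      unfolding mul by auto
    \<comment> \<open>This integral change of coordinates is invertible because
      \<open>p * n' + r * k' = 1\<close>; the converse direction uses its inverse.\<close>
    define j where "j = n' * fst w + k' * snd w"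
    define k where "k = r * fst w - p * snd w"
    have "y = j * g" unfolding w(2) nk(2) j_def using nk(1) by (simp add: algebra_simps)
    moreover have "j * p + k * k' = (p * n' + r * k') * fst w" "j * r - k * n' = (p * n' + r * k') * snd w"
      by (simp_all add: j_def k_def algebra_simps)
    then have ww: "fst w = j * p + k * k'" "snd w = j * r - k * n'" unfolding pr' by auto
    have "x = j * b + k * a0" unfolding w(1) ww b_def a0_def by (simp add: algebra_simps)
    ultimately show "\<exists>j k. y = j * g \<and> x = j * b + k * a0" by blast
  next
    assume "\<exists>j k. y = j * g \<and> x = j * b + k * a0"
    then obtain j k where jk: "y = j * g" "x = j * b + k * a0" by blast
    have "n * (j * p + k * k') + (m + n) * (j * r - k * n') = j * (p * n + r * (m + n)) + k * (k' * n - n' * (m + n))"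
      by (simp add: algebra_simps)
    also have "k' * n - n' * (m + n) = 0" unfolding nk(2) by (subst nk(1)) simp
    finally have snd: "n * (j * p + k * k') + (m + n) * (j * r - k * n') = j * g" by (simp add: pr)
    have fst: "m * (j * p + k * k') + c * n * (j * r - k * n') = j * b + k * a0"
      unfolding b_def a0_def by (simp only: algebra_simps)
    have "qmul q z (j * p + k * k', j * r - k * n') = (x, y)"
      unfolding mul jk fst_conv snd_conv snd fst ..
    then show "\<exists>w. qmul q z w = (x, y)" by blast
  qed
  have "a0 \<noteq> 0" using a0 qnorm_eq_0_iff[of z] z unfolding N_def by auto
  have abs_iff: "(\<exists>j k. y = j * g \<and> x = j * b + k * a0) \<longleftrightarrow> (\<exists>j k. y = j * g \<and> x = j * b + k * \<bar>a0\<bar>)" for x y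
  proof -
    have "(\<exists>k. x = t + k * a0) \<longleftrightarrow> (\<exists>k. x = t + k * \<bar>a0\<bar>)" for t
    proof -
      have "(\<exists>k. x = t + k * d) \<longleftrightarrow> d dvd x - t" for d
      proof
        assume "d dvd x - t"
        then obtain k where "x - t = d * k" by (rule dvdE)
        then have "x = t + k * d" by (simp add: algebra_simps)
        then show "\<exists>k. x = t + k * d" ..
      qed auto
      then show ?thesis by simp
    qed
    then show ?thesis by blast
  qed
  show ?thesis
  proof (rule that[of "\<bar>a0\<bar>" g b])
    show "\<bar>a0\<bar> * g = \<bar>qnorm q z\<bar>" using a0 g unfolding N_def[symmetric] by (metis abs_mult abs_of_pos)
  qed (use \<open>a0 \<noteq> 0\<close> g key abs_iff in auto)
qed

text \<open>Subtracting a multiple of \<open>(b, g)\<close> reduces the second coordinate modulo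
  \<open>g\<close>, after which the first one is reduced modulo \<open>a\<close>. This gives each
  coset exactly one representative in a rectangle with \<open>a * g\<close> points.\<close>

lemma ideal_norm_PIdl:
  assumes z: "z \<noteq> 0"
  shows "ideal_norm q (PIdl\<^bsub>integer_ring q\<^esub> (val q z)) = nat \<bar>qnorm q z\<bar>"
proof -
  let ?R = "integer_ring q"
  define I where "I = PIdl\<^bsub>?R\<^esub> (val q z)"
  obtain a b g where abg: "a > 0" "g > 0" "a * g = \<bar>qnorm q z\<bar>"
    "\<And>x y. (\<exists>w. qmul q z w = (x, y)) \<longleftrightarrow> (\<exists>j k. y = j * g \<and> x = j * b + k * a)"
    by (rule PIdl_lattice[OF z]) blast
  interpret I: ideal I ?R unfolding I_def using O.cgenideal_ideal[OF val_mem] .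
  have mem: "val q v \<in> I \<longleftrightarrow> (\<exists>j k. snd v = j * g \<and> fst v = j * b + k * a)" for v
  proof -
    have "val q v \<in> I \<longleftrightarrow> (\<exists>w. qmul q z w = v)" unfolding I_def PIdl_val by (auto simp: val_inj)
    then show ?thesis using abg(4)[of "fst v" "snd v"] by simp
  qed
  define red where "red = (\<lambda>v::int \<times> int. ((fst v - (snd v div g) * b) mod a, snd v mod g))"
  have coset_eq: "(I +>\<^bsub>?R\<^esub> val q v = I +>\<^bsub>?R\<^esub> val q v') \<longleftrightarrow> red v = red v'" for v v'
  proof -
    have "(I +>\<^bsub>?R\<^esub> val q v = I +>\<^bsub>?R\<^esub> val q v') \<longleftrightarrow> val q v \<in> I +>\<^bsub>?R\<^esub> val q v'"
      using I.a_rcos_self[OF val_mem[of v]] O.a_repr_independence[of "val q v" I "val q v'"] I.a_subgroup by auto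
    also have "\<dots> \<longleftrightarrow> val q v \<ominus>\<^bsub>?R\<^esub> val q v' \<in> I"
      using I.a_rcos_module_minus[of "val q v'" "val q v"] O.ring_axioms by simp
    also have "val q v \<ominus>\<^bsub>?R\<^esub> val q v' = val q (v - v')"
    proof -
      have "\<ominus>\<^bsub>?R\<^esub> val q v' = val q (- v')"
        by (rule O.minus_equality) (use val_mem[of "- v'"] in \<open>auto simp: val_minus\<close>)
      then show ?thesis by (simp add: a_minus_def flip: val_add)
    qed
    also have "val q (v - v') \<in> I \<longleftrightarrow> red v = red v'"
    proof
      assume "val q (v - v') \<in> I"
      then obtain j k where "snd v - snd v' = j * g" "fst v - fst v' = j * b + k * a"
        unfolding mem by auto
      then have "snd v = snd v' + j * g" and f: "fst v = fst v' + j * b + k * a" by auto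
      then have "snd v div g = snd v' div g + j" "snd v mod g = snd v' mod g" using abg(2) by simp_all
      moreover from this have "fst v - snd v div g * b = (fst v' - snd v' div g * b) + k * a"
        unfolding f by (simp add: algebra_simps)
      ultimately show "red v = red v'" unfolding red_def by simp
    next
      assume eq: "red v = red v'"
      define j where "j = snd v div g - snd v' div g"
      have m: "snd v mod g = snd v' mod g" using eq by (simp add: red_def)
      have "snd v - snd v' = g * (snd v div g) - g * (snd v' div g)"
        using mult_div_mod_eq[of g "snd v"] mult_div_mod_eq[of g "snd v'"] m by linarith
      then have "snd v - snd v' = j * g" unfolding j_def by (simp add: algebra_simps)
      moreover have "a dvd (fst v - (snd v div g) * b) - (fst v' - (snd v' div g) * b)"
        using eq by (simp add: red_def mod_eq_dvd_iff)
      then obtain k where "(fst v - (snd v div g) * b) - (fst v' - (snd v' div g) * b) = a * k" by (rule dvdE)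
      then have "fst v - fst v' = j * b + k * a" unfolding j_def by (simp add: algebra_simps)
      ultimately show "val q (v - v') \<in> I" unfolding mem by auto
    qed
    finally show ?thesis .
  qed
  have "carrier (?R Quot I) = (\<lambda>v. I +>\<^bsub>?R\<^esub> val q v) ` UNIV"
    by (auto simp: FactRing_def A_RCOSETS_def' integer_ring_carrier)
  then have "ideal_norm q I = card (range (\<lambda>v. I +>\<^bsub>?R\<^esub> val q v))"
    by (simp add: ideal_norm_def)
  also have "\<dots> = card (range red)" by (rule card_image_cong_kernel) (simp add: coset_eq)
  also have "range red = {0..<a} \<times> {0..<g}"
  proof (intro equalityI subsetI)
    fix s assume "s \<in> {0..<a} \<times> {0..<g}"
    then have "s = red s" by (auto simp: red_def)
    then show "s \<in> range red" by blast
  qed (use abg in \<open>auto simp: red_def\<close>)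
  also have "card \<dots> = nat \<bar>qnorm q z\<bar>"
    using abg(1,2) by (simp add: abg(3)[symmetric] nat_mult_distrib)
  finally show ?thesis unfolding I_def .
qed

end


text \<open>A unit \<open>u ^ n\<close> multiplies the absolute ratio of the embeddings by
  \<open>u ^ (2 * n)\<close>, so the window from \<open>1\<close> to \<open>u^2\<close> selects the
  exponent and positivity selects the sign.\<close>

definition fdom :: "nat \<Rightarrow> real \<Rightarrow> (int \<times> int) set" where
  "fdom q u = {z. val q z > 0 \<and> 1 \<le> \<bar>val q z / con q z\<bar> \<and> \<bar>val q z / con q z\<bar> < u\<^sup>2}"

text \<open>The angle of a generator, normalised so that the fundamental domain has angles in
  \<open>[0, 1)\<close> and the characters become the powers of
  \<open>cis (2 * pi * theta q u z)\<close>.\<close>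

definition theta :: "nat \<Rightarrow> real \<Rightarrow> int \<times> int \<Rightarrow> real" where
  "theta q u z = ln \<bar>val q z / con q z\<bar> / (2 * ln u)"

section \<open>Narrow class number one: generators, units and the fundamental domain\<close>

locale real_quad_narrow = real_quad +
  assumes narrow: "narrow_class_number q = 1"
begin

abbreviation "R \<equiv> integer_ring q"

lemma carrier_nonzero_ideal: "carrier R \<in> nonzero_ideals q"
proof -
  have "1 \<in> carrier R" using val_mem[of "(1, 0)"] by (simp add: val_1)
  then have "carrier R \<noteq> {0}" by (metis singletonD zero_neq_one)
  then show ?thesis by (simp add: nonzero_ideals_def O.oneideal)
qed

lemma quad_field_1: "1 \<in> quad_field q"
  using val_in_quad_field[of "(1, 0)"] by (simp add: val_1)

lemma fractional_idealI: "I \<in> nonzero_ideals q \<Longrightarrow> c \<in> quad_field q \<Longrightarrow> c \<noteq> 0 \<Longrightarrow> (\<lambda>x. c * x) ` I \<in> fractional_ideals q"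
  unfolding fractional_ideals_def by blast

lemma nonzero_ideal_fractional: "I \<in> nonzero_ideals q \<Longrightarrow> I \<in> fractional_ideals q"
  using fractional_idealI[of I 1] quad_field_1 by simp

lemma totally_positive_1: "totally_positive q 1"
  using conjugate_val[of "(1, 0)"] quad_field_1 by (simp add: totally_positive_def val_1)

text \<open>There is a single class, so \<open>J\<close> and the ring have the same image under the
  relation. Reflexivity at \<open>J\<close> places \<open>J\<close> in the image of the ring, which
  is the required totally positive multiplier.\<close>

lemma fractional_ideal_generator:
  assumes "J \<in> fractional_ideals q"
  obtains c where "totally_positive q c" "J = (\<lambda>x. c * x) ` carrier R"
proof -
  let ?F = "fractional_ideals q" and ?E = "narrow_equiv q"
  obtain C where C: "?F // ?E = {C}"
    using narrow unfolding narrow_class_number_def by (rule card_1_singletonE)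
  have O: "carrier R \<in> ?F" using carrier_nonzero_ideal by (rule nonzero_ideal_fractional)
  have "?E `` {J} \<in> ?F // ?E" "?E `` {carrier R} \<in> ?F // ?E"
    using assms O by (auto intro: quotientI)
  then have "?E `` {J} = ?E `` {carrier R}" unfolding C by simp
  moreover have "(J, J) \<in> ?E" unfolding narrow_equiv_def using assms totally_positive_1
    by (auto intro!: exI[of _ 1])
  ultimately have "(carrier R, J) \<in> ?E" by auto
  then show ?thesis using that unfolding narrow_equiv_def by blast
qed

lemma ideal_principal:
  assumes "I \<in> nonzero_ideals q"
  obtains z where "z \<noteq> 0" "I = PIdl\<^bsub>R\<^esub> (val q z)"
proof -
  obtain c where c: "totally_positive q c" "I = (\<lambda>x. c * x) ` carrier R"
    using fractional_ideal_generator[OF nonzero_ideal_fractional[OF assms]] .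
  have "1 \<in> carrier R" using val_mem[of "(1, 0)"] by (simp add: val_1)
  then have "c \<in> I" using c(2) by force
  moreover have "ideal I R" using assms by (simp add: nonzero_ideals_def)
  then have "I \<subseteq> carrier R" by (metis ideal.Icarr subsetI)
  ultimately obtain z where z: "c = val q z" by (auto simp: integer_ring_carrier)
  have "z \<noteq> 0" using c(1) z by (auto simp: totally_positive_def)
  moreover have "I = PIdl\<^bsub>R\<^esub> (val q z)"
    unfolding c(2) z PIdl_val integer_ring_carrier by (auto simp: val_mul)
  ultimately show ?thesis using that by blast
qed

text \<open>The inverse of a unit is its conjugate times its norm, the norm being a sign.\<close>

lemma qnorm_unit_inverse:
  assumes "\<bar>qnorm q z\<bar> = 1"
  obtains w where "val q z * val q w = 1" "con q z * con q w = 1" "\<bar>qnorm q w\<bar> = 1"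
proof -
  define s where "s = qnorm q z"
  have s: "s * s = 1" using assms unfolding s_def by (metis abs_mult_self_eq mult.right_neutral)
  define w where "w = qmul q (s, 0) (qconj z)"
  have sv: "val q (s, 0) = of_int s" "con q (s, 0) = of_int s" by (simp_all add: val_def con_def)
  have ss: "real_of_int s * real_of_int s = 1" using s by (metis of_int_1 of_int_mult)
  have "val q z * val q w = (val q z * con q z) * of_int s" by (simp add: w_def val_mul sv val_qconj)
  then have 1: "val q z * val q w = 1" using ss by (simp add: val_con s_def)
  have "con q z * con q w = (val q z * con q z) * of_int s" by (simp add: w_def con_mul sv con_qconj)
  then have 2: "con q z * con q w = 1" using ss by (simp add: val_con s_def)
  have "real_of_int (qnorm q z * qnorm q w) = 1"
    using 1 2 by (simp flip: val_con) (metis mult.assoc mult.left_commute mult_1)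
  then have "qnorm q z * qnorm q w = 1" by (metis of_int_eq_1_iff)
  then have "\<bar>qnorm q w\<bar> = 1" using assms by (metis abs_1 abs_mult mult_1)
  with 1 2 show ?thesis using that by blast
qed

lemma Units_iff: "x \<in> Units R \<longleftrightarrow> (\<exists>z. x = val q z \<and> \<bar>qnorm q z\<bar> = 1)"
proof
  assume "x \<in> Units R"
  then obtain y where "x \<in> carrier R" "y \<in> carrier R" "x * y = 1" by (auto simp: Units_def)
  then obtain z w where zw: "x = val q z" "y = val q w" "val q (qmul q z w) = val q (1, 0)"
    by (auto simp: integer_ring_carrier val_1 val_mul)
  then have "qmul q z w = (1, 0)" by (simp add: val_inj)
  then have "qnorm q z * qnorm q w = 1" by (simp flip: qnorm_mul) (simp add: qnorm_def)
  then have "\<bar>qnorm q z\<bar> = 1" using zmult_eq_1_iff by auto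
  then show "\<exists>z. x = val q z \<and> \<bar>qnorm q z\<bar> = 1" using zw by blast
next
  assume "\<exists>z. x = val q z \<and> \<bar>qnorm q z\<bar> = 1"
  then obtain z where z: "x = val q z" "\<bar>qnorm q z\<bar> = 1" by blast
  then obtain w where "val q z * val q w = 1" using qnorm_unit_inverse by metis
  then show "x \<in> Units R" unfolding Units_def z(1) by (auto intro!: bexI[of _ "val q w"] simp: mult.commute)
qed

definition quad_units :: "real set" where
  "quad_units = {val q z | z. \<bar>qnorm q z\<bar> = 1}"

lemma Units_eq: "Units R = quad_units"
  using Units_iff by (auto simp: quad_units_def)

lemma quad_units_mult: "x \<in> quad_units \<Longrightarrow> y \<in> quad_units \<Longrightarrow> x * y \<in> quad_units"
proof -
  assume "x \<in> quad_units" "y \<in> quad_units"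
  then obtain z w where "x = val q z" "y = val q w" "\<bar>qnorm q z\<bar> = 1" "\<bar>qnorm q w\<bar> = 1"
    unfolding quad_units_def by blast
  then have "x * y = val q (qmul q z w)" "\<bar>qnorm q (qmul q z w)\<bar> = 1"
    by (simp_all add: val_mul qnorm_mul abs_mult)
  then show ?thesis unfolding quad_units_def by blast
qed

lemma quad_units_inverse: "x \<in> quad_units \<Longrightarrow> inverse x \<in> quad_units"
proof -
  assume "x \<in> quad_units"
  then obtain z where "x = val q z" "\<bar>qnorm q z\<bar> = 1" unfolding quad_units_def by blast
  moreover from this obtain w where "val q z * val q w = 1" "\<bar>qnorm q w\<bar> = 1"
    using qnorm_unit_inverse by metis
  ultimately have "inverse x = val q w" "\<bar>qnorm q w\<bar> = 1" by (auto simp: inverse_unique)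
  then show ?thesis unfolding quad_units_def by blast
qed

lemma quad_units_1: "1 \<in> quad_units"
  unfolding quad_units_def using val_1(1) by (force simp: qnorm_def)

lemma quad_units_minus: "x \<in> quad_units \<Longrightarrow> - x \<in> quad_units"
proof -
  have "-1 \<in> quad_units" unfolding quad_units_def
    by (rule CollectI, rule exI[of _ "(-1, 0)"]) (simp add: val_def qnorm_def)
  then show "x \<in> quad_units \<Longrightarrow> - x \<in> quad_units" using quad_units_mult[of "-1" x] by simp
qed

lemma quad_units_powi: "x \<in> quad_units \<Longrightarrow> x powi n \<in> quad_units"
proof -
  assume x: "x \<in> quad_units"
  have "y ^ j \<in> quad_units" if "y \<in> quad_units" for y j
    using that by (induction j) (auto intro: quad_units_mult quad_units_1)
  then show ?thesis using x quad_units_inverse by (simp add: power_int_def)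
qed

text \<open>A totally positive generator of the ideal of \<open>sqrt q\<close> exists since the narrow class number is one;
  its quotient by \<open>sqrt q\<close> is a unit of norm \<open>- 1\<close>, hence not \<open>\<plusminus> 1\<close>. This replaces Dirichlet's unit theorem.\<close>

lemma exists_unit_gt_1: "\<exists>x\<in>quad_units. x > 1"
proof -
  \<comment> \<open>Coordinates of \<open>sqrt q\<close>, since
    \<open>2 * om - 1 = sqrt q\<close>.\<close>
  define s where "s = ((-1, 2) :: int \<times> int)"
  have s: "val q s = sqrt (real q)" "con q s = - sqrt (real q)"
    by (simp_all add: s_def val_def con_def om_def omc_def field_simps)
  have "sqrt (real q) \<noteq> 0" using q_ge_5 by simp
  moreover have "sqrt (real q) \<in> quad_field q" using val_in_quad_field[of s] s by simp
  ultimately have "(\<lambda>x. sqrt (real q) * x) ` carrier R \<in> fractional_ideals q"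
    using carrier_nonzero_ideal by (intro fractional_idealI) auto
  then obtain c where c: "totally_positive q c"
    "(\<lambda>x. sqrt (real q) * x) ` carrier R = (\<lambda>x. c * x) ` carrier R"
    by (rule fractional_ideal_generator)
  have "1 \<in> carrier R" using val_mem[of "(1, 0)"] by (simp add: val_1)
  then have "c * 1 \<in> (\<lambda>x. sqrt (real q) * x) ` carrier R" "sqrt (real q) * 1 \<in> (\<lambda>x. c * x) ` carrier R"
    using c(2) by blast+
  then obtain X Y where XY: "X \<in> carrier R" "c * 1 = sqrt (real q) * X"
    "Y \<in> carrier R" "sqrt (real q) * 1 = c * Y" by blast
  then obtain x y where "X = val q x" "Y = val q y" unfolding integer_ring_carrier by blast
  with XY have xy: "c = sqrt (real q) * val q x" "sqrt (real q) = c * val q y"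
    by simp_all
  have "sqrt (real q) = sqrt (real q) * (val q x * val q y)"
    using xy(2)[unfolded xy(1)] by (simp only: mult.assoc)
  then have "val q x * val q y = 1" using \<open>sqrt (real q) \<noteq> 0\<close> by simp
  then have "val q x \<in> Units R" unfolding Units_def by (auto intro!: bexI[of _ "val q y"] simp: mult.commute)
  then have u: "val q x \<in> quad_units" by (simp add: Units_eq)
  have "c = val q (qmul q s x)" by (simp add: xy(1) val_mul s)
  then have "conjugate q c = - sqrt (real q) * con q x" by (simp add: con_mul s)
  then have "sqrt (real q) * con q x < 0" "sqrt (real q) * val q x > 0"
    using c(1) unfolding totally_positive_def xy(1) by auto
  moreover have "sqrt (real q) > 0" using q_ge_5 by simp
  ultimately have "con q x < 0" "val q x > 0"
    by (simp_all only: mult_less_0_iff zero_less_mult_iff) auto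
  then have "val q x \<noteq> 1" using val_inj[of x "(1, 0)"] val_1 by auto
  then consider "val q x > 1" | "inverse (val q x) > 1" using \<open>val q x > 0\<close>
    by (metis less_linear one_less_inverse)
  then show ?thesis using u quad_units_inverse by cases auto
qed

text \<open>The order is discrete under its two embeddings: their difference is
  \<open>sqrt q\<close> times the second coordinate, and their sum then determines the
  first.\<close>

lemma finite_lattice_box: "finite {z. \<bar>val q z\<bar> \<le> B \<and> \<bar>con q z\<bar> \<le> B}"
proof (rule finite_subset)
  define M where "M = \<lceil>2 * B\<rceil>"
  show "{z. \<bar>val q z\<bar> \<le> B \<and> \<bar>con q z\<bar> \<le> B} \<subseteq> {-M..M} \<times> {-M..M}"
  proof
    fix z assume "z \<in> {z. \<bar>val q z\<bar> \<le> B \<and> \<bar>con q z\<bar> \<le> B}"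
    then have z: "\<bar>val q z\<bar> \<le> B" "\<bar>con q z\<bar> \<le> B" by auto
    have "val q z - con q z = of_int (snd z) * sqrt (real q)"
      unfolding val_def con_def using om_sq(5) by (metis add_diff_cancel_left right_diff_distrib)
    then have "\<bar>of_int (snd z)\<bar> * sqrt (real q) = \<bar>val q z - con q z\<bar>" by (simp add: abs_mult)
    moreover have "\<bar>real_of_int (snd z)\<bar> * 2 \<le> \<bar>of_int (snd z)\<bar> * sqrt (real q)"
      using sqrt_q_gt_2 by (intro mult_left_mono) auto
    ultimately have n: "\<bar>real_of_int (snd z)\<bar> \<le> B" using z by linarith
    have "val q z + con q z = 2 * of_int (fst z) + of_int (snd z)"
      by (simp add: val_eq con_eq)
    then have m: "\<bar>real_of_int (fst z)\<bar> \<le> 2 * B" using z n by linarith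
    show "z \<in> {-M..M} \<times> {-M..M}"
      using n m unfolding M_def by (auto simp: mem_Times_iff) linarith+
  qed
qed auto

lemma quad_unit_con:
  assumes "\<bar>qnorm q z\<bar> = 1"
  shows "\<bar>con q z\<bar> = 1 / \<bar>val q z\<bar>"
proof -
  have "\<bar>val q z\<bar> * \<bar>con q z\<bar> = 1" using assms val_con[of z] by (metis abs_mult of_int_1 of_int_abs)
  then show ?thesis by (metis eq_divide_imp mult.commute mult_zero_left zero_neq_one)
qed

text \<open>A unit \<open>x > 1\<close> has a conjugate of modulus \<open>1 / x < 1\<close>. The
  units between \<open>1\<close> and a given one therefore lie in a finite box and have a least
  element.\<close>

lemma minimal_unit: "\<exists>u\<in>quad_units. u > 1 \<and> (\<forall>x\<in>quad_units. x > 1 \<longrightarrow> u \<le> x)"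
proof -
  obtain x0 where x0: "x0 \<in> quad_units" "x0 > 1" using exists_unit_gt_1 by blast
  define S where "S = {x \<in> quad_units. 1 < x \<and> x \<le> x0}"
  have "S \<subseteq> val q ` {z. \<bar>val q z\<bar> \<le> x0 \<and> \<bar>con q z\<bar> \<le> x0}"
  proof
    fix x assume "x \<in> S"
    then obtain z where z: "x = val q z" "\<bar>qnorm q z\<bar> = 1" "1 < x" "x \<le> x0"
      unfolding S_def quad_units_def by blast
    have "1 / \<bar>val q z\<bar> \<le> 1" using z by (simp add: divide_le_eq)
    then have "\<bar>con q z\<bar> \<le> x0" using quad_unit_con[OF z(2)] x0(2) by linarith
    then show "x \<in> val q ` {z. \<bar>val q z\<bar> \<le> x0 \<and> \<bar>con q z\<bar> \<le> x0}" using z by auto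
  qed
  then have fin: "finite S" by (rule finite_surj[OF finite_lattice_box])
  have "x0 \<in> S" using x0 by (simp add: S_def)
  then have m: "Min S \<in> S" "\<And>x. x \<in> S \<Longrightarrow> Min S \<le> x"
    using Min_in[OF fin] Min_le[OF fin] by blast+
  have "Min S \<le> x" if "x \<in> quad_units" "x > 1" for x
  proof (cases "x \<le> x0")
    case True
    then show ?thesis using m(2) that by (simp add: S_def)
  next
    case False
    then show ?thesis using m(2)[OF \<open>x0 \<in> S\<close>] by linarith
  qed
  then show ?thesis using m(1) unfolding S_def by blast
qed

text \<open>Dividing a positive unit by the largest power of the minimal unit \<open>u\<close> below
  it leaves a unit in \<open>[1, u)\<close>, which must be \<open>1\<close>. Conversely any
  generator \<open>w > 1\<close> satisfies \<open>w >= u\<close> by minimality and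
  \<open>w <= u\<close> because \<open>u\<close> is a positive power of \<open>w\<close>; this
  resolves the definite description.\<close>

lemma fundamental_unit_props:
  "fundamental_unit q > 1" "fundamental_unit q \<in> quad_units"
  "quad_units = {s * fundamental_unit q powi n | s n. s \<in> {1, -1}}"
proof -
  obtain u where u: "u \<in> quad_units" "u > 1" "\<And>x. x \<in> quad_units \<Longrightarrow> x > 1 \<Longrightarrow> u \<le> x"
    using minimal_unit by blast
  have pos: "\<exists>n. x = u powi n" if x: "x \<in> quad_units" "x > 0" for x
  proof -
    define n where "n = \<lfloor>log u x\<rfloor>"
    have y: "x * u powi (-n) \<in> quad_units" using x u by (intro quad_units_mult quad_units_powi)
    have "u powr of_int n \<le> x" "x < u powr (of_int n + 1)"
      using u x unfolding n_def by (auto simp: le_log_iff[symmetric] log_less_iff[symmetric])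
    then have "u powi n \<le> x" "x < u powi n * u"
      using u by (auto simp: powr_real_of_int' powr_add)
    then have "1 \<le> x * u powi (-n)" "x * u powi (-n) < u"
      using u by (auto simp: power_int_minus field_simps)
    with u(3)[OF y] have "x * u powi (-n) = 1" by linarith
    then have "x = u powi n" using u by (simp add: power_int_minus field_simps)
    then show ?thesis by blast
  qed
  have all: "quad_units = {s * u powi n | s n. s \<in> {1, -1}}"
  proof (intro equalityI subsetI)
    fix x assume x: "x \<in> quad_units"
    obtain z where z: "x = val q z" "\<bar>qnorm q z\<bar> = 1" using x unfolding quad_units_def by blast
    then have "z \<noteq> 0" using qnorm_eq_0_iff[of z] by auto
    then have "x \<noteq> 0" using z by (simp add: val_eq_0_iff)
    then consider "x > 0" | "- x > 0" by linarith
    then show "x \<in> {s * u powi n | s n. s \<in> {1, -1}}"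
    proof cases
      case 1
      then show ?thesis using pos x by force
    next
      case 2
      then obtain n where "- x = u powi n" using pos quad_units_minus x by blast
      then have "x = (-1) * u powi n" by simp
      then show ?thesis by blast
    qed
  next
    fix x assume "x \<in> {s * u powi n | s n. s \<in> {1, -1}}"
    then show "x \<in> quad_units" using u quad_units_powi quad_units_minus by auto
  qed
  have "fundamental_unit q = u"
    unfolding fundamental_unit_def Units_eq
  proof (rule the_equality)
    show "u > 1 \<and> quad_units = {s * u powi n | s n. s \<in> {1, -1}}" using u all by simp
  next
    fix w assume w: "w > 1 \<and> quad_units = {s * w powi n | s n. s \<in> {1, -1}}"
    have "w \<in> quad_units" using w by (metis (mono_tags, lifting) CollectI insertI1 mult_1 power_int_1_right)
    then have "u \<le> w" using u w by simp
    obtain s n where sn: "u = s * w powi n" "s \<in> {1, -1}" using w u(1) by blast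
    have "w powi n > 0" using w by simp
    then have s: "s = 1" using sn u by auto
    have "n > 0"
    proof (rule ccontr)
      assume "\<not> n > 0"
      then have "w powi n \<le> 1" using w power_int_increasing[of n 0 w] by simp
      then show False using sn s u by simp
    qed
    then have "w powi 1 \<le> w powi n" using w by (intro power_int_increasing) auto
    then have "w \<le> u" using sn s by simp
    with \<open>u \<le> w\<close> show "w = u" by simp
  qed
  with u all show "fundamental_unit q > 1" "fundamental_unit q \<in> quad_units"
    "quad_units = {s * fundamental_unit q powi n | s n. s \<in> {1, -1}}" by simp_all
qed

abbreviation "eps \<equiv> fundamental_unit q"

lemma quad_unit_ratio:
  assumes "\<bar>qnorm q z\<bar> = 1"
  obtains n :: int where "\<bar>val q z / con q z\<bar> = (eps\<^sup>2) powi n" "\<bar>val q z\<bar> = eps powi n"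
proof -
  have "val q z \<in> quad_units" using assms unfolding quad_units_def by blast
  then obtain s n where sn: "val q z = s * eps powi n" "s \<in> {1, -1}"
    using fundamental_unit_props(3) by blast
  have "\<bar>val q z\<bar> = eps powi n" using sn fundamental_unit_props(1) by (auto simp: abs_mult)
  moreover from this have "\<bar>val q z / con q z\<bar> = eps powi n * eps powi n"
    using quad_unit_con[OF assms] by (simp add: abs_divide)
  then have "\<bar>val q z / con q z\<bar> = (eps\<^sup>2) powi n" by (simp add: power2_eq_square power_int_mult_distrib)
  ultimately show ?thesis using that by blast
qed

lemma PIdl_eq_ratio:
  assumes "PIdl\<^bsub>R\<^esub> (val q z) = PIdl\<^bsub>R\<^esub> (val q w)" "w \<noteq> 0"
  obtains n :: int where "\<bar>val q z / con q z\<bar> = \<bar>val q w / con q w\<bar> * (eps\<^sup>2) powi n"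
    "\<bar>val q z\<bar> = \<bar>val q w\<bar> * eps powi n"
proof -
  have "val q z \<in> PIdl\<^bsub>R\<^esub> (val q w)" "val q w \<in> PIdl\<^bsub>R\<^esub> (val q z)"
    using assms O.cgenideal_self[OF val_mem[of z]] O.cgenideal_self[OF val_mem[of w]] by simp_all
  then obtain x y where xy: "z = qmul q w x" "w = qmul q z y" by (auto simp: PIdl_val val_inj)
  then have "qnorm q w = qnorm q w * (qnorm q x * qnorm q y)" by (metis mult.assoc qnorm_mul)
  then have "qnorm q x * qnorm q y = 1" using assms(2) qnorm_eq_0_iff[of w] by simp
  then have "\<bar>qnorm q x\<bar> = 1" using zmult_eq_1_iff by auto
  then obtain n where n: "\<bar>val q x / con q x\<bar> = (eps\<^sup>2) powi n" "\<bar>val q x\<bar> = eps powi n" by (rule quad_unit_ratio)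
  show ?thesis
  proof (rule that[of n])
    show "\<bar>val q z / con q z\<bar> = \<bar>val q w / con q w\<bar> * (eps\<^sup>2) powi n"
      unfolding n(1)[symmetric] by (simp add: xy(1) val_mul con_mul abs_mult abs_divide)
    show "\<bar>val q z\<bar> = \<bar>val q w\<bar> * eps powi n"
      unfolding n(2)[symmetric] by (simp add: xy(1) val_mul abs_mult)
  qed
qed

lemma unit_shift:
  obtains e where "\<bar>qnorm q e\<bar> = 1" "val q e = eps powi n"
proof -
  have "eps powi n \<in> quad_units" using fundamental_unit_props quad_units_powi by blast
  then show ?thesis using that unfolding quad_units_def by auto
qed

lemma PIdl_unit_mult:
  assumes "\<bar>qnorm q e\<bar> = 1"
  shows "PIdl\<^bsub>R\<^esub> (val q (qmul q z e)) = PIdl\<^bsub>R\<^esub> (val q z)"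
proof -
  obtain e' where e': "val q e * val q e' = 1" using qnorm_unit_inverse[OF assms] by metis
  show ?thesis
  proof (intro equalityI subsetI)
    fix x assume "x \<in> PIdl\<^bsub>R\<^esub> (val q (qmul q z e))"
    then obtain w where "x = val q (qmul q (qmul q z e) w)" by (auto simp: PIdl_val)
    then have "x = val q (qmul q z (qmul q e w))" by (simp add: val_mul)
    then show "x \<in> PIdl\<^bsub>R\<^esub> (val q z)" unfolding PIdl_val by blast
  next
    fix x assume "x \<in> PIdl\<^bsub>R\<^esub> (val q z)"
    then obtain w where "x = val q (qmul q z w)" by (auto simp: PIdl_val)
    then have "x = val q (qmul q (qmul q z e) (qmul q e' w))" using e' by (simp add: val_mul)
    then show "x \<in> PIdl\<^bsub>R\<^esub> (val q (qmul q z e))" unfolding PIdl_val by blast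
  qed
qed

lemma PIdl_minus: "PIdl\<^bsub>R\<^esub> (val q (- z)) = PIdl\<^bsub>R\<^esub> (val q z)"
proof -
  have "qmul q z (-1, 0) = - z" by (simp add: qmul_def prod_eq_iff)
  then show ?thesis using PIdl_unit_mult[of "(-1, 0)" z] by (simp add: qnorm_def)
qed

text \<open>Two generators of one ideal have ratios differing by an integral power of
  \<open>eps^2\<close>, and a window of multiplicative length \<open>eps^2\<close> forces that power
  to be trivial. For existence, any generator is moved into the window by the unit read off from the
  floor of a logarithm, and its sign is adjusted.\<close>

lemma bij_betw_fdom_ideals: "bij_betw (\<lambda>z. PIdl\<^bsub>R\<^esub> (val q z)) (fdom q eps) (nonzero_ideals q)"
proof (rule bij_betwI')
  have e1: "eps\<^sup>2 > 1" using fundamental_unit_props(1) by (simp add: one_less_power)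
  then have e0: "eps\<^sup>2 > 0" by linarith
  fix z w assume zw: "z \<in> fdom q eps" "w \<in> fdom q eps"
  show "PIdl\<^bsub>R\<^esub> (val q z) = PIdl\<^bsub>R\<^esub> (val q w) \<longleftrightarrow> z = w"
  proof
    assume eq: "PIdl\<^bsub>R\<^esub> (val q z) = PIdl\<^bsub>R\<^esub> (val q w)"
    have "w \<noteq> 0" using zw by (auto simp: fdom_def)
    with eq obtain n where n: "\<bar>val q z / con q z\<bar> = \<bar>val q w / con q w\<bar> * (eps\<^sup>2) powi n"
      "\<bar>val q z\<bar> = \<bar>val q w\<bar> * eps powi n" by (rule PIdl_eq_ratio)
    have "n = 0"
    proof (rule ccontr)
      assume "n \<noteq> 0"
      then consider "n \<ge> 1" | "n \<le> -1" by linarith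
      then show False
      proof cases
        case 1
        then have "(eps\<^sup>2) powi 1 \<le> (eps\<^sup>2) powi n" using e1 by (intro power_int_increasing) auto
        then have "1 * eps\<^sup>2 \<le> \<bar>val q w / con q w\<bar> * (eps\<^sup>2) powi n"
          using zw e1 unfolding fdom_def by (intro mult_mono) auto
        then show False using n zw unfolding fdom_def by auto
      next
        case 2
        then have "(eps\<^sup>2) powi n \<le> (eps\<^sup>2) powi (-1)" using e1 by (intro power_int_increasing) auto
        then have "\<bar>val q w / con q w\<bar> * (eps\<^sup>2) powi n \<le> \<bar>val q w / con q w\<bar> * (eps\<^sup>2) powi (-1)"
          by (intro mult_left_mono) auto
        also have "\<dots> = \<bar>val q w / con q w\<bar> / eps\<^sup>2" by (simp add: power_int_minus divide_inverse)
        also have "\<dots> < 1" using zw e0 unfolding fdom_def by (subst divide_less_eq_1_pos) auto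
        finally show False using n zw unfolding fdom_def by auto
      qed
    qed
    then have "val q z = val q w" using n zw unfolding fdom_def by simp
    then show "z = w" by (simp add: val_inj)
  qed simp
next
  fix z assume "z \<in> fdom q eps"
  then have "z \<noteq> 0" by (auto simp: fdom_def)
  then show "PIdl\<^bsub>R\<^esub> (val q z) \<in> nonzero_ideals q" by (rule PIdl_mem_nonzero_ideals)
next
  have e1: "eps\<^sup>2 > 1" using fundamental_unit_props(1) by (simp add: one_less_power)
  then have e0: "eps\<^sup>2 > 0" by linarith
  fix I assume "I \<in> nonzero_ideals q"
  then obtain z where z: "z \<noteq> 0" "I = PIdl\<^bsub>R\<^esub> (val q z)" by (rule ideal_principal)
  define r where "r = \<bar>val q z / con q z\<bar>"
  have r: "r > 0" using z by (simp add: r_def val_eq_0_iff con_eq_0_iff)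
  define n where "n = \<lfloor>log (eps\<^sup>2) r\<rfloor>"
  have "(eps\<^sup>2) powr of_int n \<le> r" "r < (eps\<^sup>2) powr (of_int n + 1)"
    using e1 r unfolding n_def by (auto simp: le_log_iff[symmetric] log_less_iff[symmetric])
  then have rn: "(eps\<^sup>2) powi n \<le> r" "r < (eps\<^sup>2) powi n * eps\<^sup>2"
    using e0 powr_real_of_int'[of "eps\<^sup>2" n] by (auto simp: powr_add)
  obtain e where e: "\<bar>qnorm q e\<bar> = 1" "val q e = eps powi (-n)" by (rule unit_shift)
  have "\<bar>con q e\<bar> = 1 / \<bar>eps powi (-n)\<bar>" using quad_unit_con[OF e(1)] e(2) by simp
  then have "\<bar>val q e / con q e\<bar> = eps powi (-n) * eps powi (-n)"
    using e(2) fundamental_unit_props(1) by (simp add: abs_divide)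
  then have er: "\<bar>val q e / con q e\<bar> = inverse ((eps\<^sup>2) powi n)"
    by (simp add: power2_eq_square power_int_mult_distrib power_int_minus)
  define w where "w = qmul q z e"
  have w: "PIdl\<^bsub>R\<^esub> (val q w) = I" unfolding w_def z(2) by (rule PIdl_unit_mult[OF e(1)])
  have "\<bar>val q w / con q w\<bar> = r * \<bar>val q e / con q e\<bar>"
    by (simp add: w_def val_mul con_mul r_def abs_mult abs_divide)
  then have "\<bar>val q w / con q w\<bar> = r * inverse ((eps\<^sup>2) powi n)" by (simp only: er)
  moreover have "(eps\<^sup>2) powi n > 0" using e0 by (rule zero_less_power_int)
  ultimately have rw: "1 \<le> \<bar>val q w / con q w\<bar>" "\<bar>val q w / con q w\<bar> < eps\<^sup>2"
    using rn by (auto simp: field_simps)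
  show "\<exists>w\<in>fdom q eps. I = PIdl\<^bsub>R\<^esub> (val q w)"
  proof (cases "val q w > 0")
    case True
    then have "w \<in> fdom q eps" using rw by (simp add: fdom_def)
    then show ?thesis using w by auto
  next
    case False
    have "val q w \<noteq> 0" using rw by auto
    then have "- w \<in> fdom q eps" using rw False by (simp add: fdom_def val_minus con_minus)
    then show ?thesis using w PIdl_minus[of w] by auto
  qed
qed

lemma hecke_char_PIdl:
  assumes z: "z \<noteq> 0"
  shows "hecke_char q k (PIdl\<^bsub>R\<^esub> (val q z)) = cis (2 * pi * real k * theta q eps z)"
proof -
  define I where "I = PIdl\<^bsub>R\<^esub> (val q z)"
  define \<alpha> where "\<alpha> = (SOME \<alpha>. \<alpha> \<in> carrier R \<and> I = PIdl\<^bsub>R\<^esub> \<alpha>)"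
  have "\<alpha> \<in> carrier R \<and> I = PIdl\<^bsub>R\<^esub> \<alpha>"
    unfolding \<alpha>_def by (rule someI[of _ "val q z"]) (simp add: I_def)
  then obtain w where w: "\<alpha> = val q w" "PIdl\<^bsub>R\<^esub> (val q w) = PIdl\<^bsub>R\<^esub> (val q z)"
    unfolding I_def by (auto simp: integer_ring_carrier)
  obtain n where n: "\<bar>val q w / con q w\<bar> = \<bar>val q z / con q z\<bar> * (eps\<^sup>2) powi n"
    using PIdl_eq_ratio[OF w(2) z] .
  have pos: "\<bar>val q z / con q z\<bar> > 0" using z by (simp add: val_eq_0_iff con_eq_0_iff)
  have e1: "eps > 1" by (rule fundamental_unit_props)
  then have le: "ln eps > 0" by simp
  have lnw: "ln \<bar>val q w / con q w\<bar> = ln \<bar>val q z / con q z\<bar> + of_int n * (2 * ln eps)"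
  proof -
    have "ln ((eps\<^sup>2) powi n) = of_int n * (2 * ln eps)"
      using e1 powr_real_of_int'[of "eps\<^sup>2" n, symmetric] by (simp add: ln_powr ln_realpow)
    then show ?thesis unfolding n using pos e1 by (subst ln_mult) auto
  qed
  have wpos: "\<bar>val q w / con q w\<bar> > 0" unfolding n using pos e1 by (intro mult_pos_pos) auto
  have "hecke_char q k I = complex_of_real \<bar>val q w / con q w\<bar> powr
      (complex_of_real (pi * real k / ln eps) * \<i>)"
    unfolding hecke_char_def Let_def \<alpha>_def[symmetric] w(1) conjugate_val ..
  also have "\<dots> = exp (complex_of_real (pi * real k / ln eps) * \<i> * complex_of_real (ln \<bar>val q w / con q w\<bar>))"
    using wpos by (simp only: powr_def Ln_of_real) auto
  also have "\<dots> = cis (pi * real k / ln eps * ln \<bar>val q w / con q w\<bar>)"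
    by (simp add: cis_conv_exp mult_ac)
  \<comment> \<open>The generator chosen by the definition differs from \<open>val q z\<close> by an
    unknown unit, whose effect is \<open>k * n\<close> full turns.\<close>
  also have "pi * real k / ln eps * ln \<bar>val q w / con q w\<bar> = 2 * pi * real k * theta q eps z + 2 * pi * of_int (int k * n)"
    unfolding lnw theta_def using le by (simp add: field_simps)
  also have "cis \<dots> = cis (2 * pi * real k * theta q eps z)"
    by (simp flip: cis_mult)
  finally show ?thesis unfolding I_def .
qed

end


section \<open>Theta functions\<close>

text \<open>Termwise integration over a countable index set. An enumeration, extended by zero off
  its range, reduces it to series over the naturals, and absolute convergence carries the result
  back to unordered sums.\<close>

lemma integral_has_sum:
  fixes f :: "'i \<Rightarrow> 'a \<Rightarrow> complex"
  assumes "countable I" and int: "\<And>i. i \<in> I \<Longrightarrow> integrable M (f i)"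
    and sum: "(\<lambda>i. \<integral>x. norm (f i x) \<partial>M) summable_on I"
    and ptw: "\<And>x. x \<in> space M \<Longrightarrow> ((\<lambda>i. f i x) has_sum g x) I"
  shows "integrable M g" "((\<lambda>i. \<integral>x. f i x \<partial>M) has_sum (\<integral>x. g x \<partial>M)) I"
proof -
  define e where "e = to_nat_on I"
  define h where "h = (\<lambda>n x. if n \<in> e ` I then f (from_nat_into I n) x else 0)"
  have inj: "inj_on e I" unfolding e_def using \<open>countable I\<close> by (rule inj_on_to_nat_on)
  have he: "h (e i) = f i" if "i \<in> I" for i
    using that \<open>countable I\<close> by (simp add: h_def e_def)
  have h0: "h n = (\<lambda>x. 0)" if "n \<notin> e ` I" for n using that by (simp add: h_def)
  \<comment> \<open>Any functional vanishing at the zero function sees the same sum over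
    \<open>I\<close> and over the naturals. It is applied to evaluation at a point, to the L1 norm
    and to the integral.\<close>
  have transfer: "((\<lambda>n. \<phi> (h n)) has_sum s) UNIV \<longleftrightarrow> ((\<lambda>i. \<phi> (f i)) has_sum s) I"
    if "\<phi> (\<lambda>x. 0) = 0" for \<phi> :: "('a \<Rightarrow> complex) \<Rightarrow> 'b :: {comm_monoid_add, topological_space}" and s
  proof -
    have "((\<lambda>n. \<phi> (h n)) has_sum s) UNIV \<longleftrightarrow> ((\<lambda>n. \<phi> (h n)) has_sum s) (e ` I)"
      by (rule has_sum_cong_neutral) (auto simp: h0 that)
    also have "\<dots> \<longleftrightarrow> ((\<lambda>n. \<phi> (h n)) \<circ> e has_sum s) I"
      by (rule has_sum_reindex[OF inj])
    also have "\<dots> \<longleftrightarrow> ((\<lambda>i. \<phi> (f i)) has_sum s) I"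
      by (rule has_sum_cong) (simp add: he)
    finally show ?thesis .
  qed
  have ptw': "((\<lambda>n. h n x) has_sum g x) UNIV" if "x \<in> space M" for x
    using transfer[of "\<lambda>u. u x" "g x"] ptw[OF that] by simp
  have g_eq: "g x = (\<Sum>n. h n x)" if "x \<in> space M" for x
    using has_sum_imp_sums[OF ptw'[OF that]] by (rule sums_unique)
  have hint: "integrable M (h n)" for n
    using int he by (cases "n \<in> e ` I") (auto simp: h0)
  have AE: "AE x in M. summable (\<lambda>n. norm (h n x))"
  proof (rule AE_I2)
    fix x assume "x \<in> space M"
    then have "(\<lambda>n. h n x) summable_on UNIV" using ptw' by (auto simp: summable_on_def)
    then have "(\<lambda>n. norm (h n x)) summable_on UNIV"
      by (simp flip: summable_on_iff_abs_summable_on_complex)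
    then show "summable (\<lambda>n. norm (h n x))" by (rule summable_on_imp_summable)
  qed
  have sm: "(\<lambda>n. \<integral>x. norm (h n x) \<partial>M) summable_on UNIV"
    using sum transfer[of "\<lambda>u. \<integral>x. norm (u x) \<partial>M"] by (simp add: summable_on_def)
  then have sm': "summable (\<lambda>n. \<integral>x. norm (h n x) \<partial>M)" by (rule summable_on_imp_summable)
  have "integrable M (\<lambda>x. \<Sum>n. h n x)" by (rule integrable_suminf[OF hint AE sm'])
  then show "integrable M g" by (rule Bochner_Integration.integrable_cong[THEN iffD1, rotated -1]) (auto simp: g_eq)
  have "(\<lambda>n. \<integral>x. h n x \<partial>M) sums (\<integral>x. (\<Sum>n. h n x) \<partial>M)" by (rule sums_integral[OF hint AE sm'])
  moreover have "(\<integral>x. (\<Sum>n. h n x) \<partial>M) = (\<integral>x. g x \<partial>M)"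
    by (rule Bochner_Integration.integral_cong) (auto simp: g_eq)
  moreover have "summable (\<lambda>n. norm (\<integral>x. h n x \<partial>M))"
    by (rule summable_comparison_test'[OF sm', of 0]) (simp add: integral_norm_bound)
  ultimately have "((\<lambda>n. \<integral>x. h n x \<partial>M) has_sum (\<integral>x. g x \<partial>M)) UNIV"
    by (intro norm_summable_imp_has_sum) auto
  then show "((\<lambda>i. \<integral>x. f i x \<partial>M) has_sum (\<integral>x. g x \<partial>M)) I"
    using transfer[of "\<lambda>u. \<integral>x. u x \<partial>M"] by simp
qed

section \<open>The Fejer kernel and uniqueness of Fourier coefficients\<close>

definition fejer :: "nat \<Rightarrow> real \<Rightarrow> complex" where
  "fejer N x = (\<Sum>j<N. \<Sum>k<N. cis (2 * pi * of_int (int j - int k) * x)) / of_nat N"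

text \<open>The double sum is the Dirichlet kernel times its complex conjugate, so the kernel is
  real and nonnegative. The same identity is used again in the large sieve.\<close>

lemma fejer_eq: "fejer N x = of_real ((norm (\<Sum>j<N. cis (2 * pi * x) ^ j))\<^sup>2 / real N)"
proof -
  have "(\<Sum>j<N. \<Sum>k<N. cis (2 * pi * of_int (int j - int k) * x))
      = (\<Sum>j<N. cis (2 * pi * x) ^ j) * cnj (\<Sum>j<N. cis (2 * pi * x) ^ j)"
    unfolding cnj_sum sum_product
    by (intro sum.cong refl) (simp only: complex_cnj_power cis_cnj Complex.DeMoivre cis_mult, simp add: algebra_simps)
  also have "\<dots> = of_real ((norm (\<Sum>j<N. cis (2 * pi * x) ^ j))\<^sup>2)"
    by (simp only: complex_norm_square)
  finally show ?thesis by (simp add: fejer_def)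
qed

lemma norm_geometric_cis_le:
  assumes "cis t \<noteq> 1"
  shows "norm (\<Sum>j<N. cis t ^ j) \<le> 2 / norm (1 - cis t)"
proof -
  have "norm (\<Sum>j<N. cis t ^ j) = norm (1 - cis t ^ N) / norm (1 - cis t)"
    using assms by (simp add: sum_gp_strict norm_divide)
  also have "\<dots> \<le> 2 / norm (1 - cis t)"
    using norm_triangle_ineq4[of 1 "cis t ^ N"] by (intro divide_right_mono) (auto simp: norm_power)
  finally show ?thesis .
qed

lemma integral_cis_period:
  "(cis \<circ> (\<lambda>y. 2 * pi * of_int n * (x - y)) has_integral (if n = 0 then 1 else 0)) {0..1::real}"
proof (cases "n = 0")
  case True
  then show ?thesis using has_integral_const_real[of "1::complex" 0 1] by (simp add: o_def)
next
  case False
  define c where "c = - (2 * pi * of_int n * \<i> :: complex)"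
  have c: "c \<noteq> 0" using False by (simp add: c_def)
  have "((\<lambda>y. exp (c * (of_real y - of_real x)) / c) has_vector_derivative exp (c * (of_real y - of_real x))) (at y within {0..1})" for y
    by (rule has_vector_derivative_real_field) (use c in \<open>auto intro!: derivative_eq_intros\<close>)
  then have "((\<lambda>y. exp (c * of_real (y - x)) / c) has_vector_derivative exp (c * of_real (y - x))) (at y within {0..1})" for y
    by simp
  then have "((\<lambda>y. exp (c * of_real (y - x))) has_integral (exp (c * of_real (1 - x)) / c - exp (c * of_real (0 - x)) / c)) {0..1}"
    by (intro fundamental_theorem_of_calculus) auto
  moreover have E: "exp (c * of_real (y - x)) = cis (2 * pi * of_int n * (x - y))" for y
    by (simp add: c_def cis_conv_exp algebra_simps)
  moreover have P: "cis (2 * pi * of_int n * (x - 1)) = cis (2 * pi * of_int n * (x - 0))"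
    by (simp add: right_diff_distrib flip: cis_divide)
  ultimately have "((\<lambda>y. cis (2 * pi * of_int n * (x - y))) has_integral 0) {0..1}"
    unfolding E P by simp
  then show ?thesis using False by (simp add: o_def)
qed

text \<open>Both sides of the theta inversion formulas are compared by their Fourier coefficients.\<close>

lemma fourier_unique:
  fixes f :: "real \<Rightarrow> complex"
  assumes cont: "continuous_on {0..1} f"
    and coeff: "\<And>n::int. integral {0..1} (\<lambda>y. f y * cis (2 * pi * of_int n * y)) = 0"
    and x: "0 < x" "x < 1"
  shows "f x = 0"
proof -
  have int_fejer: "integral {0..1} (\<lambda>y. fejer N (x - y)) = 1" if "N > 0" for N
  proof -
    have "((\<lambda>y. (\<Sum>j<N. \<Sum>k<N. cis (2 * pi * of_int (int j - int k) * (x - y))) / of_nat N)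
       has_integral (\<Sum>j<N. \<Sum>k<N. if int j - int k = 0 then 1 else 0) / of_nat N) {0..1}"
      by (intro has_integral_divide has_integral_sum integral_cis_period[unfolded o_def] finite_lessThan)
    then have "integral {0..1} (\<lambda>y. fejer N (x - y)) = (\<Sum>j<N. \<Sum>k<N. if int j - int k = 0 then 1 else 0) / of_nat N"
      unfolding fejer_def by (rule integral_unique)
    also have "(\<Sum>j<N. \<Sum>k<N. if int j - int k = 0 then 1 else 0 :: complex) = (\<Sum>j<N. \<Sum>k<N. if j = k then 1 else 0)"
      by (intro sum.cong refl) auto
    also have "\<dots> = of_nat N" by (simp add: sum.delta)
    also have "of_nat N / of_nat N = (1::complex)" using that by simp
    finally show ?thesis .
  qed
  have int_f: "integral {0..1} (\<lambda>y. f y * fejer N (x - y)) = 0" for N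
  proof -
    have 1: "((\<lambda>y. f y * cis (2 * pi * of_int n * (x - y))) has_integral 0) {0..1}" for n
    proof -
      have "(\<lambda>y. f y * cis (2 * pi * of_int (- n) * y)) integrable_on {0..1}"
        by (intro integrable_continuous_real continuous_intros cont)
      then have "((\<lambda>y. f y * cis (2 * pi * of_int (- n) * y)) has_integral 0) {0..1}"
        using coeff[of "- n"] by (metis integrable_integral)
      from has_integral_mult_right[OF this, of "cis (2 * pi * of_int n * x)"]
      have "((\<lambda>y. cis (2 * pi * of_int n * x) * (f y * cis (2 * pi * of_int (- n) * y))) has_integral 0) {0..1}"
        by simp
      moreover have "cis (2 * pi * of_int n * x) * (f y * cis (2 * pi * of_int (- n) * y)) =
          f y * cis (2 * pi * of_int n * (x - y))" for y
        by (simp add: cis_mult right_diff_distrib)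
      ultimately show ?thesis by (simp only:)
    qed
    have "((\<lambda>y. (\<Sum>j<N. \<Sum>k<N. f y * cis (2 * pi * of_int (int j - int k) * (x - y))) / of_nat N)
       has_integral (\<Sum>j<N. \<Sum>k<N. 0) / of_nat N) {0..1}"
      by (intro has_integral_divide has_integral_sum 1 finite_lessThan)
    from integral_unique[OF this] show ?thesis unfolding fejer_def
      by (simp only: sum_distrib_left times_divide_eq_right) simp
  qed
  obtain M where M: "\<And>y. y \<in> {0..1} \<Longrightarrow> norm (f y) \<le> M"
    using compact_continuous_image[OF cont compact_Icc] by (metis bounded_iff compact_imp_bounded imageI)
  have "norm (f x) \<le> M" using M x by simp
  have M0: "M \<ge> 0" using M[of 0] norm_ge_zero[of "f 0"] by (simp del: norm_ge_zero)
  have small: "norm (f x) \<le> e" if e: "e > 0" for e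
  proof -
    obtain d where d: "d > 0" "\<And>y. y \<in> {0..1} \<Longrightarrow> dist y x < d \<Longrightarrow> dist (f y) (f x) < e"
      using cont x e unfolding continuous_on_iff by (metis atLeastAtMost_iff less_imp_le)
    \<comment> \<open>Away from \<open>x\<close> the kernel is small: as \<open>x\<close> is
      interior to the unit interval, no point of \<open>S\<close> is congruent to \<open>x\<close>
      modulo 1, and compactness bounds the denominator of the geometric sum below by some
      \<open>m > 0\<close>.\<close>
    define S where "S = {y \<in> {0..1}. d \<le> dist y x}"
    have S_eq: "S = {0..1} \<inter> (\<lambda>y. dist y x) -` {d..}" by (auto simp: S_def)
    have "compact S" unfolding S_eq
      by (intro closed_Int_compact compact_Int_closed compact_Icc continuous_closed_vimage) (auto intro!: continuous_intros)
    have nz: "cis (2 * pi * (x - y)) \<noteq> 1" if "y \<in> S" for y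
    proof
      assume "cis (2 * pi * (x - y)) = 1"
      then have "cos (2 * pi * (x - y)) = 1" by (metis Re_complex_of_real cis.simps(1) of_real_1)
      then obtain n :: int where "2 * pi * (x - y) = of_int n * 2 * pi" using cos_one_2pi_int by blast
      then have n: "x - y = of_int n" by simp
      have "\<bar>x - y\<bar> < 1" using that x unfolding S_def by auto
      then have "n = 0" using n by linarith
      then show False using n that d(1) unfolding S_def by simp
    qed
    have "\<exists>m>0. \<forall>y\<in>S. m \<le> norm (1 - cis (2 * pi * (x - y)))"
    proof (cases "S = {}")
      case False
      have "continuous_on S (\<lambda>y. norm (1 - cis (2 * pi * (x - y))))" by (intro continuous_intros)
      then obtain y0 where "y0 \<in> S" "\<forall>y\<in>S. norm (1 - cis (2 * pi * (x - y0))) \<le> norm (1 - cis (2 * pi * (x - y)))"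
        using continuous_attains_inf[OF \<open>compact S\<close> False] by blast
      then show ?thesis using nz by (intro exI[of _ "norm (1 - cis (2 * pi * (x - y0)))"]) auto
    qed (auto intro: exI[of _ 1])
    then obtain m where m: "m > 0" "\<And>y. y \<in> S \<Longrightarrow> m \<le> norm (1 - cis (2 * pi * (x - y)))" by blast
    \<comment> \<open>The constant is \<open>2 * M\<close>, a bound for the difference of two values
      of \<open>f\<close>, times \<open>(2 / m)^2\<close> from the squared geometric sum.\<close>
    have bound: "norm (f x) \<le> e + (8 * M / m\<^sup>2) / real N" if N: "N > 0" for N
    proof -
      define F where "F = (\<lambda>y. (norm (\<Sum>j<N. cis (2 * pi * (x - y)) ^ j))\<^sup>2 / real N)"
      have F: "fejer N (x - y) = of_real (F y)" for y by (simp add: fejer_eq F_def)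
      have F0: "F y \<ge> 0" for y by (simp add: F_def)
      have contF: "continuous_on {0..1} F" unfolding F_def by (intro continuous_intros)  (use N in auto)
      have contf: "continuous_on {0..1} (\<lambda>y. f y * of_real (F y))" by (intro continuous_intros cont contF)
      have "integral {0..1} (complex_of_real \<circ> F) = of_real (integral {0..1} F)"
        by (rule integral_linear) (intro integrable_continuous_real contF bounded_linear_of_real)+
      then have "integral {0..1} (\<lambda>y. complex_of_real (F y)) = of_real (integral {0..1} F)"
        by (simp add: o_def)
      then have intF: "integral {0..1} F = 1" using int_fejer[OF N] unfolding F by simp
      have "f x = integral {0..1} (\<lambda>y. f x * of_real (F y)) - integral {0..1} (\<lambda>y. f y * of_real (F y))"
        using int_fejer[OF N] int_f[of N] unfolding F by simp
      also have "\<dots> = integral {0..1} (\<lambda>y. f x * of_real (F y) - f y * of_real (F y))"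
        by (rule integral_diff[symmetric])
          (intro integrable_continuous_real continuous_intros contF contf)+
      finally have fx: "f x = integral {0..1} (\<lambda>y. f x * of_real (F y) - f y * of_real (F y))" .
      have "norm (f x) \<le> integral {0..1} (\<lambda>y. e * F y + 8 * M / m\<^sup>2 / real N)"
        unfolding fx[symmetric] 
      proof (subst fx, rule integral_norm_bound_integral)
        fix y :: real assume y: "y \<in> {0..1}"
        have eq: "norm (f x * of_real (F y) - f y * of_real (F y)) = norm (f x - f y) * F y"
          using F0[of y] by (simp flip: left_diff_distrib add: norm_mult)
        show "norm (f x * of_real (F y) - f y * of_real (F y)) \<le> e * F y + 8 * M / m\<^sup>2 / real N"
        proof (cases "y \<in> S")
          case False
          then have "norm (f x - f y) \<le> e" using d(2)[OF y] y unfolding S_def by (auto simp: dist_norm norm_minus_commute)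
          then have "norm (f x - f y) * F y \<le> e * F y" using F0 by (intro mult_right_mono)
          moreover have "0 \<le> 8 * M / m\<^sup>2 / real N" using M0 by simp
          ultimately show ?thesis unfolding eq by linarith
        next
          case True
          have "norm (\<Sum>j<N. cis (2 * pi * (x - y)) ^ j) \<le> 2 / norm (1 - cis (2 * pi * (x - y)))"
            by (rule norm_geometric_cis_le[OF nz[OF True]])
          also have "\<dots> \<le> 2 / m" using m(2)[OF True] m(1) by (intro divide_left_mono mult_pos_pos) auto
          finally have "(norm (\<Sum>j<N. cis (2 * pi * (x - y)) ^ j))\<^sup>2 \<le> (2 / m)\<^sup>2" by (rule power_mono) simp
          then have "F y \<le> (2 / m)\<^sup>2 / real N" unfolding F_def by (intro divide_right_mono) auto
          moreover have "norm (f x - f y) \<le> 2 * M"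
            using norm_triangle_ineq4[of "f x" "f y"] M[of x] M[OF y] x by simp
          ultimately have "norm (f x - f y) * F y \<le> (2 * M) * ((2 / m)\<^sup>2 / real N)"
            using F0 M0 by (intro mult_mono) auto
          also have "\<dots> = 8 * M / m\<^sup>2 / real N" by (simp add: power_divide)
          finally show ?thesis unfolding eq using F0[of y] e by (simp add: add_increasing)
        qed
      qed (intro integrable_continuous_real continuous_intros contF contf)+
      also have "\<dots> = e * integral {0..1} F + 8 * M / m\<^sup>2 / real N"
        by (subst integral_add) (auto intro!: integrable_continuous_real continuous_intros contF)
      finally show ?thesis using intF by simp
    qed
    have "(\<lambda>N. e + (8 * M / m\<^sup>2) / real N) \<longlonglongrightarrow> e + 0"
      by (intro tendsto_intros lim_const_over_n)
    then have "norm (f x) \<le> e + 0"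
      by (rule LIMSEQ_le_const) (use bound in \<open>auto intro!: exI[of _ 1]\<close>)
    then show ?thesis by simp
  qed
  then have "norm (f x) \<le> 0" by (meson dense_ge)
  then show ?thesis by simp
qed


lemma summable_on_int_if_summable:
  fixes f :: "int \<Rightarrow> real"
  assumes "\<And>m. f m \<ge> 0" "summable (\<lambda>n. f (int n))" "summable (\<lambda>n. f (- int n))"
  shows "f summable_on UNIV"
proof -
  have "(\<lambda>n. f (int n)) summable_on UNIV" "(\<lambda>n. f (- int n)) summable_on UNIV"
    using assms by (simp_all add: summable_on_UNIV_nonneg_real_iff)
  then have "f summable_on range int" "f summable_on range (\<lambda>n. - int n)"
    by (simp_all add: summable_on_reindex inj_on_def o_def)
  then have "f summable_on range int \<union> range (\<lambda>n. - int n)"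
    by (intro summable_on_union)
  also have "range int \<union> range (\<lambda>n. - int n) = UNIV"
    by (auto simp: image_iff) (metis int_cases2)
  finally show ?thesis .
qed

lemma summable_on_gaussian_int:
  fixes c :: real
  assumes "c > 0"
  shows "(\<lambda>m::int. exp (- c * of_int m ^ 2)) summable_on UNIV"
proof -
  have "summable (\<lambda>n. exp (- c * (of_nat n)\<^sup>2))"
  proof (rule summable_comparison_test'[of "\<lambda>n. exp (- c) ^ n" 0])
    show "summable (\<lambda>n. exp (- c) ^ n)" using assms by (intro summable_geometric) auto
    fix n :: nat
    have "real n \<le> (real n)\<^sup>2" by (cases n) (auto simp: power2_eq_square)
    then have "exp (- c * (real n)\<^sup>2) \<le> exp (real n * - c)" using assms by simp
    then show "norm (exp (- c * (real n)\<^sup>2)) \<le> exp (- c) ^ n" by (simp only: exp_of_nat_mult norm_exp) simp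
  qed
  then show ?thesis by (intro summable_on_int_if_summable) auto
qed

definition gauss :: "real \<Rightarrow> real \<Rightarrow> int \<Rightarrow> real" where
  "gauss a x m = exp (- pi * a * (of_int m + x)\<^sup>2)"

text \<open>A summable majorant of the shifted Gaussian, uniform for shifts up to \<open>S\<close>;
  it comes from \<open>m^2 / 2 <= (m + x)^2 + x^2\<close>.\<close>

definition gbound :: "real \<Rightarrow> real \<Rightarrow> int \<Rightarrow> real" where
  "gbound a S m = exp (pi * a * S\<^sup>2) * exp (- (pi * a / 2) * of_int m ^ 2)"

lemma gauss_le_gbound:
  assumes "a > 0" "\<bar>x\<bar> \<le> S"
  shows "gauss a x m \<le> gbound a S m"
proof -
  have "x\<^sup>2 \<le> S\<^sup>2" using assms(2) by (simp add: abs_le_square_iff[symmetric])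
  moreover have "(of_int m)\<^sup>2 / 2 \<le> (of_int m + x)\<^sup>2 + x\<^sup>2"
  proof -
    have "0 \<le> (of_int m / 2 + x)\<^sup>2 * 2" by simp
    also have "\<dots> = (of_int m + x)\<^sup>2 + x\<^sup>2 - (of_int m)\<^sup>2 / 2" by (simp add: power2_eq_square field_simps)
    finally show ?thesis by simp
  qed
  ultimately have "(of_int m)\<^sup>2 / 2 - S\<^sup>2 \<le> (of_int m + x)\<^sup>2" by linarith
  then have "(pi * a) * ((of_int m)\<^sup>2 / 2 - S\<^sup>2) \<le> (pi * a) * (of_int m + x)\<^sup>2"
    using assms(1) by (intro mult_left_mono) auto
  then show ?thesis unfolding gauss_def gbound_def mult_exp_exp exp_le_cancel_iff
    by (simp add: algebra_simps)
qed

lemma gbound_summable: "a > 0 \<Longrightarrow> gbound a S summable_on UNIV"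
  unfolding gbound_def by (intro summable_on_cmult_right summable_on_gaussian_int) auto

lemma gauss_summable: "a > 0 \<Longrightarrow> gauss a x summable_on UNIV"
  by (rule summable_on_comparison_test[OF gbound_summable[of a "\<bar>x\<bar>"]])
    (auto simp: gauss_le_gbound, simp add: gauss_def)

text \<open>The affine substitution \<open>y = - s + c * x\<close> with
  \<open>c = 1 / sqrt (2 * pi * a)\<close> turns the integral into the characteristic function of
  the standard normal distribution.\<close>

lemma gauss_fourier:
  assumes a: "a > 0"
  shows "integrable lborel (\<lambda>y. of_real (exp (- pi * a * (y + s)\<^sup>2)) * cis (2 * pi * of_int n * y))" (is "integrable lborel ?f")
    and "(\<integral>y. of_real (exp (- pi * a * (y + s)\<^sup>2)) * cis (2 * pi * of_int n * y) \<partial>lborel)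
       = of_real (exp (- pi * of_int n ^ 2 / a) / sqrt a) * cis (- 2 * pi * of_int n * s)"
proof -
  define c where "c = 1 / sqrt (2 * pi * a)"
  define k where "k = (of_real (sqrt (2 * pi)) * cis (- 2 * pi * of_int n * s) :: complex)"
  have c: "c > 0" using a by (simp add: c_def)
  have c2: "c\<^sup>2 = 1 / (2 * pi * a)" using a by (simp add: c_def power_divide)
  define t where "t = 2 * pi * of_int n * c"
  have eq: "?f (- s + c * x) = k * (of_real (std_normal_density x) * exp (\<i> * of_real (t * x)))" for x
  proof -
    have "pi * a * (c * x)\<^sup>2 = x\<^sup>2 / 2" using a by (simp add: power_mult_distrib c2 field_simps)
    then have "exp (- pi * a * (- s + c * x + s)\<^sup>2) = exp (- (x\<^sup>2 / 2))" by simp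
    moreover have "cis (2 * pi * of_int n * (- s + c * x)) = cis (- 2 * pi * of_int n * s) * exp (\<i> * of_real (t * x))"
      by (simp add: t_def cis_conv_exp algebra_simps flip: exp_add)
    moreover have "exp (- (x\<^sup>2 / 2)) = sqrt (2 * pi) * std_normal_density x"
      by (simp add: std_normal_density_def)
    ultimately show ?thesis by (simp only: k_def of_real_mult mult_ac)
  qed
  interpret N: prob_space std_normal_distribution
    using prob_space_normal_density[of 1 0] by simp
  have int: "integrable std_normal_distribution (\<lambda>x. exp (\<i> * of_real (t * x)))"
    by (rule N.integrable_const_bound[of _ 1]) auto
  then have int': "integrable lborel (\<lambda>x. of_real (std_normal_density x) * exp (\<i> * of_real (t * x)))"
    by (subst (asm) integrable_density) (auto simp: scaleR_conv_of_real)
  have "(\<integral>x. of_real (std_normal_density x) * exp (\<i> * of_real (t * x)) \<partial>lborel)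
      = (\<integral>x. exp (\<i> * of_real (t * x)) \<partial>std_normal_distribution)"
    by (subst integral_density) (auto simp: scaleR_conv_of_real)
  also have "\<dots> = of_real (exp (- (t\<^sup>2) / 2))"
    using fun_cong[OF char_std_normal_distribution, of t] by (simp add: char_def)
  also have "- (t\<^sup>2) / 2 = - pi * of_int n ^ 2 / a"
    using a by (simp add: t_def power_mult_distrib c2 power2_eq_square[of pi] field_simps)
  finally have val: "(\<integral>x. of_real (std_normal_density x) * exp (\<i> * of_real (t * x)) \<partial>lborel) =
      of_real (exp (- pi * of_int n ^ 2 / a))" .
  have "integrable lborel (\<lambda>x. ?f (- s + c * x))"
    unfolding eq using int' by simp
  then show "integrable lborel ?f"
    using c by (subst (asm) lborel_integrable_real_affine_iff) auto
  have "(\<integral>y. ?f y \<partial>lborel) = \<bar>c\<bar> *\<^sub>R (\<integral>x. ?f (- s + c * x) \<partial>lborel)"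
    using c by (intro lborel_integral_real_affine) auto
  also have "(\<integral>x. ?f (- s + c * x) \<partial>lborel) = k * of_real (exp (- pi * of_int n ^ 2 / a))"
    unfolding eq by (simp only: integral_mult_right_zero val)
  also have "\<bar>c\<bar> *\<^sub>R (k * of_real (exp (- pi * of_int n ^ 2 / a))) = of_real c * (k * of_real (exp (- pi * of_int n ^ 2 / a)))"
    using c by (simp add: scaleR_conv_of_real)
  also have "\<dots> = of_real (c * sqrt (2 * pi) * exp (- pi * of_int n ^ 2 / a)) * cis (- 2 * pi * of_int n * s)"
    by (simp add: k_def mult_ac)
  also have "c * sqrt (2 * pi) * exp (- pi * of_int n ^ 2 / a) = exp (- pi * of_int n ^ 2 / a) / sqrt a"
    using a by (simp add: c_def real_sqrt_mult)
  finally show "(\<integral>y. ?f y \<partial>lborel) = of_real (exp (- pi * of_int n ^ 2 / a) / sqrt a) * cis (- 2 * pi * of_int n * s)" .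
qed

text \<open>Translates of the half-open interval tile the line exactly, which unfolding requires,
  whereas Fourier coefficients are stated over the closed one.\<close>

lemma set_integral_half_open:
  fixes f :: "real \<Rightarrow> complex"
  assumes "continuous_on {0..1} f"
  shows "(\<integral>y. indicator {0..<1} y * f y \<partial>lborel) = integral {0..1} f"
proof -
  have 1: "set_integrable lborel {0..1} f" using assms by (rule borel_integrable_atLeastAtMost')
  have "(\<integral>y. indicator {0..<1} y * f y \<partial>lborel) = (\<integral>y. indicator {0..1} y *\<^sub>R f y \<partial>lborel)"
  proof (rule integral_cong_AE)
    have m: "(\<lambda>y. indicator {0..1} y *\<^sub>R f y) \<in> borel_measurable lborel"
      using 1 unfolding set_integrable_def by (rule borel_measurable_integrable)
    then show "(\<lambda>y. indicator {0..1} y *\<^sub>R f y) \<in> borel_measurable lborel" .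
    have "(\<lambda>y. indicator {0..<1} y * f y) = (\<lambda>y. indicator {0..<1} y *\<^sub>R (indicator {0..1} y *\<^sub>R f y))"
      by (auto simp: fun_eq_iff indicator_def)
    moreover have "(\<lambda>y. indicator {0..<1::real} y *\<^sub>R (indicator {0..1} y *\<^sub>R f y)) \<in> borel_measurable lborel"
      by (intro borel_measurable_scaleR m) auto
    ultimately show "(\<lambda>y. indicator {0..<1} y * f y) \<in> borel_measurable lborel"
      by (simp only:)
    show "AE y in lborel. indicator {0..<1} y * f y = indicator {0..1} y *\<^sub>R f y"
      using AE_lborel_singleton[of 1] by eventually_elim (auto simp: indicator_def)
  qed
  also have "\<dots> = integral {0..1} f"
    using set_borel_integral_eq_integral(2)[OF 1] unfolding set_lebesgue_integral_def .
  finally show ?thesis .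
qed

lemma integral_uniform_series:
  fixes F :: "int \<Rightarrow> real \<Rightarrow> complex"
  assumes cont: "\<And>m. continuous_on UNIV (F m)"
    and bound: "\<And>m y. y \<in> {0..1} \<Longrightarrow> norm (F m y) \<le> B m" and B: "B summable_on UNIV"
  shows "continuous_on {0..1} (\<lambda>y. \<Sum>\<^sub>\<infinity>m. F m y)"
    and "((\<lambda>m. \<integral>y. indicator {0..<1} y * F m y \<partial>lborel) has_sum integral {0..1} (\<lambda>y. \<Sum>\<^sub>\<infinity>m. F m y)) UNIV"
    and "(\<lambda>m. \<integral>y. norm (indicator {0..<1} y * F m y) \<partial>lborel) summable_on UNIV"
proof -
  show cont': "continuous_on {0..1} (\<lambda>y. \<Sum>\<^sub>\<infinity>m. F m y)"
  proof (rule uniform_limit_theorem)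
    show "uniform_limit {0..1} (\<lambda>X y. \<Sum>m\<in>X. F m y) (\<lambda>y. \<Sum>\<^sub>\<infinity>m. F m y) (finite_subsets_at_top UNIV)"
      by (rule Weierstrass_m_test_general[OF _ B]) (use bound in auto)
    show "\<forall>\<^sub>F X in finite_subsets_at_top UNIV. continuous_on {0..1} (\<lambda>y. \<Sum>m\<in>X. F m y)"
      by (intro always_eventually allI continuous_on_sum continuous_on_subset[OF cont]) auto
  qed auto
  have meas: "F m \<in> borel_measurable borel" for m
    using cont by (rule borel_measurable_continuous_onI)
  have B0: "B m \<ge> 0" for m using bound[of 0 m] norm_ge_zero[of "F m 0"] by (simp del: norm_ge_zero)
  have intind: "integrable lborel (\<lambda>y. indicator {0..<1::real} y * B m)" for m
    by (intro integrable_mult_left integrable_real_indicator) auto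
  have nb: "norm (indicator {0..<1} y * F m y) \<le> indicator {0..<1} y * B m" for y m
    using bound[of y m] by (auto simp: indicator_def)
  have int: "integrable lborel (\<lambda>y. indicator {0..<1} y * F m y)" for m
    by (rule Bochner_Integration.integrable_bound[OF intind[of m]]) (use meas nb B0 in \<open>auto intro: order_trans\<close>)
  show sm: "(\<lambda>m. \<integral>y. norm (indicator {0..<1} y * F m y) \<partial>lborel) summable_on UNIV"
  proof (rule summable_on_comparison_test[OF B])
    fix m
    have "(\<integral>y. norm (indicator {0..<1} y * F m y) \<partial>lborel) \<le> (\<integral>y. indicator {0..<1::real} y * B m \<partial>lborel)"
    proof (rule Bochner_Integration.integral_mono)
      show "integrable lborel (\<lambda>y. norm (indicator {0..<1} y * F m y))" by (rule integrable_norm[OF int])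
    qed (rule intind nb)+
    also have "\<dots> = B m" by simp
    finally show "(\<integral>y. norm (indicator {0..<1} y * F m y) \<partial>lborel) \<le> B m" .
  qed simp
  have "((\<lambda>m. indicator {0..<1} y * F m y) has_sum (indicator {0..<1} y * (\<Sum>\<^sub>\<infinity>m. F m y))) UNIV" for y
  proof (cases "y \<in> {0..<1}")
    case True
    have "(\<lambda>m. norm (F m y)) summable_on UNIV"
      by (rule summable_on_comparison_test[OF B]) (use True bound in auto)
    then have "((\<lambda>m. F m y) has_sum (\<Sum>\<^sub>\<infinity>m. F m y)) UNIV"
      by (rule has_sum_infsum[OF abs_summable_summable])
    then show ?thesis using True by simp
  qed simp
  from integral_has_sum(2)[OF _ int sm this]
  show "((\<lambda>m. \<integral>y. indicator {0..<1} y * F m y \<partial>lborel) has_sum integral {0..1} (\<lambda>y. \<Sum>\<^sub>\<infinity>m. F m y)) UNIV"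
    by (simp add: set_integral_half_open[OF cont'])
qed

lemma integral_unit_interval_shift:
  fixes f :: "real \<Rightarrow> 'b :: {banach, second_countable_topology}"
  shows "(\<integral>y. indicator {0..<1} y *\<^sub>R f (y + a) \<partial>lborel) = (\<integral>y. indicator {a..<a + 1} y *\<^sub>R f y \<partial>lborel)"
proof -
  have "(\<integral>y. indicator {a..<a + 1} y *\<^sub>R f y \<partial>lborel) = (\<integral>y. indicator {a..<a + 1} (a + 1 * y) *\<^sub>R f (a + 1 * y) \<partial>lborel)"
    by (subst lborel_integral_real_affine[where c = 1 and t = a]) auto
  also have "\<dots> = (\<integral>y. indicator {0..<1} y *\<^sub>R f (y + a) \<partial>lborel)"
    by (intro Bochner_Integration.integral_cong) (auto simp: indicator_def add.commute)
  finally show ?thesis by simp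
qed

text \<open>Poisson summation for a Gaussian. The Fourier coefficients of the periodised Gaussian
  unfold to integrals over the whole line, known from \<open>gauss_fourier\<close>; those of the
  exponential series are read off by orthogonality.\<close>

theorem theta_one_dim:
  assumes a: "a > 0"
  shows "((\<lambda>m::int. of_real (exp (- pi * of_int m ^ 2 / a) / sqrt a) * cis (2 * pi * of_int m * x))
     has_sum of_real (\<Sum>\<^sub>\<infinity>m. gauss a x m)) UNIV"
proof -
  \<comment> \<open>The shift puts the point in question at \<open>1 / 2\<close>, because
    \<open>fourier_unique\<close> speaks about interior points only.\<close>
  define s where "s = x - 1 / 2"
  define h where "h = (\<lambda>m::int. exp (- pi * of_int m ^ 2 / a) / sqrt a)"
  define F where "F = (\<lambda>m y. complex_of_real (gauss a (y + s) m))"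
  define G where "G = (\<lambda>m y. of_real (h m) * cis (2 * pi * of_int m * (y + s)))"
  have h0: "h m \<ge> 0" for m using a by (simp add: h_def)
  have hs: "h summable_on UNIV"
  proof -
    have "(\<lambda>m::int. exp (- (pi / a) * of_int m ^ 2) * (1 / sqrt a)) summable_on UNIV"
      using a by (intro summable_on_cmult_left summable_on_gaussian_int) auto
    then show ?thesis by (simp add: h_def)
  qed
  have contF: "continuous_on UNIV (F m)" and contG: "continuous_on UNIV (G m)" for m
    unfolding F_def G_def gauss_def by (intro continuous_intros)+
  have ys: "\<bar>y + s\<bar> \<le> 1 + \<bar>s\<bar>" if "y \<in> {0..1}" for y using that by auto
  have bF: "norm (F m y * cis t) \<le> gbound a (1 + \<bar>s\<bar>) m" if "y \<in> {0..1}" for m y t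
    using gauss_le_gbound[OF a ys[OF that], of m] by (simp add: F_def norm_mult gauss_def)
  have bG: "norm (G m y * cis t) \<le> h m" for m y t
    using h0 by (simp add: G_def norm_mult)
  define f where "f = (\<lambda>y. (\<Sum>\<^sub>\<infinity>m. F m y) - (\<Sum>\<^sub>\<infinity>m. G m y))"
  have contf1: "continuous_on {0..1} (\<lambda>y. \<Sum>\<^sub>\<infinity>m. F m y)"
    by (rule integral_uniform_series(1)[OF contF _ gbound_summable[OF a]]) (use bF[of _ _ 0] in simp)
  have contf2: "continuous_on {0..1} (\<lambda>y. \<Sum>\<^sub>\<infinity>m. G m y)"
    by (rule integral_uniform_series(1)[OF contG _ hs]) (use bG[of _ _ 0] in simp)
  have "f (1 / 2) = 0"
  proof (rule fourier_unique)
    show "continuous_on {0..1} f" unfolding f_def by (intro continuous_intros contf1 contf2)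
    fix n :: int
    define c where "c = of_real (exp (- pi * of_int n ^ 2 / a) / sqrt a) * cis (- 2 * pi * of_int n * s)"
    let ?e = "\<lambda>y. cis (2 * pi * of_int n * y)"
    have conte: "continuous_on UNIV ?e" by (intro continuous_intros)
    define g where "g = (\<lambda>y. of_real (exp (- pi * a * (y + s)\<^sup>2)) * ?e y)"
    have Fg: "F m y * ?e y = g (y + of_int m)" for m y
    proof -
      have "?e (y + of_int m) = ?e y * cis (2 * pi * of_int (n * m))"
        by (simp add: cis_mult distrib_left mult_ac)
      then show ?thesis by (simp add: F_def g_def gauss_def add_ac)
    qed
    have gint: "integrable lborel g" and gval: "(\<integral>y. g y \<partial>lborel) = c"
      unfolding g_def c_def by (rule gauss_fourier[OF a])+
    note SF = integral_uniform_series[OF continuous_on_mult[OF contF conte] bF gbound_summable[OF a]]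
    have ind: "indicator A y * z = indicator A y *\<^sub>R (z::complex)" for A y z by (simp add: indicator_def)
    have "((\<lambda>m. \<integral>y. indicator {of_int m..<of_int m + 1} y *\<^sub>R g y \<partial>lborel) has_sum (\<integral>y. g y \<partial>lborel)) (UNIV::int set)"
    proof (rule integral_has_sum(2))
      show "integrable lborel (\<lambda>y. indicator {of_int i..<of_int i + 1} y *\<^sub>R g y)" for i :: int
        using gint by (intro integrable_mult_indicator) auto
      have "(\<integral>y. norm (indicator {of_int m..<of_int m + 1} y *\<^sub>R g y) \<partial>lborel) = (\<integral>y. norm (indicator {0..<1} y * (F m y * ?e y)) \<partial>lborel)" for m :: int
        using integral_unit_interval_shift[of "\<lambda>y. norm (g y)" "of_int m"] by (simp add: Fg ind norm_mult)
      then show "(\<lambda>i::int. \<integral>y. norm (indicator {of_int i..<of_int i + 1} y *\<^sub>R g y) \<partial>lborel) summable_on UNIV"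
        using SF(3) by simp
      fix y :: real
      let ?I = "\<lambda>i::int. indicator {of_int i..<of_int i + 1} y *\<^sub>R g y"
      have 1: "?I \<lfloor>y\<rfloor> = g y" by (simp add: indicator_def)
      have "(?I has_sum ?I \<lfloor>y\<rfloor>) {\<lfloor>y\<rfloor>}" by (rule has_sum_finiteI) auto
      then have A: "(?I has_sum g y) {\<lfloor>y\<rfloor>}" unfolding 1 .
      have Z: "?I i = 0" if "i \<noteq> \<lfloor>y\<rfloor>" for i :: int
        using that floor_unique[of i y] by (auto simp: indicator_def)
      show "(?I has_sum g y) UNIV"
        by (rule iffD1[OF has_sum_cong_neutral, rotated 3, OF A]) (use Z in blast)+
    qed auto
    then have "((\<lambda>m. \<integral>y. indicator {0..<1} y * (F m y * ?e y) \<partial>lborel) has_sum c) UNIV"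
      unfolding ind Fg integral_unit_interval_shift gval .
    with SF(2) have IF: "integral {0..1} (\<lambda>y. \<Sum>\<^sub>\<infinity>m. F m y * ?e y) = c"
      by (rule has_sum_unique)
    note SG = integral_uniform_series[OF continuous_on_mult[OF contG conte] bG hs]
    have tG: "(\<integral>y. indicator {0..<1} y * (G m y * ?e y) \<partial>lborel) = (if m = - n then c else 0)" for m
    proof -
      have "(\<integral>y. indicator {0..<1} y * (G m y * ?e y) \<partial>lborel) = integral {0..1} (\<lambda>y. G m y * ?e y)"
        by (rule set_integral_half_open, rule continuous_on_subset[OF continuous_on_mult[OF contG conte]]) auto
      also have "integral {0..1} (\<lambda>y. G m y * ?e y) = integral {0..1} (\<lambda>y. (of_real (h m) * cis (2 * pi * of_int m * s)) * cis (2 * pi * of_int (- (m + n)) * (0 - y)))"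
        by (intro arg_cong2[of _ _ _ _ integral] ext refl) (simp add: G_def cis_mult algebra_simps)
      also have "\<dots> = (of_real (h m) * cis (2 * pi * of_int m * s)) * (if - (m + n) = 0 then 1 else 0)"
        by (rule integral_unique, rule has_integral_mult_right, rule integral_cis_period[unfolded o_def])
      also have "\<dots> = (if m = - n then c else 0)" by (auto simp: c_def h_def)
      finally show ?thesis .
    qed
    have "((\<lambda>m. if m = - n then c else 0) has_sum c) {- n}" by (rule has_sum_finiteI) auto
    then have "((\<lambda>m. if m = - n then c else 0) has_sum c) UNIV"
      by (rule iffD1[OF has_sum_cong_neutral, rotated 3]) auto
    with SG(2) have IG: "integral {0..1} (\<lambda>y. \<Sum>\<^sub>\<infinity>m. G m y * ?e y) = c"
      unfolding tG by (rule has_sum_unique)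
    have "integral {0..1} (\<lambda>y. f y * ?e y) = integral {0..1} (\<lambda>y. (\<Sum>\<^sub>\<infinity>m. F m y * ?e y) - (\<Sum>\<^sub>\<infinity>m. G m y * ?e y))"
    proof (rule integral_cong)
      fix y :: real assume y: "y \<in> {0..1}"
      have "(\<Sum>\<^sub>\<infinity>m. F m y * ?e y) = (\<Sum>\<^sub>\<infinity>m. F m y) * ?e y" "(\<Sum>\<^sub>\<infinity>m. G m y * ?e y) = (\<Sum>\<^sub>\<infinity>m. G m y) * ?e y"
        by (rule infsum_cmult_left', rule infsum_cmult_left')
      then show "f y * ?e y = (\<Sum>\<^sub>\<infinity>m. F m y * ?e y) - (\<Sum>\<^sub>\<infinity>m. G m y * ?e y)"
        by (simp add: f_def left_diff_distrib)
    qed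
    also have "\<dots> = c - c"
      by (subst integral_diff) (auto intro!: integrable_continuous_real SF(1) SG(1) simp: IF IG)
    finally show "integral {0..1} (\<lambda>y. f y * ?e y) = 0" by simp
  qed auto
  then have "(\<Sum>\<^sub>\<infinity>m. F m (1/2)) = (\<Sum>\<^sub>\<infinity>m. G m (1/2))" by (simp add: f_def)
  moreover have "(\<Sum>\<^sub>\<infinity>m. F m (1/2)) = of_real (\<Sum>\<^sub>\<infinity>m. gauss a x m)"
    using has_sum_bounded_linear[OF bounded_linear_of_real has_sum_infsum[OF gauss_summable[OF a]]]
    unfolding F_def s_def by (intro infsumI) simp
  moreover have "(\<lambda>m. G m (1/2)) summable_on UNIV"
    by (rule abs_summable_summable, rule summable_on_comparison_test[OF hs]) (use bG[of _ "1/2" 0] in auto)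
  ultimately have "((\<lambda>m. G m (1/2)) has_sum of_real (\<Sum>\<^sub>\<infinity>m. gauss a x m)) UNIV"
    using has_sum_infsum by metis
  then show ?thesis by (simp add: G_def h_def s_def)
qed


lemma summable_on_product_real:
  fixes f :: "'a \<Rightarrow> real" and g :: "'b \<Rightarrow> real"
  assumes "f summable_on A" "g summable_on B" "\<And>x. f x \<ge> 0" "\<And>y. g y \<ge> 0"
  shows "(\<lambda>(x, y). f x * g y) summable_on A \<times> B"
proof -
  have "(\<lambda>z. norm ((\<lambda>(x, y). f x * g y) z)) summable_on A \<times> B"
    unfolding Infinite_Sum.abs_summable_on_Sigma_iff using assms
    by (simp add: abs_mult infsum_cmult_right' summable_on_cmult_right summable_on_cmult_left abs_of_nonneg infsum_nonneg)
  then show ?thesis by (rule abs_summable_summable)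
qed

text \<open>Completing the square in either variable bounds \<open>A\<close> or \<open>C\<close>
  times the form by the determinant times one square. Adding both gives determinant over trace,
  which is below the smallest eigenvalue.\<close>

lemma pos_def_form_lower_bound:
  fixes A B C :: real
  assumes "A > 0" "A * C - B\<^sup>2 > 0"
  shows "C > 0" "(A * C - B\<^sup>2) / (A + C) * (m\<^sup>2 + n\<^sup>2) \<le> A * m\<^sup>2 + 2 * B * m * n + C * n\<^sup>2"
proof -
  have "A * C > 0" using assms(2) zero_le_power2[of B] by linarith
  then show C: "C > 0" using assms(1) by (simp add: zero_less_mult_iff)
  have 1: "A * (A * m\<^sup>2 + 2 * B * m * n + C * n\<^sup>2) = (A * m + B * n)\<^sup>2 + (A * C - B\<^sup>2) * n\<^sup>2"
    "C * (A * m\<^sup>2 + 2 * B * m * n + C * n\<^sup>2) = (C * n + B * m)\<^sup>2 + (A * C - B\<^sup>2) * m\<^sup>2"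
    by (simp_all add: power2_eq_square algebra_simps)
  have "(A * C - B\<^sup>2) * (m\<^sup>2 + n\<^sup>2) \<le> (A + C) * (A * m\<^sup>2 + 2 * B * m * n + C * n\<^sup>2)"
    unfolding distrib_right[of A C] 1 by (simp add: algebra_simps)
  then show "(A * C - B\<^sup>2) / (A + C) * (m\<^sup>2 + n\<^sup>2) \<le> A * m\<^sup>2 + 2 * B * m * n + C * n\<^sup>2"
    using assms(1) C by (simp add: divide_le_eq mult.commute)
qed

lemma gaussian_form_summable:
  fixes A B C :: real
  assumes "A > 0" "A * C - B\<^sup>2 > 0" "c > 0"
  shows "(\<lambda>(m, n). exp (- c * (A * of_int m ^ 2 + 2 * B * of_int m * of_int n + C * of_int n ^ 2)))
     summable_on (UNIV :: (int \<times> int) set)"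
proof -
  define l where "l = (A * C - B\<^sup>2) / (A + C)"
  have l: "l > 0" using assms pos_def_form_lower_bound(1)[OF assms(1,2)] by (simp add: l_def)
  have g: "(\<lambda>m::int. exp (- (c * l) * of_int m ^ 2)) summable_on UNIV"
    using l assms(3) by (intro summable_on_gaussian_int) simp
  have "(\<lambda>(m, n). exp (- (c * l) * of_int m ^ 2) * exp (- (c * l) * of_int n ^ 2)) summable_on (UNIV :: int set) \<times> (UNIV :: int set)"
    by (rule summable_on_product_real[OF g g]) auto
  then have "(\<lambda>z::int \<times> int. exp (- (c * l) * of_int (fst z) ^ 2) * exp (- (c * l) * of_int (snd z) ^ 2)) summable_on UNIV"
    by (simp add: case_prod_unfold)
  then show ?thesis unfolding case_prod_unfold
  proof (rule summable_on_comparison_test)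
    fix z :: "int \<times> int"
    have "c * (l * ((of_int (fst z))\<^sup>2 + (of_int (snd z))\<^sup>2)) \<le> c * (A * of_int (fst z) ^ 2 + 2 * B * of_int (fst z) * of_int (snd z) + C * of_int (snd z) ^ 2)"
      using pos_def_form_lower_bound(2)[OF assms(1,2)] assms(3) unfolding l_def by (intro mult_left_mono) auto
    then show "exp (- c * (A * of_int (fst z) ^ 2 + 2 * B * of_int (fst z) * of_int (snd z) + C * of_int (snd z) ^ 2))
        \<le> exp (- (c * l) * of_int (fst z) ^ 2) * exp (- (c * l) * of_int (snd z) ^ 2)"
      unfolding mult_exp_exp exp_le_cancel_iff by (simp add: algebra_simps)
  qed auto
qed

text \<open>One absolutely convergent mixed series \<open>G\<close> is summed in both orders:
  inversion in the first index yields the form itself, inversion in the second yields the form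
  divided by \<open>D\<close> with its variables exchanged. A binary form and its dual agree up to
  such an exchange, so the same form appears on both sides.\<close>

theorem theta_two_dim:
  fixes A B C D :: real
  assumes A: "A > 0" and D: "D > 0" "D = A * C - B\<^sup>2"
  shows "(\<Sum>\<^sub>\<infinity>(m, n)\<in>(UNIV :: (int \<times> int) set). exp (- pi * (A * of_int m ^ 2 + 2 * B * of_int m * of_int n + C * of_int n ^ 2)))
    = 1 / sqrt D * (\<Sum>\<^sub>\<infinity>(m, n)\<in>(UNIV :: (int \<times> int) set). exp (- (pi / D) * (A * of_int m ^ 2 + 2 * B * of_int m * of_int n + C * of_int n ^ 2)))"
proof -
  define S where "S = (\<lambda>c. \<Sum>\<^sub>\<infinity>(m, n)\<in>(UNIV :: (int \<times> int) set). exp (- c * (A * of_int m ^ 2 + 2 * B * of_int m * of_int n + C * of_int n ^ 2)))"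
  define h where "h = (\<lambda>m::int. exp (- pi * of_int m ^ 2 / A) / sqrt A)"
  define k where "k = (\<lambda>n::int. exp (- pi * of_int n ^ 2 / (A / D)) / sqrt (A / D))"
  define e where "e = (\<lambda>m n::int. cis (2 * pi * of_int m * (B * of_int n / A)))"
  define G where "G = (\<lambda>m n. of_real (h m * k n) * e m n)"
  have AD: "A / D > 0" using A D by simp
  have hs: "h summable_on UNIV" "k summable_on UNIV"
  proof -
    have "(\<lambda>m::int. exp (- (pi / A) * of_int m ^ 2) * (1 / sqrt A)) summable_on UNIV"
      using A by (intro summable_on_cmult_left summable_on_gaussian_int) auto
    then show "h summable_on UNIV" by (simp add: h_def)
    have "(\<lambda>m::int. exp (- (pi / (A / D)) * of_int m ^ 2) * (1 / sqrt (A / D))) summable_on UNIV"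
      using A D by (intro summable_on_cmult_left summable_on_gaussian_int) auto
    then show "k summable_on UNIV" by (simp add: k_def mult_ac)
  qed
  have h0: "h m \<ge> 0" "k m \<ge> 0" for m using A AD by (simp_all add: h_def k_def)
  have "(\<lambda>(m, n). h m * k n) summable_on UNIV \<times> UNIV"
    by (rule summable_on_product_real[OF hs]) (use h0 in auto)
  then have "(\<lambda>z. norm ((\<lambda>(m, n). G m n) z)) summable_on UNIV \<times> UNIV"
    by (rule summable_on_cong[THEN iffD1, rotated]) (auto simp: G_def e_def norm_mult h0)
  then have Gs: "(\<lambda>(m, n). G m n) summable_on UNIV \<times> UNIV" by (rule abs_summable_summable)
  have swap: "(\<Sum>\<^sub>\<infinity>m. \<Sum>\<^sub>\<infinity>n. G m n) = (\<Sum>\<^sub>\<infinity>n. \<Sum>\<^sub>\<infinity>m. G m n)" by (rule infsum_swap_banach[OF Gs])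
  have r1: "(\<Sum>\<^sub>\<infinity>m. G m n) = of_real (k n * (\<Sum>\<^sub>\<infinity>m. gauss A (B * of_int n / A) m))" for n
  proof -
    have "((\<lambda>m. of_real (k n) * (of_real (h m) * e m n)) has_sum of_real (k n) * of_real (\<Sum>\<^sub>\<infinity>m. gauss A (B * of_int n / A) m)) UNIV"
      unfolding h_def e_def by (intro has_sum_cmult_right theta_one_dim A)
    then show ?thesis by (intro infsumI) (simp add: G_def mult_ac)
  qed
  have r2: "(\<Sum>\<^sub>\<infinity>n. G m n) = of_real (h m * (\<Sum>\<^sub>\<infinity>n. gauss (A / D) (B * of_int m / A) n))" for m
  proof -
    have "((\<lambda>n. of_real (h m) * (of_real (k n) * cis (2 * pi * of_int n * (B * of_int m / A))))
       has_sum of_real (h m) * of_real (\<Sum>\<^sub>\<infinity>n. gauss (A / D) (B * of_int m / A) n)) UNIV"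
      unfolding k_def by (intro has_sum_cmult_right theta_one_dim AD)
    then show ?thesis by (intro infsumI) (simp add: G_def e_def mult_ac)
  qed
  have ofr: "(\<Sum>\<^sub>\<infinity>x. complex_of_real (f x)) = complex_of_real (\<Sum>\<^sub>\<infinity>x. f x)" if "f summable_on UNIV" for f :: "int \<Rightarrow> real"
    using has_sum_bounded_linear[OF bounded_linear_of_real has_sum_infsum[OF that]] by (intro infsumI) simp
  have Q1: "k n * gauss A (B * of_int n / A) m = exp (- pi * (A * of_int m ^ 2 + 2 * B * of_int m * of_int n + C * of_int n ^ 2)) * inverse (sqrt (A / D))" for m n
  proof -
    have "A * (of_int m + B * of_int n / A)\<^sup>2 + of_int n ^ 2 / (A / D) = A * of_int m ^ 2 + 2 * B * of_int m * of_int n + C * of_int n ^ 2"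
      using A unfolding D(2) by (simp add: power2_eq_square field_simps)
    moreover have "- pi * of_int n ^ 2 / (A / D) + - pi * A * (of_int m + B * of_int n / A)\<^sup>2
        = - pi * (A * (of_int m + B * of_int n / A)\<^sup>2 + of_int n ^ 2 / (A / D))"
      by (simp add: ring_distribs)
    ultimately have "- pi * of_int n ^ 2 / (A / D) + - pi * A * (of_int m + B * of_int n / A)\<^sup>2 = - pi * (A * of_int m ^ 2 + 2 * B * of_int m * of_int n + C * of_int n ^ 2)"
      by (simp only:)
    then show ?thesis unfolding k_def gauss_def by (simp add: divide_inverse[of _ "sqrt _"] flip: exp_add)
  qed
  have Q2: "h m * gauss (A / D) (B * of_int m / A) n = exp (- (pi / D) * (A * of_int n ^ 2 + 2 * B * of_int n * of_int m + C * of_int m ^ 2)) * inverse (sqrt A)" for m n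
  proof -
    have "D \<noteq> 0" using D by simp
    have "D * (of_int m ^ 2 / A) + A * (of_int n + B * of_int m / A)\<^sup>2 = A * of_int n ^ 2 + 2 * B * of_int n * of_int m + C * of_int m ^ 2"
      using A unfolding D(2) by (simp add: power2_eq_square field_simps)
    then have "(pi / D) * (A * of_int n ^ 2 + 2 * B * of_int n * of_int m + C * of_int m ^ 2) = (pi / D) * (D * (of_int m ^ 2 / A)) + (pi / D) * (A * (of_int n + B * of_int m / A)\<^sup>2)"
      by (simp only: distrib_left[symmetric])
    then have "- pi * of_int m ^ 2 / A + - pi * (A / D) * (of_int n + B * of_int m / A)\<^sup>2 = - (pi / D) * (A * of_int n ^ 2 + 2 * B * of_int n * of_int m + C * of_int m ^ 2)"
      using \<open>D \<noteq> 0\<close> by simp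
    then show ?thesis unfolding h_def gauss_def by (simp add: divide_inverse[of _ "sqrt _"] flip: exp_add)
  qed
  have D': "A * C - B\<^sup>2 > 0" using D by simp
  have sm: "(\<lambda>(m, n). exp (- c * (A * of_int m ^ 2 + 2 * B * of_int m * of_int n + C * of_int n ^ 2))) summable_on UNIV \<times> UNIV" if "c > 0" for c
    using gaussian_form_summable[OF A D' that] by simp
  have sm': "(\<lambda>(n, m). exp (- c * (A * of_int m ^ 2 + 2 * B * of_int m * of_int n + C * of_int n ^ 2))) summable_on UNIV \<times> UNIV" if "c > 0" for c
    using sm[OF that] by (subst summable_on_swap) (simp add: case_prod_unfold)
  have S1: "(\<Sum>\<^sub>\<infinity>n. \<Sum>\<^sub>\<infinity>m. exp (- c * (A * of_int m ^ 2 + 2 * B * of_int m * of_int n + C * of_int n ^ 2))) = S c" if "c > 0" for c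
    unfolding infsum_swap_banach[OF sm'[OF that]] S_def using infsum_Sigma'_banach[OF sm[OF that]] by simp
  have summ_n: "(\<lambda>n. \<Sum>\<^sub>\<infinity>m. exp (- c * (A * of_int m ^ 2 + 2 * B * of_int m * of_int n + C * of_int n ^ 2))) summable_on UNIV" if "c > 0" for c
    using summable_on_Sigma_banach[OF sm'[OF that]] by simp
  have q1: "k n * (\<Sum>\<^sub>\<infinity>m. gauss A (B * of_int n / A) m) = (\<Sum>\<^sub>\<infinity>m. exp (- pi * (A * of_int m ^ 2 + 2 * B * of_int m * of_int n + C * of_int n ^ 2))) * inverse (sqrt (A / D))" for n
    unfolding infsum_cmult_right'[symmetric] Q1 by (rule infsum_cmult_left')
  have q2: "h m * (\<Sum>\<^sub>\<infinity>n. gauss (A / D) (B * of_int m / A) n) = (\<Sum>\<^sub>\<infinity>n. exp (- (pi / D) * (A * of_int n ^ 2 + 2 * B * of_int n * of_int m + C * of_int m ^ 2))) * inverse (sqrt A)" for m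
    unfolding infsum_cmult_right'[symmetric] Q2 by (rule infsum_cmult_left')
  have pD: "pi / D > 0" using D by simp
  have L: "(\<Sum>\<^sub>\<infinity>n. \<Sum>\<^sub>\<infinity>m. G m n) = of_real (S pi * inverse (sqrt (A / D)))"
    unfolding r1 q1 by (subst ofr[OF summable_on_cmult_left[OF summ_n[OF pi_gt_zero]]])
      (simp only: infsum_cmult_left' S1[OF pi_gt_zero])
  have R: "(\<Sum>\<^sub>\<infinity>m. \<Sum>\<^sub>\<infinity>n. G m n) = of_real (S (pi / D) * inverse (sqrt A))"
    unfolding r2 q2 by (subst ofr[OF summable_on_cmult_left[OF summ_n[OF pD]]])
      (simp only: infsum_cmult_left' S1[OF pD])
  have "complex_of_real (S pi * inverse (sqrt (A / D))) = complex_of_real (S (pi / D) * inverse (sqrt A))"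
    using L R swap by simp
  then have "S pi * inverse (sqrt (A / D)) = S (pi / D) * inverse (sqrt A)"
    by (simp only: of_real_eq_iff)
  then have "S pi = 1 / sqrt D * S (pi / D)"
    using A D(1) by (simp add: real_sqrt_divide field_simps)
  then show ?thesis unfolding S_def .
qed

context real_quad
begin

text \<open>The Gaussian in logarithmic coordinates: \<open>v\<close> scales both embeddings alike,
  \<open>w\<close> scales them in opposite directions, so that units act by translating
  \<open>w\<close>. Dividing by the covolume \<open>sqrt q\<close> makes the determinant of the form
  exactly \<open>exp (2 * v)\<close>.\<close>

definition qexp :: "int \<times> int \<Rightarrow> real \<Rightarrow> real \<Rightarrow> real" where
  "qexp z v w = exp (- (pi / sqrt (real q)) * ((val q z)\<^sup>2 * exp (v + w) + (con q z)\<^sup>2 * exp (v - w)))"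

definition qtheta :: "real \<Rightarrow> real \<Rightarrow> real" where
  "qtheta v w = (\<Sum>\<^sub>\<infinity>z. qexp z v w)"

lemma qexp_pos: "qexp z v w > 0"
  by (simp add: qexp_def)

lemma qtheta_aux:
  obtains A B C where "A > 0" "exp (2 * v) = A * C - B\<^sup>2"
    "\<And>m n. ((val q (m, n))\<^sup>2 * exp (v + w) + (con q (m, n))\<^sup>2 * exp (v - w)) / sqrt (real q)
        = A * of_int m ^ 2 + 2 * B * of_int m * of_int n + C * of_int n ^ 2"
proof -
  define r where "r = sqrt (real q)"
  have r: "r > 0" "r * r = real q" using q_ge_5 by (simp_all add: r_def)
  define A B C where "A = (exp (v + w) + exp (v - w)) / r"
    and "B = (om q * exp (v + w) + omc q * exp (v - w)) / r"
    and "C = ((om q)\<^sup>2 * exp (v + w) + (omc q)\<^sup>2 * exp (v - w)) / r"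
  have A: "A > 0" using r by (simp add: A_def add_pos_pos)
  have e: "exp (v + w) * exp (v - w) = exp (2 * v)" by (simp add: mult_exp_exp)
  have "A * C - B\<^sup>2 = exp (v + w) * exp (v - w) * (om q - omc q)\<^sup>2 / (r * r)"
    unfolding A_def B_def C_def using r(1) by (simp add: power2_eq_square field_simps)
  also have "(om q - omc q)\<^sup>2 = r * r" by (simp add: om_sq(5) r_def power2_eq_square)
  finally have D: "exp (2 * v) = A * C - B\<^sup>2" using r(1) e by simp
  have "((val q (m, n))\<^sup>2 * exp (v + w) + (con q (m, n))\<^sup>2 * exp (v - w)) / sqrt (real q)
        = A * of_int m ^ 2 + 2 * B * of_int m * of_int n + C * of_int n ^ 2" for m n
    unfolding A_def B_def C_def val_def con_def fst_conv snd_conv r_def[symmetric] using r(1)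
    by (simp add: power2_eq_square field_simps)
  then show ?thesis using that A D by blast
qed

lemma qexp_summable: "(\<lambda>z. qexp z v w) summable_on UNIV"
proof -
  obtain A B C where AB: "A > 0" "exp (2 * v) = A * C - B\<^sup>2"
    "\<And>m n. ((val q (m, n))\<^sup>2 * exp (v + w) + (con q (m, n))\<^sup>2 * exp (v - w)) / sqrt (real q)
        = A * of_int m ^ 2 + 2 * B * of_int m * of_int n + C * of_int n ^ 2"
    by (rule qtheta_aux[of v w]) (rule that)
  have D: "A * C - B\<^sup>2 > 0" unfolding AB(2)[symmetric] by simp
  show ?thesis using gaussian_form_summable[OF AB(1) D, of pi]
    unfolding AB(3)[symmetric] by (simp add: qexp_def case_prod_unfold)
qed

text \<open>Inversion divides the form by its determinant \<open>exp (2 * v)\<close>, which is the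
  replacement of \<open>v\<close> by \<open>- v\<close>; \<open>w\<close> stays fixed because the
  form is its own dual up to an exchange of variables.\<close>

theorem qtheta_functional: "qtheta v w = exp (- v) * qtheta (- v) w"
proof -
  obtain A B C where AB: "A > 0" "exp (2 * v) = A * C - B\<^sup>2"
    "\<And>m n. ((val q (m, n))\<^sup>2 * exp (v + w) + (con q (m, n))\<^sup>2 * exp (v - w)) / sqrt (real q)
        = A * of_int m ^ 2 + 2 * B * of_int m * of_int n + C * of_int n ^ 2"
    by (rule qtheta_aux[of v w]) (rule that)
  have D: "exp (2 * v) > 0" by simp
  have sq: "sqrt (exp (2 * v)) = exp v"
    by (rule real_sqrt_unique) (simp_all add: power2_eq_square mult_exp_exp)
  have "exp (- (2 * v)) * exp (v + w) = exp (- v + w)" "exp (- (2 * v)) * exp (v - w) = exp (- v - w)"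
    by (simp_all add: mult_exp_exp)
  then have e: "x * exp (- v + w) + y * exp (- v - w) = exp (- (2 * v)) * (x * exp (v + w) + y * exp (v - w))" for x y
    by (simp add: distrib_left mult.left_commute)
  have f0: "(pi / exp (2 * v)) * (X / sqrt (real q)) = (pi / sqrt (real q)) * (exp (- (2 * v)) * X)" for X
    by (simp add: exp_minus divide_inverse mult_ac)
  have f: "- (pi / exp (2 * v)) * (X / sqrt (real q)) = - (pi / sqrt (real q)) * (exp (- (2 * v)) * X)" for X
    using f0[of X] by (simp only: mult_minus_left)
  have R: "exp (- (pi / exp (2 * v)) * (((val q z)\<^sup>2 * exp (v + w) + (con q z)\<^sup>2 * exp (v - w)) / sqrt (real q))) = qexp z (- v) w" for z
    unfolding qexp_def e f ..
  have L: "exp (- pi * (((val q z)\<^sup>2 * exp (v + w) + (con q z)\<^sup>2 * exp (v - w)) / sqrt (real q))) = qexp z v w" for z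
    by (simp add: qexp_def)
  show ?thesis
    using theta_two_dim[OF AB(1) D AB(2)] unfolding AB(3)[symmetric] sq L R case_prod_eta
    by (simp add: qtheta_def exp_minus divide_inverse case_prod_unfold)
qed

end


section \<open>Mellin transforms\<close>

lemma integrable_lborel_of_absolutely_integrable:
  fixes f :: "real \<Rightarrow> real"
  assumes "f absolutely_integrable_on UNIV" "f \<in> borel_measurable borel"
  shows "integrable lborel f" "integral\<^sup>L lborel f = integral UNIV f"
proof -
  have "integrable lebesgue f" using assms(1) by (simp add: set_integrable_def)
  then show i: "integrable lborel f" using assms(2) integrable_completion[of f lborel] by simp
  show "integral\<^sup>L lborel f = integral UNIV f" by (rule integral_lborel[OF i, symmetric])
qed

lemma complex_integral_by_parts_Re_Im:
  fixes f :: "'a \<Rightarrow> complex"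
  assumes "integrable M (\<lambda>x. Re (f x))" "integrable M (\<lambda>x. Im (f x))"
  shows "integrable M f" "integral\<^sup>L M f = Complex (\<integral>x. Re (f x) \<partial>M) (\<integral>x. Im (f x) \<partial>M)"
proof -
  have "integrable M (\<lambda>x. of_real (Re (f x)) + \<i> * of_real (Im (f x)))"
    using assms by (intro Bochner_Integration.integrable_add integrable_mult_right integrable_of_real)
  then show i: "integrable M f" by (simp flip: complex_eq)
  show "integral\<^sup>L M f = Complex (\<integral>x. Re (f x) \<partial>M) (\<integral>x. Im (f x) \<partial>M)"
    using i by (simp add: complex_eq_iff)
qed

text \<open>Euler's integral after \<open>t = exp x\<close>, carried out on real and imaginary
  parts. On the additive line all later scalings and reflections become affine substitutions for
  Lebesgue measure.\<close>

lemma mellin_exp: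
  fixes a :: complex
  assumes a: "Re a > 0"
  shows "integrable lborel (\<lambda>x::real. exp (a * of_real x - of_real (exp x)))" (is "integrable _ ?g")
    "(\<integral>x. exp (a * complex_of_real x - of_real (exp x)) \<partial>lborel) = Gamma a"
proof -
  let ?f = "\<lambda>t. complex_of_real t powr (a - 1) / of_real (exp t)"
  have ab: "?f absolutely_integrable_on {0<..}" by (rule absolutely_integrable_Gamma_integral'[OF a])
  have ig: "(?f has_integral Gamma a) {0<..}" by (rule Gamma_integral_complex'[OF a])
  have img: "range exp = {0::real<..}" by (auto simp: image_iff) (metis exp_ln)
  have eq: "of_real (exp x) * ?f (exp x) = ?g x" for x :: real
  proof -
    have "complex_of_real (exp x) powr (a - 1) = exp ((a - 1) * of_real x)"
      by (simp add: powr_def Ln_of_real flip: exp_of_real)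
    then show ?thesis by (simp add: exp_diff left_diff_distrib exp_of_real)
  qed
  have D: "(exp has_field_derivative exp x) (at x within UNIV)" for x :: real
    using DERIV_exp[of x] by simp
  have CV: "(\<lambda>x. \<bar>exp x\<bar> * \<phi> (exp x)) absolutely_integrable_on UNIV \<and>
      integral UNIV (\<lambda>x. \<bar>exp x\<bar> * \<phi> (exp x)) = b \<longleftrightarrow>
      \<phi> absolutely_integrable_on range exp \<and> integral (range exp) \<phi> = b" for \<phi> :: "real \<Rightarrow> real" and b
    by (rule has_absolute_integral_change_of_variables_1'[of UNIV exp exp]) (use D in \<open>auto simp: inj_on_def\<close>)
  have "(\<lambda>x. \<bar>exp x\<bar> * Re (?f (exp x))) absolutely_integrable_on UNIV \<and>
      integral UNIV (\<lambda>x. \<bar>exp x\<bar> * Re (?f (exp x))) = Re (Gamma a)"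
  proof (rule CV[THEN iffD2])
    have "(\<lambda>t. Re (?f t)) absolutely_integrable_on {0<..}"
      using absolutely_integrable_linear[OF ab bounded_linear_Re] by (simp add: o_def)
    moreover have "integral {0<..} (\<lambda>t. Re (?f t)) = Re (Gamma a)"
      using has_integral_linear[OF ig bounded_linear_Re] by (intro integral_unique) (simp add: o_def)
    ultimately show "(\<lambda>t. Re (?f t)) absolutely_integrable_on range exp \<and> integral (range exp) (\<lambda>t. Re (?f t)) = Re (Gamma a)"
      unfolding img by blast
  qed
  moreover have "\<bar>exp x\<bar> * Re (?f (exp x)) = Re (?g x)" for x
    unfolding eq[symmetric] by simp
  ultimately have R: "(\<lambda>x. Re (?g x)) absolutely_integrable_on UNIV" "integral UNIV (\<lambda>x. Re (?g x)) = Re (Gamma a)"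
    by simp_all
  have "(\<lambda>x. \<bar>exp x\<bar> * Im (?f (exp x))) absolutely_integrable_on UNIV \<and>
      integral UNIV (\<lambda>x. \<bar>exp x\<bar> * Im (?f (exp x))) = Im (Gamma a)"
  proof (rule CV[THEN iffD2])
    have "(\<lambda>t. Im (?f t)) absolutely_integrable_on {0<..}"
      using absolutely_integrable_linear[OF ab bounded_linear_Im] by (simp add: o_def)
    moreover have "integral {0<..} (\<lambda>t. Im (?f t)) = Im (Gamma a)"
      using has_integral_linear[OF ig bounded_linear_Im] by (intro integral_unique) (simp add: o_def)
    ultimately show "(\<lambda>t. Im (?f t)) absolutely_integrable_on range exp \<and> integral (range exp) (\<lambda>t. Im (?f t)) = Im (Gamma a)"
      unfolding img by blast
  qed
  moreover have "\<bar>exp x\<bar> * Im (?f (exp x)) = Im (?g x)" for x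
    unfolding eq[symmetric] by simp
  ultimately have I: "(\<lambda>x. Im (?g x)) absolutely_integrable_on UNIV" "integral UNIV (\<lambda>x. Im (?g x)) = Im (Gamma a)"
    by simp_all
  have meas: "(\<lambda>x. Re (?g x)) \<in> borel_measurable borel" "(\<lambda>x. Im (?g x)) \<in> borel_measurable borel"
    by (auto intro!: borel_measurable_continuous_onI continuous_intros)
  note LR = integrable_lborel_of_absolutely_integrable[OF R(1) meas(1)]
  note LI = integrable_lborel_of_absolutely_integrable[OF I(1) meas(2)]
  show "integrable lborel ?g" by (rule complex_integral_by_parts_Re_Im(1)[OF LR(1) LI(1)])
  show "integral\<^sup>L lborel ?g = Gamma a"
    unfolding complex_integral_by_parts_Re_Im(2)[OF LR(1) LI(1)] LR(2) LI(2) R(2) I(2) by simp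
qed

lemma mellin_exp_scaled:
  fixes a :: complex and p :: real
  assumes a: "Re a > 0" and p: "p > 0"
  shows "integrable lborel (\<lambda>x::real. exp (a * of_real x - of_real (p * exp x)))" (is "integrable _ ?g")
    "(\<integral>x. exp (a * complex_of_real x - of_real (p * exp x)) \<partial>lborel) = Gamma a * exp (- a * of_real (ln p))"
proof -
  let ?f = "\<lambda>x::real. exp (a * of_real x - of_real (exp x))"
  have eq: "?g (- ln p + 1 * x) = exp (- a * of_real (ln p)) * ?f x" for x
  proof -
    have "p * exp (- ln p + 1 * x) = exp x" using p by (simp add: exp_diff)
    then show ?thesis by (simp add: algebra_simps flip: exp_add)
  qed
  have i: "integrable lborel (\<lambda>x. ?g (- ln p + 1 * x))"
    unfolding eq by (intro integrable_mult_right mellin_exp(1)[OF a])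
  then show "integrable lborel ?g"
    by (subst (asm) lborel_integrable_real_affine_iff) auto
  have "integral\<^sup>L lborel ?g = \<bar>1\<bar> *\<^sub>R (\<integral>x. ?g (- ln p + 1 * x) \<partial>lborel)"
    by (intro lborel_integral_real_affine) auto
  also have "(\<integral>x. ?g (- ln p + 1 * x) \<partial>lborel) = exp (- a * of_real (ln p)) * Gamma a"
    unfolding eq by (simp only: integral_mult_right_zero mellin_exp(2)[OF a])
  finally show "integral\<^sup>L lborel ?g = Gamma a * exp (- a * of_real (ln p))" by (simp add: mult.commute)
qed

lemma integral_reflect_double:
  fixes h :: "real \<Rightarrow> complex"
  shows "(\<integral>v. h (2 * v - x) \<partial>lborel) = (\<integral>y. h y \<partial>lborel) / 2"
    and "integrable lborel h \<Longrightarrow> integrable lborel (\<lambda>v. h (2 * v - x))"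
proof -
  have "(\<integral>y. h y \<partial>lborel) = \<bar>2\<bar> *\<^sub>R (\<integral>v. h (- x + 2 * v) \<partial>lborel)"
    by (intro lborel_integral_real_affine) auto
  then show "(\<integral>v. h (2 * v - x) \<partial>lborel) = (\<integral>y. h y \<partial>lborel) / 2"
    by (simp add: scaleR_conv_of_real add.commute)
  assume "integrable lborel h"
  then have "integrable lborel (\<lambda>v. h (- x + 2 * v))"
    by (subst lborel_integrable_real_affine_iff) auto
  then show "integrable lborel (\<lambda>v. h (2 * v - x))" by (simp add: add.commute)
qed

text \<open>After \<open>v + w\<close> and \<open>v - w\<close> are taken as variables, the Mellin transform of a Bessel function is a product
  of two gamma integrals.\<close>

lemma half_convolution:
  fixes f h :: "real \<Rightarrow> complex"
  assumes f: "integrable lborel f" and h: "integrable lborel h"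
  shows "integrable lborel (\<lambda>v. \<integral>w. f (v + w) * h (v - w) \<partial>lborel)"
    "(\<integral>v. (\<integral>w. f (v + w) * h (v - w) \<partial>lborel) \<partial>lborel) = (\<integral>x. f x \<partial>lborel) * (\<integral>x. h x \<partial>lborel) / 2"
proof -
  have [measurable]: "f \<in> borel_measurable borel" "h \<in> borel_measurable borel"
    using f h by auto
  let ?g = "\<lambda>x v. f x * h (2 * v - x)"
  have nh: "integrable lborel (\<lambda>y. complex_of_real (norm (h y)))" using h by (intro integrable_of_real integrable_norm)
  have norm_int: "(\<integral>v. norm (?g x v) \<partial>lborel) = norm (f x) * ((\<integral>y. norm (h y) \<partial>lborel) / 2)" for x
  proof -
    have "complex_of_real (\<integral>v. norm (h (2 * v - x)) \<partial>lborel) = complex_of_real ((\<integral>y. norm (h y) \<partial>lborel) / 2)"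
      using integral_reflect_double(1)[of "\<lambda>y. of_real (norm (h y))" x] by simp
    then have "(\<integral>v. norm (h (2 * v - x)) \<partial>lborel) = (\<integral>y. norm (h y) \<partial>lborel) / 2" by (simp only: of_real_eq_iff)
    then show ?thesis by (simp add: norm_mult)
  qed
  have g: "integrable (lborel \<Otimes>\<^sub>M lborel) (case_prod ?g)"
  proof (rule lborel_pair.Fubini_integrable)
    show "case_prod ?g \<in> borel_measurable (lborel \<Otimes>\<^sub>M lborel)" by measurable
    show "integrable lborel (\<lambda>x. \<integral>v. norm (case_prod ?g (x, v)) \<partial>lborel)"
      unfolding prod.case norm_int by (intro integrable_mult_left integrable_norm f)
    show "AE x in lborel. integrable lborel (\<lambda>v. case_prod ?g (x, v))"
      unfolding prod.case by (intro AE_I2 integrable_mult_right integral_reflect_double(2) h)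
  qed
  have eq: "(\<integral>w. f (v + w) * h (v - w) \<partial>lborel) = (\<integral>x. ?g x v \<partial>lborel)" for v
  proof -
    have "(\<integral>x. ?g x v \<partial>lborel) = \<bar>1\<bar> *\<^sub>R (\<integral>w. ?g (v + 1 * w) v \<partial>lborel)"
      by (intro lborel_integral_real_affine) auto
    then show ?thesis by (simp add: algebra_simps)
  qed
  show "integrable lborel (\<lambda>v. \<integral>w. f (v + w) * h (v - w) \<partial>lborel)"
    unfolding eq by (rule lborel_pair.integrable_snd[OF g])
  have "(\<integral>v. (\<integral>x. ?g x v \<partial>lborel) \<partial>lborel) = (\<integral>x. (\<integral>v. ?g x v \<partial>lborel) \<partial>lborel)"
    by (rule lborel_pair.Fubini_integral[OF g])
  also have "\<dots> = (\<integral>x. f x * ((\<integral>y. h y \<partial>lborel) / 2) \<partial>lborel)"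
    by (simp only: integral_mult_right_zero integral_reflect_double(1))
  also have "\<dots> = (\<integral>x. f x \<partial>lborel) * (\<integral>x. h x \<partial>lborel) / 2"
    by (simp only: integral_mult_left_zero) simp
  finally show "(\<integral>v. (\<integral>w. f (v + w) * h (v - w) \<partial>lborel) \<partial>lborel) = (\<integral>x. f x \<partial>lborel) * (\<integral>x. h x \<partial>lborel) / 2"
    unfolding eq .
qed

text \<open>Expanding the exponential and integrating termwise gives an everywhere convergent power
  series in \<open>s\<close>; the weights \<open>exp (R * |g|)\<close> dominate all partial
  sums.\<close>

lemma integral_exp_entire:
  fixes f :: "'a \<Rightarrow> complex" and g :: "'a \<Rightarrow> real"
  assumes [measurable]: "f \<in> borel_measurable M" "g \<in> borel_measurable M"
    and int: "\<And>R. integrable M (\<lambda>x. norm (f x) * exp (R * \<bar>g x\<bar>))"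
  shows "(\<lambda>s. \<integral>x. f x * exp (s * of_real (g x)) \<partial>M) holomorphic_on UNIV"
proof -
  define F where "F = (\<lambda>s. \<integral>x. f x * exp (s * of_real (g x)) \<partial>M)"
  define a where "a = (\<lambda>n. \<integral>x. f x * (of_real (g x) ^ n / fact n) \<partial>M)"
  have sums: "(\<lambda>n. a n * s ^ n) sums F s" for s
  proof -
    let ?t = "\<lambda>n x. f x * ((s * of_real (g x)) ^ n / fact n)"
    let ?b = "\<lambda>x. norm (f x) * exp (norm s * \<bar>g x\<bar>)"
    have ex: "(\<lambda>n. (norm s * \<bar>g x\<bar>) ^ n / fact n) sums exp (norm s * \<bar>g x\<bar>)" for x
      using exp_converges[of "norm s * \<bar>g x\<bar>"] by (simp add: divide_inverse mult.commute)
    have nt: "norm (?t n x) = norm (f x) * ((norm s * \<bar>g x\<bar>) ^ n / fact n)" for n x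
      by (simp add: norm_mult norm_divide norm_power)
    have part: "(\<Sum>n\<in>I. norm (?t n x)) \<le> ?b x" if "finite I" for I x
      unfolding nt sum_distrib_left[symmetric] sums_unique[OF ex]
      by (intro mult_left_mono sum_le_suminf sums_summable[OF ex] that) auto
    have it: "integrable M (?t n)" for n
      by (rule Bochner_Integration.integrable_bound[OF int[of "norm s"]]) (use part[of "{n}"] in auto)
    have AE: "AE x in M. summable (\<lambda>n. norm (?t n x))"
      unfolding nt by (intro AE_I2 summable_mult sums_summable[OF ex])
    have sm: "summable (\<lambda>n. \<integral>x. norm (?t n x) \<partial>M)"
    proof (rule summableI_nonneg_bounded)
      fix N
      have "(\<Sum>n<N. \<integral>x. norm (?t n x) \<partial>M) = (\<integral>x. (\<Sum>n<N. norm (?t n x)) \<partial>M)"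
        by (rule Bochner_Integration.integral_sum[symmetric]) (intro integrable_norm it)
      also have "\<dots> \<le> (\<integral>x. ?b x \<partial>M)"
        by (intro integral_mono Bochner_Integration.integrable_sum integrable_norm it int part finite_lessThan)
      finally show "(\<Sum>n<N. \<integral>x. norm (?t n x) \<partial>M) \<le> (\<integral>x. ?b x \<partial>M)" .
    qed auto
    have "(\<lambda>n. integral\<^sup>L M (?t n)) sums (\<integral>x. (\<Sum>n. ?t n x) \<partial>M)"
      by (rule sums_integral[OF it AE sm])
    moreover have "integral\<^sup>L M (?t n) = a n * s ^ n" for n
      unfolding a_def integral_mult_left_zero[symmetric]
      by (intro Bochner_Integration.integral_cong refl) (simp add: power_mult_distrib)
    moreover have "(\<Sum>n. ?t n x) = f x * exp (s * of_real (g x))" for x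
    proof -
      have "(\<lambda>n. (s * of_real (g x)) ^ n / fact n) sums exp (s * of_real (g x))"
        using exp_converges[of "s * of_real (g x)"] by (simp add: scaleR_conv_of_real divide_inverse mult.commute)
      from sums_mult[OF this, of "f x"] show ?thesis by (rule sums_unique[symmetric])
    qed
    ultimately show ?thesis by (simp add: F_def)
  qed
  have "F holomorphic_on ball 0 r" for r
    by (rule power_series_holomorphic[of 0 r a]) (use sums in simp)
  then have "F holomorphic_on (\<Union>r. ball 0 r)"
    by (intro holomorphic_on_UN_open) auto
  moreover have "(\<Union>r::real. ball (0::complex) r) = UNIV"
  proof (intro equalityI subsetI)
    fix x :: complex
    have "x \<in> ball 0 (norm x + 1)" by simp
    then show "x \<in> (\<Union>r::real. ball (0::complex) r)" by blast
  qed simp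
  ultimately show ?thesis by (simp add: F_def)
qed


section \<open>Continuation and functional equation\<close>

lemma powi_interval_unique:
  fixes U :: real
  assumes U: "U > 1" and r: "1 \<le> r" "r < U" "1 \<le> r'" "r' < U"
    and eq: "U powi j * r = U powi j' * r'"
  shows "j = j'"
proof -
  have aux: "\<not> i < i'" if "1 \<le> x" "x < U" "1 \<le> y" "U powi i * x = U powi i' * y" for i i' :: int and x y
  proof
    assume "i < i'"
    have "U powi i * U = U powi (i + 1)" using U by (simp add: power_int_add)
    also have "\<dots> \<le> U powi i'" using U \<open>i < i'\<close> by (intro power_int_increasing) auto
    also have "U powi i' * 1 \<le> U powi i' * y" using that U by (intro mult_left_mono) auto
    then have "U powi i' \<le> U powi i' * y" by simp
    finally have "U powi i * U \<le> U powi i' * y" .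
    moreover have "U powi i * x < U powi i * U" using that U by (intro mult_strict_left_mono) auto
    ultimately show False using that by linarith
  qed
  from aux[of r r' j j'] aux[of r' r j' j] assms show ?thesis by force
qed

lemma integral_period_shift:
  fixes f :: "real \<Rightarrow> 'b :: {banach, second_countable_topology}"
  shows "(\<integral>y. indicator {0..<p} y *\<^sub>R f (y + a) \<partial>lborel) = (\<integral>y. indicator {a..<a + p} y *\<^sub>R f y \<partial>lborel)"
proof -
  have "(\<integral>y. indicator {a..<a + p} y *\<^sub>R f y \<partial>lborel) = (\<integral>y. indicator {a..<a + p} (a + 1 * y) *\<^sub>R f (a + 1 * y) \<partial>lborel)"
    by (subst lborel_integral_real_affine[where c = 1 and t = a]) auto
  also have "\<dots> = (\<integral>y. indicator {0..<p} y *\<^sub>R f (y + a) \<partial>lborel)"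
    by (intro Bochner_Integration.integral_cong) (auto simp: indicator_def add.commute)
  finally show ?thesis by simp
qed

lemma has_sum_singleton: "(f has_sum f a) {a}"
  by (rule has_sum_finiteI) auto

lemma cis_measurable [measurable (raw)]:
  assumes "f \<in> borel_measurable M"
  shows "(\<lambda>x. cis (f x)) \<in> borel_measurable M"
  using measurable_compose[OF assms borel_measurable_continuous_onI[of cis]]
  by (simp add: continuous_on_cis continuous_on_id)

lemma integral_partition:
  fixes g :: "real \<Rightarrow> complex"
  assumes p: "p > 0" and g: "integrable lborel g"
  shows "((\<lambda>j::int. \<integral>y. indicator {p * of_int j..<p * of_int j + p} y *\<^sub>R g y \<partial>lborel) has_sum (\<integral>y. g y \<partial>lborel)) UNIV"
proof (rule integral_has_sum(2))
  let ?I = "\<lambda>j::int. {p * of_int j..<p * of_int j + p}"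
  have uniq: "y \<in> ?I j \<longleftrightarrow> j = \<lfloor>y / p\<rfloor>" for y j
  proof -
    have "y \<in> ?I j \<longleftrightarrow> of_int j \<le> y / p \<and> y / p < of_int j + 1" using p by (auto simp: field_simps)
    then show ?thesis using floor_eq_iff[of "y / p" j] by auto
  qed
  show int: "integrable lborel (\<lambda>y. indicator (?I i) y *\<^sub>R g y)" for i
    using g by (intro integrable_mult_indicator) auto
  show "(\<lambda>i. \<integral>y. norm (indicator (?I i) y *\<^sub>R g y) \<partial>lborel) summable_on UNIV"
  proof (rule nonneg_bdd_above_summable_on)
    show "bdd_above (sum (\<lambda>i. \<integral>y. norm (indicator (?I i) y *\<^sub>R g y) \<partial>lborel) ` {F. F \<subseteq> UNIV \<and> finite F})"
    proof (rule bdd_aboveI2)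
      fix F :: "int set" assume "F \<in> {F. F \<subseteq> UNIV \<and> finite F}"
      then have F: "finite F" by simp
      have le: "(\<Sum>i\<in>F. norm (indicator (?I i) y *\<^sub>R g y)) \<le> norm (g y)" for y
      proof -
        have "(\<Sum>i\<in>F. norm (indicator (?I i) y *\<^sub>R g y)) = (\<Sum>i\<in>F. if i = \<lfloor>y / p\<rfloor> then norm (g y) else 0)"
          by (intro sum.cong refl) (use uniq[of y] in \<open>auto simp: indicator_def\<close>)
        also have "\<dots> \<le> norm (g y)" using F by simp
        finally show ?thesis .
      qed
      have "(\<Sum>i\<in>F. \<integral>y. norm (indicator (?I i) y *\<^sub>R g y) \<partial>lborel) = (\<integral>y. (\<Sum>i\<in>F. norm (indicator (?I i) y *\<^sub>R g y)) \<partial>lborel)"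
        by (rule Bochner_Integration.integral_sum[symmetric]) (rule integrable_norm[OF int])
      also have "\<dots> \<le> (\<integral>y. norm (g y) \<partial>lborel)"
        by (rule integral_mono[OF Bochner_Integration.integrable_sum integrable_norm[OF g] le]) (rule integrable_norm[OF int])
      finally show "(\<Sum>i\<in>F. \<integral>y. norm (indicator (?I i) y *\<^sub>R g y) \<partial>lborel) \<le> (\<integral>y. norm (g y) \<partial>lborel)" .
    qed
  qed auto
  fix y :: real
  let ?f = "\<lambda>i. indicator (?I i) y *\<^sub>R g y"
  have 1: "?f \<lfloor>y / p\<rfloor> = g y" using uniq[of y "\<lfloor>y / p\<rfloor>"] by (simp add: indicator_def)
  have "(?f has_sum ?f \<lfloor>y / p\<rfloor>) {\<lfloor>y / p\<rfloor>}" by (rule has_sum_singleton)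
  then have A: "(?f has_sum g y) {\<lfloor>y / p\<rfloor>}" unfolding 1 .
  have Z: "?f i = 0" if "i \<noteq> \<lfloor>y / p\<rfloor>" for i :: int
    using that uniq[of y i] by (simp add: indicator_def)
  show "(?f has_sum g y) UNIV"
    by (rule iffD1[OF has_sum_cong_neutral, rotated 3, OF A]) (use Z in blast)+
qed auto

lemma integral_cis_half_open_period:
  assumes p: "p > 0" and k: "k \<noteq> (0::int)"
  shows "(\<integral>w. indicator {0..<p} w *\<^sub>R cis (2 * pi * of_int k / p * w) \<partial>lborel) = 0"
proof -
  have "(\<integral>w. indicator {0..<p} w *\<^sub>R cis (2 * pi * of_int k / p * w) \<partial>lborel) =
     \<bar>p\<bar> *\<^sub>R (\<integral>y. indicator {0..<p} (0 + p * y) *\<^sub>R cis (2 * pi * of_int k / p * (0 + p * y)) \<partial>lborel)"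
    using p by (intro lborel_integral_real_affine) auto
  also have "(\<integral>y. indicator {0..<p} (0 + p * y) *\<^sub>R cis (2 * pi * of_int k / p * (0 + p * y)) \<partial>lborel)
     = (\<integral>y. indicator {0..<1} y * cis (2 * pi * of_int (- k) * (0 - y)) \<partial>lborel)"
    using p by (intro Bochner_Integration.integral_cong) (auto simp: indicator_def mult_ac zero_le_mult_iff)
  also have "\<dots> = integral {0..1} (\<lambda>y. cis (2 * pi * of_int (- k) * (0 - y)))"
    by (rule set_integral_half_open) (intro continuous_intros)
  also have "\<dots> = 0"
    using integral_unique[OF integral_cis_period[of "- k" 0]] k by (simp add: o_def)
  finally show ?thesis by simp
qed

text \<open>Both signs of each generator are kept: the theta series runs over all nonzero lattice points.\<close>

definition fdom_pm :: "nat \<Rightarrow> real \<Rightarrow> (int \<times> int) set" where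
  "fdom_pm q u = {z. z \<noteq> 0 \<and> 1 \<le> \<bar>val q z / con q z\<bar> \<and> \<bar>val q z / con q z\<bar> < u\<^sup>2}"

section \<open>Unfolding the theta function along the unit group\<close>

locale quad_unit = real_quad +
  fixes u :: real
  assumes u_gt_1: "u > 1"
    and units: "\<And>j::int. \<exists>e. val q e = u powi j \<and> \<bar>qnorm q e\<bar> = 1"
begin

definition unit_elt :: "int \<Rightarrow> int \<times> int" where
  "unit_elt j = (SOME e. val q e = u powi j \<and> \<bar>qnorm q e\<bar> = 1)"

lemma unit_elt: "val q (unit_elt j) = u powi j" "\<bar>con q (unit_elt j)\<bar> = u powi (- j)"
proof -
  have 1: "val q (unit_elt j) = u powi j \<and> \<bar>qnorm q (unit_elt j)\<bar> = 1"
    unfolding unit_elt_def using units[of j] by (rule someI_ex)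
  then show "val q (unit_elt j) = u powi j" by blast
  have "u powi j > 0" using u_gt_1 by simp
  have "\<bar>val q (unit_elt j)\<bar> * \<bar>con q (unit_elt j)\<bar> = 1"
    using 1 val_con[of "unit_elt j"] by (metis abs_mult of_int_1 of_int_abs)
  then have "u powi j * \<bar>con q (unit_elt j)\<bar> = 1" using 1 \<open>u powi j > 0\<close> by simp
  then have "inverse (u powi j) = \<bar>con q (unit_elt j)\<bar>" by (rule inverse_unique)
  then show "\<bar>con q (unit_elt j)\<bar> = u powi (- j)" by (simp add: power_int_minus)
qed

definition orb :: "(int \<times> int) \<times> int \<Rightarrow> int \<times> int" where
  "orb x = qmul q (unit_elt (snd x)) (fst x)"

lemma val_orb: "val q (orb (z, j)) = u powi j * val q z"
  and con_orb: "\<bar>con q (orb (z, j))\<bar> = u powi (- j) * \<bar>con q z\<bar>"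
  by (simp_all add: orb_def val_mul con_mul unit_elt abs_mult)

lemma ratio_orb: "\<bar>val q (orb (z, j)) / con q (orb (z, j))\<bar> = (u\<^sup>2) powi j * \<bar>val q z / con q z\<bar>"
proof -
  have "u powi j > 0" using u_gt_1 by simp
  then show ?thesis
    by (simp add: abs_divide val_orb con_orb abs_mult power_int_minus power2_eq_square power_int_mult_distrib field_simps)
qed

lemma u2: "u\<^sup>2 > 1" "u\<^sup>2 > 0"
  using u_gt_1 by (simp_all add: one_less_power)

text \<open>Each application of the unit multiplies the ratio of embeddings by \<open>u^2\<close>,
  so exactly one translate of a nonzero lattice point has its ratio in the window.\<close>

lemma bij_betw_orb: "bij_betw orb (fdom_pm q u \<times> UNIV) (UNIV - {0})"
proof (rule bij_betwI')
  fix x y assume xy: "x \<in> fdom_pm q u \<times> (UNIV :: int set)" "y \<in> fdom_pm q u \<times> (UNIV :: int set)"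
  obtain z j w i where eq: "x = (z, j)" "y = (w, i)" by (cases x, cases y) auto
  show "orb x = orb y \<longleftrightarrow> x = y"
  proof
    assume o: "orb x = orb y"
    have "j = i"
    proof (rule powi_interval_unique[OF u2(1)])
      show "(u\<^sup>2) powi j * \<bar>val q z / con q z\<bar> = (u\<^sup>2) powi i * \<bar>val q w / con q w\<bar>"
        unfolding ratio_orb[symmetric] using o eq by simp
    qed (use xy in \<open>auto simp: eq fdom_pm_def\<close>)
    then have "u powi j * val q z = u powi j * val q w" using o unfolding eq by (simp flip: val_orb)
    then have "z = w" using u_gt_1 by (auto simp: val_inj)
    with \<open>j = i\<close> show "x = y" by (simp add: eq)
  qed simp
next
  fix x assume x: "x \<in> fdom_pm q u \<times> (UNIV :: int set)"
  obtain z j where eq: "x = (z, j)" by (cases x) auto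
  have "u powi j > 0" using u_gt_1 by simp
  then have "val q (orb x) \<noteq> 0" using x unfolding eq val_orb by (auto simp: fdom_pm_def val_eq_0_iff)
  then show "orb x \<in> UNIV - {0}" by (auto simp: val_eq_0_iff)
next
  fix z assume "z \<in> UNIV - {0 :: int \<times> int}"
  then have z: "z \<noteq> 0" by simp
  define r where "r = \<bar>val q z / con q z\<bar>"
  have r: "r > 0" using z by (simp add: r_def val_eq_0_iff con_eq_0_iff)
  define n where "n = \<lfloor>log (u\<^sup>2) r\<rfloor>"
  have "(u\<^sup>2) powr of_int n \<le> r" "r < (u\<^sup>2) powr (of_int n + 1)"
    using u2 r unfolding n_def by (auto simp: le_log_iff[symmetric] log_less_iff[symmetric])
  then have rn: "(u\<^sup>2) powi n \<le> r" "r < (u\<^sup>2) powi n * u\<^sup>2"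
    using u2 powr_real_of_int'[of "u\<^sup>2" n] by (auto simp: powr_add)
  have pn: "(u\<^sup>2) powi n > 0" using u2 by simp
  define w where "w = orb (z, - n)"
  have "\<bar>val q w / con q w\<bar> = inverse ((u\<^sup>2) powi n) * r"
    unfolding w_def ratio_orb r_def by (simp add: power_int_minus)
  then have "1 \<le> \<bar>val q w / con q w\<bar>" "\<bar>val q w / con q w\<bar> < u\<^sup>2"
    using rn pn by (auto simp: field_simps)
  moreover from this have "w \<noteq> 0" by auto
  ultimately have "w \<in> fdom_pm q u" by (simp add: fdom_pm_def)
  moreover have "u powi n * u powi (- n) = 1" using u_gt_1 by (simp flip: power_int_add)
  then have "val q (orb (w, n)) = val q z" unfolding val_orb w_def by (simp flip: mult.assoc)
  then have "z = orb (w, n)" by (simp add: val_inj)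
  ultimately show "\<exists>x\<in>fdom_pm q u \<times> UNIV. z = orb x" by blast
qed

abbreviation "log_unit \<equiv> ln u"

lemma log_unit_pos: "log_unit > 0"
  using u_gt_1 by simp

lemma exp_log_unit: "exp (2 * log_unit * of_int j) = (u powi j)\<^sup>2"
proof -
  have "u powi j = exp (log_unit * of_int j)"
    using u_gt_1 powr_real_of_int'[of u j] by (simp add: powr_def mult.commute)
  then show ?thesis by (simp add: power2_eq_square flip: exp_add)
qed

lemma qexp_orb: "qexp (orb (z, j)) v w = qexp z v (w + 2 * log_unit * of_int j)"
proof -
  have "u powi j > 0" using u_gt_1 by simp
  have "(con q (orb (z, j)))\<^sup>2 = (u powi (- j) * \<bar>con q z\<bar>)\<^sup>2" by (metis con_orb power2_abs)
  also have "\<dots> = inverse ((u powi j)\<^sup>2) * (con q z)\<^sup>2" by (simp add: power_mult_distrib power_int_minus power_inverse)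
  finally have c: "(con q (orb (z, j)))\<^sup>2 = inverse ((u powi j)\<^sup>2) * (con q z)\<^sup>2" .
  have e: "exp (v + (w + 2 * log_unit * of_int j)) = exp (v + w) * (u powi j)\<^sup>2"
    "exp (v - (w + 2 * log_unit * of_int j)) = exp (v - w) * inverse ((u powi j)\<^sup>2)"
    unfolding exp_log_unit[symmetric] exp_minus[symmetric] mult_exp_exp by (simp_all add: algebra_simps)
  show ?thesis unfolding qexp_def c e val_orb by (simp add: power_mult_distrib mult_ac)
qed

lemma qexp_le:
  assumes "\<bar>w\<bar> \<le> b"
  shows "qexp z v w \<le> qexp z (v - b) 0"
proof -
  have "(val q z)\<^sup>2 * exp (v - b) \<le> (val q z)\<^sup>2 * exp (v + w)" "(con q z)\<^sup>2 * exp (v - b) \<le> (con q z)\<^sup>2 * exp (v - w)"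
    using assms by (intro mult_left_mono; simp)+
  then have "(pi / sqrt (real q)) * ((val q z)\<^sup>2 * exp (v - b) + (con q z)\<^sup>2 * exp (v - b))
     \<le> (pi / sqrt (real q)) * ((val q z)\<^sup>2 * exp (v + w) + (con q z)\<^sup>2 * exp (v - w))"
    by (intro mult_left_mono) auto
  then show ?thesis by (simp add: qexp_def)
qed

lemma qexp_summable_nz: "(\<lambda>z. qexp z v w) summable_on (UNIV - {0})"
  by (rule summable_on_subset_banach[OF qexp_summable]) auto

lemma qtheta_has_sum_nz: "((\<lambda>z. qexp z v w) has_sum (qtheta v w - 1)) (UNIV - {0})"
proof -
  have "((\<lambda>z. qexp z v w) has_sum qexp 0 v w) {0}" by (rule has_sum_finiteI) auto
  moreover have "((\<lambda>z. qexp z v w) has_sum qtheta v w) UNIV"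
    unfolding qtheta_def by (rule has_sum_infsum[OF qexp_summable])
  ultimately have "((\<lambda>z. qexp z v w) has_sum (qtheta v w - qexp 0 v w)) (UNIV - {0})"
    by (intro has_sum_Diff) auto
  then show ?thesis by (simp add: qexp_def)
qed

lemma qexp_measurable [measurable]: "(\<lambda>w. qexp z v w) \<in> borel_measurable borel"
  unfolding qexp_def by (intro borel_measurable_continuous_onI continuous_intros)

text \<open>Both embeddings of \<open>z\<close> are nonzero, so the decay is doubly exponential at
  both ends. For either sign of \<open>w\<close> a gamma integrand with exponent one is a majorant,
  reflected for negative \<open>w\<close>.\<close>

lemma qexp_integrable:
  assumes "z \<noteq> 0"
  shows "integrable lborel (\<lambda>w. qexp z v w)"
proof -
  define p r where "p = pi / sqrt (real q) * (val q z)\<^sup>2 * exp v" and "r = pi / sqrt (real q) * (con q z)\<^sup>2 * exp v"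
  have pr: "p > 0" "r > 0" using assms q_ge_5 by (simp_all add: p_def r_def val_eq_0_iff con_eq_0_iff)
  have q: "qexp z v w = exp (- p * exp w - r * exp (- w))" for w
    by (simp add: qexp_def p_def r_def exp_add exp_diff exp_minus algebra_simps divide_inverse)
  have 1: "integrable lborel (\<lambda>w. exp (w - t * exp w))" if "t > 0" for t :: real
  proof -
    have "integrable lborel (\<lambda>w. complex_of_real (exp (w - t * exp w)))"
      using mellin_exp_scaled(1)[of 1 t] that unfolding mult_1 of_real_diff[symmetric] exp_of_real[symmetric] by simp
    from integrable_Re[OF this] show ?thesis by simp
  qed
  have 2: "integrable lborel (\<lambda>w. exp (- w - r * exp (- w)))"
    using lborel_integrable_real_affine_iff[of "-1" "\<lambda>w. exp (w - r * exp w)" 0] 1[OF pr(2)] by simp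
  show ?thesis
  proof (rule Bochner_Integration.integrable_bound)
    show "integrable lborel (\<lambda>w. exp (w - p * exp w) + exp (- w - r * exp (- w)))"
      by (intro Bochner_Integration.integrable_add 1 2 pr)
    show "AE w in lborel. norm (qexp z v w) \<le> norm (exp (w - p * exp w) + exp (- w - r * exp (- w)))"
    proof (rule AE_I2)
      fix w :: real
      have "p * exp w > 0" "r * exp (- w) > 0" using pr by simp_all
      then have "- p * exp w - r * exp (- w) \<le> w - p * exp w \<or> - p * exp w - r * exp (- w) \<le> - w - r * exp (- w)"
        by linarith
      then have "qexp z v w \<le> exp (w - p * exp w) \<or> qexp z v w \<le> exp (- w - r * exp (- w))"
        unfolding q exp_le_cancel_iff .
      then have "qexp z v w \<le> exp (w - p * exp w) + exp (- w - r * exp (- w))"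
        using exp_gt_zero[of "w - p * exp w"] exp_gt_zero[of "- w - r * exp (- w)"] by linarith
      then show "norm (qexp z v w) \<le> norm (exp (w - p * exp w) + exp (- w - r * exp (- w)))"
        using qexp_pos[of z v w] by simp
    qed
  qed auto
qed

text \<open>The functions \<open>cis (hecke_freq k * w)\<close> are the characters of the circle of
  length \<open>2 * log_unit\<close>, on which the theta function lives because the unit acts by
  translation.\<close>

definition hecke_freq :: "nat \<Rightarrow> real" where
  "hecke_freq k = pi * real k / log_unit"

text \<open>For nonzero \<open>z\<close> this is, up to a phase, twice the K-Bessel function of
  order \<open>i * hecke_freq k\<close> at
  \<open>2 * pi * abs_norm z * exp v / sqrt q\<close>.\<close>

definition bessel :: "nat \<Rightarrow> int \<times> int \<Rightarrow> real \<Rightarrow> complex" where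
  "bessel k z v = (\<integral>w. of_real (qexp z v w) * cis (- hecke_freq k * w) \<partial>lborel)"

definition theta_coeff :: "nat \<Rightarrow> real \<Rightarrow> complex" where
  "theta_coeff k v = (\<integral>w. indicator {0..<2 * log_unit} w *\<^sub>R (of_real (qtheta v w - 1) * cis (- hecke_freq k * w)) \<partial>lborel)"

lemma cis_hecke_freq_period: "cis (- hecke_freq k * (w + 2 * log_unit * of_int j)) = cis (- hecke_freq k * w)"
proof -
  have "- hecke_freq k * (w + 2 * log_unit * of_int j) = - hecke_freq k * w + 2 * pi * of_int (- (int k * j))"
    using log_unit_pos by (simp add: hecke_freq_def field_simps)
  then have "cis (- hecke_freq k * (w + 2 * log_unit * of_int j)) = cis (- hecke_freq k * w) * cis (2 * pi * of_int (- (int k * j)))"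
    by (simp only: cis_mult)
  also have "cis (2 * pi * of_int (- (int k * j))) = 1" by (rule cis_multiple_2pi) simp
  finally show ?thesis by simp
qed

lemma theta_coeff_has_sum_nz:
  shows "integrable lborel (\<lambda>w. indicator {0..<2 * log_unit} w *\<^sub>R (complex_of_real (qtheta v w - 1) * cis (- hecke_freq k * w)))"
  and "((\<lambda>z. \<integral>w. indicator {0..<2 * log_unit} w *\<^sub>R (of_real (qexp z v w) * cis (- hecke_freq k * w)) \<partial>lborel) has_sum theta_coeff k v) (UNIV - {0})"
proof -
  note facts = integral_has_sum[where M = lborel and I = "UNIV - {0}" and g = "\<lambda>w. indicator {0..<2 * log_unit} w *\<^sub>R (complex_of_real (qtheta v w - 1) * cis (- hecke_freq k * w))"
    and f = "\<lambda>z w. indicator {0..<2 * log_unit} w *\<^sub>R (of_real (qexp z v w) * cis (- hecke_freq k * w))"]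
  have "integrable lborel (\<lambda>w. indicator {0..<2 * log_unit} w *\<^sub>R (complex_of_real (qexp z v w) * cis (- hecke_freq k * w)))" if "z \<in> UNIV - {0}" for z
  proof -
    have z: "z \<noteq> 0" using that by simp
    have m: "(\<lambda>w. indicator {0..<2 * log_unit} w *\<^sub>R (complex_of_real (qexp z v w) * cis (- hecke_freq k * w))) \<in> borel_measurable lborel"
      by measurable
    show ?thesis
      by (rule Bochner_Integration.integrable_bound[OF qexp_integrable[OF z, of v] m])
        (auto simp: norm_mult indicator_def qexp_pos less_imp_le)
  qed
  moreover have sm: "(\<lambda>z. 2 * log_unit * qexp z (v - 2 * log_unit) 0) summable_on (UNIV - {0})"
    by (intro summable_on_cmult_right qexp_summable_nz)
  have "(\<lambda>z. \<integral>w. norm (indicator {0..<2 * log_unit} w *\<^sub>R (complex_of_real (qexp z v w) * cis (- hecke_freq k * w))) \<partial>lborel) summable_on (UNIV - {0})"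
  proof (rule summable_on_comparison_test[OF sm])
    fix z :: "int \<times> int" assume "z \<in> UNIV - {0}"
    then have z: "z \<noteq> 0" by simp
    have "(\<integral>w. norm (indicator {0..<2 * log_unit} w *\<^sub>R (complex_of_real (qexp z v w) * cis (- hecke_freq k * w))) \<partial>lborel)
       = (\<integral>w. indicator {0..<2 * log_unit} w * qexp z v w \<partial>lborel)"
      using qexp_pos[of z v] by (intro Bochner_Integration.integral_cong) (auto simp: norm_mult indicator_def less_imp_le)
    also have "\<dots> \<le> (\<integral>w. indicator {0..<2 * log_unit} w * qexp z (v - 2 * log_unit) 0 \<partial>lborel)"
    proof (rule integral_mono)
      show "integrable lborel (\<lambda>w. indicator {0..<2 * log_unit} w * qexp z v w)"
        using integrable_mult_indicator[OF _ qexp_integrable[OF z, of v], of "{0..<2 * log_unit}"] by simp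
      show "integrable lborel (\<lambda>w. indicator {0..<2 * log_unit} w * qexp z (v - 2 * log_unit) 0)"
        using log_unit_pos by (intro integrable_mult_left integrable_real_indicator) auto
      show "indicator {0..<2 * log_unit} w * qexp z v w \<le> indicator {0..<2 * log_unit} w * qexp z (v - 2 * log_unit) 0" for w :: real
        using qexp_le[of w "2 * log_unit" z v] by (auto simp: indicator_def)
    qed
    also have "\<dots> = 2 * log_unit * qexp z (v - 2 * log_unit) 0" using log_unit_pos by simp
    finally show "(\<integral>w. norm (indicator {0..<2 * log_unit} w *\<^sub>R (complex_of_real (qexp z v w) * cis (- hecke_freq k * w))) \<partial>lborel) \<le> 2 * log_unit * qexp z (v - 2 * log_unit) 0" .
  qed simp
  moreover have "((\<lambda>z. indicator {0..<2 * log_unit} w *\<^sub>R (complex_of_real (qexp z v w) * cis (- hecke_freq k * w))) has_sum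
     indicator {0..<2 * log_unit} w *\<^sub>R (complex_of_real (qtheta v w - 1) * cis (- hecke_freq k * w))) (UNIV - {0})" for w
  proof -
  have "((\<lambda>z. complex_of_real (qexp z v w)) has_sum of_real (qtheta v w - 1)) (UNIV - {0})"
    using has_sum_bounded_linear[OF bounded_linear_of_real qtheta_has_sum_nz[of v w]] .
  then have "((\<lambda>z. (complex_of_real (indicator {0..<2 * log_unit} w) * cis (- hecke_freq k * w)) * complex_of_real (qexp z v w)) has_sum
     (complex_of_real (indicator {0..<2 * log_unit} w) * cis (- hecke_freq k * w)) * of_real (qtheta v w - 1)) (UNIV - {0})"
    by (rule has_sum_cmult_right)
  then show ?thesis
    by (simp only: scaleR_conv_of_real mult_ac)
  qed
  ultimately show "integrable lborel (\<lambda>w. indicator {0..<2 * log_unit} w *\<^sub>R (complex_of_real (qtheta v w - 1) * cis (- hecke_freq k * w)))"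
    "((\<lambda>z. \<integral>w. indicator {0..<2 * log_unit} w *\<^sub>R (of_real (qexp z v w) * cis (- hecke_freq k * w)) \<partial>lborel) has_sum theta_coeff k v) (UNIV - {0})"
    unfolding theta_coeff_def by (intro facts; simp)+
qed

text \<open>The nonzero lattice points are grouped into orbits of the unit. Within an orbit the
  integrals over one period are integrals of a single function over consecutive periods, and
  together they make up the integral over the line.\<close>

theorem theta_coeff_has_sum: "((\<lambda>z. bessel k z v) has_sum theta_coeff k v) (fdom_pm q u)"
proof -
  let ?J = "\<lambda>z w. complex_of_real (qexp z v w) * cis (- hecke_freq k * w)"
  have orb: "(\<integral>w. indicator {0..<2 * log_unit} w *\<^sub>R ?J (orb (z, j)) w \<partial>lborel)
     = (\<integral>w. indicator {2 * log_unit * of_int j..<2 * log_unit * of_int j + 2 * log_unit} w *\<^sub>R ?J z w \<partial>lborel)" for z j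
    unfolding integral_period_shift[symmetric] qexp_orb cis_hecke_freq_period ..
  have A: "((\<lambda>x. \<integral>w. indicator {0..<2 * log_unit} w *\<^sub>R ?J (orb x) w \<partial>lborel) has_sum theta_coeff k v) (fdom_pm q u \<times> UNIV)"
    using theta_coeff_has_sum_nz(2)[of v k] by (subst has_sum_reindex_bij_betw[OF bij_betw_orb])
  have B: "((\<lambda>j. \<integral>w. indicator {0..<2 * log_unit} w *\<^sub>R ?J (orb (z, j)) w \<partial>lborel) has_sum bessel k z v) UNIV" if "z \<in> fdom_pm q u" for z
    unfolding orb bessel_def
  proof (rule integral_partition)
    have z: "z \<noteq> 0" using that by (simp add: fdom_pm_def)
    have m: "?J z \<in> borel_measurable lborel" by measurable
    show "integrable lborel (?J z)"
      by (rule Bochner_Integration.integrable_bound[OF qexp_integrable[OF z, of v] m])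
        (auto simp: norm_mult)
  qed (use log_unit_pos in simp)
  show ?thesis by (rule has_sum_SigmaD[OF A B])
qed

text \<open>The term of the zero vector contributes only constants in \<open>w\<close>, and these
  have vanishing Fourier coefficient for \<open>k > 0\<close>. Hence no polar terms arise and the
  continuation below is entire.\<close>

lemma theta_coeff_reflect:
  assumes k: "k > 0"
  shows "theta_coeff k (- v) = of_real (exp v) * theta_coeff k v"
proof -
  let ?c = "\<lambda>w. cis (- hecke_freq k * w)" and ?i = "\<lambda>w. indicator {0..<2 * log_unit} w :: real"
  have m: "(\<lambda>w. ?i w *\<^sub>R ?c w) \<in> borel_measurable lborel" by measurable
  have i1: "integrable lborel ?i" using log_unit_pos by (intro integrable_real_indicator) auto
  have z: "(\<integral>w. ?i w *\<^sub>R ?c w \<partial>lborel) = 0"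
    using integral_cis_half_open_period[of "2 * log_unit" "- int k"] k log_unit_pos by (simp add: hecke_freq_def mult_ac)
  have ii: "integrable lborel (\<lambda>w. ?i w *\<^sub>R ?c w)"
    by (rule Bochner_Integration.integrable_bound[OF i1 m]) (auto simp: indicator_def)
  have it: "integrable lborel (\<lambda>w. ?i w *\<^sub>R (of_real (qtheta v w - 1) * ?c w))"
    by (rule theta_coeff_has_sum_nz(1))
  have "?i w *\<^sub>R (of_real (qtheta (- v) w - 1) * ?c w) =
     of_real (exp v) * (?i w *\<^sub>R (of_real (qtheta v w - 1) * ?c w)) + of_real (exp v - 1) * (?i w *\<^sub>R ?c w)" for w
  proof -
    have "qtheta (- v) w - 1 = exp v * (qtheta v w - 1) + (exp v - 1)"
      using qtheta_functional[of "- v" w] by (simp add: algebra_simps)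
    then have "complex_of_real (qtheta (- v) w - 1) = of_real (exp v) * of_real (qtheta v w - 1) + of_real (exp v - 1)"
      by (simp only: of_real_add of_real_mult)
    then show ?thesis by (simp only: scaleR_conv_of_real) (simp add: algebra_simps)
  qed
  then have "theta_coeff k (- v) = (\<integral>w. of_real (exp v) * (?i w *\<^sub>R (of_real (qtheta v w - 1) * ?c w)) + of_real (exp v - 1) * (?i w *\<^sub>R ?c w) \<partial>lborel)"
    unfolding theta_coeff_def by simp
  also have "\<dots> = of_real (exp v) * theta_coeff k v + of_real (exp v - 1) * 0"
    unfolding theta_coeff_def z[symmetric]
    by (subst Bochner_Integration.integral_add) (auto simp only: integral_mult_right_zero intro!: integrable_mult_right it ii)
  finally show ?thesis by simp
qed

end


section \<open>The Dirichlet series as a Mellin transform, and its functional equation\<close>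

lemma summable_on_int_powr:
  fixes s :: real
  assumes "s > 1"
  shows "(\<lambda>m::int. (1 + \<bar>of_int m\<bar>) powr (- s)) summable_on UNIV"
proof (rule summable_on_int_if_summable)
  have "summable (\<lambda>n. real (Suc n) powr (- s))"
    using assms by (subst summable_Suc_iff) (simp add: summable_real_powr_iff)
  then show "summable (\<lambda>n. (1 + \<bar>real_of_int (int n)\<bar>) powr (- s))"
    "summable (\<lambda>n. (1 + \<bar>real_of_int (- int n)\<bar>) powr (- s))"
    by (simp_all add: add.commute)
qed auto

text \<open>Gamma quotients are written with \<open>rGamma\<close>, so that the identity covers the
  pole of \<open>Gamma z\<close> at \<open>z = 0\<close> as well.\<close>

lemma Gamma_plus1_rGamma:
  fixes z :: complex
  assumes "Re z > -1"
  shows "Gamma (z + 1) * rGamma z = z"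
proof -
  have "z + 1 \<notin> \<int>\<^sub>\<le>\<^sub>0" using assms by (auto elim!: nonpos_Ints_cases simp: complex_eq_iff)
  then have "Gamma (z + 1) * rGamma (z + 1) = 1"
    by (simp add: Gamma_def rGamma_eq_zero_iff)
  then show ?thesis using rGamma_plus1[of z] by (metis mult.assoc mult.commute mult.right_neutral)
qed

lemma Gamma_plus2_rGamma:
  fixes z :: complex
  assumes "Re z > -2"
  shows "Gamma (z + 2) * rGamma z = z * (z + 1)"
proof -
  have "Gamma (z + 1 + 1) * rGamma (z + 1) = z + 1" by (rule Gamma_plus1_rGamma) (use assms in simp)
  moreover have "rGamma z = z * rGamma (z + 1)" by (simp add: rGamma_plus1)
  ultimately show ?thesis by (simp add: algebra_simps)
qed

context quad_unit
begin

lemma form_lower_bound: "(of_int (fst z))\<^sup>2 + (of_int (snd z))\<^sup>2 \<le> (val q z)\<^sup>2 + (con q z)\<^sup>2"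
proof -
  define m n :: real where "m = of_int (fst z)" and "n = of_int (snd z)"
  have "(val q z)\<^sup>2 + (con q z)\<^sup>2 = 2 * m\<^sup>2 + 2 * m * n * (om q + omc q) + n\<^sup>2 * (om q * om q + omc q * omc q)"
    by (simp add: val_def con_def m_def n_def power2_eq_square algebra_simps)
  also have "om q * om q + omc q * omc q = 1 + 2 * real (q div 4)"
    using om_sq(1,2,4) by linarith
  also have "2 * m\<^sup>2 + 2 * m * n * (om q + omc q) + n\<^sup>2 * (1 + 2 * real (q div 4)) = 2 * m\<^sup>2 + 2 * m * n + n\<^sup>2 * (1 + 2 * real (q div 4))"
    unfolding om_sq(4) by simp
  also have "\<dots> = m\<^sup>2 + (m + n)\<^sup>2 + n\<^sup>2 * (2 * real (q div 4))"
    by (simp add: power2_eq_square algebra_simps)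
  finally have e: "(val q z)\<^sup>2 + (con q z)\<^sup>2 = m\<^sup>2 + (m + n)\<^sup>2 + n\<^sup>2 * (2 * real (q div 4))" .
  have "q div 4 \<ge> 1" using q_ge_5 by simp
  then have "real (q div 4) \<ge> 1" by linarith
  then have "n\<^sup>2 * 1 \<le> n\<^sup>2 * (2 * real (q div 4))" by (intro mult_left_mono) auto
  then show ?thesis unfolding e m_def[symmetric] n_def[symmetric] using zero_le_power2[of "m + n"] by linarith
qed

abbreviation "abs_norm z \<equiv> \<bar>real_of_int (qnorm q z)\<bar>"

lemma abs_norm_eq: "abs_norm z = \<bar>val q z\<bar> * \<bar>con q z\<bar>"
  by (metis abs_mult of_int_abs val_con)

lemma abs_norm_ge_1: "z \<noteq> 0 \<Longrightarrow> abs_norm z \<ge> 1"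
  using qnorm_eq_0_iff[of z] by linarith

text \<open>In the fundamental domain the two embeddings agree up to a factor \<open>u^2\<close>, so
  each is comparable with the square root of the norm, and the norm controls the Euclidean
  size.\<close>

lemma fdom_pm_bounds:
  assumes "z \<in> fdom_pm q u"
  shows "\<bar>val q z\<bar> \<le> u * sqrt (abs_norm z)" "\<bar>con q z\<bar> \<le> sqrt (abs_norm z)"
    "(of_int (fst z))\<^sup>2 + (of_int (snd z))\<^sup>2 \<le> (u\<^sup>2 + 1) * abs_norm z"
proof -
  have z: "z \<noteq> 0" and r: "1 \<le> \<bar>val q z / con q z\<bar>" "\<bar>val q z / con q z\<bar> < u\<^sup>2"
    using assms by (auto simp: fdom_pm_def)
  have c: "\<bar>con q z\<bar> > 0" using z by (simp add: con_eq_0_iff)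
  have le: "\<bar>con q z\<bar> \<le> \<bar>val q z\<bar>" "\<bar>val q z\<bar> \<le> u\<^sup>2 * \<bar>con q z\<bar>"
    using r c by (auto simp: abs_divide field_simps)
  have "\<bar>con q z\<bar>\<^sup>2 \<le> abs_norm z" unfolding abs_norm_eq power2_eq_square using le by (intro mult_right_mono) auto
  then show 2: "\<bar>con q z\<bar> \<le> sqrt (abs_norm z)" by (rule real_le_rsqrt)
  have v2: "\<bar>val q z\<bar>\<^sup>2 \<le> u\<^sup>2 * abs_norm z"
  proof -
    have "\<bar>val q z\<bar> * \<bar>val q z\<bar> \<le> \<bar>val q z\<bar> * (u\<^sup>2 * \<bar>con q z\<bar>)" using le by (intro mult_left_mono) auto
    then show ?thesis unfolding abs_norm_eq power2_eq_square by (simp add: mult_ac)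
  qed
  then have "\<bar>val q z\<bar> \<le> sqrt (u\<^sup>2 * abs_norm z)" by (rule real_le_rsqrt)
  then show "\<bar>val q z\<bar> \<le> u * sqrt (abs_norm z)" using u_gt_1 by (simp add: real_sqrt_mult)
  have "(val q z)\<^sup>2 + (con q z)\<^sup>2 \<le> u\<^sup>2 * abs_norm z + abs_norm z"
    using v2 \<open>\<bar>con q z\<bar>\<^sup>2 \<le> abs_norm z\<close> by simp
  then show "(of_int (fst z))\<^sup>2 + (of_int (snd z))\<^sup>2 \<le> (u\<^sup>2 + 1) * abs_norm z"
    using form_lower_bound[of z] by (simp add: algebra_simps)
qed

text \<open>On the fundamental domain \<open>(1 + |m|) * (1 + |n|)\<close> is at most
  \<open>C * abs_norm z\<close>, which splits the majorant into a product of two one-dimensional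
  series.\<close>

lemma abs_norm_powr_summable:
  assumes s: "s > 1"
  shows "(\<lambda>z. abs_norm z powr (- s)) summable_on fdom_pm q u"
proof -
  define C where "C = 4 * (u\<^sup>2 + 1)"
  have C: "C > 0" using u_gt_1 by (simp add: C_def add_pos_pos)
  have g: "(\<lambda>m::int. (1 + \<bar>of_int m\<bar>) powr (- s)) summable_on UNIV" by (rule summable_on_int_powr[OF s])
  have "(\<lambda>(m, n). (1 + \<bar>of_int m\<bar>) powr (- s) * (1 + \<bar>of_int n\<bar>) powr (- s)) summable_on (UNIV :: int set) \<times> (UNIV :: int set)"
    by (rule summable_on_product_real[OF g g]) auto
  then have "(\<lambda>z::int \<times> int. (1 + \<bar>of_int (fst z)\<bar>) powr (- s) * (1 + \<bar>of_int (snd z)\<bar>) powr (- s)) summable_on UNIV"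
    by (simp add: case_prod_unfold)
  then have "(\<lambda>z::int \<times> int. (1 + \<bar>of_int (fst z)\<bar>) powr (- s) * (1 + \<bar>of_int (snd z)\<bar>) powr (- s)) summable_on fdom_pm q u"
    by (rule summable_on_subset_banach) auto
  then have "(\<lambda>z::int \<times> int. C powr s * ((1 + \<bar>of_int (fst z)\<bar>) powr (- s) * (1 + \<bar>of_int (snd z)\<bar>) powr (- s))) summable_on fdom_pm q u"
    by (rule summable_on_cmult_right)
  then show ?thesis
  proof (rule summable_on_comparison_test)
    fix z assume z: "z \<in> fdom_pm q u"
    define m n :: real where "m = \<bar>of_int (fst z)\<bar>" and "n = \<bar>of_int (snd z)\<bar>"
    have z0: "z \<noteq> 0" using z by (simp add: fdom_pm_def)
    then have "fst z \<noteq> 0 \<or> snd z \<noteq> 0" by (auto simp: prod_eq_iff)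
    then have max1: "1 \<le> max m n" unfolding m_def n_def by linarith
    have m0: "m \<ge> 0" "n \<ge> 0" by (auto simp: m_def n_def)
    have "(1 + m) * (1 + n) \<le> (2 * max m n) * (2 * max m n)"
      using max1 m0 by (intro mult_mono) auto
    also have "\<dots> \<le> 4 * (m\<^sup>2 + n\<^sup>2)" using m0 by (auto simp: max_def power2_eq_square)
    also have "m\<^sup>2 + n\<^sup>2 \<le> (u\<^sup>2 + 1) * abs_norm z" using fdom_pm_bounds(3)[OF z] by (simp add: m_def n_def)
    then have "4 * (m\<^sup>2 + n\<^sup>2) \<le> C * abs_norm z" unfolding C_def mult.assoc by (rule mult_left_mono) simp
    finally have le: "(1 + m) * (1 + n) \<le> C * abs_norm z" .
    have "(C * abs_norm z) powr (- s) \<le> ((1 + m) * (1 + n)) powr (- s)"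
      using le m0 s by (intro powr_mono2') (auto intro: mult_pos_pos)
    then have "C powr s * (C powr (- s) * abs_norm z powr (- s)) \<le> C powr s * ((1 + m) powr (- s) * (1 + n) powr (- s))"
      using C m0 by (intro mult_left_mono) (auto simp: powr_mult)
    moreover have "C powr s * (C powr (- s) * abs_norm z powr (- s)) = abs_norm z powr (- s)"
      using C by (simp add: powr_minus)
    ultimately show "abs_norm z powr (- s) \<le> C powr s * ((1 + \<bar>of_int (fst z)\<bar>) powr (- s) * (1 + \<bar>of_int (snd z)\<bar>) powr (- s))"
      by (simp add: m_def n_def)
  qed auto
qed

abbreviation "log_cond \<equiv> ln (pi / sqrt (real q))"

lemma c_pos: "pi / sqrt (real q) > 0"
  using q_ge_5 by simp

definition dirichlet_term :: "nat \<Rightarrow> complex \<Rightarrow> int \<times> int \<Rightarrow> complex" where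
  "dirichlet_term k s z = exp (- s * of_real (ln (abs_norm z))) * cis (hecke_freq k * ln \<bar>val q z / con q z\<bar>)"

definition gamma_factor :: "nat \<Rightarrow> complex \<Rightarrow> complex" where
  "gamma_factor k s = Gamma ((s - \<i> * of_real (hecke_freq k)) / 2) * Gamma ((s + \<i> * of_real (hecke_freq k)) / 2) * exp (- s * of_real log_cond)"

lemma bessel_mellin:
  assumes z: "z \<noteq> 0" and s: "Re s > 0"
  shows "integrable lborel (\<lambda>v. bessel k z v * exp (s * of_real v))"
    "(\<integral>v. bessel k z v * exp (s * of_real v) \<partial>lborel) = gamma_factor k s / 2 * dirichlet_term k s z"
proof -
  \<comment> \<open>The exponents are chosen so that \<open>a + b = s\<close> and
    \<open>a - b = - i * hecke_freq k\<close>.\<close>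
  define a b where "a = (s - \<i> * of_real (hecke_freq k)) / 2" and "b = (s + \<i> * of_real (hecke_freq k)) / 2"
  define c where "c = pi / sqrt (real q)"
  define p r where "p = c * (val q z)\<^sup>2" and "r = c * (con q z)\<^sup>2"
  have c: "c > 0" unfolding c_def by (rule c_pos)
  have vc: "val q z \<noteq> 0" "con q z \<noteq> 0" using z by (simp_all add: val_eq_0_iff con_eq_0_iff)
  have pr: "p > 0" "r > 0" using c vc by (simp_all add: p_def r_def)
  have ab: "Re a > 0" "Re b > 0" using s by (simp_all add: a_def b_def)
  define f h where "f = (\<lambda>x::real. exp (a * of_real x - of_real (p * exp x)))" and "h = (\<lambda>x::real. exp (b * of_real x - of_real (r * exp x)))"
  have eq: "f (v + w) * h (v - w) = of_real (qexp z v w) * cis (- hecke_freq k * w) * exp (s * of_real v)" for v w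
  proof -
    have "a * of_real (v + w) + b * of_real (v - w) = s * of_real v + \<i> * of_real (- hecke_freq k * w)"
      by (simp add: a_def b_def field_simps)
    moreover have "- of_real (p * exp (v + w)) - of_real (r * exp (v - w)) = complex_of_real (- (pi / sqrt (real q)) * ((val q z)\<^sup>2 * exp (v + w) + (con q z)\<^sup>2 * exp (v - w)))"
      by (simp add: p_def r_def c_def algebra_simps)
    ultimately have "(a * of_real (v + w) - of_real (p * exp (v + w))) + (b * of_real (v - w) - of_real (r * exp (v - w)))
      = of_real (- (pi / sqrt (real q)) * ((val q z)\<^sup>2 * exp (v + w) + (con q z)\<^sup>2 * exp (v - w))) + \<i> * of_real (- hecke_freq k * w) + s * of_real v"
      by (simp add: algebra_simps)
    then show ?thesis unfolding f_def h_def mult_exp_exp qexp_def cis_conv_exp exp_of_real[symmetric] by simp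
  qed
  have inner: "(\<integral>w. f (v + w) * h (v - w) \<partial>lborel) = bessel k z v * exp (s * of_real v)" for v
    unfolding eq bessel_def by (simp only: integral_mult_left_zero)
  have fi: "integrable lborel f" "integral\<^sup>L lborel f = Gamma a * exp (- a * of_real (ln p))"
    unfolding f_def by (rule mellin_exp_scaled[OF ab(1) pr(1)])+
  have hi: "integrable lborel h" "integral\<^sup>L lborel h = Gamma b * exp (- b * of_real (ln r))"
    unfolding h_def by (rule mellin_exp_scaled[OF ab(2) pr(2)])+
  show "integrable lborel (\<lambda>v. bessel k z v * exp (s * of_real v))"
    using half_convolution(1)[OF fi(1) hi(1)] unfolding inner .
  have lnp: "ln p = log_cond + 2 * ln \<bar>val q z\<bar>" "ln r = log_cond + 2 * ln \<bar>con q z\<bar>"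
  proof -
    have L: "ln (c * x\<^sup>2) = ln c + 2 * ln \<bar>x\<bar>" if "x \<noteq> 0" for x :: real
    proof -
      have "ln (c * x\<^sup>2) = ln c + ln (x\<^sup>2)" using c that by (subst ln_mult) auto
      then show ?thesis using that ln_realpow[of "\<bar>x\<bar>" 2] by simp
    qed
    from L[OF vc(1)] L[OF vc(2)] show "ln p = log_cond + 2 * ln \<bar>val q z\<bar>" "ln r = log_cond + 2 * ln \<bar>con q z\<bar>"
      unfolding p_def r_def c_def by simp_all
  qed
  have lnN: "ln (abs_norm z) = ln \<bar>val q z\<bar> + ln \<bar>con q z\<bar>" "ln \<bar>val q z / con q z\<bar> = ln \<bar>val q z\<bar> - ln \<bar>con q z\<bar>"
    using vc by (simp_all add: abs_norm_eq ln_mult ln_div abs_divide)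
  have "- a * of_real (ln p) + - b * of_real (ln r) = - s * of_real log_cond + (- s * of_real (ln (abs_norm z)) + \<i> * of_real (hecke_freq k * ln \<bar>val q z / con q z\<bar>))"
    unfolding lnp lnN a_def b_def by (simp add: field_simps)
  then have "exp (- a * of_real (ln p)) * exp (- b * of_real (ln r)) = exp (- s * of_real log_cond) * dirichlet_term k s z"
    unfolding dirichlet_term_def mult_exp_exp cis_conv_exp by simp
  then have "Gamma a * exp (- a * of_real (ln p)) * (Gamma b * exp (- b * of_real (ln r))) = Gamma a * Gamma b * (exp (- s * of_real log_cond) * dirichlet_term k s z)"
    by (simp add: mult_ac)
  then show "(\<integral>v. bessel k z v * exp (s * of_real v) \<partial>lborel) = gamma_factor k s / 2 * dirichlet_term k s z"
    using half_convolution(2)[OF fi(1) hi(1)] unfolding inner fi(2) hi(2)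
    by (simp add: gamma_factor_def a_def b_def)
qed

lemma norm_dirichlet_term: "z \<noteq> 0 \<Longrightarrow> norm (dirichlet_term k s z) = abs_norm z powr (- Re s)"
  using abs_norm_ge_1[of z] by (simp add: dirichlet_term_def norm_mult powr_def mult.commute)

lemma dirichlet_term_summable: "Re s > 1 \<Longrightarrow> dirichlet_term k s summable_on fdom_pm q u"
proof -
  assume s: "Re s > 1"
  have "(\<lambda>z. norm (dirichlet_term k s z)) summable_on fdom_pm q u"
    using abs_norm_powr_summable[OF s] by (rule summable_on_cong[THEN iffD1, rotated]) (simp add: norm_dirichlet_term fdom_pm_def)
  then show ?thesis by (rule abs_summable_summable)
qed

lemma hecke_freq_0 [simp]: "hecke_freq 0 = 0"
  by (simp add: hecke_freq_def)

text \<open>The case \<open>k = 0\<close> has a positive integrand and serves as the majorant for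
  every \<open>k\<close>.\<close>

lemma norm_bessel_le: "norm (bessel k z v) \<le> Re (bessel 0 z v)"
proof -
  have "norm (bessel k z v) \<le> (\<integral>w. norm (complex_of_real (qexp z v w) * cis (- hecke_freq k * w)) \<partial>lborel)"
    unfolding bessel_def by (rule integral_norm_bound)
  also have "\<dots> = (\<integral>w. qexp z v w \<partial>lborel)"
    using qexp_pos by (intro Bochner_Integration.integral_cong) (auto simp: norm_mult less_imp_le)
  also have "\<dots> = Re (bessel 0 z v)" by (simp add: bessel_def)
  finally show ?thesis .
qed

text \<open>Termwise Mellin transformation. The L1 norms of the terms are bounded by the transforms
  for \<open>k = 0\<close> at the real point \<open>Re s\<close>, and these are constant multiples
  of norm powers summable for \<open>Re s > 1\<close>.\<close>

lemma theta_coeff_mellin: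
  assumes s: "Re s > 1"
  shows "integrable lborel (\<lambda>v. theta_coeff k v * exp (s * of_real v))"
    "(\<integral>v. theta_coeff k v * exp (s * of_real v) \<partial>lborel) = gamma_factor k s / 2 * (\<Sum>\<^sub>\<infinity>z\<in>fdom_pm q u. dirichlet_term k s z)"
proof -
  define \<sigma> where "\<sigma> = Re s"
  let ?f = "\<lambda>z v. bessel k z v * exp (s * of_real v)"
  have nz: "z \<noteq> 0" if "z \<in> fdom_pm q u" for z using that by (simp add: fdom_pm_def)
  have int: "integrable lborel (?f z)" if "z \<in> fdom_pm q u" for z
    using nz[OF that] s by (intro bessel_mellin(1)) auto
  have "(\<lambda>z. norm (gamma_factor 0 \<sigma> / 2) * abs_norm z powr (- \<sigma>)) summable_on fdom_pm q u"
    using s by (intro summable_on_cmult_right abs_norm_powr_summable) (simp add: \<sigma>_def)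
  then have sm: "(\<lambda>z. \<integral>v. norm (?f z v) \<partial>lborel) summable_on fdom_pm q u"
  proof (rule summable_on_comparison_test)
    fix z assume z: "z \<in> fdom_pm q u"
    have z0: "z \<noteq> 0" by (rule nz[OF z])
    have s0: "Re (complex_of_real \<sigma>) > 0" using s by (simp add: \<sigma>_def)
    note B = bessel_mellin[OF z0 s0, of 0]
    have e: "exp (complex_of_real \<sigma> * complex_of_real v) = of_real (exp (\<sigma> * v))" for v
      unfolding of_real_mult[symmetric] exp_of_real ..
    have "(\<integral>v. norm (?f z v) \<partial>lborel) \<le> (\<integral>v. Re (bessel 0 z v * exp (of_real \<sigma> * of_real v)) \<partial>lborel)"
    proof (rule integral_mono)
      show "integrable lborel (\<lambda>v. norm (?f z v))" by (rule integrable_norm[OF int[OF z]])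
      show "integrable lborel (\<lambda>v. Re (bessel 0 z v * exp (of_real \<sigma> * of_real v)))" by (rule integrable_Re[OF B(1)])
      show "norm (?f z v) \<le> Re (bessel 0 z v * exp (of_real \<sigma> * of_real v))" for v
        using mult_right_mono[OF norm_bessel_le[of k z v], of "exp (\<sigma> * v)"]
        unfolding e by (simp add: norm_mult \<sigma>_def)
    qed
    also have "\<dots> = Re (\<integral>v. bessel 0 z v * exp (of_real \<sigma> * of_real v) \<partial>lborel)" by (rule integral_Re[OF B(1)])
    also have "\<dots> = Re (gamma_factor 0 \<sigma> / 2 * dirichlet_term 0 \<sigma> z)" by (simp only: B(2))
    also have "\<dots> \<le> norm (gamma_factor 0 \<sigma> / 2 * dirichlet_term 0 \<sigma> z)" by (rule complex_Re_le_cmod)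
    also have "\<dots> = norm (gamma_factor 0 \<sigma> / 2) * abs_norm z powr (- \<sigma>)" by (simp only: norm_mult norm_dirichlet_term[OF z0] Re_complex_of_real)
    finally show "(\<integral>v. norm (?f z v) \<partial>lborel) \<le> norm (gamma_factor 0 \<sigma> / 2) * abs_norm z powr (- \<sigma>)" .
  qed simp
  have ptw: "((\<lambda>z. ?f z v) has_sum theta_coeff k v * exp (s * of_real v)) (fdom_pm q u)" for v
    by (intro has_sum_cmult_left theta_coeff_has_sum)
  have cn: "countable (fdom_pm q u)" by simp
  show "integrable lborel (\<lambda>v. theta_coeff k v * exp (s * of_real v))"
    by (rule integral_has_sum(1)[OF cn int sm ptw])
  have "((\<lambda>z. \<integral>v. ?f z v \<partial>lborel) has_sum (\<integral>v. theta_coeff k v * exp (s * of_real v) \<partial>lborel)) (fdom_pm q u)"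
    by (rule integral_has_sum(2)[OF cn int sm ptw])
  moreover have "((\<lambda>z. \<integral>v. ?f z v \<partial>lborel) has_sum (gamma_factor k s / 2 * (\<Sum>\<^sub>\<infinity>z\<in>fdom_pm q u. dirichlet_term k s z))) (fdom_pm q u)"
  proof -
    have "((\<lambda>z. gamma_factor k s / 2 * dirichlet_term k s z) has_sum (gamma_factor k s / 2 * (\<Sum>\<^sub>\<infinity>z\<in>fdom_pm q u. dirichlet_term k s z))) (fdom_pm q u)"
      by (intro has_sum_cmult_right has_sum_infsum dirichlet_term_summable s)
    then show ?thesis
      by (rule has_sum_cong[THEN iffD1, rotated]) (use nz s bessel_mellin(2) in auto)
  qed
  ultimately show "(\<integral>v. theta_coeff k v * exp (s * of_real v) \<partial>lborel) = gamma_factor k s / 2 * (\<Sum>\<^sub>\<infinity>z\<in>fdom_pm q u. dirichlet_term k s z)"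
    by (rule has_sum_unique)
qed

text \<open>Measurability is inherited from the integrable Mellin integrand at \<open>s = 2\<close>
  after multiplication by \<open>exp (- 2 v)\<close>.\<close>

lemma theta_coeff_measurable [measurable]: "theta_coeff k \<in> borel_measurable borel"
proof -
  have "(\<lambda>v. theta_coeff k v * exp (2 * of_real v)) \<in> borel_measurable lborel"
    using theta_coeff_mellin(1)[of 2 k] by auto
  then have [measurable]: "(\<lambda>v. theta_coeff k v * exp (2 * of_real v)) \<in> borel_measurable borel" by simp
  have [measurable]: "(\<lambda>v::real. exp (- (2 * complex_of_real v))) \<in> borel_measurable borel"
    by (intro borel_measurable_continuous_onI continuous_intros)
  have "(\<lambda>v. (theta_coeff k v * exp (2 * of_real v)) * exp (- (2 * complex_of_real v))) \<in> borel_measurable borel"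
    by measurable
  moreover have "(theta_coeff k v * exp (2 * of_real v)) * exp (- (2 * complex_of_real v)) = theta_coeff k v" for v
    by (simp add: mult.assoc mult_exp_exp)
  ultimately show ?thesis by simp
qed

text \<open>The reflection \<open>v \<mapsto> - v\<close> of the theta function turns the other half of the Mellin integral into \<open>half_lambda k (1 - s)\<close>.\<close>

definition half_lambda :: "nat \<Rightarrow> complex \<Rightarrow> complex" where
  "half_lambda k s = (\<integral>v. (indicator {0..} v *\<^sub>R theta_coeff k v) * exp (s * of_real v) \<partial>lborel)"

text \<open>On the half line \<open>v >= 0\<close> an arbitrary exponential weight is dominated by
  the Mellin integrand at the real point \<open>max R 2\<close>, inside the region of absolute
  convergence.\<close>

lemma half_lambda_integrable: "integrable lborel (\<lambda>v. norm (indicator {0..} v *\<^sub>R theta_coeff k v) * exp (R * \<bar>v\<bar>))"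
proof -
  define \<sigma> where "\<sigma> = max R 2"
  have "Re (complex_of_real \<sigma>) > 1" by (simp add: \<sigma>_def)
  from theta_coeff_mellin(1)[OF this, of k]
  have "integrable lborel (\<lambda>v. theta_coeff k v * exp (of_real \<sigma> * of_real v))" .
  then show ?thesis
  proof (rule Bochner_Integration.integrable_bound)
    show "(\<lambda>v. norm (indicator {0..} v *\<^sub>R theta_coeff k v) * exp (R * \<bar>v\<bar>)) \<in> borel_measurable lborel"
      by measurable
    show "AE v in lborel. norm (norm (indicator {0..} v *\<^sub>R theta_coeff k v) * exp (R * \<bar>v\<bar>)) \<le> norm (theta_coeff k v * exp (of_real \<sigma> * of_real v))"
    proof (rule AE_I2)
      fix v :: real
      show "norm (norm (indicator {0..} v *\<^sub>R theta_coeff k v) * exp (R * \<bar>v\<bar>)) \<le> norm (theta_coeff k v * exp (of_real \<sigma> * of_real v))"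
      proof (cases "v \<ge> 0")
        case True
        then have "R * v \<le> \<sigma> * v" unfolding \<sigma>_def by (intro mult_right_mono) auto
        then show ?thesis using True by (auto simp: norm_mult intro!: mult_left_mono)
      qed simp
    qed
  qed
qed

lemma half_lambda_holomorphic: "half_lambda k holomorphic_on UNIV"
  unfolding half_lambda_def by (rule integral_exp_entire[OF _ _ half_lambda_integrable]) measurable

lemma half_lambda_bound: "\<exists>C. \<forall>s. Re s \<le> R \<longrightarrow> norm (half_lambda k s) \<le> C"
proof (intro exI allI impI)
  fix s :: complex assume s: "Re s \<le> R"
  have "norm (half_lambda k s) \<le> (\<integral>v. norm ((indicator {0..} v *\<^sub>R theta_coeff k v) * exp (s * of_real v)) \<partial>lborel)"
    unfolding half_lambda_def by (rule integral_norm_bound)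
  also have "\<dots> \<le> (\<integral>v. norm (indicator {0..} v *\<^sub>R theta_coeff k v) * exp (R * \<bar>v\<bar>) \<partial>lborel)"
  proof (rule integral_mono')
    show "integrable lborel (\<lambda>v. norm (indicator {0..} v *\<^sub>R theta_coeff k v) * exp (R * \<bar>v\<bar>))" by (rule half_lambda_integrable)
    fix v :: real
    show "norm ((indicator {0..} v *\<^sub>R theta_coeff k v) * exp (s * of_real v)) \<le> norm (indicator {0..} v *\<^sub>R theta_coeff k v) * exp (R * \<bar>v\<bar>)"
    proof (cases "v \<ge> 0")
      case True
      then have "Re s * v \<le> R * v" using s by (intro mult_right_mono)
      then show ?thesis using True by (auto simp: norm_mult intro!: mult_left_mono)
    qed simp
  qed auto
  finally show "norm (half_lambda k s) \<le> (\<integral>v. norm (indicator {0..} v *\<^sub>R theta_coeff k v) * exp (R * \<bar>v\<bar>) \<partial>lborel)" .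
qed

lemma theta_coeff_mellin_split:
  assumes s: "Re s > 1" and k: "k > 0"
  shows "(\<integral>v. theta_coeff k v * exp (s * of_real v) \<partial>lborel) = half_lambda k s + half_lambda k (1 - s)"
proof -
  let ?g = "\<lambda>v. theta_coeff k v * exp (s * of_real v)"
  have g: "integrable lborel ?g" by (rule theta_coeff_mellin(1)[OF s])
  have i1: "integrable lborel (\<lambda>v. indicator {0..} v *\<^sub>R ?g v)" and i2: "integrable lborel (\<lambda>v. indicator {..<0} v *\<^sub>R ?g v)"
    by (intro integrable_mult_indicator g; simp)+
  have "(\<integral>v. ?g v \<partial>lborel) = (\<integral>v. indicator {0..} v *\<^sub>R ?g v + indicator {..<0} v *\<^sub>R ?g v \<partial>lborel)"
    by (intro Bochner_Integration.integral_cong) (auto simp: indicator_def)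
  also have "\<dots> = (\<integral>v. indicator {0..} v *\<^sub>R ?g v \<partial>lborel) + (\<integral>v. indicator {..<0} v *\<^sub>R ?g v \<partial>lborel)"
    by (rule Bochner_Integration.integral_add[OF i1 i2])
  also have "(\<integral>v. indicator {0..} v *\<^sub>R ?g v \<partial>lborel) = half_lambda k s" by (simp add: half_lambda_def)
  also have "(\<integral>v. indicator {..<0} v *\<^sub>R ?g v \<partial>lborel) = \<bar>-1\<bar> *\<^sub>R (\<integral>v. indicator {..<0} (0 + (-1) * v) *\<^sub>R ?g (0 + (-1) * v) \<partial>lborel)"
    by (intro lborel_integral_real_affine) auto
  also have "\<dots> = (\<integral>v. indicator {..<0} (0 + (-1) * v) *\<^sub>R ?g (0 + (-1) * v) \<partial>lborel)" by simp
  also have "\<dots> = (\<integral>v. (indicator {0..} v *\<^sub>R theta_coeff k v) * exp ((1 - s) * of_real v) \<partial>lborel)"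
  proof (rule integral_cong_AE)
    have [measurable]: "(\<lambda>v::real. exp (c * complex_of_real v)) \<in> borel_measurable borel" for c
      by (intro borel_measurable_continuous_onI continuous_intros)
    show "(\<lambda>v. indicator {..<0} (0 + (-1) * v) *\<^sub>R ?g (0 + (-1) * v)) \<in> borel_measurable lborel"
      by measurable
    show "(\<lambda>v. (indicator {0..} v *\<^sub>R theta_coeff k v) * exp ((1 - s) * of_real v)) \<in> borel_measurable lborel"
      by measurable
    show "AE v in lborel. indicator {..<0} (0 + (-1) * v) *\<^sub>R ?g (0 + (-1) * v) = (indicator {0..} v *\<^sub>R theta_coeff k v) * exp ((1 - s) * of_real v)"
      using AE_lborel_singleton[of 0]
    proof eventually_elim
      case (elim v)
      have "theta_coeff k (- v) * exp (s * of_real (- v)) = theta_coeff k v * exp ((1 - s) * of_real v)"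
        unfolding theta_coeff_reflect[OF k] exp_of_real[symmetric] by (simp add: mult_ac mult_exp_exp algebra_simps)
      then show ?case using elim by (auto simp: indicator_def)
    qed
  qed
  finally show ?thesis by (simp add: half_lambda_def)
qed

text \<open>The completed function, visibly symmetric under \<open>s\<close> to
  \<open>1 - s\<close>, with its gamma factor removed by \<open>rGamma\<close>, so that the product
  is entire. No constant remains: the Mellin transform carries \<open>1 / 2\<close> and
  \<open>fdom_pm\<close> counts every ideal twice.\<close>

definition hecke_ext :: "nat \<Rightarrow> complex \<Rightarrow> complex" where
  "hecke_ext k s = (half_lambda k s + half_lambda k (1 - s)) * exp (s * of_real log_cond) *
     (rGamma ((s - \<i> * of_real (hecke_freq k)) / 2) * rGamma ((s + \<i> * of_real (hecke_freq k)) / 2))"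

lemma hecke_ext_holomorphic: "hecke_ext k holomorphic_on UNIV"
proof -
  have "(\<lambda>s::complex. 1 - s) holomorphic_on UNIV" by (intro holomorphic_intros)
  from holomorphic_on_compose[OF this holomorphic_on_subset[OF half_lambda_holomorphic]]
  have "(\<lambda>s. half_lambda k (1 - s)) holomorphic_on UNIV" by (simp add: o_def)
  then show ?thesis unfolding hecke_ext_def
    by (intro holomorphic_intros half_lambda_holomorphic) auto
qed

lemma hecke_ext_eq_sum:
  assumes s: "Re s > 1" and k: "k > 0"
  shows "hecke_ext k s = (\<Sum>\<^sub>\<infinity>z\<in>fdom_pm q u. dirichlet_term k s z) / 2"
proof -
  have pos: "Gamma z * rGamma z = 1" if "Re z > 0" for z :: complex
  proof -
    have "z \<notin> \<int>\<^sub>\<le>\<^sub>0" using that by (auto elim!: nonpos_Ints_cases)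
    then show ?thesis by (simp add: Gamma_def rGamma_eq_zero_iff)
  qed
  let ?a = "(s - \<i> * of_real (hecke_freq k)) / 2" and ?b = "(s + \<i> * of_real (hecke_freq k)) / 2" and ?S = "\<Sum>\<^sub>\<infinity>z\<in>fdom_pm q u. dirichlet_term k s z"
  have "hecke_ext k s = (Gamma ?a * rGamma ?a) * (Gamma ?b * rGamma ?b) * (exp (- s * of_real log_cond) * exp (s * of_real log_cond)) * (?S / 2)"
    unfolding hecke_ext_def theta_coeff_mellin_split[OF assms, symmetric] theta_coeff_mellin(2)[OF s] gamma_factor_def
    by (simp add: mult_ac)
  also have "exp (- s * of_real log_cond) * exp (s * of_real log_cond) = 1" by (simp add: mult_exp_exp)
  finally show ?thesis using pos[of ?a] pos[of ?b] s by simp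
qed

text \<open>If \<open>\<chi>\<close> is the quotient in the functional equation \<open>L(s) = \<chi>(s) L(1 - s)\<close>, then \<open>chi_quad = shift_quad * \<chi>\<close>.
  The quadratic factor removes the poles of \<open>\<chi>\<close> on the line \<open>Re s = 1\<close>, which the strip below crosses.\<close>

definition shift_quad :: "nat \<Rightarrow> complex \<Rightarrow> complex" where
  "shift_quad k s = (s - 1)\<^sup>2 + (of_real (hecke_freq k))\<^sup>2"

definition chi_quad :: "nat \<Rightarrow> complex \<Rightarrow> complex" where
  "chi_quad k s = 4 * exp ((2 * s - 1) * of_real log_cond) *
     (Gamma ((3 - s + \<i> * of_real (hecke_freq k)) / 2) * Gamma ((3 - s - \<i> * of_real (hecke_freq k)) / 2)) *
     (rGamma ((s - \<i> * of_real (hecke_freq k)) / 2) * rGamma ((s + \<i> * of_real (hecke_freq k)) / 2))"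

lemma shift_quad_eq: "shift_quad k s = (s - 1 + \<i> * of_real (hecke_freq k)) * (s - 1 - \<i> * of_real (hecke_freq k))"
  by (simp add: shift_quad_def power2_eq_square algebra_simps)

text \<open>The symmetric bracket cancels, leaving gamma factors. Each \<open>Gamma\<close> in
  \<open>chi_quad\<close> sits one step to the right of the \<open>rGamma\<close> coming from
  \<open>1 - s\<close>, so each pair leaves half of one linear factor of \<open>shift_quad\<close>;
  the constant \<open>4\<close> clears the halves.\<close>

lemma hecke_ext_functional:
  assumes s: "Re s < 3"
  shows "shift_quad k s * hecke_ext k s = chi_quad k s * hecke_ext k (1 - s)"
proof -
  define i\<kappa> where "i\<kappa> = \<i> * complex_of_real (hecke_freq k)"
  have 1: "Gamma ((3 - s + i\<kappa>) / 2) * rGamma ((1 - s + i\<kappa>) / 2) = (1 - s + i\<kappa>) / 2"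
    using Gamma_plus1_rGamma[of "(1 - s + i\<kappa>) / 2"] s by (simp add: i\<kappa>_def field_simps)
  have 2: "Gamma ((3 - s - i\<kappa>) / 2) * rGamma ((1 - s - i\<kappa>) / 2) = (1 - s - i\<kappa>) / 2"
    using Gamma_plus1_rGamma[of "(1 - s - i\<kappa>) / 2"] s by (simp add: i\<kappa>_def field_simps)
  have e: "exp ((2 * s - 1) * of_real log_cond) * exp ((1 - s) * of_real log_cond) = exp (s * of_real log_cond)"
    unfolding mult_exp_exp by (simp add: algebra_simps)
  have LL1: "hecke_ext k (1 - s) = (half_lambda k s + half_lambda k (1 - s)) * exp ((1 - s) * of_real log_cond) *
     (rGamma ((1 - s - i\<kappa>) / 2) * rGamma ((1 - s + i\<kappa>) / 2))"
    by (simp add: hecke_ext_def i\<kappa>_def add.commute)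
  have "chi_quad k s * hecke_ext k (1 - s) = 4 * (exp ((2 * s - 1) * of_real log_cond) * exp ((1 - s) * of_real log_cond)) *
     ((Gamma ((3 - s + i\<kappa>) / 2) * rGamma ((1 - s + i\<kappa>) / 2)) * (Gamma ((3 - s - i\<kappa>) / 2) * rGamma ((1 - s - i\<kappa>) / 2))) *
     (half_lambda k s + half_lambda k (1 - s)) * (rGamma ((s - i\<kappa>) / 2) * rGamma ((s + i\<kappa>) / 2))"
    unfolding chi_quad_def LL1 i\<kappa>_def by (simp only: mult_ac)
  also have "\<dots> = ((1 - s + i\<kappa>) * (1 - s - i\<kappa>)) * hecke_ext k s"
    unfolding 1 2 e by (simp add: hecke_ext_def i\<kappa>_def[symmetric] mult_ac)
  also have "(1 - s + i\<kappa>) * (1 - s - i\<kappa>) = shift_quad k s"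
    by (simp add: shift_quad_eq i\<kappa>_def algebra_simps)
  finally show ?thesis ..
qed

lemma norm_exp_log_cond: "norm (exp ((2 * s - 1) * of_real log_cond)) = (pi / sqrt (real q)) powr (2 * Re s - 1)"
  using q_ge_5 by (simp add: powr_def)

lemma Gamma_cnj_rGamma:
  fixes z :: complex
  assumes "Re z > 0"
  shows "norm (Gamma z) * norm (rGamma (cnj z)) = 1"
proof -
  have "z \<notin> \<int>\<^sub>\<le>\<^sub>0" using assms by (auto elim!: nonpos_Ints_cases)
  then have "norm (Gamma z * rGamma z) = 1" by (simp add: Gamma_def rGamma_eq_zero_iff)
  moreover have "norm (rGamma (cnj z)) = norm (rGamma z)" by (metis cnj_rGamma complex_mod_cnj)
  ultimately show ?thesis by (simp add: norm_mult)
qed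

text \<open>Each \<open>Gamma\<close> is paired with an \<open>rGamma\<close> whose argument is its
  complex conjugate up to an integer shift, so moduli reduce to polynomials. The shift is one here;
  on the lines \<open>3 / 2\<close> and \<open>- (1 / 2)\<close> below it is zero and two.\<close>

lemma norm_chi_quad_half:
  assumes s: "Re s = 1 / 2"
  shows "norm (chi_quad k s) = norm (shift_quad k s)"
proof -
  define i\<kappa> where "i\<kappa> = \<i> * complex_of_real (hecke_freq k)"
  have cs: "cnj s = 1 - s" using s by (simp add: complex_eq_iff)
  have A: "norm (Gamma ((3 - s + i\<kappa>) / 2)) * norm (rGamma ((s - i\<kappa>) / 2)) = norm (s - 1 - i\<kappa>) / 2"
  proof -
    have c: "cnj ((s - i\<kappa>) / 2) = (1 - s + i\<kappa>) / 2" by (simp add: cs i\<kappa>_def)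
    have "norm (rGamma ((s - i\<kappa>) / 2)) = norm (rGamma ((1 - s + i\<kappa>) / 2))" unfolding c[symmetric] by (metis cnj_rGamma complex_mod_cnj)
    moreover have "Gamma ((3 - s + i\<kappa>) / 2) * rGamma ((1 - s + i\<kappa>) / 2) = (1 - s + i\<kappa>) / 2"
      using Gamma_plus1_rGamma[of "(1 - s + i\<kappa>) / 2"] s by (simp add: i\<kappa>_def field_simps)
    moreover have "norm (1 - s + i\<kappa>) = norm (s - 1 - i\<kappa>)" using norm_minus_commute[of "1 + i\<kappa>" s] by (simp add: algebra_simps)
    ultimately show ?thesis by (metis norm_divide norm_mult norm_numeral)
  qed
  have B: "norm (Gamma ((3 - s - i\<kappa>) / 2)) * norm (rGamma ((s + i\<kappa>) / 2)) = norm (s - 1 + i\<kappa>) / 2"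
  proof -
    have c: "cnj ((s + i\<kappa>) / 2) = (1 - s - i\<kappa>) / 2" by (simp add: cs i\<kappa>_def)
    have "norm (rGamma ((s + i\<kappa>) / 2)) = norm (rGamma ((1 - s - i\<kappa>) / 2))" unfolding c[symmetric] by (metis cnj_rGamma complex_mod_cnj)
    moreover have "Gamma ((3 - s - i\<kappa>) / 2) * rGamma ((1 - s - i\<kappa>) / 2) = (1 - s - i\<kappa>) / 2"
      using Gamma_plus1_rGamma[of "(1 - s - i\<kappa>) / 2"] s by (simp add: i\<kappa>_def field_simps)
    moreover have "norm (1 - s - i\<kappa>) = norm (s - 1 + i\<kappa>)" using norm_minus_commute[of "1 - i\<kappa>" s] by (simp add: algebra_simps)
    ultimately show ?thesis by (metis norm_divide norm_mult norm_numeral)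
  qed
  have "norm (chi_quad k s) = 4 * norm (exp ((2 * s - 1) * of_real log_cond)) * ((norm (Gamma ((3 - s + i\<kappa>) / 2)) * norm (rGamma ((s - i\<kappa>) / 2))) * (norm (Gamma ((3 - s - i\<kappa>) / 2)) * norm (rGamma ((s + i\<kappa>) / 2))))"
    unfolding chi_quad_def i\<kappa>_def by (simp only: norm_mult norm_numeral mult_ac)
  also have "\<dots> = norm (shift_quad k s)"
    unfolding A B norm_exp_log_cond s shift_quad_eq i\<kappa>_def[symmetric] using q_ge_5 by (simp add: norm_mult)
  finally show ?thesis .
qed

lemma norm_chi_quad_three_halves:
  assumes s: "Re s = 3 / 2"
  shows "norm (chi_quad k s) = 4 * pi\<^sup>2 / real q"
proof -
  define i\<kappa> where "i\<kappa> = \<i> * complex_of_real (hecke_freq k)"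
  have cs: "cnj s = 3 - s" using s by (simp add: complex_eq_iff)
  have c: "cnj ((3 - s + i\<kappa>) / 2) = (s - i\<kappa>) / 2" "cnj ((3 - s - i\<kappa>) / 2) = (s + i\<kappa>) / 2"
    by (simp_all add: cs i\<kappa>_def)
  have re: "Re ((3 - s + i\<kappa>) / 2) > 0" "Re ((3 - s - i\<kappa>) / 2) > 0" using s by (simp_all add: i\<kappa>_def)
  have A: "norm (Gamma ((3 - s + i\<kappa>) / 2)) * norm (rGamma ((s - i\<kappa>) / 2)) = 1"
    "norm (Gamma ((3 - s - i\<kappa>) / 2)) * norm (rGamma ((s + i\<kappa>) / 2)) = 1"
    using Gamma_cnj_rGamma[OF re(1)] Gamma_cnj_rGamma[OF re(2)] unfolding c by simp_all
  have "norm (chi_quad k s) = 4 * norm (exp ((2 * s - 1) * of_real log_cond)) * ((norm (Gamma ((3 - s + i\<kappa>) / 2)) * norm (rGamma ((s - i\<kappa>) / 2))) * (norm (Gamma ((3 - s - i\<kappa>) / 2)) * norm (rGamma ((s + i\<kappa>) / 2))))"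
    unfolding chi_quad_def i\<kappa>_def by (simp only: norm_mult norm_numeral mult_ac)
  also have "\<dots> = 4 * pi\<^sup>2 / real q"
    unfolding A norm_exp_log_cond s using c_pos powr_numeral[of "pi / sqrt (real q)" "num.Bit0 num.One"] by (simp add: power_divide)
  finally show ?thesis .
qed

lemma norm_chi_quad_minus_half:
  assumes s: "Re s = - (1 / 2)"
  shows "norm (chi_quad k s) = real q / (4 * pi\<^sup>2) * norm (s\<^sup>2 + (of_real (hecke_freq k))\<^sup>2) * norm (shift_quad k s)"
proof -
  define i\<kappa> where "i\<kappa> = \<i> * complex_of_real (hecke_freq k)"
  have cs: "cnj s = - 1 - s" using s by (simp add: complex_eq_iff)
  have A: "norm (Gamma ((3 - s + i\<kappa>) / 2)) * norm (rGamma ((s - i\<kappa>) / 2)) = norm (s - i\<kappa>) * norm (s - 1 - i\<kappa>) / 4"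
  proof -
    have c: "cnj ((s - i\<kappa>) / 2) = (- 1 - s + i\<kappa>) / 2" by (simp add: cs i\<kappa>_def)
    have "norm (rGamma ((s - i\<kappa>) / 2)) = norm (rGamma ((- 1 - s + i\<kappa>) / 2))" unfolding c[symmetric] by (metis cnj_rGamma complex_mod_cnj)
    moreover have "Gamma ((3 - s + i\<kappa>) / 2) * rGamma ((- 1 - s + i\<kappa>) / 2) = (- 1 - s + i\<kappa>) / 2 * ((1 - s + i\<kappa>) / 2)"
      using Gamma_plus2_rGamma[of "(- 1 - s + i\<kappa>) / 2"] s by (simp add: i\<kappa>_def field_simps)
    moreover have "norm ((- 1 - s + i\<kappa>) / 2) = norm (s - i\<kappa>) / 2" unfolding c[symmetric] complex_mod_cnj by (simp add: norm_divide)
    moreover have "norm (1 - s + i\<kappa>) = norm (s - 1 - i\<kappa>)" using norm_minus_commute[of "1 + i\<kappa>" s] by (simp add: algebra_simps)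
    ultimately have "norm (Gamma ((3 - s + i\<kappa>) / 2)) * norm (rGamma ((s - i\<kappa>) / 2)) = norm (s - i\<kappa>) / 2 * (norm (s - 1 - i\<kappa>) / 2)"
      by (metis norm_divide norm_mult norm_numeral)
    then show ?thesis by simp
  qed
  have B: "norm (Gamma ((3 - s - i\<kappa>) / 2)) * norm (rGamma ((s + i\<kappa>) / 2)) = norm (s + i\<kappa>) * norm (s - 1 + i\<kappa>) / 4"
  proof -
    have c: "cnj ((s + i\<kappa>) / 2) = (- 1 - s - i\<kappa>) / 2" by (simp add: cs i\<kappa>_def)
    have "norm (rGamma ((s + i\<kappa>) / 2)) = norm (rGamma ((- 1 - s - i\<kappa>) / 2))" unfolding c[symmetric] by (metis cnj_rGamma complex_mod_cnj)
    moreover have "Gamma ((3 - s - i\<kappa>) / 2) * rGamma ((- 1 - s - i\<kappa>) / 2) = (- 1 - s - i\<kappa>) / 2 * ((1 - s - i\<kappa>) / 2)"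
      using Gamma_plus2_rGamma[of "(- 1 - s - i\<kappa>) / 2"] s by (simp add: i\<kappa>_def field_simps)
    moreover have "norm ((- 1 - s - i\<kappa>) / 2) = norm (s + i\<kappa>) / 2" unfolding c[symmetric] complex_mod_cnj by (simp add: norm_divide)
    moreover have "norm (1 - s - i\<kappa>) = norm (s - 1 + i\<kappa>)" using norm_minus_commute[of "1 - i\<kappa>" s] by (simp add: algebra_simps)
    ultimately have "norm (Gamma ((3 - s - i\<kappa>) / 2)) * norm (rGamma ((s + i\<kappa>) / 2)) = norm (s + i\<kappa>) / 2 * (norm (s - 1 + i\<kappa>) / 2)"
      by (metis norm_divide norm_mult norm_numeral)
    then show ?thesis by simp
  qed
  have sk: "s\<^sup>2 + (of_real (hecke_freq k))\<^sup>2 = (s + i\<kappa>) * (s - i\<kappa>)" by (simp add: i\<kappa>_def power2_eq_square algebra_simps)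
  have pw: "(pi / sqrt (real q)) powr (- 2) = real q / pi\<^sup>2"
    using c_pos powr_numeral[of "pi / sqrt (real q)" "num.Bit0 num.One"] by (simp add: powr_minus power_divide)
  have "norm (chi_quad k s) = 4 * norm (exp ((2 * s - 1) * of_real log_cond)) * ((norm (Gamma ((3 - s + i\<kappa>) / 2)) * norm (rGamma ((s - i\<kappa>) / 2))) * (norm (Gamma ((3 - s - i\<kappa>) / 2)) * norm (rGamma ((s + i\<kappa>) / 2))))"
    unfolding chi_quad_def i\<kappa>_def by (simp only: norm_mult norm_numeral mult_ac)
  also have "\<dots> = 4 * (pi / sqrt (real q)) powr (- 2) * ((norm (s - i\<kappa>) * norm (s - 1 - i\<kappa>) / 4) * (norm (s + i\<kappa>) * norm (s - 1 + i\<kappa>) / 4))"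
    unfolding A B norm_exp_log_cond s by simp
  also have "\<dots> = real q / (4 * pi\<^sup>2) * norm (s\<^sup>2 + (of_real (hecke_freq k))\<^sup>2) * norm (shift_quad k s)"
    unfolding pw sk shift_quad_eq i\<kappa>_def[symmetric] norm_mult by simp
  finally show ?thesis .
qed

end


section \<open>A large sieve for the Hecke characters\<close>

text \<open>The chord has length \<open>2 * sin (pi * |t|)\<close>, and concavity of the sine on a
  quarter period gives Jordan's inequality.\<close>

lemma norm_one_minus_cis_ge:
  assumes "\<bar>t\<bar> \<le> 1 / 2"
  shows "4 * \<bar>t\<bar> \<le> norm (1 - cis (2 * pi * t))"
proof -
  have a: "sin (pi * \<bar>t\<bar>) \<ge> 2 * \<bar>t\<bar>"
  proof (cases "\<bar>t\<bar> = 0")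
    case False
    have "convex_on {0..pi / 2} (\<lambda>x. - sin x)"
      by (rule f''_ge0_imp_convex[where f' = "\<lambda>x. - cos x" and f'' = sin])
        (auto intro!: derivative_eq_intros sin_ge_zero)
    from convex_onD[OF this, of "2 * \<bar>t\<bar>" 0 "pi / 2"] assms
    show ?thesis by (simp add: mult_ac)
  qed simp
  have "(norm (1 - cis (2 * pi * t)))\<^sup>2 = (1 - cos (2 * pi * t))\<^sup>2 + (sin (2 * pi * t))\<^sup>2"
    by (simp add: cmod_power2)
  also have "\<dots> = 1 - 2 * cos (2 * pi * t) + ((cos (2 * pi * t))\<^sup>2 + (sin (2 * pi * t))\<^sup>2)"
    by (simp add: power2_eq_square algebra_simps)
  also have "\<dots> = 2 - 2 * cos (2 * (pi * t))" by (simp add: mult_ac)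
  also have "\<dots> = (2 * sin (pi * t))\<^sup>2" by (simp add: cos_double_sin power2_eq_square)
  also have "\<dots> = (2 * sin (pi * \<bar>t\<bar>))\<^sup>2" by (auto simp: abs_if)
  finally have "norm (1 - cis (2 * pi * t)) = \<bar>2 * sin (pi * \<bar>t\<bar>)\<bar>"
    by (metis norm_ge_zero real_sqrt_abs abs_of_nonneg)
  then show ?thesis using a by linarith
qed

lemma half_power_squared: "((1 / 2 :: real) ^ i)\<^sup>2 = (1 / 4) ^ i"
  by (induction i) (auto simp: power2_eq_square)

text \<open>For the least \<open>i\<close> with \<open>|t| <= 2 ^ i / L\<close> the geometric sum is
  at most \<open>L / 2 ^ i\<close>, either trivially or because \<open>|t|\<close> exceeds half of
  that threshold. Writing the decay as a sum of indicators reduces the large sieve to counting pairs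
  of nearby angles. The index \<open>i = L\<close> always qualifies, so the least one
  exists.\<close>

lemma dirichlet_kernel_bound:
  fixes L :: nat
  assumes L: "L > 0" and t: "\<bar>t\<bar> \<le> 1 / 2"
  shows "(norm (\<Sum>j<L. cis (2 * pi * t) ^ j))\<^sup>2
     \<le> (real L)\<^sup>2 * (\<Sum>i\<le>L. 4 * (1 / 4) ^ i * of_bool (\<bar>t\<bar> \<le> 2 ^ i / real L))"
proof -
  define D where "D = norm (\<Sum>j<L. cis (2 * pi * t) ^ j)"
  have D1: "D \<le> real L"
  proof -
    have "D \<le> (\<Sum>j<L. norm (cis (2 * pi * t) ^ j))" unfolding D_def by (rule norm_sum)
    then show ?thesis by (simp add: norm_power)
  qed
  have D0: "D \<ge> 0" by (simp add: D_def)
  define P where "P = (\<lambda>i. \<bar>t\<bar> \<le> 2 ^ i / real L)"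
  have PL: "P L"
  proof -
    have "real L \<le> 2 ^ L" by (simp add: of_nat_less_two_power less_imp_le)
    then have "1 \<le> 2 ^ L / real L" using L by simp
    then show ?thesis unfolding P_def using t by linarith
  qed
  define i where "i = (LEAST i. P i)"
  have Pi: "P i" unfolding i_def using PL by (rule LeastI)
  have iL: "i \<le> L" unfolding i_def using PL by (rule Least_le)
  have "D\<^sup>2 \<le> (real L)\<^sup>2 * (4 * (1 / 4) ^ i)"
  proof (cases i)
    case 0
    have "D\<^sup>2 \<le> (real L)\<^sup>2" using D1 D0 by (rule power_mono)
    then show ?thesis using zero_le_power2[of "real L"] unfolding 0 power_0 by linarith
  next
    case (Suc i')
    have "\<not> P i'" using Suc not_less_Least[of i' P] unfolding i_def by simp
    then have big: "\<bar>t\<bar> > 2 ^ i' / real L" by (simp add: P_def)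
    have tp: "\<bar>t\<bar> > 0" using big L by (meson divide_nonneg_nonneg le_less_trans of_nat_0_le_iff zero_le_numeral zero_le_power)
    have ge: "4 * \<bar>t\<bar> \<le> norm (1 - cis (2 * pi * t))" by (rule norm_one_minus_cis_ge[OF t])
    then have ne: "cis (2 * pi * t) \<noteq> 1" using tp by auto
    have "D \<le> 2 / norm (1 - cis (2 * pi * t))" unfolding D_def by (rule norm_geometric_cis_le[OF ne])
    also have "\<dots> \<le> 2 / (4 * \<bar>t\<bar>)" using ge tp by (intro divide_left_mono mult_pos_pos) linarith+
    also have "\<dots> \<le> 2 / (4 * (2 ^ i' / real L))"
      using big L tp by (intro divide_left_mono mult_pos_pos) (auto intro: less_imp_le)
    also have "\<dots> = real L * (1 / 2) ^ i" using Suc by (simp add: power_divide)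
    finally have "D\<^sup>2 \<le> (real L * (1 / 2) ^ i)\<^sup>2" using D0 by (rule power_mono)
    also have "\<dots> = (real L)\<^sup>2 * (1 / 4) ^ i" unfolding power_mult_distrib half_power_squared ..
    also have "\<dots> \<le> (real L)\<^sup>2 * (4 * (1 / 4) ^ i)" by (intro mult_left_mono) auto
    finally show ?thesis .
  qed
  also have "4 * (1 / 4 :: real) ^ i \<le> (\<Sum>i\<le>L. 4 * (1 / 4) ^ i * of_bool (P i))"
  proof -
    have "4 * (1 / 4 :: real) ^ i = 4 * (1 / 4) ^ i * of_bool (P i)" using Pi by simp
    also have "\<dots> \<le> (\<Sum>i\<le>L. 4 * (1 / 4) ^ i * of_bool (P i))"
      using iL by (intro member_le_sum) auto
    finally show ?thesis .
  qed
  finally show ?thesis unfolding D_def P_def by (simp add: mult_left_mono)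
qed

text \<open>Averaging the sums over a window of length \<open>N\<close> against a Fejer weight makes all terms nonnegative, so
  that the coefficients may be replaced by their absolute values.\<close>

lemma fejer_large_sieve:
  fixes c :: "'a \<Rightarrow> complex" and \<theta> :: "'a \<Rightarrow> real" and N :: nat
  assumes S: "finite S" and N: "N > 0"
  shows "(\<Sum>k\<in>{1..N}. (norm (\<Sum>a\<in>S. c a * cis (2 * pi * real k * \<theta> a)))\<^sup>2)
    \<le> 1 / real N * (\<Sum>a\<in>S. \<Sum>b\<in>S. norm (c a) * norm (c b) * (norm (\<Sum>j<2 * N. cis (2 * pi * (\<theta> a - \<theta> b)) ^ j))\<^sup>2)"
proof -
  define T where "T = (\<lambda>k::int. \<Sum>a\<in>S. c a * cis (2 * pi * of_int k * \<theta> a))"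
  define F where "F = (\<lambda>k::int. (norm (T k))\<^sup>2)"
  let ?J = "{..<2 * N} \<times> {..<2 * N}"
  have F0: "F k \<ge> 0" for k by (simp add: F_def)
  \<comment> \<open>Every \<open>k\<close> in \<open>{1..N}\<close> is a difference
    \<open>(k + i) - i\<close> of indices below \<open>2 * N\<close> in at least \<open>N\<close>
    ways; as \<open>F\<close> is nonnegative, all remaining pairs may be added.\<close>
  have "real N * (\<Sum>k\<in>{1..N}. F (int k)) = (\<Sum>k\<in>{1..N}. \<Sum>i<N. F (int k))"
    by (simp add: sum_distrib_left)
  also have "\<dots> = (\<Sum>(k, i)\<in>{1..N} \<times> {..<N}. F (int k))" by (rule sum.cartesian_product)
  also have "\<dots> = (\<Sum>p\<in>(\<lambda>(k, i). (k + i, i)) ` ({1..N} \<times> {..<N}). F (int (fst p) - int (snd p)))"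
    by (subst sum.reindex) (auto simp: inj_on_def intro!: sum.cong)
  also have "\<dots> \<le> (\<Sum>p\<in>?J. F (int (fst p) - int (snd p)))"
    by (rule sum_mono2) (auto simp: F0)
  finally have 1: "real N * (\<Sum>k\<in>{1..N}. F (int k)) \<le> (\<Sum>p\<in>?J. F (int (fst p) - int (snd p)))" .
  have Fexp: "complex_of_real (F k) = (\<Sum>a\<in>S. \<Sum>b\<in>S. (c a * cnj (c b)) * cis (2 * pi * of_int k * (\<theta> a - \<theta> b)))" for k
  proof -
    have "complex_of_real (F k) = T k * cnj (T k)" by (simp only: F_def complex_norm_square)
    also have "\<dots> = (\<Sum>a\<in>S. \<Sum>b\<in>S. (c a * cis (2 * pi * of_int k * \<theta> a)) * cnj (c b * cis (2 * pi * of_int k * \<theta> b)))"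
      unfolding T_def cnj_sum sum_product ..
    also have "\<dots> = (\<Sum>a\<in>S. \<Sum>b\<in>S. (c a * cnj (c b)) * (cis (2 * pi * of_int k * \<theta> a) * cis (- (2 * pi * of_int k * \<theta> b))))"
      by (intro sum.cong refl) (simp add: cis_cnj mult_ac)
    also have "\<dots> = (\<Sum>a\<in>S. \<Sum>b\<in>S. (c a * cnj (c b)) * cis (2 * pi * of_int k * (\<theta> a - \<theta> b)))"
      by (simp only: cis_mult) (simp add: right_diff_distrib)
    finally show ?thesis .
  qed
  have ker: "(\<Sum>p\<in>?J. cis (2 * pi * of_int (int (fst p) - int (snd p)) * t)) = of_real ((norm (\<Sum>j<2 * N. cis (2 * pi * t) ^ j))\<^sup>2)" for t
  proof -
    have "(\<Sum>p\<in>?J. cis (2 * pi * of_int (int (fst p) - int (snd p)) * t)) = of_nat (2 * N) * fejer (2 * N) t"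
      using N unfolding fejer_def by (simp add: sum.cartesian_product case_prod_unfold)
    also have "\<dots> = of_real ((norm (\<Sum>j<2 * N. cis (2 * pi * t) ^ j))\<^sup>2)" using N by (simp add: fejer_eq)
    finally show ?thesis .
  qed
  have "complex_of_real (\<Sum>p\<in>?J. F (int (fst p) - int (snd p))) = (\<Sum>p\<in>?J. \<Sum>a\<in>S. \<Sum>b\<in>S. (c a * cnj (c b)) * cis (2 * pi * of_int (int (fst p) - int (snd p)) * (\<theta> a - \<theta> b)))"
    unfolding of_real_sum Fexp ..
  also have "\<dots> = (\<Sum>a\<in>S. \<Sum>p\<in>?J. \<Sum>b\<in>S. (c a * cnj (c b)) * cis (2 * pi * of_int (int (fst p) - int (snd p)) * (\<theta> a - \<theta> b)))"
    by (rule sum.swap)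
  also have "\<dots> = (\<Sum>a\<in>S. \<Sum>b\<in>S. \<Sum>p\<in>?J. (c a * cnj (c b)) * cis (2 * pi * of_int (int (fst p) - int (snd p)) * (\<theta> a - \<theta> b)))"
    by (intro sum.cong refl sum.swap)
  also have "\<dots> = (\<Sum>a\<in>S. \<Sum>b\<in>S. (c a * cnj (c b)) * of_real ((norm (\<Sum>j<2 * N. cis (2 * pi * (\<theta> a - \<theta> b)) ^ j))\<^sup>2))"
    unfolding sum_distrib_left[symmetric] ker ..
  finally have eq: "complex_of_real (\<Sum>p\<in>?J. F (int (fst p) - int (snd p))) = \<dots>" .
  have "(\<Sum>p\<in>?J. F (int (fst p) - int (snd p))) = norm (complex_of_real (\<Sum>p\<in>?J. F (int (fst p) - int (snd p))))"
    unfolding norm_of_real by (rule abs_of_nonneg[symmetric]) (intro sum_nonneg F0)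
  also have "\<dots> \<le> (\<Sum>a\<in>S. \<Sum>b\<in>S. norm (c a) * norm (c b) * (norm (\<Sum>j<2 * N. cis (2 * pi * (\<theta> a - \<theta> b)) ^ j))\<^sup>2)"
    unfolding eq by (intro order_trans[OF norm_sum] sum_mono) (auto simp: norm_mult norm_power intro!: order_trans[OF norm_sum] sum_mono)
  finally have "real N * (\<Sum>k\<in>{1..N}. F (int k)) \<le> \<dots>" using 1 by linarith
  then have "(\<Sum>k\<in>{1..N}. F (int k)) \<le> 1 / real N * (\<Sum>a\<in>S. \<Sum>b\<in>S. norm (c a) * norm (c b) * (norm (\<Sum>j<2 * N. cis (2 * pi * (\<theta> a - \<theta> b)) ^ j))\<^sup>2)"
    using N by (simp add: field_simps)
  then show ?thesis by (simp add: F_def T_def)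
qed

section \<open>Counting integer vectors with small determinant\<close>

lemma card_int_interval_le:
  assumes "a \<le> b"
  shows "real (card {\<lceil>a\<rceil>..\<lfloor>b\<rfloor>}) \<le> b - a + 1"
  using assms by simp linarith

text \<open>The determinant is a multiple of \<open>g = gcd m n\<close>, so it takes at most
  \<open>2 * M / g + 1\<close> values. For a fixed value \<open>x\<close> is determined modulo
  \<open>h = |m| / g\<close>, so the quotient \<open>x div h\<close> separates the solutions, and
  the box limits the quotients.\<close>

lemma card_det_box_aux:
  fixes m n :: int and B M :: real
  assumes m: "m \<noteq> 0" and B: "B \<ge> 0" and M: "M \<ge> 0"
  shows "finite {(x, y). \<bar>of_int x\<bar> \<le> B \<and> \<bar>of_int y\<bar> \<le> B \<and> \<bar>of_int (m * y - n * x)\<bar> \<le> M}" (is "finite ?T")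
    and "real (card {(x, y). \<bar>of_int x\<bar> \<le> B \<and> \<bar>of_int y\<bar> \<le> B \<and> \<bar>of_int (m * y - n * x)\<bar> \<le> M})
      \<le> (2 * M / of_int (gcd m n) + 1) * (2 * B * of_int (gcd m n) / \<bar>of_int m\<bar> + 2)"
proof -
  define g where "g = gcd m n"
  have g: "g > 0" using m by (simp add: g_def)
  obtain m' n' where mn: "m = g * m'" "n = g * n'" unfolding g_def by (meson dvdE gcd_dvd1 gcd_dvd2)
  have cop: "Rings.coprime m' n'"
    using m mn gcd_coprime[of m n m' n'] unfolding g_def by (simp add: mult.commute)
  define h where "h = \<bar>m'\<bar>"
  have h: "h > 0" using m mn by (simp add: h_def)
  have gh: "\<bar>m\<bar> = g * h" using g by (simp add: mn h_def abs_mult)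
  define f where "f = (\<lambda>(x, y). (m' * y - n' * x, x div h))"
  have dt: "m * y - n * x = g * (m' * y - n' * x)" for x y by (simp add: mn algebra_simps)
  have inj: "inj_on f ?T"
  proof (rule inj_onI)
    fix p p' assume eq: "f p = f p'"
    obtain x y x' y' where pp: "p = (x, y)" "p' = (x', y')" by (cases p, cases p') auto
    from eq have e1: "m' * y - n' * x = m' * y' - n' * x'" and e2: "x div h = x' div h" by (auto simp: pp f_def)
    then have "n' * (x - x') = m' * (y - y')" by (simp add: algebra_simps)
    then have "m' dvd n' * (x - x')" by simp
    then have "m' dvd x - x'" using cop by (simp add: coprime_dvd_mult_right_iff)
    then have "h dvd x - x'" by (simp add: h_def)
    then have "x mod h = x' mod h" by (simp add: mod_eq_dvd_iff)
    then have "x = x'" using e2 by (metis mult_div_mod_eq)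
    then have "m' * (y - y') = 0" using e1 by (simp add: algebra_simps)
    then show "p = p'" using \<open>x = x'\<close> h by (auto simp: pp h_def)
  qed
  define X where "X = {\<lceil>- (M / of_int g)\<rceil>..\<lfloor>M / of_int g\<rfloor>}"
  define Y where "Y = {\<lceil>- (B / of_int h) - 1\<rceil>..\<lfloor>B / of_int h\<rfloor>}"
  have sub: "f ` ?T \<subseteq> X \<times> Y"
  proof
    fix s assume "s \<in> f ` ?T"
    then obtain x y where xy: "\<bar>of_int x\<bar> \<le> B" "\<bar>of_int (m * y - n * x)\<bar> \<le> M" "s = (m' * y - n' * x, x div h)"
      by (auto simp: f_def)
    have "real_of_int g * \<bar>of_int (m' * y - n' * x)\<bar> \<le> M" using xy(2) g unfolding dt by (simp add: abs_mult)
    then have "\<bar>real_of_int (m' * y - n' * x)\<bar> \<le> M / of_int g" using g by (simp add: field_simps)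
    then have 1: "m' * y - n' * x \<in> X" unfolding X_def by (auto simp: ceiling_le_iff le_floor_iff abs_le_iff)
    have "real_of_int x / of_int h - 1 < of_int (x div h)" "of_int (x div h) \<le> real_of_int x / of_int h"
    proof -
      have f: "x div h = \<lfloor>real_of_int x / of_int h\<rfloor>" by (rule floor_divide_of_int_eq[symmetric])
      show "real_of_int x / of_int h - 1 < of_int (x div h)" "of_int (x div h) \<le> real_of_int x / of_int h"
        unfolding f by linarith+
    qed
    moreover have "- (B / of_int h) \<le> real_of_int x / of_int h" "real_of_int x / of_int h \<le> B / of_int h"
      using xy(1) h by (auto simp: field_simps abs_le_iff)
    ultimately have "- (B / of_int h) - 1 \<le> of_int (x div h)" "of_int (x div h) \<le> B / of_int h" by linarith+
    then have "x div h \<in> Y" unfolding Y_def atLeastAtMost_iff ceiling_le_iff le_floor_iff by (rule conjI)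
    then show "s \<in> X \<times> Y" using 1 xy(3) by simp
  qed
  have fin: "finite (X \<times> Y)" by (simp add: X_def Y_def)
  have finf: "finite (f ` ?T)" using sub fin by (rule finite_subset)
  then show "finite ?T" using inj by (rule finite_imageD)
  have "card ?T = card (f ` ?T)" using inj by (rule card_image[symmetric])
  also have "\<dots> \<le> card X * card Y" using card_mono[OF fin sub] by (simp add: card_cartesian_product)
  finally have "real (card ?T) \<le> real (card X * card Y)" by (rule of_nat_mono)
  then have "real (card ?T) \<le> real (card X) * real (card Y)" by (simp only: of_nat_mult)
  also have "\<dots> \<le> (M / of_int g - - (M / of_int g) + 1) * (B / of_int h - (- (B / of_int h) - 1) + 1)"
  proof (intro mult_mono)
    show "real (card X) \<le> M / of_int g - - (M / of_int g) + 1" unfolding X_def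
    proof (rule card_int_interval_le)
      have "0 \<le> M / of_int g" using M g by simp
      then show "- (M / of_int g) \<le> M / of_int g" by linarith
    qed
    have "0 \<le> B / of_int h" using B h by simp
    then have "- (B / of_int h) - 1 \<le> B / of_int h" by linarith
    then show "real (card Y) \<le> B / of_int h - (- (B / of_int h) - 1) + 1" unfolding Y_def by (rule card_int_interval_le)
    show "0 \<le> M / of_int g - - (M / of_int g) + 1" using M g by simp
  qed simp
  also have "\<dots> = (2 * M / of_int g + 1) * (2 * B / of_int h + 2)" by simp
  also have "2 * B / of_int h = 2 * B * of_int g / \<bar>of_int m\<bar>"
  proof -
    have "\<bar>real_of_int m\<bar> = of_int g * of_int h" using gh by (metis of_int_abs of_int_mult)
    then show ?thesis using g h by simp
  qed
  finally show "real (card ?T) \<le> (2 * M / of_int (gcd m n) + 1) * (2 * B * of_int (gcd m n) / \<bar>of_int m\<bar> + 2)"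
    unfolding g_def .
qed

text \<open>When the larger coordinate of \<open>(m, n)\<close> is comparable with the side of the
  box, the product bound becomes linear in \<open>M\<close> and the gcd. If the large coordinate is
  \<open>n\<close>, the coordinates are exchanged.\<close>

lemma card_det_box:
  fixes m n :: int and B M :: real
  assumes mn: "of_int (max \<bar>m\<bar> \<bar>n\<bar>) \<ge> \<mu>" "\<mu> > 0" and B: "B \<ge> 0" and M: "M \<ge> 0" and box_ratio: "B \<le> \<rho> * \<mu>"
  shows "finite {(x, y). \<bar>of_int x\<bar> \<le> B \<and> \<bar>of_int y\<bar> \<le> B \<and> \<bar>of_int (m * y - n * x)\<bar> \<le> M}"
    and "real (card {(x, y). \<bar>of_int x\<bar> \<le> B \<and> \<bar>of_int y\<bar> \<le> B \<and> \<bar>of_int (m * y - n * x)\<bar> \<le> M})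
      \<le> (2 * \<rho> + 2) * (2 * M + of_int (gcd m n))"
proof -
  have main: "finite {(x, y). \<bar>of_int x\<bar> \<le> B \<and> \<bar>of_int y\<bar> \<le> B \<and> \<bar>of_int (m * y - n * x)\<bar> \<le> M} \<and>
    real (card {(x, y). \<bar>of_int x\<bar> \<le> B \<and> \<bar>of_int y\<bar> \<le> B \<and> \<bar>of_int (m * y - n * x)\<bar> \<le> M})
      \<le> (2 * \<rho> + 2) * (2 * M + of_int (gcd m n))" if big: "\<mu> \<le> \<bar>of_int m\<bar>" for m n :: int
  proof -
    have m0: "m \<noteq> 0" using big mn(2) by auto
    define g where "g = real_of_int (gcd m n)"
    have "gcd m n > 0" using m0 by simp
    then have g: "g \<ge> 1" unfolding g_def by linarith
    have "B / \<bar>of_int m\<bar> \<le> \<rho>"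
    proof -
      have "0 \<le> \<rho> * \<mu>" using B box_ratio by linarith
      then have "\<rho> \<ge> 0" using mn(2) by (simp add: zero_le_mult_iff)
      then have "\<rho> * \<mu> \<le> \<rho> * \<bar>of_int m\<bar>" using big by (intro mult_left_mono)
      then have "B \<le> \<rho> * \<bar>of_int m\<bar>" using box_ratio by linarith
      then show ?thesis using m0 by (simp add: divide_le_eq)
    qed
    then have "2 * B * g / \<bar>of_int m\<bar> \<le> 2 * \<rho> * g" using mult_right_mono[of "B / \<bar>of_int m\<bar>" \<rho> "2 * g"] g by (simp add: mult_ac)
    then have "2 * B * g / \<bar>of_int m\<bar> + 2 \<le> (2 * \<rho> + 2) * g" using g by (simp add: distrib_right)
    then have "(2 * M / g + 1) * (2 * B * g / \<bar>of_int m\<bar> + 2) \<le> (2 * M / g + 1) * ((2 * \<rho> + 2) * g)"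
      using M g by (intro mult_left_mono) auto
    also have "\<dots> = (2 * \<rho> + 2) * (2 * M + g)" using g by (simp add: field_simps)
    finally show ?thesis using card_det_box_aux[OF m0 B M, of n] unfolding g_def by linarith
  qed
  let ?A = "\<lambda>m n. {(x, y). \<bar>of_int x\<bar> \<le> B \<and> \<bar>of_int y\<bar> \<le> B \<and> \<bar>real_of_int (m * y - n * x)\<bar> \<le> M}"
  have "finite (?A m n) \<and> real (card (?A m n)) \<le> (2 * \<rho> + 2) * (2 * M + of_int (gcd m n))"
  proof (cases "\<mu> \<le> \<bar>of_int m\<bar>")
    case True
    then show ?thesis by (rule main)
  next
    case False
    then have "\<mu> \<le> \<bar>of_int n\<bar>" using mn(1) by (auto simp: max_def split: if_splits)
    then have *: "finite (?A n m) \<and> real (card (?A n m)) \<le> (2 * \<rho> + 2) * (2 * M + of_int (gcd n m))" by (rule main)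
    have eq: "\<bar>real_of_int (m * y - n * x)\<bar> = \<bar>real_of_int (n * x - m * y)\<bar>" for x y
      by (simp add: abs_minus_commute)
    have mem: "(x, y) \<in> ?A m n \<longleftrightarrow> (y, x) \<in> ?A n m" for x y
      unfolding mem_Collect_eq prod.case eq by blast
    have bij: "bij_betw prod.swap (?A m n) (?A n m)"
    proof (rule bij_betwI[where g = prod.swap])
      have sw: "prod.swap \<in> ?A m n \<rightarrow> ?A n m" "prod.swap \<in> ?A n m \<rightarrow> ?A m n"
      proof -
        have a: "prod.swap p \<in> ?A n m" if "p \<in> ?A m n" for p
          using that mem[of "fst p" "snd p"] unfolding prod.swap_def prod.collapse by (rule iffD1[rotated])
        have b: "prod.swap p \<in> ?A m n" if "p \<in> ?A n m" for p
          using that mem[of "snd p" "fst p"] unfolding prod.swap_def prod.collapse by (rule iffD2[rotated])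
        show "prod.swap \<in> ?A m n \<rightarrow> ?A n m" by (rule Pi_I) (rule a)
        show "prod.swap \<in> ?A n m \<rightarrow> ?A m n" by (rule Pi_I) (rule b)
      qed
      show "prod.swap \<in> ?A m n \<rightarrow> ?A n m" "prod.swap \<in> ?A n m \<rightarrow> ?A m n" by (rule sw)+
    qed simp_all
    have "card (?A m n) = card (?A n m)" "finite (?A m n) = finite (?A n m)"
      using bij_betw_same_card[OF bij] bij_betw_finite[OF bij] by auto
    then show ?thesis using * by (simp add: gcd.commute)
  qed
  then show "finite (?A m n)" "real (card (?A m n)) \<le> (2 * \<rho> + 2) * (2 * M + of_int (gcd m n))" by auto
qed

lemma finite_int_box: "finite {z::int \<times> int. \<bar>of_int (fst z)\<bar> \<le> B \<and> \<bar>of_int (snd z)\<bar> \<le> (B::real)}"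
proof (rule finite_subset)
  show "{z::int \<times> int. \<bar>of_int (fst z)\<bar> \<le> B \<and> \<bar>of_int (snd z)\<bar> \<le> B} \<subseteq> {- \<lfloor>B\<rfloor>..\<lfloor>B\<rfloor>} \<times> {- \<lfloor>B\<rfloor>..\<lfloor>B\<rfloor>}"
    by (auto simp: mem_Times_iff le_floor_iff abs_le_iff minus_le_iff)
qed auto

lemma card_multiples_box:
  fixes g :: nat and B :: real
  assumes g: "g > 0" and gB: "real g \<le> B"
  shows "real (card {z::int \<times> int. \<bar>of_int (fst z)\<bar> \<le> B \<and> \<bar>of_int (snd z)\<bar> \<le> B \<and> int g dvd fst z \<and> int g dvd snd z}) \<le> (3 * B / real g)\<^sup>2"
proof -
  let ?I = "{\<lceil>- (B / real g)\<rceil>..\<lfloor>B / real g\<rfloor>}"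
  have "{z::int \<times> int. \<bar>of_int (fst z)\<bar> \<le> B \<and> \<bar>of_int (snd z)\<bar> \<le> B \<and> int g dvd fst z \<and> int g dvd snd z}
    \<subseteq> (\<lambda>(a, b). (int g * a, int g * b)) ` (?I \<times> ?I)" (is "?Z \<subseteq> _")
  proof
    fix z assume "z \<in> ?Z"
    then have zB: "\<bar>real_of_int (fst z)\<bar> \<le> B" "\<bar>real_of_int (snd z)\<bar> \<le> B" and dv: "int g dvd fst z" "int g dvd snd z" by auto
    obtain a where a: "fst z = int g * a" using dv(1) by (rule dvdE)
    obtain b where b: "snd z = int g * b" using dv(2) by (rule dvdE)
    note ab = a b
    have "real g * \<bar>real_of_int a\<bar> \<le> B" "real g * \<bar>real_of_int b\<bar> \<le> B" using zB unfolding ab by (simp_all add: abs_mult)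
    then have "\<bar>real_of_int a\<bar> \<le> B / real g" "\<bar>real_of_int b\<bar> \<le> B / real g" using g by (simp_all add: field_simps)
    then have "a \<in> ?I" "b \<in> ?I" by (auto simp: ceiling_le_iff le_floor_iff abs_le_iff)
    then show "z \<in> (\<lambda>(a, b). (int g * a, int g * b)) ` (?I \<times> ?I)"
      by (intro image_eqI[of _ _ "(a, b)"]) (auto simp: ab prod_eq_iff)
  qed
  then have "card ?Z \<le> card (?I \<times> ?I)" by (rule surj_card_le[rotated]) simp
  then have "real (card ?Z) \<le> real (card (?I \<times> ?I))" by (rule of_nat_mono)
  then have "real (card ?Z) \<le> real (card ?I) * real (card ?I)" by (simp only: card_cartesian_product of_nat_mult)
  also have "\<dots> \<le> (3 * B / real g) * (3 * B / real g)"
  proof -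
    have "B / real g \<ge> 1" using g gB by simp
    then have "real (card ?I) \<le> B / real g - - (B / real g) + 1" by (intro card_int_interval_le) linarith
    also have "\<dots> \<le> 3 * B / real g" using \<open>B / real g \<ge> 1\<close> by simp
    finally show ?thesis by (intro mult_mono) auto
  qed
  finally show ?thesis by (simp add: power2_eq_square)
qed

text \<open>The gcd is one of the common divisors, so it is at most the sum of all of them. Points
  divisible by \<open>g\<close> number at most \<open>9 * B^2 / g^2\<close>, and the weight
  \<open>g\<close> leaves a harmonic sum.\<close>

lemma sum_gcd_box:
  fixes B :: real
  assumes B: "B \<ge> 1"
  shows "(\<Sum>z | \<bar>of_int (fst z)\<bar> \<le> B \<and> \<bar>of_int (snd z)\<bar> \<le> B \<and> z \<noteq> (0::int \<times> int). real_of_int (gcd (fst z) (snd z)))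
    \<le> 9 * B\<^sup>2 * (1 + ln B)"
proof -
  define Z where "Z = {z::int \<times> int. \<bar>of_int (fst z)\<bar> \<le> B \<and> \<bar>of_int (snd z)\<bar> \<le> B \<and> z \<noteq> 0}"
  have fin: "finite Z" unfolding Z_def by (rule finite_subset[OF _ finite_int_box[of B]]) auto
  define n where "n = nat \<lfloor>B\<rfloor>"
  have n: "n \<ge> 1" "real n \<le> B" using B unfolding n_def by linarith+
  have le: "real_of_int (gcd (fst z) (snd z)) \<le> (\<Sum>g\<in>{1..n}. real g * of_bool (int g dvd fst z \<and> int g dvd snd z))" if "z \<in> Z" for z
  proof -
    define g where "g = nat (gcd (fst z) (snd z))"
    have "fst z \<noteq> 0 \<or> snd z \<noteq> 0" using that by (auto simp: Z_def prod_eq_iff)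
    then have gp: "gcd (fst z) (snd z) > 0" by auto
    have "gcd (fst z) (snd z) \<le> \<bar>fst z\<bar> \<or> gcd (fst z) (snd z) \<le> \<bar>snd z\<bar>"
      using \<open>fst z \<noteq> 0 \<or> snd z \<noteq> 0\<close> by (metis abs_ge_self dvd_imp_le_int gcd_dvd1 gcd_dvd2 abs_of_pos gp)
    then have "real_of_int (gcd (fst z) (snd z)) \<le> \<bar>real_of_int (fst z)\<bar> \<or> real_of_int (gcd (fst z) (snd z)) \<le> \<bar>real_of_int (snd z)\<bar>"
      unfolding of_int_abs[symmetric] of_int_le_iff .
    then have "real_of_int (gcd (fst z) (snd z)) \<le> B" using that unfolding Z_def by auto
    then have "g \<le> n" unfolding g_def n_def by (intro nat_mono) (simp add: le_floor_iff)
    moreover have "g \<ge> 1" using gp unfolding g_def by linarith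
    ultimately have gI: "g \<in> {1..n}" by simp
    have ig: "int g = gcd (fst z) (snd z)" using gp by (simp add: g_def)
    have "real_of_int (gcd (fst z) (snd z)) = real g * of_bool (int g dvd fst z \<and> int g dvd snd z)"
      unfolding ig using gp by (simp add: g_def)
    also have "\<dots> \<le> (\<Sum>g\<in>{1..n}. real g * of_bool (int g dvd fst z \<and> int g dvd snd z))"
      using gI by (intro member_le_sum) auto
    finally show ?thesis .
  qed
  have "(\<Sum>z\<in>Z. real_of_int (gcd (fst z) (snd z))) \<le> (\<Sum>z\<in>Z. \<Sum>g\<in>{1..n}. real g * of_bool (int g dvd fst z \<and> int g dvd snd z))"
    by (rule sum_mono[OF le])
  also have "\<dots> = (\<Sum>g\<in>{1..n}. \<Sum>z\<in>Z. real g * of_bool (int g dvd fst z \<and> int g dvd snd z))" by (rule sum.swap)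
  also have "\<dots> \<le> (\<Sum>g\<in>{1..n}. real g * (3 * B / real g)\<^sup>2)"
  proof (rule sum_mono)
    fix g assume g: "g \<in> {1..n}"
    have "(\<Sum>z\<in>Z. real g * of_bool (int g dvd fst z \<and> int g dvd snd z)) = real g * real (card (Z \<inter> {z. int g dvd fst z \<and> int g dvd snd z}))"
      using fin by (simp add: sum_distrib_left[symmetric] sum_of_bool_eq)
    also have "card (Z \<inter> {z. int g dvd fst z \<and> int g dvd snd z}) \<le> card {z::int \<times> int. \<bar>of_int (fst z)\<bar> \<le> B \<and> \<bar>of_int (snd z)\<bar> \<le> B \<and> int g dvd fst z \<and> int g dvd snd z}"
      by (rule card_mono) (auto simp: Z_def intro: finite_subset[OF _ finite_int_box[of B]])
    also have "real \<dots> \<le> (3 * B / real g)\<^sup>2" using g n by (intro card_multiples_box) auto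
    finally show "(\<Sum>z\<in>Z. real g * of_bool (int g dvd fst z \<and> int g dvd snd z)) \<le> real g * (3 * B / real g)\<^sup>2"
      by (simp add: mult_left_mono)
  qed
  also have "\<dots> = 9 * B\<^sup>2 * (\<Sum>g\<in>{1..n}. 1 / real g)"
    unfolding sum_distrib_left by (intro sum.cong refl) (simp add: power2_eq_square field_simps)
  also have "(\<Sum>g\<in>{1..n}. 1 / real g) \<le> 1 + ln B"
  proof -
    have "(\<Sum>g\<in>{1..n}. 1 / real g) = harm n" by (simp add: harm_def divide_inverse)
    also have "\<dots> \<le> ln (real n) + 1"
      using decseqD[OF decseq_harm_diff_ln, of 0 "n - 1"] n by (simp add: harm_def)
    also have "ln (real n) \<le> ln B" using n by simp
    finally show ?thesis by simp
  qed
  finally show ?thesis unfolding Z_def by (simp add: mult_left_mono)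
qed


lemma abs_exp_minus_1_le: "\<bar>exp y - 1\<bar> \<le> \<bar>y\<bar> * exp \<bar>y\<bar>" for y :: real
proof (cases "y \<ge> 0")
  case True
  have "1 - exp (- y) \<le> y" using exp_ge_add_one_self[of "- y"] by simp
  then have "(1 - exp (- y)) * exp y \<le> y * exp y" by (intro mult_right_mono) auto
  moreover have "(1 - exp (- y)) * exp y = exp y - 1" by (simp add: left_diff_distrib mult_exp_exp)
  ultimately show ?thesis using True by simp
next
  case False
  then have "1 - exp y \<le> - y" "exp y \<le> 1" using exp_ge_add_one_self[of y] by (linarith, simp)
  moreover have "- y * 1 \<le> - y * exp (- y)" using False by (intro mult_left_mono) auto
  moreover have "\<bar>y\<bar> = - y" "\<bar>exp y - 1\<bar> = 1 - exp y" using False by auto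
  ultimately show ?thesis by simp
qed

section \<open>Dyadic norm blocks and pairs with nearby angles\<close>

context quad_unit
begin

lemma fdom_subset_fdom_pm: "fdom q u \<subseteq> fdom_pm q u"
  by (auto simp: fdom_def fdom_pm_def)

lemma theta_range:
  assumes "z \<in> fdom q u"
  shows "0 \<le> theta q u z" "theta q u z < 1"
proof -
  define r where "r = \<bar>val q z / con q z\<bar>"
  have r: "1 \<le> r" "r < u\<^sup>2" using assms by (auto simp: fdom_def r_def)
  then have "ln r < ln (u\<^sup>2)" "0 \<le> ln r" using ln_less_cancel_iff[of r "u\<^sup>2"] ln_ge_zero[of r] by linarith+
  moreover have "ln (u\<^sup>2) = 2 * log_unit" using u_gt_1 by (simp add: ln_realpow)
  ultimately show "0 \<le> theta q u z" "theta q u z < 1"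
    unfolding theta_def r_def[symmetric] using log_unit_pos by (auto simp: divide_less_eq)
qed

definition norm_block :: "nat \<Rightarrow> (int \<times> int) set" where
  "norm_block j = {z \<in> fdom q u. 2 ^ j \<le> abs_norm z \<and> abs_norm z < 2 ^ Suc j}"

definition box_radius :: "nat \<Rightarrow> real" where
  "box_radius j = sqrt ((u\<^sup>2 + 1) * 2 ^ Suc j)"

lemma box_radius_ge_1: "box_radius j \<ge> 1"
proof -
  have "(1::real) \<le> 2 ^ Suc j" by (rule one_le_power) simp
  then have "1 * 1 \<le> (u\<^sup>2 + 1) * 2 ^ Suc j" by (intro mult_mono) auto
  then show ?thesis unfolding box_radius_def by simp
qed

lemma box_radius_sq: "(box_radius j)\<^sup>2 = (u\<^sup>2 + 1) * 2 ^ Suc j"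
proof -
  have "0 \<le> (u\<^sup>2 + 1) * 2 ^ Suc j" by simp
  then show ?thesis unfolding box_radius_def by (rule real_sqrt_pow2)
qed

lemma norm_block_box:
  assumes "z \<in> norm_block j"
  shows "\<bar>of_int (fst z)\<bar> \<le> box_radius j" "\<bar>of_int (snd z)\<bar> \<le> box_radius j" "z \<noteq> 0"
proof -
  have z: "z \<in> fdom_pm q u" "abs_norm z \<le> 2 ^ Suc j" using assms fdom_subset_fdom_pm by (auto simp: norm_block_def)
  have "(of_int (fst z))\<^sup>2 + (of_int (snd z))\<^sup>2 \<le> (u\<^sup>2 + 1) * abs_norm z" by (rule fdom_pm_bounds(3)[OF z(1)])
  also have "\<dots> \<le> (u\<^sup>2 + 1) * 2 ^ Suc j" using z(2) by (intro mult_left_mono) auto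
  finally have b: "(real_of_int (fst z))\<^sup>2 + (real_of_int (snd z))\<^sup>2 \<le> (u\<^sup>2 + 1) * 2 ^ Suc j" .
  then have "\<bar>real_of_int (fst z)\<bar>\<^sup>2 \<le> (u\<^sup>2 + 1) * 2 ^ Suc j" "\<bar>real_of_int (snd z)\<bar>\<^sup>2 \<le> (u\<^sup>2 + 1) * 2 ^ Suc j"
    using zero_le_power2[of "real_of_int (fst z)"] zero_le_power2[of "real_of_int (snd z)"]
    unfolding power2_abs by linarith+
  from real_le_rsqrt[OF this(1)] real_le_rsqrt[OF this(2)]
  show "\<bar>of_int (fst z)\<bar> \<le> box_radius j" "\<bar>of_int (snd z)\<bar> \<le> box_radius j" unfolding box_radius_def .
  show "z \<noteq> 0" using z(1) by (simp add: fdom_pm_def)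
qed

lemma finite_norm_block: "finite (norm_block j)"
  by (rule finite_subset[OF _ finite_int_box[of "box_radius j"]]) (use norm_block_box in auto)

lemma card_norm_block: "real (card (norm_block j)) \<le> 9 * (box_radius j)\<^sup>2"
proof -
  let ?Z = "{z::int \<times> int. \<bar>of_int (fst z)\<bar> \<le> box_radius j \<and> \<bar>of_int (snd z)\<bar> \<le> box_radius j \<and> int 1 dvd fst z \<and> int 1 dvd snd z}"
  have "finite ?Z" by (rule finite_subset[OF _ finite_int_box[of "box_radius j"]]) auto
  then have "card (norm_block j) \<le> card ?Z" by (rule card_mono) (use norm_block_box in auto)
  then have "real (card (norm_block j)) \<le> real (card ?Z)" by (rule of_nat_mono)
  also have "\<dots> \<le> (3 * box_radius j / real 1)\<^sup>2" by (rule card_multiples_box) (use box_radius_ge_1 in auto)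
  finally show ?thesis by (simp add: power_mult_distrib)
qed

text \<open>The norm form is at most \<open>2 + q\<close> times the square of the larger coordinate,
  so a large norm forces a large coordinate. This provides the \<open>\<mu>\<close> of
  \<open>card_det_box\<close>.\<close>

lemma norm_block_lower:
  assumes "z \<in> norm_block j"
  shows "sqrt (2 ^ j / (2 + real q)) \<le> of_int (max \<bar>fst z\<bar> \<bar>snd z\<bar>)"
proof -
  define M where "M = max \<bar>real_of_int (fst z)\<bar> \<bar>real_of_int (snd z)\<bar>"
  define m n where "m = real_of_int (fst z)" and "n = real_of_int (snd z)"
  have M: "\<bar>m\<bar> \<le> M" "\<bar>n\<bar> \<le> M" "M \<ge> 0" by (auto simp: M_def m_def n_def)
  have p: "\<bar>x * y\<bar> \<le> M * M" if "\<bar>x\<bar> \<le> M" "\<bar>y\<bar> \<le> M" for x y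
    unfolding abs_mult using that M(3) by (intro mult_mono) auto
  have "real_of_int (qnorm q z) = m * m + m * n - real (q div 4) * (n * n)"
    by (simp add: qnorm_def m_def n_def)
  then have "abs_norm z \<le> \<bar>m * m\<bar> + \<bar>m * n\<bar> + \<bar>real (q div 4) * (n * n)\<bar>" by linarith
  also have "\<bar>real (q div 4) * (n * n)\<bar> = real (q div 4) * \<bar>n * n\<bar>" by (simp add: abs_mult)
  also have "real (q div 4) * \<bar>n * n\<bar> \<le> real q * (M * M)"
    using p[OF M(2,2)] by (intro mult_mono) auto
  finally have "abs_norm z \<le> M * M + M * M + real q * (M * M)" using p[OF M(1,1)] p[OF M(1,2)] by linarith
  moreover have "2 ^ j \<le> abs_norm z" using assms by (simp add: norm_block_def)
  ultimately have "2 ^ j \<le> (2 + real q) * (M * M)" by (simp add: algebra_simps)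
  then have "2 ^ j / (2 + real q) \<le> M\<^sup>2" by (simp add: divide_le_eq power2_eq_square mult.commute)
  then have "sqrt (2 ^ j / (2 + real q)) \<le> M" using M(3) by (rule real_le_lsqrt[rotated 1])
  moreover have "M = of_int (max \<bar>fst z\<bar> \<bar>snd z\<bar>)" by (simp add: M_def of_int_max)
  ultimately show ?thesis by simp
qed

text \<open>Two points of a half block with nearby angles are almost proportional, so their determinant, an
  integer, is small; the pairs are then counted by the value of the determinant.\<close>

lemma det_identity:
  "val q a * con q b - con q a * val q b = - sqrt (real q) * of_int (fst a * snd b - snd a * fst b)"
proof -
  have "val q a * con q b - con q a * val q b = (om q - omc q) * (of_int (snd a) * of_int (fst b) - of_int (fst a) * of_int (snd b))"
    by (simp add: val_def con_def algebra_simps)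
  then show ?thesis unfolding om_sq(5) by (simp add: algebra_simps)
qed

text \<open>With \<open>y = 2 * log_unit\<close> times the difference of the angles,
  \<open>exp y\<close> is the quotient of the two ratios; equal signs of the conjugates remove the
  absolute values, so the determinant times \<open>sqrt q\<close> is
  \<open>con q a * val q b * (exp y - 1)\<close> up to sign. The embeddings contribute
  \<open>u * N\<close>, and the other \<open>u\<close> is \<open>exp |y|\<close>, since
  \<open>|y| <= log_unit\<close>.\<close>

lemma det_bound:
  assumes a: "a \<in> fdom q u" and b: "b \<in> fdom q u" and s: "con q a > 0 \<longleftrightarrow> con q b > 0"
    and t: "\<bar>theta q u a - theta q u b\<bar> \<le> 1 / 2"
    and N: "abs_norm a \<le> N" "abs_norm b \<le> N"
  shows "\<bar>real_of_int (fst a * snd b - snd a * fst b)\<bar> \<le> 2 * log_unit * u\<^sup>2 * N * \<bar>theta q u a - theta q u b\<bar>"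
proof -
  have nz: "con q a \<noteq> 0" "con q b \<noteq> 0" "val q a > 0" "val q b > 0" using a b by (auto simp: fdom_def con_eq_0_iff)
  define y where "y = 2 * log_unit * (theta q u a - theta q u b)"
  have N0: "N \<ge> 0" using N(1) by linarith
  have "y = ln \<bar>val q a / con q a\<bar> - ln \<bar>val q b / con q b\<bar>"
    using log_unit_pos by (simp add: y_def theta_def field_simps)
  then have "exp y = \<bar>val q a / con q a\<bar> / \<bar>val q b / con q b\<bar>"
    using nz by (simp add: exp_diff)
  also have "\<dots> = (val q a * con q b) / (con q a * val q b)"
    using nz s by (auto simp: abs_if field_simps not_less order_less_le)
  finally have "val q a * con q b - con q a * val q b = con q a * val q b * (exp y - 1)"
    using nz by (simp add: field_simps)
  then have "\<bar>- sqrt (real q) * of_int (fst a * snd b - snd a * fst b)\<bar> = \<bar>con q a\<bar> * \<bar>val q b\<bar> * \<bar>exp y - 1\<bar>"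
    unfolding det_identity by (simp add: abs_mult)
  then have e: "sqrt (real q) * \<bar>real_of_int (fst a * snd b - snd a * fst b)\<bar> = \<bar>con q a\<bar> * \<bar>val q b\<bar> * \<bar>exp y - 1\<bar>"
    by (simp add: abs_mult)
  have "\<bar>y\<bar> \<le> log_unit"
  proof -
    have "\<bar>y\<bar> = 2 * log_unit * \<bar>theta q u a - theta q u b\<bar>" using log_unit_pos by (simp add: y_def abs_mult)
    also have "\<dots> \<le> 2 * log_unit * (1 / 2)" using t log_unit_pos by (intro mult_left_mono) auto
    finally show ?thesis by simp
  qed
  then have "exp \<bar>y\<bar> \<le> u" using u_gt_1 by (metis exp_le_cancel_iff exp_ln less_trans zero_less_one)
  then have "\<bar>y\<bar> * exp \<bar>y\<bar> \<le> \<bar>y\<bar> * u" by (intro mult_left_mono) auto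
  then have y1: "\<bar>exp y - 1\<bar> \<le> \<bar>y\<bar> * u" using abs_exp_minus_1_le[of y] by linarith
  have "\<bar>con q a\<bar> \<le> sqrt (abs_norm a)" "\<bar>val q b\<bar> \<le> u * sqrt (abs_norm b)"
    using fdom_pm_bounds(1,2) a b fdom_subset_fdom_pm by blast+
  moreover have "sqrt (abs_norm a) \<le> sqrt N" "sqrt (abs_norm b) \<le> sqrt N" using N by simp_all
  ultimately have cv: "\<bar>con q a\<bar> \<le> sqrt N" "\<bar>val q b\<bar> \<le> u * sqrt N"
    using u_gt_1 by (auto intro: order_trans mult_left_mono)
  have "\<bar>con q a\<bar> * \<bar>val q b\<bar> * \<bar>exp y - 1\<bar> \<le> sqrt N * (u * sqrt N) * (\<bar>y\<bar> * u)"
    using cv y1 u_gt_1 N0 by (intro mult_mono) auto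
  also have "\<dots> = (sqrt N * sqrt N) * u\<^sup>2 * \<bar>y\<bar>" by (simp add: power2_eq_square)
  also have "sqrt N * sqrt N = N" using N0 by simp
  also have "N * u\<^sup>2 * \<bar>y\<bar> = 2 * log_unit * u\<^sup>2 * N * \<bar>theta q u a - theta q u b\<bar>"
    using log_unit_pos by (simp add: y_def abs_mult)
  finally have "sqrt (real q) * \<bar>real_of_int (fst a * snd b - snd a * fst b)\<bar> \<le> 2 * log_unit * u\<^sup>2 * N * \<bar>theta q u a - theta q u b\<bar>"
    using e by simp
  moreover have "1 * \<bar>real_of_int (fst a * snd b - snd a * fst b)\<bar> \<le> sqrt (real q) * \<bar>real_of_int (fst a * snd b - snd a * fst b)\<bar>"
    using sqrt_q_gt_2 by (intro mult_right_mono) linarith+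
  ultimately show ?thesis unfolding mult_1 by (rule order_trans[rotated])
qed

text \<open>The quotient of \<open>box_radius j\<close> by the lower bound of
  \<open>norm_block_lower\<close>; it does not depend on \<open>j\<close>.\<close>

definition box_ratio :: real where
  "box_ratio = sqrt (2 * (u\<^sup>2 + 1) * (2 + real q))"

lemma box_radius_box_ratio: "box_radius j \<le> box_ratio * sqrt (2 ^ j / (2 + real q))"
proof -
  have "box_ratio * sqrt (2 ^ j / (2 + real q)) = sqrt (2 * (u\<^sup>2 + 1) * (2 + real q) * (2 ^ j / (2 + real q)))"
    unfolding box_ratio_def by (rule real_sqrt_mult[symmetric])
  also have "2 * (u\<^sup>2 + 1) * (2 + real q) * (2 ^ j / (2 + real q)) = (u\<^sup>2 + 1) * 2 ^ Suc j"
    by (simp add: field_simps)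
  finally show ?thesis by (simp add: box_radius_def)
qed

text \<open>Restricting the angles to a half circle keeps the distance on the circle equal to the distance on the
  line, and equal signs of the conjugates exclude pairs with a determinant of the size of the norm.\<close>

definition half_block :: "nat \<Rightarrow> bool \<times> bool \<Rightarrow> (int \<times> int) set" where
  "half_block j c = {z \<in> norm_block j. (con q z > 0) = fst c \<and> (theta q u z < 1 / 2) = snd c}"

text \<open>The factors come from \<open>card_det_box\<close>, from the block size
  \<open>9 * (box_radius j)^2 = 18 * (u^2 + 1) * 2 ^ j\<close>, and from the determinant range
  together with the logarithm of the radius.\<close>

definition pair_const :: real where
  "pair_const = (2 * box_ratio + 2) * (18 * (u\<^sup>2 + 1)) * (8 * log_unit * u\<^sup>2 + 1 + ln (2 * (u\<^sup>2 + 1)))"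

lemma pair_const_pos: "pair_const > 0"
proof -
  have "box_ratio \<ge> 0" by (simp add: box_ratio_def)
  moreover have "ln (2 * (u\<^sup>2 + 1)) \<ge> 0" by (rule ln_ge_zero) (use u2(1) in simp)
  moreover have "8 * log_unit * u\<^sup>2 \<ge> 0" using log_unit_pos by simp
  moreover have "u\<^sup>2 + 1 > 0" using u2(1) by linarith
  ultimately have "2 * box_ratio + 2 > 0" "18 * (u\<^sup>2 + 1) > 0" "8 * log_unit * u\<^sup>2 + 1 + ln (2 * (u\<^sup>2 + 1)) > 0"
    by (simp, simp, linarith)
  then show ?thesis unfolding pair_const_def by (metis mult_pos_pos)
qed

text \<open>Angles within \<open>\<delta>\<close> force a determinant of at most a constant times
  \<open>2 ^ j * \<delta>\<close>, so \<open>card_det_box\<close> bounds the partners of each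
  \<open>a\<close> by that quantity plus a gcd. Summed over the block, the gcds cost a logarithm
  only, here \<open>j\<close>.\<close>

lemma half_block_pair_count:
  assumes d: "\<delta> \<ge> 0"
  shows "(\<Sum>a\<in>half_block j c. real (card {b \<in> half_block j c. \<bar>theta q u a - theta q u b\<bar> \<le> \<delta>}))
     \<le> pair_const * 2 ^ j * (2 ^ j * \<delta> + real j + 1)"
proof -
  define M where "M = 2 * log_unit * u\<^sup>2 * 2 ^ Suc j * \<delta>"
  have M: "M \<ge> 0" using log_unit_pos d by (simp add: M_def)
  have rho0: "box_ratio \<ge> 0" by (simp add: box_ratio_def)
  have sub: "half_block j c \<subseteq> norm_block j" by (auto simp: half_block_def)
  have half: "\<bar>theta q u a - theta q u b\<bar> \<le> 1 / 2" if "a \<in> half_block j c" "b \<in> half_block j c" for a b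
  proof -
    have "0 \<le> theta q u a" "theta q u a < 1" "0 \<le> theta q u b" "theta q u b < 1"
      using theta_range that by (auto simp: half_block_def norm_block_def)
    moreover have "(theta q u a < 1 / 2) = (theta q u b < 1 / 2)" using that by (simp add: half_block_def)
    ultimately show ?thesis by linarith
  qed
  have one: "real (card {b \<in> half_block j c. \<bar>theta q u a - theta q u b\<bar> \<le> \<delta>}) \<le> (2 * box_ratio + 2) * (2 * M + of_int (gcd (fst a) (snd a)))"
    if a: "a \<in> half_block j c" for a
  proof -
    let ?T = "{(x, y). \<bar>of_int x\<bar> \<le> box_radius j \<and> \<bar>of_int y\<bar> \<le> box_radius j \<and> \<bar>real_of_int (fst a * y - snd a * x)\<bar> \<le> M}"
    have ab: "a \<in> norm_block j" using a sub by blast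
    have mu: "sqrt (2 ^ j / (2 + real q)) > 0" by simp
    note T = card_det_box[OF norm_block_lower[OF ab] mu _ M box_radius_box_ratio]
    have B0: "0 \<le> box_radius j" using box_radius_ge_1[of j] by linarith
    have "{b \<in> half_block j c. \<bar>theta q u a - theta q u b\<bar> \<le> \<delta>} \<subseteq> ?T"
    proof
      fix b assume "b \<in> {b \<in> half_block j c. \<bar>theta q u a - theta q u b\<bar> \<le> \<delta>}"
      then have b: "b \<in> half_block j c" "\<bar>theta q u a - theta q u b\<bar> \<le> \<delta>" by auto
      have bb: "b \<in> norm_block j" using b sub by blast
      have "\<bar>real_of_int (fst a * snd b - snd a * fst b)\<bar> \<le> 2 * log_unit * u\<^sup>2 * 2 ^ Suc j * \<bar>theta q u a - theta q u b\<bar>"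
        by (rule det_bound[OF _ _ _ half[OF a b(1)]]) (use a b ab bb in \<open>auto simp: half_block_def norm_block_def\<close>)
      also have "\<dots> \<le> M" unfolding M_def using b(2) log_unit_pos by (intro mult_left_mono) auto
      finally show "b \<in> ?T" using norm_block_box[OF bb] by (simp add: case_prod_unfold)
    qed
    then have "card {b \<in> half_block j c. \<bar>theta q u a - theta q u b\<bar> \<le> \<delta>} \<le> card ?T"
      by (rule card_mono[OF T(1)[OF B0]])
    then have "real (card {b \<in> half_block j c. \<bar>theta q u a - theta q u b\<bar> \<le> \<delta>}) \<le> real (card ?T)" by (rule of_nat_mono)
    also have "\<dots> \<le> (2 * box_ratio + 2) * (2 * M + of_int (gcd (fst a) (snd a)))" by (rule T(2)[OF B0])
    finally show ?thesis .
  qed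
  have "(\<Sum>a\<in>half_block j c. real (card {b \<in> half_block j c. \<bar>theta q u a - theta q u b\<bar> \<le> \<delta>})) \<le> (\<Sum>a\<in>half_block j c. (2 * box_ratio + 2) * (2 * M + of_int (gcd (fst a) (snd a))))"
    by (rule sum_mono[OF one])
  also have "\<dots> \<le> (\<Sum>a\<in>norm_block j. (2 * box_ratio + 2) * (2 * M + of_int (gcd (fst a) (snd a))))"
    using rho0 M by (intro sum_mono2 finite_norm_block sub) auto
  also have "\<dots> = (2 * box_ratio + 2) * (2 * M * real (card (norm_block j)) + (\<Sum>a\<in>norm_block j. of_int (gcd (fst a) (snd a))))"
    by (simp add: sum_distrib_left[symmetric] sum.distrib)
  also have "\<dots> \<le> (2 * box_ratio + 2) * (2 * M * (9 * (box_radius j)\<^sup>2) + 9 * (box_radius j)\<^sup>2 * (1 + ln (box_radius j)))"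
  proof (intro mult_left_mono add_mono)
    have "(\<Sum>a\<in>norm_block j. real_of_int (gcd (fst a) (snd a))) \<le> (\<Sum>z | \<bar>of_int (fst z)\<bar> \<le> box_radius j \<and> \<bar>of_int (snd z)\<bar> \<le> box_radius j \<and> z \<noteq> (0::int \<times> int). real_of_int (gcd (fst z) (snd z)))"
    proof (rule sum_mono2)
      show "finite {z. \<bar>of_int (fst z)\<bar> \<le> box_radius j \<and> \<bar>of_int (snd z)\<bar> \<le> box_radius j \<and> z \<noteq> (0::int \<times> int)}"
        by (rule finite_subset[OF _ finite_int_box[of "box_radius j"]]) auto
      show "norm_block j \<subseteq> {z. \<bar>of_int (fst z)\<bar> \<le> box_radius j \<and> \<bar>of_int (snd z)\<bar> \<le> box_radius j \<and> z \<noteq> 0}"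
        using norm_block_box by blast
    qed simp
    also have "\<dots> \<le> 9 * (box_radius j)\<^sup>2 * (1 + ln (box_radius j))" by (rule sum_gcd_box[OF box_radius_ge_1])
    finally show "(\<Sum>a\<in>norm_block j. real_of_int (gcd (fst a) (snd a))) \<le> 9 * (box_radius j)\<^sup>2 * (1 + ln (box_radius j))" .
  qed (use M rho0 card_norm_block in auto)
  also have "\<dots> = (2 * box_ratio + 2) * (9 * (box_radius j)\<^sup>2) * (2 * M + 1 + ln (box_radius j))" by (simp add: algebra_simps)
  also have "\<dots> = (2 * box_ratio + 2) * (18 * (u\<^sup>2 + 1)) * 2 ^ j * (2 * M + 1 + ln (box_radius j))" unfolding box_radius_sq by simp
  also have "\<dots> \<le> (2 * box_ratio + 2) * (18 * (u\<^sup>2 + 1)) * 2 ^ j * ((8 * log_unit * u\<^sup>2 + 1 + ln (2 * (u\<^sup>2 + 1))) * (2 ^ j * \<delta> + real j + 1))"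
  proof (intro mult_left_mono)
    define c0 where "c0 = ln (2 * (u\<^sup>2 + 1))"
    have c0: "c0 \<ge> 0" using u2(1) by (simp add: c0_def)
    have "box_radius j \<le> (box_radius j)\<^sup>2" using box_radius_ge_1[of j] self_le_power[of "box_radius j" 2] by simp
    then have "ln (box_radius j) \<le> ln ((box_radius j)\<^sup>2)" using box_radius_ge_1[of j] by simp
    also have "(box_radius j)\<^sup>2 = (2 * (u\<^sup>2 + 1)) * 2 ^ j" unfolding box_radius_sq by simp
    also have "ln ((2 * (u\<^sup>2 + 1)) * 2 ^ j) = c0 + real j * ln 2"
    proof -
      have p: "2 * (u\<^sup>2 + 1) > 0" "(2::real) ^ j > 0" using u2(1) by auto
      have "ln ((2::real) ^ j) = real j * ln 2" by (rule ln_realpow)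
      then show ?thesis unfolding c0_def ln_mult_pos[OF p] by simp
    qed
    also have "real j * ln 2 \<le> real j * 1" using ln_2_less_1 by (intro mult_left_mono) auto
    finally have lb: "ln (box_radius j) \<le> c0 + real j" by simp
    define A where "A = 8 * log_unit * u\<^sup>2"
    have A: "A \<ge> 0" using log_unit_pos by (simp add: A_def)
    have "2 * M = A * (2 ^ j * \<delta>)" by (simp add: M_def A_def)
    then have "2 * M + 1 + ln (box_radius j) \<le> A * (2 ^ j * \<delta>) + 1 + c0 + real j" using lb by linarith
    also have "\<dots> \<le> (A + 1 + c0) * (2 ^ j * \<delta> + real j + 1)"
    proof -
      have "0 \<le> A * (real j + 1)" "0 \<le> 2 ^ j * \<delta>" "0 \<le> c0 * (2 ^ j * \<delta> + real j)" using A c0 d by auto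
      then show ?thesis by (simp add: algebra_simps)
    qed
    finally show "2 * M + 1 + ln (box_radius j) \<le> (8 * log_unit * u\<^sup>2 + 1 + ln (2 * (u\<^sup>2 + 1))) * (2 ^ j * \<delta> + real j + 1)"
      by (simp add: A_def c0_def)
  qed (use rho0 in auto)
  also have "\<dots> = pair_const * 2 ^ j * (2 ^ j * \<delta> + real j + 1)" by (simp add: pair_const_def mult_ac)
  finally show ?thesis .
qed

text \<open>The dyadic kernel bound turns the Fejer sum into pair counts at distance
  \<open>2 ^ i / L\<close>. A count grows at most like \<open>2 ^ i\<close> while its weight decays
  like \<open>4 ^ i\<close>, so the sum over \<open>i\<close> is a convergent geometric series,
  bounded by \<open>2\<close>.\<close>

lemma half_block_sieve:
  fixes c :: "int \<times> int \<Rightarrow> complex" and N :: nat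
  assumes N: "N > 0" and cm: "\<And>a. a \<in> half_block j cl \<Longrightarrow> norm (c a) \<le> cm"
  shows "(\<Sum>k\<in>{1..N}. (norm (\<Sum>a\<in>half_block j cl. c a * cis (2 * pi * real k * theta q u a)))\<^sup>2)
     \<le> 32 * pair_const * cm\<^sup>2 * 2 ^ j * (2 ^ j + real N) * (real j + 1)"
proof (cases "half_block j cl = {}")
  case True
  then show ?thesis using pair_const_pos by (simp add: zero_le_mult_iff)
next
  case False
  define S where "S = half_block j cl"
  define L where "L = 2 * N"
  have finS: "finite S" unfolding S_def by (rule finite_subset[OF _ finite_norm_block[of j]]) (auto simp: half_block_def)
  have cm0: "cm \<ge> 0" using False cm norm_ge_zero order_trans by blast
  have L: "L > 0" using N by (simp add: L_def)
  have half: "\<bar>theta q u a - theta q u b\<bar> \<le> 1 / 2" if "a \<in> S" "b \<in> S" for a b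
  proof -
    have "0 \<le> theta q u a" "theta q u a < 1" "0 \<le> theta q u b" "theta q u b < 1"
      using theta_range that by (auto simp: S_def half_block_def norm_block_def)
    moreover have "(theta q u a < 1 / 2) = (theta q u b < 1 / 2)" using that by (simp add: S_def half_block_def)
    ultimately show ?thesis by linarith
  qed
  let ?D = "\<lambda>a b. (norm (\<Sum>j<L. cis (2 * pi * (theta q u a - theta q u b)) ^ j))\<^sup>2"
  let ?P = "\<lambda>i a b. of_bool (\<bar>theta q u a - theta q u b\<bar> \<le> 2 ^ i / real L) :: real"
  have "(\<Sum>k\<in>{1..N}. (norm (\<Sum>a\<in>S. c a * cis (2 * pi * real k * theta q u a)))\<^sup>2)
     \<le> 1 / real N * (\<Sum>a\<in>S. \<Sum>b\<in>S. norm (c a) * norm (c b) * ?D a b)"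
    unfolding L_def by (rule fejer_large_sieve[OF finS N])
  also have "\<dots> \<le> 1 / real N * (\<Sum>a\<in>S. \<Sum>b\<in>S. cm\<^sup>2 * ((real L)\<^sup>2 * (\<Sum>i\<le>L. 4 * (1 / 4) ^ i * ?P i a b)))"
  proof (intro mult_left_mono sum_mono)
    fix a b assume ab: "a \<in> S" "b \<in> S"
    have "norm (c a) * norm (c b) \<le> cm\<^sup>2" unfolding power2_eq_square using cm ab cm0 unfolding S_def by (intro mult_mono) auto
    then show "norm (c a) * norm (c b) * ?D a b \<le> cm\<^sup>2 * ((real L)\<^sup>2 * (\<Sum>i\<le>L. 4 * (1 / 4) ^ i * ?P i a b))"
      using dirichlet_kernel_bound[OF L half[OF ab]] by (intro mult_mono) auto
  qed auto
  also have "(\<Sum>a\<in>S. \<Sum>b\<in>S. cm\<^sup>2 * ((real L)\<^sup>2 * (\<Sum>i\<le>L. 4 * (1 / 4) ^ i * ?P i a b)))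
     = cm\<^sup>2 * ((real L)\<^sup>2 * (\<Sum>i\<le>L. 4 * (1 / 4) ^ i * (\<Sum>a\<in>S. \<Sum>b\<in>S. ?P i a b)))"
  proof -
    have "(\<Sum>a\<in>S. \<Sum>b\<in>S. \<Sum>i\<le>L. 4 * (1 / 4) ^ i * ?P i a b) = (\<Sum>a\<in>S. \<Sum>i\<le>L. \<Sum>b\<in>S. 4 * (1 / 4) ^ i * ?P i a b)"
      by (intro sum.cong refl sum.swap)
    also have "\<dots> = (\<Sum>i\<le>L. \<Sum>a\<in>S. \<Sum>b\<in>S. 4 * (1 / 4) ^ i * ?P i a b)" by (rule sum.swap)
    finally show ?thesis by (simp only: sum_distrib_left[symmetric])
  qed
  also have "1 / real N * \<dots> \<le> 1 / real N * (cm\<^sup>2 * ((real L)\<^sup>2 * (4 * pair_const * 2 ^ j * (2 ^ j / real L * 2 + (real j + 1) * 2))))"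
  proof (intro mult_left_mono)
    have "(\<Sum>i\<le>L. 4 * (1 / 4) ^ i * (\<Sum>a\<in>S. \<Sum>b\<in>S. ?P i a b)) \<le> (\<Sum>i\<le>L. 4 * (1 / 4) ^ i * (pair_const * 2 ^ j * (2 ^ j * (2 ^ i / real L) + real j + 1)))"
    proof (intro sum_mono mult_left_mono)
      fix i
      have "(\<Sum>b\<in>S. ?P i a b) = real (card {b \<in> S. \<bar>theta q u a - theta q u b\<bar> \<le> 2 ^ i / real L})" for a
        using finS by (simp add: sum_of_bool_eq Int_def)
      then have "(\<Sum>a\<in>S. \<Sum>b\<in>S. ?P i a b) = (\<Sum>a\<in>S. real (card {b \<in> S. \<bar>theta q u a - theta q u b\<bar> \<le> 2 ^ i / real L}))" by simp
      also have "\<dots> \<le> pair_const * 2 ^ j * (2 ^ j * (2 ^ i / real L) + real j + 1)"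
        unfolding S_def by (rule half_block_pair_count) simp
      finally show "(\<Sum>a\<in>S. \<Sum>b\<in>S. ?P i a b) \<le> pair_const * 2 ^ j * (2 ^ j * (2 ^ i / real L) + real j + 1)" .
    qed auto
    also have "\<dots> = 4 * pair_const * 2 ^ j * (2 ^ j / real L * (\<Sum>i\<le>L. (1 / 2) ^ i) + (real j + 1) * (\<Sum>i\<le>L. (1 / 4) ^ i))"
    proof -
      have h: "(1 / 4) ^ i * 2 ^ i = (1 / 2 :: real) ^ i" for i by (simp flip: power_mult_distrib)
      have "4 * (1 / 4) ^ i * (pair_const * 2 ^ j * (2 ^ j * (2 ^ i / real L) + real j + 1))
        = 4 * pair_const * 2 ^ j * (2 ^ j / real L * (1 / 2) ^ i + (real j + 1) * (1 / 4) ^ i)" for i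
        unfolding h[symmetric] by (simp add: algebra_simps)
      then show ?thesis by (simp only: sum_distrib_left[symmetric] sum.distrib)
    qed
    also have "\<dots> \<le> 4 * pair_const * 2 ^ j * (2 ^ j / real L * 2 + (real j + 1) * 2)"
    proof (intro mult_left_mono add_mono)
      show "(\<Sum>i\<le>L. (1 / 2) ^ i) \<le> (2::real)"
        using sum_gp_strict[of "1 / 2 :: real" "Suc L"] by (simp add: lessThan_Suc_atMost)
      show "(\<Sum>i\<le>L. (1 / 4) ^ i) \<le> (2::real)"
      proof -
        define g where "g = (1 / 4 :: real) ^ Suc L"
        have "(\<Sum>i\<le>L. (1 / 4 :: real) ^ i) = (1 - g) / (1 - 1 / 4)"
          using sum_gp_strict[of "1 / 4 :: real" "Suc L"] unfolding lessThan_Suc_atMost g_def by simp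
        moreover have "g \<ge> 0" by (simp add: g_def)
        ultimately show "(\<Sum>i\<le>L. (1 / 4) ^ i) \<le> (2::real)" by simp
      qed
    qed (use pair_const_pos in auto)
    finally show "(\<Sum>i\<le>L. 4 * (1 / 4) ^ i * (\<Sum>a\<in>S. \<Sum>b\<in>S. ?P i a b)) \<le> 4 * pair_const * 2 ^ j * (2 ^ j / real L * 2 + (real j + 1) * 2)" .
  qed auto
  also have "\<dots> = 16 * pair_const * cm\<^sup>2 * 2 ^ j * (2 ^ j + 2 * real N * (real j + 1))"
    using N by (simp add: L_def power2_eq_square field_simps)
  also have "\<dots> \<le> 16 * pair_const * cm\<^sup>2 * 2 ^ j * (2 * ((2 ^ j + real N) * (real j + 1)))"
  proof (intro mult_left_mono)
    have "0 \<le> 2 ^ j * real j" by simp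
    then show "2 ^ j + 2 * real N * (real j + 1) \<le> 2 * ((2 ^ j + real N) * (real j + 1))"
      by (simp add: algebra_simps)
  qed (use pair_const_pos in auto)
  also have "\<dots> = 32 * pair_const * cm\<^sup>2 * 2 ^ j * (2 ^ j + real N) * (real j + 1)" by simp
  finally show ?thesis unfolding S_def .
qed

lemma norm_block_half_block: "(\<Sum>a\<in>norm_block j. f a) = (\<Sum>cl\<in>UNIV. \<Sum>a\<in>half_block j cl. f a)" for f :: "int \<times> int \<Rightarrow> complex"
proof -
  have "(\<Sum>cl\<in>(\<lambda>z. (con q z > 0, theta q u z < 1 / 2)) ` norm_block j. \<Sum>a | a \<in> norm_block j \<and> (con q a > 0, theta q u a < 1 / 2) = cl. f a) = (\<Sum>a\<in>norm_block j. f a)"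
    by (rule sum.image_gen[symmetric, OF finite_norm_block])
  moreover have "{a. a \<in> norm_block j \<and> (con q a > 0, theta q u a < 1 / 2) = cl} = half_block j cl" for cl
    by (cases cl) (auto simp: half_block_def)
  moreover have "(\<Sum>cl\<in>(\<lambda>z. (con q z > 0, theta q u z < 1 / 2)) ` norm_block j. \<Sum>a\<in>half_block j cl. f a) = (\<Sum>cl\<in>UNIV. \<Sum>a\<in>half_block j cl. f a)"
    by (rule sum.mono_neutral_left) (auto simp: half_block_def intro!: sum.neutral)
  ultimately show ?thesis by simp
qed

text \<open>Cauchy-Schwarz over the four half blocks costs a factor 4 and adding their bounds
  another 4, which turns 32 into 512.\<close>

lemma norm_block_sieve:
  fixes c :: "int \<times> int \<Rightarrow> complex" and N :: nat
  assumes N: "N > 0" and cm: "\<And>a. a \<in> norm_block j \<Longrightarrow> norm (c a) \<le> cm"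
  shows "(\<Sum>k\<in>{1..N}. (norm (\<Sum>a\<in>norm_block j. c a * cis (2 * pi * real k * theta q u a)))\<^sup>2)
     \<le> 512 * pair_const * cm\<^sup>2 * 2 ^ j * (2 ^ j + real N) * (real j + 1)"
proof -
  let ?T = "\<lambda>k cl. \<Sum>a\<in>half_block j cl. c a * cis (2 * pi * real k * theta q u a)"
  let ?B = "32 * pair_const * cm\<^sup>2 * 2 ^ j * (2 ^ j + real N) * (real j + 1)"
  have card4: "card (UNIV :: (bool \<times> bool) set) = 4" by (simp add: card_UNIV_bool flip: UNIV_Times_UNIV)
  have "(norm (\<Sum>a\<in>norm_block j. c a * cis (2 * pi * real k * theta q u a)))\<^sup>2 \<le> 4 * (\<Sum>cl\<in>UNIV. (norm (?T k cl))\<^sup>2)" for k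
  proof -
    have "norm (\<Sum>a\<in>norm_block j. c a * cis (2 * pi * real k * theta q u a)) \<le> (\<Sum>cl\<in>UNIV. norm (?T k cl))"
      unfolding norm_block_half_block by (rule norm_sum)
    then have "(norm (\<Sum>a\<in>norm_block j. c a * cis (2 * pi * real k * theta q u a)))\<^sup>2 \<le> (\<Sum>cl\<in>UNIV. norm (?T k cl))\<^sup>2" by (rule power_mono) simp
    also have "\<dots> \<le> real (card (UNIV :: (bool \<times> bool) set)) * (\<Sum>cl\<in>UNIV. (norm (?T k cl))\<^sup>2)"
      using sum_squared_le_sum_of_squares[of "\<lambda>cl. norm (?T k cl)" UNIV] by (simp add: mult.commute)
    finally show ?thesis unfolding card4 by simp
  qed
  then have "(\<Sum>k\<in>{1..N}. (norm (\<Sum>a\<in>norm_block j. c a * cis (2 * pi * real k * theta q u a)))\<^sup>2) \<le> (\<Sum>k\<in>{1..N}. 4 * (\<Sum>cl\<in>UNIV. (norm (?T k cl))\<^sup>2))"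
    by (intro sum_mono)
  also have "\<dots> = 4 * (\<Sum>cl\<in>UNIV. \<Sum>k\<in>{1..N}. (norm (?T k cl))\<^sup>2)"
    unfolding sum_distrib_left[symmetric] by (subst sum.swap) simp
  also have "\<dots> \<le> 4 * (\<Sum>cl\<in>(UNIV :: (bool \<times> bool) set). ?B)"
    by (intro mult_left_mono sum_mono half_block_sieve[OF N] cm) (auto simp: half_block_def)
  also have "\<dots> = 4 * (4 * ?B)" by (simp only: sum_constant card4)
  finally show ?thesis by simp
qed

end


section \<open>The second moment\<close>

lemma L2_set_sum_le:
  fixes f :: "'a \<Rightarrow> 'b \<Rightarrow> complex"
  assumes "finite I"
  shows "L2_set (\<lambda>k. norm (\<Sum>j\<in>I. f k j)) A \<le> (\<Sum>j\<in>I. L2_set (\<lambda>k. norm (f k j)) A)"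
  using assms
proof (induction I rule: finite_induct)
  case empty
  then show ?case by (simp add: L2_set_0')
next
  case (insert i I)
  have "L2_set (\<lambda>k. norm (\<Sum>j\<in>insert i I. f k j)) A \<le> L2_set (\<lambda>k. norm (f k i) + norm (\<Sum>j\<in>I. f k j)) A"
    using insert.hyps by (intro L2_set_mono) (auto intro: norm_triangle_ineq)
  also have "\<dots> \<le> L2_set (\<lambda>k. norm (f k i)) A + L2_set (\<lambda>k. norm (\<Sum>j\<in>I. f k j)) A"
    by (rule L2_set_triangle_ineq)
  finally show ?case using insert by simp
qed

lemma powr_square: "(y powr a)\<^sup>2 = y powr (2 * a)" for y a :: real
  by (simp add: power2_eq_square flip: powr_add)

lemma L2_set_le_sqrt: "(\<Sum>k\<in>A. (f k)\<^sup>2) \<le> b \<Longrightarrow> L2_set f A \<le> sqrt b"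
  unfolding L2_set_def by (rule real_sqrt_le_mono)

context quad_unit
begin

lemma qnorm_minus: "qnorm q (- z) = qnorm q z"
  by (simp add: qnorm_def)

lemma fdom_pm_eq: "fdom_pm q u = fdom q u \<union> uminus ` fdom q u" "fdom q u \<inter> uminus ` fdom q u = {}"
proof -
  have mem: "z \<in> uminus ` fdom q u \<longleftrightarrow> - z \<in> fdom q u" for z
    by (metis imageE image_eqI minus_minus)
  have sym: "- z \<in> fdom_pm q u \<longleftrightarrow> z \<in> fdom_pm q u" for z
    by (simp add: fdom_pm_def val_minus con_minus)
  have pos: "z \<in> fdom q u \<longleftrightarrow> z \<in> fdom_pm q u \<and> val q z > 0" for z
    using fdom_subset_fdom_pm by (auto simp: fdom_def fdom_pm_def)
  have nz: "val q z \<noteq> 0" if "z \<in> fdom_pm q u" for z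
    using that by (simp add: fdom_pm_def val_eq_0_iff)
  show "fdom_pm q u = fdom q u \<union> uminus ` fdom q u"
    unfolding set_eq_iff Un_iff mem pos sym val_minus using nz by (metis linorder_neqE_linordered_idom neg_0_less_iff_less)
  show "fdom q u \<inter> uminus ` fdom q u = {}"
    unfolding set_eq_iff Int_iff mem pos val_minus by (metis empty_iff less_asym neg_0_less_iff_less)
qed

lemma dirichlet_term_minus: "dirichlet_term k s (- z) = dirichlet_term k s z"
  by (simp add: dirichlet_term_def val_minus con_minus qnorm_minus)

lemma hecke_ext_has_sum:
  assumes s: "Re s > 1" and k: "k > 0"
  shows "(dirichlet_term k s has_sum hecke_ext k s) (fdom q u)"
proof -
  have sm: "dirichlet_term k s summable_on fdom q u"
    by (rule summable_on_subset_banach[OF dirichlet_term_summable[OF s] fdom_subset_fdom_pm])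
  define S where "S = (\<Sum>\<^sub>\<infinity>z\<in>fdom q u. dirichlet_term k s z)"
  have S: "(dirichlet_term k s has_sum S) (fdom q u)" unfolding S_def by (rule has_sum_infsum[OF sm])
  have "((\<lambda>z. dirichlet_term k s (- z)) has_sum S) (fdom q u)" using S by (simp add: dirichlet_term_minus)
  then have "(dirichlet_term k s has_sum S) (uminus ` fdom q u)"
    by (subst has_sum_reindex) (auto simp: o_def inj_on_def)
  from has_sum_Un_disjoint[OF S this fdom_pm_eq(2)]
  have "(dirichlet_term k s has_sum (S + S)) (fdom_pm q u)" unfolding fdom_pm_eq(1)[symmetric] .
  then have "hecke_ext k s = (S + S) / 2" unfolding hecke_ext_eq_sum[OF assms] by (simp add: infsumI)
  then show ?thesis using S by simp
qed

section \<open>Mean squares of blocks, partial sums and tails\<close>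

definition block_sum :: "nat \<Rightarrow> complex \<Rightarrow> nat \<Rightarrow> complex" where
  "block_sum k s j = (\<Sum>z\<in>norm_block j. dirichlet_term k s z)"

definition partial_sum :: "nat \<Rightarrow> nat \<Rightarrow> complex \<Rightarrow> complex" where
  "partial_sum J k s = (\<Sum>j<J. block_sum k s j)"

lemma fdom_nonzero: "z \<in> fdom q u \<Longrightarrow> z \<noteq> 0"
  using fdom_subset_fdom_pm by (auto simp: fdom_pm_def)

lemma fdom_norm_block: "fdom q u = snd ` (SIGMA j:UNIV. norm_block j)" "inj_on snd (SIGMA j:UNIV. norm_block j)"
proof -
  have ex: "\<exists>j. z \<in> norm_block j" if z: "z \<in> fdom q u" for z
  proof -
    define n where "n = nat \<bar>qnorm q z\<bar>"
    have n: "abs_norm z = real n" by (simp add: n_def)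
    have "n \<ge> 1" using abs_norm_ge_1[OF fdom_nonzero[OF z]] unfolding n by simp
    then obtain j where "2 ^ j \<le> n" "n < 2 ^ (j + 1)" using ex_power_ivl1[of 2 n] by auto
    then have "(2::real) ^ j \<le> real n" "real n < 2 ^ Suc j"
      by (metis numeral_power_le_of_nat_cancel_iff, metis Suc_eq_plus1 of_nat_less_numeral_power_cancel_iff)
    then show ?thesis using z n by (auto simp: norm_block_def)
  qed
  show "fdom q u = snd ` (SIGMA j:UNIV. norm_block j)"
  proof
    show "fdom q u \<subseteq> snd ` (SIGMA j:UNIV. norm_block j)"
    proof
      fix z assume "z \<in> fdom q u"
      then obtain j where "z \<in> norm_block j" using ex by blast
      then have "(j, z) \<in> (SIGMA j:UNIV. norm_block j)" by simp
      then show "z \<in> snd ` (SIGMA j:UNIV. norm_block j)" by (metis image_eqI snd_conv)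
    qed
  qed (auto simp: norm_block_def)
  have "i = j" if "z \<in> norm_block i" "z \<in> norm_block j" for i j z
  proof -
    have "(2::real) ^ i < 2 ^ Suc j" "(2::real) ^ j < 2 ^ Suc i" using that unfolding norm_block_def by force+
    then have "i < Suc j" "j < Suc i" using power_less_imp_less_exp[of "2::real" i "Suc j"] power_less_imp_less_exp[of "2::real" j "Suc i"] by (simp_all del: power_Suc)
    then show ?thesis by simp
  qed
  then show "inj_on snd (SIGMA j:UNIV. norm_block j)" by (auto simp: inj_on_def)
qed

lemma block_sum_sums:
  assumes s: "Re s > 1" and k: "k > 0"
  shows "block_sum k s sums hecke_ext k s"
proof -
  have "(dirichlet_term k s \<circ> snd has_sum hecke_ext k s) (SIGMA j:UNIV. norm_block j)"
    using hecke_ext_has_sum[OF assms] unfolding fdom_norm_block(1) by (rule has_sum_reindex[OF fdom_norm_block(2), THEN iffD1])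
  then have "(block_sum k s has_sum hecke_ext k s) UNIV"
    by (rule has_sum_SigmaD) (auto simp: block_sum_def intro!: has_sum_finite finite_norm_block)
  then show ?thesis by (rule has_sum_imp_sums)
qed

lemma dirichlet_term_theta: "dirichlet_term k s z = exp (- s * of_real (ln (abs_norm z))) * cis (2 * pi * real k * theta q u z)"
  using log_unit_pos by (simp add: dirichlet_term_def theta_def hecke_freq_def field_simps)

lemma dirichlet_term_holomorphic: "(\<lambda>s. dirichlet_term k s z) holomorphic_on A"
  unfolding dirichlet_term_def by (intro holomorphic_intros)

lemma partial_sum_holomorphic: "(\<lambda>s. partial_sum J k s) holomorphic_on A"
  unfolding partial_sum_def block_sum_def by (intro holomorphic_intros dirichlet_term_holomorphic)

definition sieve_const :: real where "sieve_const = 512 * pair_const"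

lemma sieve_const_pos: "sieve_const > 0"
  using pair_const_pos by (simp add: sieve_const_def)

text \<open>One form for all abscissae: \<open>cm\<close> is the largest size of
  \<open>x powr (- Re s)\<close> on the block, taken at its left end for positive
  \<open>Re s\<close> and at its right end for negative \<open>Re s\<close>.\<close>

lemma block_sum_L2:
  assumes N: "N > 0" and A: "A \<subseteq> {1..N}" and cm: "\<And>x. 2 ^ j \<le> x \<Longrightarrow> x \<le> 2 ^ Suc j \<Longrightarrow> x powr (- Re s) \<le> cm"
    and b: "cm\<^sup>2 * 2 ^ j * (2 ^ j + real N) * (real j + 1) \<le> b"
  shows "L2_set (\<lambda>k. norm (block_sum k s j)) A \<le> sqrt (sieve_const * b)"
proof (rule L2_set_le_sqrt)
  have "(\<Sum>k\<in>A. (norm (block_sum k s j))\<^sup>2) \<le> (\<Sum>k\<in>{1..N}. (norm (block_sum k s j))\<^sup>2)"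
    using A by (intro sum_mono2) auto
  also have "\<dots> = (\<Sum>k\<in>{1..N}. (norm (\<Sum>z\<in>norm_block j. exp (- s * of_real (ln (abs_norm z))) * cis (2 * pi * real k * theta q u z)))\<^sup>2)"
    unfolding block_sum_def dirichlet_term_theta ..
  also have "\<dots> \<le> 512 * pair_const * cm\<^sup>2 * 2 ^ j * (2 ^ j + real N) * (real j + 1)"
  proof (rule norm_block_sieve[OF N])
    fix z assume z: "z \<in> norm_block j"
    then have "abs_norm z \<ge> 1" by (intro abs_norm_ge_1 fdom_nonzero) (simp add: norm_block_def)
    then have "norm (exp (- s * of_real (ln (abs_norm z)))) = abs_norm z powr (- Re s)" by (simp add: powr_def)
    also have "\<dots> \<le> cm" using z by (intro cm) (auto simp: norm_block_def)
    finally show "norm (exp (- s * of_real (ln (abs_norm z)))) \<le> cm" .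
  qed
  also have "\<dots> = sieve_const * (cm\<^sup>2 * 2 ^ j * (2 ^ j + real N) * (real j + 1))" by (simp add: sieve_const_def)
  also have "\<dots> \<le> sieve_const * b" using b sieve_const_pos by (intro mult_left_mono) auto
  finally show "(\<Sum>k\<in>A. (norm (block_sum k s j))\<^sup>2) \<le> sieve_const * b" .
qed

text \<open>On the critical line \<open>cm^2 * 2 ^ j = 1\<close>, so each of the \<open>J\<close>
  blocks has mean square at most of order \<open>N * (J + 1)\<close>, with no gain or loss from its
  position.\<close>

lemma partial_sum_L2_half:
  assumes N: "2 ^ J \<le> N" and A: "A \<subseteq> {1..N}" and s: "Re s = 1 / 2"
  shows "L2_set (\<lambda>k. norm (partial_sum J k s)) A \<le> real J * sqrt (sieve_const * (2 * real N * (real J + 1)))"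
proof -
  have N0: "N > 0" using N by (metis gr0I le_zero_eq power_not_zero zero_neq_numeral)
  have NJ: "2 ^ J \<le> real N" using N by (metis numeral_power_le_of_nat_cancel_iff)
  have "L2_set (\<lambda>k. norm (partial_sum J k s)) A \<le> (\<Sum>j<J. L2_set (\<lambda>k. norm (block_sum k s j)) A)"
    unfolding partial_sum_def by (rule L2_set_sum_le) simp
  also have "\<dots> \<le> (\<Sum>j<J. sqrt (sieve_const * (2 * real N * (real J + 1))))"
  proof (intro sum_mono block_sum_L2[OF N0 A])
    fix j x assume j: "j \<in> {..<J}" and x: "2 ^ j \<le> (x::real)" "x \<le> 2 ^ Suc j"
    have "(2::real) ^ j > 0" by simp
    then show "x powr (- Re s) \<le> (2 ^ j) powr (- (1 / 2))" unfolding s using x by (intro powr_mono2') auto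
  next
    fix j assume j: "j \<in> {..<J}"
    have "(2::real) ^ j \<le> 2 ^ J" using j by (intro power_increasing) auto
    then have le: "2 ^ j + real N \<le> 2 * real N" using NJ by linarith
    have "(((2::real) ^ j) powr (- (1 / 2)))\<^sup>2 * 2 ^ j = 1"
      unfolding powr_square by (simp add: powr_minus)
    then have "(((2::real) ^ j) powr (- (1 / 2)))\<^sup>2 * 2 ^ j * (2 ^ j + real N) * (real j + 1) = (2 ^ j + real N) * (real j + 1)"
      by simp
    also have "\<dots> \<le> 2 * real N * (real J + 1)" using le j by (intro mult_mono) auto
    finally show "(((2::real) ^ j) powr (- (1 / 2)))\<^sup>2 * 2 ^ j * (2 ^ j + real N) * (real j + 1) \<le> 2 * real N * (real J + 1)" .
  qed
  also have "\<dots> = real J * sqrt (sieve_const * (2 * real N * (real J + 1)))" by simp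
  finally show ?thesis .
qed

text \<open>Here the bound for block \<open>j\<close> grows like \<open>2 ^ j\<close>, and the
  geometric sum is controlled by the last block; no additional factor \<open>J\<close>
  appears.\<close>

lemma partial_sum_L2_minus_half:
  assumes N: "2 ^ J \<le> N" and A: "A \<subseteq> {1..N}" and s: "Re s = - (1 / 2)"
  shows "L2_set (\<lambda>k. norm (partial_sum J k s)) A \<le> 2 ^ J * (2 * sqrt (sieve_const * (real N * (real J + 1))))"
proof -
  have N0: "N > 0" using N by (metis gr0I le_zero_eq power_not_zero zero_neq_numeral)
  have NJ: "2 ^ J \<le> real N" using N by (metis numeral_power_le_of_nat_cancel_iff)
  let ?c = "\<lambda>j. ((2::real) ^ Suc j) powr (1 / 2)"
  have "L2_set (\<lambda>k. norm (partial_sum J k s)) A \<le> (\<Sum>j<J. L2_set (\<lambda>k. norm (block_sum k s j)) A)"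
    unfolding partial_sum_def by (rule L2_set_sum_le) simp
  also have "\<dots> \<le> (\<Sum>j<J. sqrt (sieve_const * (4 ^ j * (4 * (real N * (real J + 1))))))"
  proof (intro sum_mono block_sum_L2[OF N0 A])
    fix j x assume j: "j \<in> {..<J}" and x: "2 ^ j \<le> (x::real)" "x \<le> 2 ^ Suc j"
    have "(2::real) ^ j > 0" by simp
    then show "x powr (- Re s) \<le> ?c j" unfolding s minus_minus using x by (intro powr_mono2) auto
  next
    fix j assume j: "j \<in> {..<J}"
    have "(2::real) ^ j \<le> 2 ^ J" using j by (intro power_increasing) auto
    then have le: "2 ^ j + real N \<le> 2 * real N" using NJ by linarith
    have "(?c j)\<^sup>2 = 2 ^ Suc j" unfolding powr_square by simp
    then have "(?c j)\<^sup>2 * 2 ^ j = 2 * 4 ^ j" by (simp flip: power_mult_distrib)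
    then have "(?c j)\<^sup>2 * 2 ^ j * (2 ^ j + real N) * (real j + 1) = 2 * 4 ^ j * ((2 ^ j + real N) * (real j + 1))"
      by simp
    also have "\<dots> \<le> 2 * 4 ^ j * (2 * real N * (real J + 1))" using le j by (intro mult_left_mono mult_mono) auto
    finally show "(?c j)\<^sup>2 * 2 ^ j * (2 ^ j + real N) * (real j + 1) \<le> 4 ^ j * (4 * (real N * (real J + 1)))" by simp
  qed
  also have "\<dots> = (\<Sum>j<J. 2 ^ j) * (2 * sqrt (sieve_const * (real N * (real J + 1))))"
  proof -
    have "sqrt (sieve_const * (4 ^ j * (4 * (real N * (real J + 1))))) = 2 ^ j * (2 * sqrt (sieve_const * (real N * (real J + 1))))" for j
    proof -
      have "sieve_const * (4 ^ j * (4 * (real N * (real J + 1)))) = (2 ^ j * 2)\<^sup>2 * (sieve_const * (real N * (real J + 1)))"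
      proof -
        have "(4::real) ^ j = (2 ^ j)\<^sup>2" by (simp add: power2_eq_square flip: power_mult_distrib)
        then show ?thesis by (simp add: power_mult_distrib)
      qed
      then have "sqrt (sieve_const * (4 ^ j * (4 * (real N * (real J + 1))))) = sqrt ((2 ^ j * 2)\<^sup>2) * sqrt (sieve_const * (real N * (real J + 1)))"
        by (simp only: real_sqrt_mult)
      then show ?thesis unfolding real_sqrt_abs by simp
    qed
    then show ?thesis by (simp add: sum_distrib_right)
  qed
  also have "\<dots> \<le> 2 ^ J * (2 * sqrt (sieve_const * (real N * (real J + 1))))"
  proof (rule mult_right_mono)
    show "(\<Sum>j<J. 2 ^ j) \<le> (2::real) ^ J" using sum_gp_strict[of "2::real" J] by simp
    show "0 \<le> 2 * sqrt (sieve_const * (real N * (real J + 1)))" using sieve_const_pos by simp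
  qed
  finally show ?thesis .
qed

text \<open>The denominator is the sum of \<open>(i + 1) * r ^ i\<close> for
  \<open>r = sqrt (1 / 2)\<close>, the decay of successive blocks on the line
  \<open>Re s = 3 / 2\<close>.\<close>

definition tail_const :: real where
  "tail_const = sqrt (3 * sieve_const) / (1 - sqrt (1 / 2))\<^sup>2"

text \<open>Beyond the cut \<open>2 ^ j\<close> dominates \<open>N\<close> up to a factor, so block
  \<open>J + i\<close> is at most of order \<open>sqrt ((J + 1) / 2 ^ J) * (i + 1) * r ^ i\<close>.
  Finite stretches are summed by the triangle inequality and the limit is taken for each
  \<open>k\<close>. The factor \<open>2 ^ J\<close> on the left is the one carried by the error
  function at \<open>Re w = 1\<close>.\<close>

lemma tail_L2:
  assumes N: "N < 2 ^ Suc J" and A: "A \<subseteq> {1..N}" and s: "Re s = 3 / 2"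
  shows "2 ^ J * L2_set (\<lambda>k. norm (hecke_ext k s - partial_sum J k s)) A \<le> tail_const * sqrt (2 ^ J * (real J + 1))"
proof (cases "N = 0")
  case True
  then have "A = {}" using A by auto
  then show ?thesis using sieve_const_pos by (simp add: tail_const_def)
next
  case False
  then have N0: "N > 0" by simp
  have NJ: "real N \<le> 2 * 2 ^ J" using N by (metis less_imp_le of_nat_less_numeral_power_cancel_iff power_Suc)
  define r where "r = sqrt (1 / 2 :: real)"
  have r: "0 \<le> r" "r < 1" "r\<^sup>2 = 1 / 2" by (auto simp: r_def)
  have r2: "sqrt (1 / 2 ^ i) = r ^ i" for i :: nat
    unfolding r_def by (metis power_one_over real_sqrt_power)
  have geo: "(\<lambda>n. of_nat (Suc n) * r ^ n) sums (1 / (1 - r)\<^sup>2)" by (rule geometric_deriv_sums) (use r in simp)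
  let ?B = "sqrt (3 * sieve_const) * sqrt ((real J + 1) / 2 ^ J) * (1 / (1 - r)\<^sup>2)"
  have bl: "L2_set (\<lambda>k. norm (block_sum k s (J + i))) A \<le> sqrt (3 * sieve_const) * sqrt ((real J + 1) / 2 ^ J) * (real (Suc i) * r ^ i)" for i
  proof -
    let ?j = "J + i" and ?c = "((2::real) ^ (J + i)) powr (- (3 / 2))"
    have "L2_set (\<lambda>k. norm (block_sum k s ?j)) A \<le> sqrt (sieve_const * (3 / 2 ^ ?j * ((real J + 1) * (real i + 1))))"
    proof (rule block_sum_L2[OF N0 A])
      fix x :: real assume x: "2 ^ ?j \<le> x" "x \<le> 2 ^ Suc ?j"
      have "(2::real) ^ ?j > 0" by simp
      then show "x powr (- Re s) \<le> ?c" unfolding s using x by (intro powr_mono2') auto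
    next
      have "?c\<^sup>2 = ((2::real) ^ ?j) powr (- 3)" unfolding powr_square by simp
      also have "\<dots> = 1 / (2 ^ ?j) ^ 3" by (simp add: powr_minus powr_numeral divide_inverse)
      finally have c: "?c\<^sup>2 = 1 / (2 ^ ?j) ^ 3" .
      have "(2::real) ^ J \<le> 2 ^ ?j" by (intro power_increasing) auto
      then have "2 ^ ?j + real N \<le> 3 * 2 ^ ?j" using NJ by linarith
      moreover have "real ?j + 1 \<le> (real J + 1) * (real i + 1)" by (simp add: algebra_simps)
      ultimately have "(2 ^ ?j + real N) * (real ?j + 1) \<le> (3 * 2 ^ ?j) * ((real J + 1) * (real i + 1))"
        by (intro mult_mono) auto
      then have "(1 / (2 ^ ?j) ^ 3 * 2 ^ ?j) * ((2 ^ ?j + real N) * (real ?j + 1)) \<le> (1 / (2 ^ ?j) ^ 3 * 2 ^ ?j) * ((3 * 2 ^ ?j) * ((real J + 1) * (real i + 1)))"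
        by (intro mult_left_mono) auto
      also have "\<dots> = 3 / 2 ^ ?j * ((real J + 1) * (real i + 1))"
      proof -
        have "(1 / y ^ 3 * y) * ((3 * y) * b) = 3 / y * b" if "y > 0" for y b :: real
          using that by (simp add: field_simps power3_eq_cube)
        then show ?thesis by simp
      qed
      finally show "?c\<^sup>2 * 2 ^ ?j * (2 ^ ?j + real N) * (real ?j + 1) \<le> 3 / 2 ^ ?j * ((real J + 1) * (real i + 1))"
        unfolding c by (simp only: mult.assoc)
    qed
    also have "sieve_const * (3 / 2 ^ ?j * ((real J + 1) * (real i + 1))) = (3 * sieve_const) * ((real J + 1) / 2 ^ J) * ((1 / 2 ^ i) * (real i + 1))"
      by (simp add: power_add)
    also have "sqrt \<dots> = sqrt (3 * sieve_const) * sqrt ((real J + 1) / 2 ^ J) * (r ^ i * sqrt (real i + 1))"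
      unfolding real_sqrt_mult r2 ..
    also have "\<dots> \<le> sqrt (3 * sieve_const) * sqrt ((real J + 1) / 2 ^ J) * (real (Suc i) * r ^ i)"
    proof (rule mult_left_mono)
      have "sqrt (real i + 1) \<le> real i + 1" by (rule real_le_lsqrt) (auto simp: power2_eq_square algebra_simps)
      then have "r ^ i * sqrt (real i + 1) \<le> r ^ i * (real i + 1)" using r by (intro mult_left_mono) auto
      then show "r ^ i * sqrt (real i + 1) \<le> real (Suc i) * r ^ i" by (simp add: mult.commute add.commute)
    qed (use sieve_const_pos in simp)
    finally show ?thesis .
  qed
  have fin: "L2_set (\<lambda>k. norm (\<Sum>i<M. block_sum k s (J + i))) A \<le> ?B" for M
  proof -
    have "L2_set (\<lambda>k. norm (\<Sum>i<M. block_sum k s (J + i))) A \<le> (\<Sum>i<M. L2_set (\<lambda>k. norm (block_sum k s (J + i))) A)"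
      by (rule L2_set_sum_le) simp
    also have "\<dots> \<le> (\<Sum>i<M. sqrt (3 * sieve_const) * sqrt ((real J + 1) / 2 ^ J) * (real (Suc i) * r ^ i))"
      by (rule sum_mono[OF bl])
    also have "\<dots> = sqrt (3 * sieve_const) * sqrt ((real J + 1) / 2 ^ J) * (\<Sum>i<M. real (Suc i) * r ^ i)"
      by (rule sum_distrib_left[symmetric])
    also have "\<dots> \<le> ?B"
    proof (rule mult_left_mono)
      show "(\<Sum>i<M. real (Suc i) * r ^ i) \<le> 1 / (1 - r)\<^sup>2"
        using sum_le_suminf[OF sums_summable[OF geo], of "{..<M}"] r unfolding sums_unique[OF geo, symmetric] by simp
    qed (use sieve_const_pos in simp)
    finally show ?thesis .
  qed
  have lim: "(\<lambda>M. L2_set (\<lambda>k. norm (\<Sum>i<M. block_sum k s (J + i))) A) \<longlonglongrightarrow> L2_set (\<lambda>k. norm (hecke_ext k s - partial_sum J k s)) A"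
    unfolding L2_set_def
  proof (intro tendsto_intros)
    fix k assume "k \<in> A"
    then have "k > 0" using A by auto
    then have "block_sum k s sums hecke_ext k s" using s by (intro block_sum_sums) auto
    then have "(\<lambda>i. block_sum k s (i + J)) sums (hecke_ext k s - partial_sum J k s)"
      unfolding partial_sum_def by (subst sums_iff_shift) simp
    then show "(\<lambda>M. \<Sum>i<M. block_sum k s (J + i)) \<longlonglongrightarrow> hecke_ext k s - partial_sum J k s"
      by (simp add: sums_def add.commute)
  qed
  have "L2_set (\<lambda>k. norm (hecke_ext k s - partial_sum J k s)) A \<le> ?B"
    by (rule LIMSEQ_le_const2[OF lim]) (use fin in blast)
  then have "2 ^ J * L2_set (\<lambda>k. norm (hecke_ext k s - partial_sum J k s)) A \<le> 2 ^ J * ?B" by (intro mult_left_mono) auto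
  also have "\<dots> = tail_const * (2 ^ J * sqrt ((real J + 1) / 2 ^ J))" by (simp add: tail_const_def r_def)
  also have "2 ^ J * sqrt ((real J + 1) / 2 ^ J) = sqrt (2 ^ J * (real J + 1))"
  proof -
    have "x * sqrt (b / x) = sqrt (x * b)" if "x > 0" for x b :: real
      using that by (simp add: real_sqrt_divide real_sqrt_mult field_simps)
    then show ?thesis by simp
  qed
  finally show ?thesis .
qed

end


section \<open>Growth in vertical strips and the maximum modulus principle\<close>

lemma norm_Gamma_strip:
  fixes a :: complex
  assumes a: "1 / 4 \<le> Re a" "Re a \<le> 2"
  shows "norm (Gamma a) \<le> Re (Gamma (1 / 4)) + Re (Gamma 2)"
proof -
  let ?g = "\<lambda>a x. exp (a * complex_of_real x - of_real (exp x))"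
  have int: "integrable lborel (?g b)" "(\<integral>x. ?g b x \<partial>lborel) = Gamma b" if "Re b > 0" for b
    using mellin_exp[OF that] by auto
  have Re: "integrable lborel (\<lambda>x. Re (?g b x))" "(\<integral>x. Re (?g b x) \<partial>lborel) = Re (Gamma b)" if "Re b > 0" for b
    using int[OF that] by simp_all
  have "norm (Gamma a) \<le> (\<integral>x. norm (?g a x) \<partial>lborel)"
  proof -
    have "Re a > 0" using a by linarith
    from int(2)[OF this] show ?thesis by (metis integral_norm_bound)
  qed
  also have "\<dots> \<le> (\<integral>x. Re (?g (1 / 4) x) + Re (?g 2 x) \<partial>lborel)"
  proof (rule integral_mono)
    show "integrable lborel (\<lambda>x. norm (?g a x))" by (rule integrable_norm[OF int(1)]) (use a in simp)
    show "integrable lborel (\<lambda>x. Re (?g (1 / 4) x) + Re (?g 2 x))" by (intro Bochner_Integration.integrable_add Re) auto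
    fix x :: real
    \<comment> \<open>On each half line one of the extreme exponents \<open>1 / 4\<close> and
      \<open>2\<close> dominates, which makes the bound independent of the imaginary part.\<close>
    have "exp (Re a * x) \<le> exp (x / 4) + exp (2 * x)"
    proof (cases "x \<ge> 0")
      case True
      then have "exp (Re a * x) \<le> exp (2 * x)" using a by (simp add: mult_right_mono)
      then show ?thesis using exp_ge_zero[of "x / 4"] by linarith
    next
      case False
      then have "exp (Re a * x) \<le> exp (1 / 4 * x)" using a by (simp only: exp_le_cancel_iff) (rule mult_right_mono_neg, auto)
      then have "exp (Re a * x) \<le> exp (x / 4)" by (simp only: mult_1 times_divide_eq_left)
      then show ?thesis using exp_ge_zero[of "2 * x"] by linarith
    qed
    then have "exp (Re a * x) * exp (- exp x) \<le> (exp (x / 4) + exp (2 * x)) * exp (- exp x)" by (intro mult_right_mono) auto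
    then show "norm (?g a x) \<le> Re (?g (1 / 4) x) + Re (?g 2 x)"
      by (simp add: Re_exp distrib_right mult_exp_exp)
  qed
  also have "\<dots> = Re (Gamma (1 / 4)) + Re (Gamma 2)"
    using Re[of "1 / 4"] Re[of 2] by (subst Bochner_Integration.integral_add) auto
  finally show ?thesis .
qed

lemma norm_sin_le_exp: "norm (sin z) \<le> exp (norm z)" for z :: complex
proof -
  have "norm (exp (\<i> * z)) \<le> exp (norm z)" "norm (exp (- (\<i> * z))) \<le> exp (norm z)"
    using norm_exp[of "\<i> * z"] norm_exp[of "- (\<i> * z)"] by (simp_all add: norm_mult)
  moreover have "norm (sin z) = norm (exp (\<i> * z) - exp (- (\<i> * z))) / 2"
    by (simp add: sin_exp_eq norm_divide norm_mult)
  ultimately show ?thesis using norm_triangle_ineq4[of "exp (\<i> * z)" "exp (- (\<i> * z))"] by linarith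
qed

text \<open>Reflection moves the argument to \<open>1 - a\<close>, whose real part lies between
  \<open>1 / 4\<close> and \<open>2\<close>, where \<open>Gamma\<close> is bounded; the exponential
  growth is that of the sine.\<close>

lemma norm_rGamma_strip:
  "\<exists>B\<ge>0. \<forall>a::complex. - 1 \<le> Re a \<and> Re a \<le> 3 / 4 \<longrightarrow> norm (rGamma a) \<le> B * exp (pi * norm a)"
proof -
  define G where "G = Re (Gamma (1 / 4)) + Re (Gamma 2)"
  have G0: "G \<ge> 0" using order_trans[OF norm_ge_zero norm_Gamma_strip[of 1]] by (simp add: G_def)
  have "norm (rGamma a) \<le> G / pi * exp (pi * norm a)" if a: "- 1 \<le> Re a" "Re a \<le> 3 / 4" for a :: complex
  proof -
    have "1 - a \<notin> \<int>\<^sub>\<le>\<^sub>0" using a by (auto elim!: nonpos_Ints_cases simp: complex_eq_iff)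
    then have "Gamma (1 - a) * rGamma (1 - a) = 1" by (simp add: Gamma_def rGamma_eq_zero_iff)
    then have "rGamma a = (rGamma a * rGamma (1 - a)) * Gamma (1 - a)" by (simp add: mult_ac)
    then have "norm (rGamma a) = norm (sin (of_real pi * a)) / pi * norm (Gamma (1 - a))"
      unfolding rGamma_reflection_complex by (simp only: norm_mult norm_divide norm_of_real abs_of_pos[OF pi_gt_zero])
    also have "\<dots> \<le> exp (pi * norm a) / pi * G"
      using norm_sin_le_exp[of "of_real pi * a"] norm_Gamma_strip[of "1 - a"] a
      by (intro mult_mono divide_right_mono) (auto simp: norm_mult G_def)
    finally show ?thesis by (simp add: mult_ac)
  qed
  then show ?thesis using G0 by (intro exI[of _ "G / pi"]) auto
qed

text \<open>On a sufficiently tall rectangle the horizontal sides contribute less than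
  \<open>e\<close>, so the vertical edges decide. Letting \<open>e\<close> tend to zero removes the
  excess.\<close>

lemma maximum_modulus_strip:
  fixes f :: "complex \<Rightarrow> complex"
  assumes hol: "f holomorphic_on {w. \<bar>Re w\<bar> < 2}"
    and edge: "\<And>w. \<bar>Re w\<bar> = 1 \<Longrightarrow> norm (f w) \<le> B"
    and decay: "\<And>w. \<bar>Re w\<bar> \<le> 1 \<Longrightarrow> norm (f w) \<le> M \<bar>Im w\<bar>" "(M \<longlongrightarrow> 0) at_top"
  shows "norm (f 0) \<le> B"
proof (rule field_le_epsilon)
  fix e :: real assume e: "e > 0"
  have B0: "B \<ge> 0" by (rule order_trans[OF norm_ge_zero edge[of 1]]) simp
  have "eventually (\<lambda>R. M R < e) at_top" using decay(2) e by (rule order_tendstoD)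
  then obtain R0 where R0: "\<And>R. R \<ge> R0 \<Longrightarrow> M R < e" unfolding eventually_at_top_linorder by blast
  define R where "R = max R0 1"
  define S where "S = cbox (Complex (- 1) (- R)) (Complex 1 R)"
  have S: "w \<in> S \<longleftrightarrow> \<bar>Re w\<bar> \<le> 1 \<and> \<bar>Im w\<bar> \<le> R" for w
    by (auto simp: S_def in_cbox_complex_iff)
  have sub: "S \<subseteq> {w. \<bar>Re w\<bar> < 2}" using S by auto
  show "norm (f 0) \<le> B + e"
  proof (rule maximum_modulus_frontier[of f S])
    show "f holomorphic_on interior S" by (rule holomorphic_on_subset[OF hol]) (use sub interior_subset in blast)
    have "closure S = S" by (simp add: S_def)
    then show "continuous_on (closure S) f"
      using holomorphic_on_imp_continuous_on[OF holomorphic_on_subset[OF hol sub]] by simp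
    show "bounded S" by (simp add: S_def bounded_cbox)
    show "0 \<in> S" using S by (simp add: R_def)
    fix w assume "w \<in> frontier S"
    then have w: "w \<in> S" "w \<notin> box (Complex (- 1) (- R)) (Complex 1 R)"
      by (auto simp: S_def frontier_def)
    then consider "\<bar>Re w\<bar> = 1" | "\<bar>Im w\<bar> = R" "\<bar>Re w\<bar> \<le> 1"
      unfolding S in_box_complex_iff by fastforce
    then show "norm (f w) \<le> B + e"
    proof cases
      case 1
      then show ?thesis using edge[of w] e by linarith
    next
      case 2
      then show ?thesis using decay(1)[of w] R0[of R] B0 by (simp add: R_def)
    qed
  qed
qed

text \<open>The family is paired with its own values at \<open>0\<close>, which reduces the claim to one scalar function.\<close>

lemma maximum_modulus_strip_L2:
  fixes f :: "'a \<Rightarrow> complex \<Rightarrow> complex"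
  assumes hol: "\<And>k. k \<in> A \<Longrightarrow> f k holomorphic_on {w. \<bar>Re w\<bar> < 2}"
    and edge: "\<And>w. \<bar>Re w\<bar> = 1 \<Longrightarrow> L2_set (\<lambda>k. norm (f k w)) A \<le> B"
    and decay: "\<And>k. k \<in> A \<Longrightarrow> \<exists>M. (\<forall>w. \<bar>Re w\<bar> \<le> 1 \<longrightarrow> norm (f k w) \<le> M \<bar>Im w\<bar>) \<and> (M \<longlongrightarrow> 0) at_top"
  shows "L2_set (\<lambda>k. norm (f k 0)) A \<le> B"
proof -
  define h where "h w = (\<Sum>k\<in>A. cnj (f k 0) * f k w)" for w
  define n0 where "n0 = L2_set (\<lambda>k. norm (f k 0)) A"
  have n0: "n0 \<ge> 0" by (simp add: n0_def)
  obtain M where M: "\<And>k w. k \<in> A \<Longrightarrow> \<bar>Re w\<bar> \<le> 1 \<Longrightarrow> norm (f k w) \<le> M k \<bar>Im w\<bar>" "\<And>k. k \<in> A \<Longrightarrow> (M k \<longlongrightarrow> 0) at_top"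
    using decay by metis
  have "norm (h 0) \<le> n0 * B"
  proof (rule maximum_modulus_strip)
    show "h holomorphic_on {w. \<bar>Re w\<bar> < 2}" unfolding h_def by (intro holomorphic_intros hol)
    fix w :: complex assume w: "\<bar>Re w\<bar> = 1"
    have "norm (h w) \<le> (\<Sum>k\<in>A. \<bar>norm (f k 0)\<bar> * \<bar>norm (f k w)\<bar>)"
      unfolding h_def by (rule order_trans[OF norm_sum]) (simp add: norm_mult)
    also have "\<dots> \<le> n0 * L2_set (\<lambda>k. norm (f k w)) A" unfolding n0_def by (rule L2_set_mult_ineq)
    also have "\<dots> \<le> n0 * B" using edge[OF w] n0 by (rule mult_left_mono)
    finally show "norm (h w) \<le> n0 * B" .
  next
    fix w :: complex assume w: "\<bar>Re w\<bar> \<le> 1"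
    have "norm (h w) \<le> (\<Sum>k\<in>A. norm (f k 0) * norm (f k w))"
      unfolding h_def by (rule order_trans[OF norm_sum]) (simp add: norm_mult)
    also have "\<dots> \<le> (\<Sum>k\<in>A. norm (f k 0) * M k \<bar>Im w\<bar>)" using M(1)[OF _ w] by (intro sum_mono mult_left_mono) auto
    finally show "norm (h w) \<le> (\<lambda>R. \<Sum>k\<in>A. norm (f k 0) * M k R) \<bar>Im w\<bar>" .
  next
    have "((\<lambda>R. \<Sum>k\<in>A. norm (f k 0) * M k R) \<longlongrightarrow> (\<Sum>k\<in>A. norm (f k 0) * 0)) at_top"
      by (intro tendsto_intros M(2))
    then show "((\<lambda>R. \<Sum>k\<in>A. norm (f k 0) * M k R) \<longlongrightarrow> 0) at_top" by simp
  qed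
  moreover have "h 0 = of_real (n0\<^sup>2)"
  proof -
    have "h 0 = (\<Sum>k\<in>A. of_real ((norm (f k 0))\<^sup>2))"
      unfolding h_def by (intro sum.cong refl) (metis complex_norm_square mult.commute of_real_power)
    also have "\<dots> = of_real (n0\<^sup>2)" by (simp add: n0_def L2_set_def sum_nonneg)
    finally show ?thesis .
  qed
  ultimately have le: "n0 * n0 \<le> n0 * B" by (simp add: power2_eq_square norm_mult)
  have "B \<ge> 0" by (rule order_trans[OF L2_set_nonneg edge[of 1]]) simp
  then show ?thesis using le n0 unfolding n0_def[symmetric] by (cases "n0 = 0") auto
qed

context quad_unit
begin

text \<open>A crude bound, with a constant depending on \<open>k\<close>, whose purpose is to
  justify the maximum principle against the factor \<open>exp (w^2)\<close>. Two reciprocal gamma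
  functions at half arguments grow together like \<open>exp (pi * norm z)\<close>, and
  \<open>4 > pi\<close>.\<close>

lemma strip_growth:
  "\<exists>G\<ge>0. \<forall>z. - (1 / 2) \<le> Re z \<and> Re z \<le> 3 / 2 \<longrightarrow>
     norm (hecke_ext k z) \<le> G * exp (4 * norm z) \<and> norm (chi_quad k z) \<le> G * exp (4 * norm z)"
proof -
  define i\<kappa> where "i\<kappa> = \<i> * complex_of_real (hecke_freq k)"
  have ni: "Re i\<kappa> = 0" by (simp add: i\<kappa>_def)
  obtain B where B: "B \<ge> 0" "\<And>a::complex. - 1 \<le> Re a \<Longrightarrow> Re a \<le> 3 / 4 \<Longrightarrow> norm (rGamma a) \<le> B * exp (pi * norm a)"
    using norm_rGamma_strip by blast
  define G where "G = Re (Gamma (1 / 4)) + Re (Gamma 2)"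
  have G0: "G \<ge> 0" using order_trans[OF norm_ge_zero norm_Gamma_strip[of 1]] by (simp add: G_def)
  obtain L where L: "\<And>s. Re s \<le> 3 / 2 \<Longrightarrow> norm (half_lambda k s) \<le> L" using half_lambda_bound[of "3 / 2" k] by blast
  have L0: "L \<ge> 0" by (rule order_trans[OF norm_ge_zero L[of 0]]) simp
  define E where "E = exp (2 * \<bar>log_cond\<bar>)"
  have E0: "E \<ge> 0" by (simp add: E_def)
  have rG: "norm (rGamma ((z - i\<kappa>) / 2) * rGamma ((z + i\<kappa>) / 2)) \<le> B\<^sup>2 * exp (pi * norm i\<kappa>) * exp (4 * norm z)"
    if z: "- (1 / 2) \<le> Re z" "Re z \<le> 3 / 2" for z
  proof -
    have a: "norm ((z - i\<kappa>) / 2) \<le> (norm z + norm i\<kappa>) / 2" "norm ((z + i\<kappa>) / 2) \<le> (norm z + norm i\<kappa>) / 2"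
      using norm_triangle_ineq4[of z i\<kappa>] norm_triangle_ineq[of z i\<kappa>] by (auto simp: norm_divide)
    have e: "B * exp (pi * norm a) \<le> B * exp (pi * ((norm z + norm i\<kappa>) / 2))" if "norm a \<le> (norm z + norm i\<kappa>) / 2" for a :: complex
      using that B(1) by (intro mult_left_mono) auto
    have "norm (rGamma ((z - i\<kappa>) / 2)) \<le> B * exp (pi * ((norm z + norm i\<kappa>) / 2))"
      by (rule order_trans[OF B(2) e[OF a(1)]]) (use z ni in auto)
    moreover have "norm (rGamma ((z + i\<kappa>) / 2)) \<le> B * exp (pi * ((norm z + norm i\<kappa>) / 2))"
      by (rule order_trans[OF B(2) e[OF a(2)]]) (use z ni in auto)
    ultimately have "norm (rGamma ((z - i\<kappa>) / 2) * rGamma ((z + i\<kappa>) / 2)) \<le> (B * exp (pi * ((norm z + norm i\<kappa>) / 2))) * (B * exp (pi * ((norm z + norm i\<kappa>) / 2)))"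
      unfolding norm_mult using B(1) by (intro mult_mono) auto
    also have "\<dots> = B\<^sup>2 * exp (pi * norm i\<kappa>) * exp (pi * norm z)"
    proof -
      have "exp (pi * ((norm z + norm i\<kappa>) / 2)) * exp (pi * ((norm z + norm i\<kappa>) / 2)) = exp (pi * norm i\<kappa>) * exp (pi * norm z)"
        unfolding mult_exp_exp by (simp add: field_simps)
      then show ?thesis by (simp add: power2_eq_square mult_ac)
    qed
    also have "\<dots> \<le> B\<^sup>2 * exp (pi * norm i\<kappa>) * exp (4 * norm z)"
      using pi_less_4 by (intro mult_left_mono) (auto intro: mult_right_mono)
    finally show ?thesis .
  qed
  let ?E1 = "(L + L) * E * (B\<^sup>2 * exp (pi * norm i\<kappa>))" and ?E2 = "4 * E * (G * G) * (B\<^sup>2 * exp (pi * norm i\<kappa>))"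
  have 1: "norm (hecke_ext k z) \<le> ?E1 * exp (4 * norm z)" if z: "- (1 / 2) \<le> Re z" "Re z \<le> 3 / 2" for z
  proof -
    have "norm (half_lambda k z + half_lambda k (1 - z)) \<le> L + L"
      using norm_triangle_mono[OF L L, of z "1 - z"] z by simp
    moreover have "norm (exp (z * of_real log_cond)) \<le> E"
    proof -
      have "Re z * log_cond \<le> \<bar>Re z\<bar> * \<bar>log_cond\<bar>" by (metis abs_ge_self abs_mult)
      also have "\<dots> \<le> 2 * \<bar>log_cond\<bar>" using z by (intro mult_right_mono) auto
      finally show ?thesis by (simp add: E_def)
    qed
    ultimately have "norm (hecke_ext k z) \<le> (L + L) * E * (B\<^sup>2 * exp (pi * norm i\<kappa>) * exp (4 * norm z))"
      unfolding hecke_ext_def norm_mult[of "_ * _"] norm_mult[of "half_lambda k z + half_lambda k (1 - z)"] i\<kappa>_def[symmetric]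
      using rG[OF z] L0 E0 by (intro mult_mono) auto
    then show ?thesis by (simp add: mult_ac)
  qed
  have 2: "norm (chi_quad k z) \<le> ?E2 * exp (4 * norm z)" if z: "- (1 / 2) \<le> Re z" "Re z \<le> 3 / 2" for z
  proof -
    have e: "norm (exp ((2 * z - 1) * of_real log_cond)) \<le> E"
    proof -
      have "(2 * Re z - 1) * log_cond \<le> \<bar>2 * Re z - 1\<bar> * \<bar>log_cond\<bar>" by (metis abs_ge_self abs_mult)
      also have "\<dots> \<le> 2 * \<bar>log_cond\<bar>" using z by (intro mult_right_mono) auto
      finally show ?thesis by (simp add: E_def)
    qed
    have g: "norm (Gamma ((3 - z + i\<kappa>) / 2) * Gamma ((3 - z - i\<kappa>) / 2)) \<le> G * G"
      unfolding norm_mult G_def by (intro mult_mono norm_Gamma_strip) (use z ni G0[unfolded G_def] in auto)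
    have "norm (chi_quad k z) = 4 * norm (exp ((2 * z - 1) * of_real log_cond)) * norm (Gamma ((3 - z + i\<kappa>) / 2) * Gamma ((3 - z - i\<kappa>) / 2))
       * norm (rGamma ((z - i\<kappa>) / 2) * rGamma ((z + i\<kappa>) / 2))"
      unfolding chi_quad_def i\<kappa>_def[symmetric] by (simp only: norm_mult norm_numeral)
    also have "\<dots> \<le> 4 * E * (G * G) * (B\<^sup>2 * exp (pi * norm i\<kappa>) * exp (4 * norm z))"
      using e g rG[OF z] G0 E0 by (intro mult_mono) auto
    finally show ?thesis by (simp add: mult_ac)
  qed
  show ?thesis
  proof (intro exI[of _ "?E1 + ?E2"] conjI allI impI)
    have p: "?E1 \<ge> 0" "?E2 \<ge> 0" using L0 E0 G0 by auto
    then show "?E1 + ?E2 \<ge> 0" by simp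
    fix z assume "- (1 / 2) \<le> Re z \<and> Re z \<le> 3 / 2"
    then show "norm (hecke_ext k z) \<le> (?E1 + ?E2) * exp (4 * norm z)" "norm (chi_quad k z) \<le> (?E1 + ?E2) * exp (4 * norm z)"
      using 1[of z] 2[of z] p mult_nonneg_nonneg[OF p(1) exp_ge_zero[of "4 * norm z"]] mult_nonneg_nonneg[OF p(2) exp_ge_zero[of "4 * norm z"]]
      unfolding distrib_right by linarith+
  qed
qed

end


text \<open>On the edges, with \<open>v = |Im w|\<close>, the ratio of \<open>shift_quad\<close>
  costs \<open>(3 + 2 * v)^2\<close> and the gamma quotient at \<open>Re w = - 1\<close> costs
  another \<open>(1 + v)^2\<close>. Both are absorbed by the factor \<open>exp (- v^2)\<close> of
  \<open>exp (w^2)\<close>.\<close>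

lemma poly_exp_bounds:
  fixes v :: real
  assumes v: "v \<ge> 0"
  shows "(3 + 2 * v)\<^sup>2 \<le> 18 * exp (v\<^sup>2)" "(3 + 2 * v)\<^sup>2 * (1 + v)\<^sup>2 \<le> 72 * exp (v\<^sup>2)"
proof -
  define y a b where "y = v\<^sup>2" and "a = (3 + 2 * v)\<^sup>2" and "b = (1 + v)\<^sup>2"
  have e: "1 + y \<le> exp y" by (rule exp_ge_add_one_self)
  have y: "y \<ge> 0" by (simp add: y_def)
  have "0 \<le> (v - 1)\<^sup>2" by simp
  then have v2: "2 * v \<le> 1 + y" by (simp add: y_def power2_eq_square algebra_simps)
  have a: "a = 9 + 12 * v + 4 * y" and b: "b = 1 + 2 * v + y"
    by (simp_all add: y_def a_def b_def power2_eq_square algebra_simps)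
  have "a \<le> 18 * (1 + y)" using a v2 y by argo
  then show "(3 + 2 * v)\<^sup>2 \<le> 18 * exp (v\<^sup>2)" unfolding a_def[symmetric] y_def[symmetric] using e by argo
  have b1: "b \<le> 2 * (1 + y)" using b v2 by argo
  have b0: "b \<ge> 0" by (simp add: b_def)
  have "a \<le> 9 * b" using a b v y by linarith
  then have "a * b \<le> (9 * b) * b" using b0 by (intro mult_right_mono)
  also have "\<dots> \<le> (9 * (2 * (1 + y))) * (2 * (1 + y))"
    using b1 b0 y by (intro mult_mono mult_left_mono) auto
  also have "\<dots> = 36 * (1 + 2 * y + y\<^sup>2)" by (simp add: power2_eq_square algebra_simps)
  also have "\<dots> \<le> 36 * (2 * exp y)" using exp_lower_Taylor_quadratic[OF y] y by argo
  finally show "(3 + 2 * v)\<^sup>2 * (1 + v)\<^sup>2 \<le> 72 * exp (v\<^sup>2)" unfolding a_def b_def y_def by simp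
qed

section \<open>The error of the sharp approximate functional equation\<close>

context quad_unit
begin

lemma hecke_freq_nonneg: "hecke_freq k \<ge> 0"
  using log_unit_pos by (simp add: hecke_freq_def)

text \<open>Both linear factors at \<open>s\<close> have real part \<open>- 1 / 2\<close>, hence
  modulus at least \<open>1 / 2\<close>; moving by \<open>w\<close> therefore multiplies each by at
  most \<open>1 + 2 * norm w\<close>.\<close>

lemma shift_quad_ratio:
  assumes s: "Re s = 1 / 2"
  shows "norm (shift_quad k (s + w)) \<le> norm (shift_quad k s) * (1 + 2 * norm w)\<^sup>2"
proof -
  have 1: "norm (s + w - 1 + c) \<le> norm (s - 1 + c) * (1 + 2 * norm w)" if "Re c = 0" for c
  proof -
    have "1 / 2 \<le> norm (s - 1 + c)" using abs_Re_le_cmod[of "s - 1 + c"] s that by simp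
    then have "1 / 2 * (2 * norm w) \<le> norm (s - 1 + c) * (2 * norm w)" by (rule mult_right_mono) simp
    moreover have "norm (s + w - 1 + c) \<le> norm (s - 1 + c) + norm w"
      using norm_triangle_ineq[of "s - 1 + c" w] by (simp add: algebra_simps)
    ultimately show ?thesis by (simp add: distrib_left)
  qed
  have "norm (shift_quad k (s + w)) \<le> (norm (s - 1 + \<i> * of_real (hecke_freq k)) * (1 + 2 * norm w)) * (norm (s - 1 - \<i> * of_real (hecke_freq k)) * (1 + 2 * norm w))"
    unfolding shift_quad_eq norm_mult[of "_ + _"] using 1[of "\<i> * of_real (hecke_freq k)"] 1[of "- (\<i> * of_real (hecke_freq k))"]
    by (intro mult_mono) auto
  also have "\<dots> = norm (shift_quad k s) * (1 + 2 * norm w)\<^sup>2"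
    unfolding shift_quad_eq norm_mult[of "_ + _"] by (simp only: power2_eq_square mult_ac)
  finally show ?thesis .
qed

text \<open>This is where the restriction on \<open>t\<close> acts: both zeros of the quadratic stay
  at vertical distance at least \<open>hecke_freq k / 2\<close> from \<open>s\<close>.\<close>

lemma shift_quad_lower:
  assumes "\<bar>Im s\<bar> \<le> hecke_freq k / 2"
  shows "(hecke_freq k)\<^sup>2 / 4 \<le> norm (shift_quad k s)"
proof -
  have "hecke_freq k / 2 \<le> norm (s - 1 + \<i> * of_real (hecke_freq k))" "hecke_freq k / 2 \<le> norm (s - 1 - \<i> * of_real (hecke_freq k))"
    using abs_Im_le_cmod[of "s - 1 + \<i> * of_real (hecke_freq k)"] abs_Im_le_cmod[of "s - 1 - \<i> * of_real (hecke_freq k)"] assms hecke_freq_nonneg[of k]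
    by auto
  then have "hecke_freq k / 2 * (hecke_freq k / 2) \<le> norm (s - 1 + \<i> * of_real (hecke_freq k)) * norm (s - 1 - \<i> * of_real (hecke_freq k))"
    using hecke_freq_nonneg[of k] by (intro mult_mono) auto
  then show ?thesis unfolding shift_quad_eq norm_mult by (simp add: power2_eq_square)
qed

lemma chi_quad_holomorphic: "chi_quad k holomorphic_on {z. Re z < 3}"
proof -
  have "(3 - z + c) / 2 \<notin> \<int>\<^sub>\<le>\<^sub>0" if "Re z < 3" "Re c = 0" for z c :: complex
  proof
    assume "(3 - z + c) / 2 \<in> \<int>\<^sub>\<le>\<^sub>0"
    then obtain n :: int where "(3 - z + c) / 2 = of_int n" "n \<le> 0" by (elim nonpos_Ints_cases) auto
    then have "Re ((3 - z + c) / 2) \<le> 0" by simp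
    then show False using that by simp
  qed
  from this[of _ "\<i> * of_real (hecke_freq k)"] this[of _ "- (\<i> * of_real (hecke_freq k))"] show ?thesis
    unfolding chi_quad_def by (intro holomorphic_intros) auto
qed

text \<open>At \<open>w = 0\<close> this is the error of the sharp approximate functional equation. By the functional equation its
  first factor also equals \<open>chi_quad * (tail at 1 - s - w) - shift_quad * (partial sum at s + w)\<close>, the form used
  for \<open>Re w = - 1\<close>.\<close>

definition afe_error :: "nat \<Rightarrow> complex \<Rightarrow> nat \<Rightarrow> complex \<Rightarrow> complex" where
  "afe_error J s k w = (shift_quad k (s + w) * (hecke_ext k (s + w) - partial_sum J k (s + w)) - chi_quad k (s + w) * partial_sum J k (1 - (s + w))) *
     exp (w * of_real (ln (2 ^ J)) + w\<^sup>2) / shift_quad k s"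

lemma afe_error_holomorphic:
  assumes s: "Re s = 1 / 2"
  shows "afe_error J s k holomorphic_on {w. \<bar>Re w\<bar> < 2}"
proof -
  have l: "(\<lambda>w. s + w) holomorphic_on {w. \<bar>Re w\<bar> < 2}" "(\<lambda>w. 1 - (s + w)) holomorphic_on {w. \<bar>Re w\<bar> < 2}"
    by (intro holomorphic_intros)+
  have c: "(\<lambda>w. f (g w)) holomorphic_on {w. \<bar>Re w\<bar> < 2}"
    if "f holomorphic_on B" "g holomorphic_on {w. \<bar>Re w\<bar> < 2}" "g ` {w. \<bar>Re w\<bar> < 2} \<subseteq> B" for f g :: "complex \<Rightarrow> complex" and B
    using holomorphic_on_compose_gen[OF that(2,1,3)] by (simp add: o_def)
  show ?thesis
    unfolding afe_error_def divide_inverse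
    by (intro holomorphic_intros c[OF hecke_ext_holomorphic l(1)] c[OF partial_sum_holomorphic[of J k UNIV] l(1)]
        c[OF partial_sum_holomorphic[of J k UNIV] l(2)] c[OF chi_quad_holomorphic l(1)] c[of "shift_quad k" UNIV, OF _ l(1)])
      (use s in \<open>auto simp: shift_quad_def[abs_def] intro!: holomorphic_intros\<close>)
qed

lemma afe_error_0:
  assumes "shift_quad k s \<noteq> 0"
  shows "afe_error J s k 0 = hecke_ext k s - partial_sum J k s - chi_quad k s / shift_quad k s * partial_sum J k (1 - s)"
  using assms by (simp add: afe_error_def field_simps)

lemma norm_partial_sum_strip:
  "\<exists>p\<ge>0. \<forall>z. Re z \<ge> - 1 \<longrightarrow> norm (partial_sum J k z) \<le> p"
proof (intro exI[of _ "\<Sum>j<J. \<Sum>z\<in>norm_block j. abs_norm z"] conjI allI impI)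
  show "0 \<le> (\<Sum>j<J. \<Sum>z\<in>norm_block j. abs_norm z)" by (intro sum_nonneg) auto
  fix s assume s: "Re s \<ge> - 1"
  have "norm (dirichlet_term k s z) \<le> abs_norm z" if "z \<in> norm_block j" for z j
  proof -
    have z: "z \<noteq> 0" using that by (intro fdom_nonzero) (simp add: norm_block_def)
    have "abs_norm z powr (- Re s) \<le> abs_norm z powr 1" using abs_norm_ge_1[OF z] s by (intro powr_mono) auto
    then show ?thesis unfolding norm_dirichlet_term[OF z] using abs_norm_ge_1[OF z] by simp
  qed
  then show "norm (partial_sum J k s) \<le> (\<Sum>j<J. \<Sum>z\<in>norm_block j. abs_norm z)"
    unfolding partial_sum_def block_sum_def by (intro order_trans[OF norm_sum] sum_mono) auto
qed

lemma norm_exp_afe_error: "norm (exp (w * of_real (ln (2 ^ J)) + w\<^sup>2)) = (2 ^ J) powr (Re w) * exp ((Re w)\<^sup>2 - (Im w)\<^sup>2)"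
  by (simp add: exp_add norm_mult powr_def power2_eq_square)

text \<open>The numerator grows at most like \<open>exp (8 * |Im w|)\<close> on the strip, and
  \<open>exp (w^2)\<close> beats this. The majorant depends on \<open>k\<close>, \<open>J\<close>
  and \<open>s\<close>, which is harmless because only its limit is used.\<close>

lemma afe_error_decay:
  assumes s: "Re s = 1 / 2" and nz: "shift_quad k s \<noteq> 0"
  shows "\<exists>M. (\<forall>w. \<bar>Re w\<bar> \<le> 1 \<longrightarrow> norm (afe_error J s k w) \<le> M \<bar>Im w\<bar>) \<and> (M \<longlongrightarrow> 0) at_top"
proof -
  obtain G where G: "G \<ge> 0" "\<And>z. - (1 / 2) \<le> Re z \<Longrightarrow> Re z \<le> 3 / 2 \<Longrightarrow> norm (hecke_ext k z) \<le> G * exp (4 * norm z)"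
    "\<And>z. - (1 / 2) \<le> Re z \<Longrightarrow> Re z \<le> 3 / 2 \<Longrightarrow> norm (chi_quad k z) \<le> G * exp (4 * norm z)"
    using strip_growth[of k] by blast
  obtain p where p: "p \<ge> 0" "\<And>z. Re z \<ge> - 1 \<Longrightarrow> norm (partial_sum J k z) \<le> p" using norm_partial_sum_strip by blast
  define b where "b = norm (shift_quad k s)"
  have b: "b > 0" using nz by (simp add: b_def)
  define C where "C = (b * (G + p) + G * p) * 2 ^ J / b"
  define a where "a = norm s + 1"
  define M where "M R = C * exp (8 * (a + R) + 1 - R\<^sup>2)" for R
  show ?thesis
  proof (intro exI[of _ M] conjI allI impI)
    show "(M \<longlongrightarrow> 0) at_top" unfolding M_def by real_asymp
    fix w :: complex assume w: "\<bar>Re w\<bar> \<le> 1"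
    define R where "R = \<bar>Im w\<bar>"
    define e where "e = exp (4 * (a + R))"
    have e1: "e \<ge> 1" by (simp add: e_def a_def R_def)
    have nw: "norm w \<le> a + R" using cmod_le[of w] w norm_ge_zero[of s] unfolding a_def R_def by linarith
    have ns: "norm (s + w) \<le> a + R" using cmod_le[of w] w norm_triangle_ineq[of s w] unfolding a_def R_def by linarith
    have re: "- (1 / 2) \<le> Re (s + w)" "Re (s + w) \<le> 3 / 2" "Re (1 - (s + w)) \<ge> - 1" using s w by auto
    have ee: "exp (4 * norm (s + w)) \<le> e" unfolding e_def using ns by simp
    have L: "norm (hecke_ext k (s + w)) \<le> G * e" "norm (chi_quad k (s + w)) \<le> G * e"
      using G(2,3)[OF re(1,2)] mult_left_mono[OF ee G(1)] by linarith+
    have P: "norm (partial_sum J k (s + w)) \<le> p" "norm (partial_sum J k (1 - (s + w))) \<le> p" using p(2) re by auto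
    have "(1 + 2 * norm w)\<^sup>2 \<le> (exp (2 * norm w))\<^sup>2" by (intro power_mono exp_ge_add_one_self) auto
    also have "\<dots> = exp (4 * norm w)" by (simp flip: exp_double)
    also have "\<dots> \<le> e" unfolding e_def using nw by simp
    finally have "b * (1 + 2 * norm w)\<^sup>2 \<le> b * e" using b by (intro mult_left_mono) auto
    then have shift_quad: "norm (shift_quad k (s + w)) \<le> b * e" using shift_quad_ratio[OF s, of k w] unfolding b_def by linarith
    have Ge: "G * e \<ge> 0" using G(1) e1 by simp
    have "norm (shift_quad k (s + w) * (hecke_ext k (s + w) - partial_sum J k (s + w)) - chi_quad k (s + w) * partial_sum J k (1 - (s + w)))
      \<le> (b * e) * (G * e + p) + (G * e) * p"
    proof (rule order_trans[OF norm_triangle_ineq4], unfold norm_mult, intro add_mono mult_mono shift_quad L P)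
      show "norm (hecke_ext k (s + w) - partial_sum J k (s + w)) \<le> G * e + p"
        using norm_triangle_ineq4[of "hecke_ext k (s + w)" "partial_sum J k (s + w)"] L(1) P(1) by linarith
    qed (use b e1 Ge in auto)
    also have "\<dots> \<le> (b * e) * (G * e + p * e) + (G * e) * (p * e)"
      using b e1 Ge G(1) p(1) mult_left_mono[OF e1 p(1)] by (intro add_mono mult_left_mono) auto
    also have "\<dots> = (b * (G + p) + G * p) * (e * e)" by (simp add: algebra_simps)
    finally have num: "norm (shift_quad k (s + w) * (hecke_ext k (s + w) - partial_sum J k (s + w)) - chi_quad k (s + w) * partial_sum J k (1 - (s + w))) \<le> (b * (G + p) + G * p) * (e * e)" .
    have "(2 ^ J) powr (Re w) \<le> ((2::real) ^ J) powr 1" using w by (intro powr_mono) auto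
    moreover have "exp ((Re w)\<^sup>2 - (Im w)\<^sup>2) \<le> exp (1 - R\<^sup>2)" using w by (simp add: R_def abs_square_le_1)
    ultimately have ex: "norm (exp (w * of_real (ln (2 ^ J)) + w\<^sup>2)) \<le> 2 ^ J * exp (1 - R\<^sup>2)"
      unfolding norm_exp_afe_error by (intro mult_mono) auto
    have "norm (afe_error J s k w) \<le> (b * (G + p) + G * p) * (e * e) * (2 ^ J * exp (1 - R\<^sup>2)) / b"
      unfolding afe_error_def norm_divide b_def[symmetric] norm_mult[of "_ - _"] using num ex b G(1) p(1) e1
      by (intro divide_right_mono mult_mono) auto
    also have "\<dots> = C * (e * e * exp (1 - R\<^sup>2))" by (simp add: C_def)
    also have "e * e * exp (1 - R\<^sup>2) = exp (8 * (a + R) + 1 - R\<^sup>2)" unfolding e_def mult_exp_exp by (simp add: algebra_simps)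
    finally show "norm (afe_error J s k w) \<le> M \<bar>Im w\<bar>" unfolding M_def R_def .
  qed
qed

text \<open>\<open>left_const\<close> bounds the linear factors of
  \<open>(s + w)^2 + (hecke_freq k)^2\<close> by a multiple of \<open>N * (1 + v)\<close>; its
  \<open>3 / 2\<close> is the frequency itself plus half of it from \<open>Im s\<close>.
  \<open>right_const\<close> is \<open>4 * pi^2 / q\<close> divided by the lower bound for
  \<open>shift_quad\<close> in terms of \<open>N\<close>, times \<open>exp 1\<close> from
  \<open>exp (w^2)\<close>.\<close>

definition left_const :: real where "left_const = 1 + 3 * pi / (2 * log_unit)"
definition right_const :: real where "right_const = 64 * exp 1 * log_unit\<^sup>2 / real q"

lemma one_plus_norm_squared_le: "\<bar>Re w\<bar> \<le> 1 \<Longrightarrow> (1 + 2 * norm w)\<^sup>2 \<le> (3 + 2 * \<bar>Im w\<bar>)\<^sup>2"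
  using cmod_le[of w] by (intro power_mono) auto

text \<open>At \<open>Re w = 1\<close> the point \<open>s + w\<close> lies on the line
  \<open>3 / 2\<close>, where \<open>chi_quad\<close> has constant modulus, so division by
  \<open>shift_quad\<close> at \<open>s\<close> gains \<open>1 / N^2\<close>. The tail meets only
  the bounded ratio of two values of \<open>shift_quad\<close>.\<close>

lemma afe_error_right:
  assumes s: "Re s = 1 / 2" and t: "\<bar>Im s\<bar> \<le> hecke_freq k / 2" and k: "k > 0" and N: "N > 0" "real N \<le> 2 * real k" and w: "Re w = 1"
  shows "norm (afe_error J s k w) \<le> 18 * exp 1 * 2 ^ J * norm (hecke_ext k (s + w) - partial_sum J k (s + w))
     + right_const * 2 ^ J / (real N)\<^sup>2 * norm (partial_sum J k (1 - (s + w)))"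
proof -
  let ?T = "norm (hecke_ext k (s + w) - partial_sum J k (s + w))" and ?P = "norm (partial_sum J k (1 - (s + w)))"
  define b where "b = norm (shift_quad k s)"
  define v where "v = \<bar>Im w\<bar>"
  have kp: "pi * real N / (2 * log_unit) \<le> hecke_freq k"
    unfolding hecke_freq_def using N(2) log_unit_pos by (simp add: field_simps)
  then have "(pi * real N / (2 * log_unit))\<^sup>2 / 4 \<le> (hecke_freq k)\<^sup>2 / 4" using log_unit_pos by (intro divide_right_mono power_mono) auto
  then have bl: "(pi * real N / (2 * log_unit))\<^sup>2 / 4 \<le> b" using shift_quad_lower[OF t] unfolding b_def by linarith
  have "(pi * real N / (2 * log_unit))\<^sup>2 / 4 > 0" using N log_unit_pos by simp
  then have b: "b > 0" using bl by linarith
  have "norm (chi_quad k (s + w)) / b = 4 * pi\<^sup>2 / real q / b" using norm_chi_quad_three_halves[of "s + w" k] s w by simp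
  also have "\<dots> \<le> 4 * pi\<^sup>2 / real q / ((pi * real N / (2 * log_unit))\<^sup>2 / 4)"
    using bl N log_unit_pos by (intro divide_left_mono) (auto intro!: mult_pos_pos b)
  also have "\<dots> = 64 * log_unit\<^sup>2 / real q / (real N)\<^sup>2" using N log_unit_pos q_ge_5 by (simp add: power_divide power_mult_distrib field_simps)
  finally have ch: "norm (chi_quad k (s + w)) / b \<le> 64 * log_unit\<^sup>2 / real q / (real N)\<^sup>2" .
  have pr: "norm (shift_quad k (s + w)) / b \<le> (3 + 2 * v)\<^sup>2"
    using order_trans[OF shift_quad_ratio[OF s, of k w] mult_left_mono[OF one_plus_norm_squared_le, of w "norm (shift_quad k s)"]] w b
    by (simp add: divide_le_eq b_def v_def mult.commute)
  have "norm (afe_error J s k w) = norm (shift_quad k (s + w) * (hecke_ext k (s + w) - partial_sum J k (s + w)) - chi_quad k (s + w) * partial_sum J k (1 - (s + w))) / b * (2 ^ J * (exp 1 * exp (- v\<^sup>2)))"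
    unfolding afe_error_def norm_divide norm_mult[of "_ - _"] norm_exp_afe_error b_def[symmetric]
    using w by (simp add: v_def mult_exp_exp)
  also have "\<dots> \<le> (norm (shift_quad k (s + w)) / b * ?T + norm (chi_quad k (s + w)) / b * ?P) * (2 ^ J * (exp 1 * exp (- v\<^sup>2)))"
  proof (rule mult_right_mono)
    have "norm (shift_quad k (s + w) * (hecke_ext k (s + w) - partial_sum J k (s + w)) - chi_quad k (s + w) * partial_sum J k (1 - (s + w))) / b
       \<le> (norm (shift_quad k (s + w)) * ?T + norm (chi_quad k (s + w)) * ?P) / b"
      unfolding norm_mult[symmetric] using b by (intro divide_right_mono norm_triangle_ineq4) auto
    then show "norm (shift_quad k (s + w) * (hecke_ext k (s + w) - partial_sum J k (s + w)) - chi_quad k (s + w) * partial_sum J k (1 - (s + w))) / b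
       \<le> norm (shift_quad k (s + w)) / b * ?T + norm (chi_quad k (s + w)) / b * ?P" by (simp add: add_divide_distrib)
  qed simp
  also have "\<dots> \<le> ((3 + 2 * v)\<^sup>2 * ?T + 64 * log_unit\<^sup>2 / real q / (real N)\<^sup>2 * ?P) * (2 ^ J * (exp 1 * exp (- v\<^sup>2)))"
    using pr ch by (intro mult_right_mono add_mono) auto
  also have "\<dots> = ((3 + 2 * v)\<^sup>2 * exp (- v\<^sup>2)) * (exp 1 * 2 ^ J * ?T) + (64 * log_unit\<^sup>2 / real q / (real N)\<^sup>2 * exp 1 * 2 ^ J * ?P) * exp (- v\<^sup>2)"
    by (simp add: algebra_simps)
  also have "\<dots> \<le> 18 * (exp 1 * 2 ^ J * ?T) + (64 * log_unit\<^sup>2 / real q / (real N)\<^sup>2 * exp 1 * 2 ^ J * ?P) * 1"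
  proof (intro add_mono mult_right_mono mult_left_mono)
    have "(3 + 2 * v)\<^sup>2 * exp (- v\<^sup>2) \<le> (18 * exp (v\<^sup>2)) * exp (- v\<^sup>2)"
      by (rule mult_right_mono[OF poly_exp_bounds(1)]) (auto simp: v_def)
    then show "(3 + 2 * v)\<^sup>2 * exp (- v\<^sup>2) \<le> 18" by (simp only: mult.assoc mult_exp_exp add.right_inverse exp_zero mult_1_right)
  qed auto
  also have "\<dots> = 18 * exp 1 * 2 ^ J * ?T + right_const * 2 ^ J / (real N)\<^sup>2 * ?P" by (simp add: right_const_def)
  finally show ?thesis .
qed

text \<open>At \<open>Re w = - 1\<close> the functional equation exchanges the roles: the tail now
  sits at \<open>1 - (s + w)\<close> on the line \<open>3 / 2\<close> with a gamma quotient of size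
  \<open>N^2\<close>, the partial sum sits on \<open>- (1 / 2)\<close>, and both gain the factor
  \<open>1 / 2 ^ J\<close>.\<close>

lemma afe_error_left:
  assumes s: "Re s = 1 / 2" and t: "\<bar>Im s\<bar> \<le> hecke_freq k / 2" and k: "k > 0" "k \<le> N" and w: "Re w = - 1"
  shows "norm (afe_error J s k w) \<le> 72 * exp 1 * (real q / (4 * pi\<^sup>2) * left_const\<^sup>2 * (real N)\<^sup>2 / 2 ^ J * norm (hecke_ext k (1 - (s + w)) - partial_sum J k (1 - (s + w)))
     + 1 / 2 ^ J * norm (partial_sum J k (s + w)))"
proof -
  let ?T = "norm (hecke_ext k (1 - (s + w)) - partial_sum J k (1 - (s + w)))" and ?P = "norm (partial_sum J k (s + w))"
  define b where "b = norm (shift_quad k s)"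
  define v where "v = \<bar>Im w\<bar>"
  have v: "v \<ge> 0" by (simp add: v_def)
  have kp0: "hecke_freq k > 0" using k log_unit_pos by (simp add: hecke_freq_def)
  then have "(hecke_freq k)\<^sup>2 / 4 > 0" by simp
  then have b: "b > 0" using shift_quad_lower[OF t] unfolding b_def by linarith
  have kpN: "hecke_freq k \<le> pi * real N / log_unit" unfolding hecke_freq_def using k log_unit_pos by (intro divide_right_mono mult_left_mono) auto
  have N1: "real N \<ge> 1" using k by simp
  have lin: "norm (s + w + c) \<le> real N * (left_const * (1 + v))" if c: "norm c = hecke_freq k" for c
  proof -
    have "norm (s + w) \<le> 1 / 2 + (hecke_freq k / 2 + v)"
      using cmod_le[of "s + w"] s w t unfolding v_def by simp
    then have "norm (s + w + c) \<le> 1 / 2 + v + 3 / 2 * hecke_freq k" using norm_triangle_ineq[of "s + w" c] c by linarith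
    also have "\<dots> \<le> real N * (1 + v) + 3 / 2 * (pi * real N / log_unit) * (1 + v)"
    proof (intro add_mono)
      have "1 * (1 / 2 + v) \<le> real N * (1 + v)" using N1 v by (intro mult_mono) auto
      then show "1 / 2 + v \<le> real N * (1 + v)" by simp
      have "3 / 2 * hecke_freq k * 1 \<le> 3 / 2 * (pi * real N / log_unit) * (1 + v)" using kpN v kp0 by (intro mult_mono) auto
      then show "3 / 2 * hecke_freq k \<le> 3 / 2 * (pi * real N / log_unit) * (1 + v)" by simp
    qed
    also have "\<dots> = real N * (left_const * (1 + v))" using log_unit_pos by (simp add: left_const_def field_simps)
    finally show ?thesis .
  qed
  have edc0: "left_const \<ge> 0" using log_unit_pos by (simp add: left_const_def)
  have "norm ((s + w)\<^sup>2 + (of_real (hecke_freq k))\<^sup>2) = norm (s + w + \<i> * of_real (hecke_freq k)) * norm (s + w + - (\<i> * of_real (hecke_freq k)))"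
    unfolding norm_mult[symmetric] by (simp add: power2_eq_square algebra_simps)
  also have "\<dots> \<le> (real N * (left_const * (1 + v))) * (real N * (left_const * (1 + v)))"
    using v edc0 hecke_freq_nonneg[of k] by (intro mult_mono lin) (auto simp: norm_mult)
  also have "\<dots> = left_const\<^sup>2 * (real N)\<^sup>2 * (1 + v)\<^sup>2" by (simp add: power2_eq_square)
  finally have quad: "norm ((s + w)\<^sup>2 + (of_real (hecke_freq k))\<^sup>2) \<le> left_const\<^sup>2 * (real N)\<^sup>2 * (1 + v)\<^sup>2" .
  let ?c = "real q / (4 * pi\<^sup>2) * (left_const\<^sup>2 * (real N)\<^sup>2 * (1 + v)\<^sup>2)"
  have ch: "norm (chi_quad k (s + w)) \<le> ?c * norm (shift_quad k (s + w))"
    using norm_chi_quad_minus_half[of "s + w" k] s w quad by (simp add: mult_right_mono mult_left_mono divide_right_mono)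
  have pr: "norm (shift_quad k (s + w)) / b \<le> (3 + 2 * v)\<^sup>2"
    using order_trans[OF shift_quad_ratio[OF s, of k w] mult_left_mono[OF one_plus_norm_squared_le, of w "norm (shift_quad k s)"]] w b
    by (simp add: divide_le_eq b_def v_def mult.commute)
  have "shift_quad k (s + w) * (hecke_ext k (s + w) - partial_sum J k (s + w)) - chi_quad k (s + w) * partial_sum J k (1 - (s + w))
    = chi_quad k (s + w) * (hecke_ext k (1 - (s + w)) - partial_sum J k (1 - (s + w))) - shift_quad k (s + w) * partial_sum J k (s + w)" (is "?num = _")
    using hecke_ext_functional[of "s + w" k] s w by (simp add: right_diff_distrib)
  then have "norm ?num \<le> norm (chi_quad k (s + w)) * ?T + norm (shift_quad k (s + w)) * ?P"
    unfolding norm_mult[symmetric] by (metis norm_triangle_ineq4)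
  also have "\<dots> \<le> (?c * norm (shift_quad k (s + w))) * ?T + norm (shift_quad k (s + w)) * ?P"
    using ch by (intro add_mono mult_right_mono) auto
  also have "\<dots> = norm (shift_quad k (s + w)) * (?c * ?T + ?P)" by (simp add: algebra_simps)
  finally have "norm ?num / b \<le> norm (shift_quad k (s + w)) / b * (?c * ?T + ?P)"
    using b by (simp add: divide_right_mono)
  also have "\<dots> \<le> (3 + 2 * v)\<^sup>2 * (?c * ?T + ?P)" using pr by (intro mult_right_mono) auto
  also have "\<dots> \<le> (3 + 2 * v)\<^sup>2 * ((1 + v)\<^sup>2 * (real q / (4 * pi\<^sup>2) * (left_const\<^sup>2 * (real N)\<^sup>2) * ?T + ?P))"
  proof (intro mult_left_mono)
    have "(1::real) ^ 2 \<le> (1 + v)\<^sup>2" using v by (intro power_mono) auto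
    then have "1 * ?P \<le> (1 + v)\<^sup>2 * ?P" by (intro mult_right_mono) auto
    then show "?c * ?T + ?P \<le> (1 + v)\<^sup>2 * (real q / (4 * pi\<^sup>2) * (left_const\<^sup>2 * (real N)\<^sup>2) * ?T + ?P)"
      by (simp add: distrib_left mult_ac)
  qed auto
  finally have num: "norm ?num / b \<le> ((3 + 2 * v)\<^sup>2 * (1 + v)\<^sup>2) * (real q / (4 * pi\<^sup>2) * (left_const\<^sup>2 * (real N)\<^sup>2) * ?T + ?P)"
    by (simp only: mult.assoc)
  have "norm (afe_error J s k w) = norm ?num / b * (1 / 2 ^ J * (exp 1 * exp (- v\<^sup>2)))"
    unfolding afe_error_def norm_divide norm_mult[of "_ - _"] norm_exp_afe_error b_def[symmetric]
    using w by (simp add: v_def mult_exp_exp powr_minus divide_inverse)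
  also have "\<dots> \<le> (((3 + 2 * v)\<^sup>2 * (1 + v)\<^sup>2) * (real q / (4 * pi\<^sup>2) * (left_const\<^sup>2 * (real N)\<^sup>2) * ?T + ?P)) * (1 / 2 ^ J * (exp 1 * exp (- v\<^sup>2)))"
    using num by (rule mult_right_mono) simp
  also have "\<dots> = (((3 + 2 * v)\<^sup>2 * (1 + v)\<^sup>2) * exp (- v\<^sup>2)) * (exp 1 * ((real q / (4 * pi\<^sup>2) * (left_const\<^sup>2 * (real N)\<^sup>2) * ?T + ?P) / 2 ^ J))"
    by (simp add: mult_ac)
  also have "\<dots> \<le> 72 * (exp 1 * ((real q / (4 * pi\<^sup>2) * (left_const\<^sup>2 * (real N)\<^sup>2) * ?T + ?P) / 2 ^ J))"
  proof (rule mult_right_mono)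
    have "((3 + 2 * v)\<^sup>2 * (1 + v)\<^sup>2) * exp (- v\<^sup>2) \<le> (72 * exp (v\<^sup>2)) * exp (- v\<^sup>2)"
      by (rule mult_right_mono[OF poly_exp_bounds(2)[OF v]]) simp
    then show "((3 + 2 * v)\<^sup>2 * (1 + v)\<^sup>2) * exp (- v\<^sup>2) \<le> 72" by (simp only: mult.assoc mult_exp_exp add.right_inverse exp_zero mult_1_right)
  qed auto
  also have "\<dots> = 72 * exp 1 * (real q / (4 * pi\<^sup>2) * left_const\<^sup>2 * (real N)\<^sup>2 / 2 ^ J * ?T + 1 / 2 ^ J * ?P)"
    by (simp add: add_divide_distrib distrib_left)
  finally show ?thesis .
qed

end


lemma L2_set_add_mult_le:
  fixes f g h :: "'a \<Rightarrow> complex"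
  assumes le: "\<And>k. k \<in> A \<Longrightarrow> norm (h k) \<le> a * norm (f k) + b * norm (g k)" and ab: "a \<ge> 0" "b \<ge> 0"
  shows "L2_set (\<lambda>k. norm (h k)) A \<le> a * L2_set (\<lambda>k. norm (f k)) A + b * L2_set (\<lambda>k. norm (g k)) A"
proof -
  have "L2_set (\<lambda>k. norm (h k)) A \<le> L2_set (\<lambda>k. a * norm (f k) + b * norm (g k)) A"
    using le by (intro L2_set_mono) auto
  also have "\<dots> \<le> L2_set (\<lambda>k. a * norm (f k)) A + L2_set (\<lambda>k. b * norm (g k)) A" by (rule L2_set_triangle_ineq)
  finally show ?thesis using ab by (simp add: L2_set_right_distrib)
qed

context quad_unit
begin

definition edge_const :: real where
  "edge_const = 18 * exp 1 * tail_const + 2 * right_const * sqrt sieve_const + 72 * exp 1 * (real q / pi\<^sup>2 * left_const\<^sup>2 * tail_const + 2 * sqrt sieve_const)"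

lemma const_nonneg: "tail_const \<ge> 0" "right_const \<ge> 0" "sqrt sieve_const \<ge> 0"
  using sieve_const_pos by (auto simp: tail_const_def right_const_def)

text \<open>As \<open>2 ^ J\<close> and \<open>N\<close> agree up to a factor two, the weights
  balance: tail and partial sum on either edge are all bounded by a constant times
  \<open>sqrt (N * (J + 1))\<close>.\<close>

lemma afe_error_edge:
  assumes A: "A \<subseteq> {1..N}" and s: "Re s = 1 / 2" and J: "2 ^ J \<le> N" "N < 2 ^ Suc J"
    and k: "\<And>k. k \<in> A \<Longrightarrow> real N \<le> 2 * real k" "\<And>k. k \<in> A \<Longrightarrow> \<bar>Im s\<bar> \<le> hecke_freq k / 2"
    and w: "\<bar>Re w\<bar> = 1"
  shows "L2_set (\<lambda>k. norm (afe_error J s k w)) A \<le> edge_const * sqrt (real N * (real J + 1))"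
proof -
  define X :: real where "X = 2 ^ J"
  have X: "X > 0" "X \<le> real N" "real N \<le> 2 * X"
    using J by (simp_all add: X_def numeral_power_le_of_nat_cancel_iff)
      (metis less_imp_le of_nat_less_numeral_power_cancel_iff power_Suc)
  have N0: "N > 0" using J(1) by (metis gr0I le_zero_eq power_not_zero zero_neq_numeral)
  define S where "S = sqrt (real N * (real J + 1))"
  have S: "S \<ge> 0" by (simp add: S_def)
  have mh: "L2_set (\<lambda>k. norm (partial_sum J k z)) A \<le> X * (2 * (sqrt sieve_const * S))" if "Re z = - (1 / 2)" for z
    using partial_sum_L2_minus_half[OF J(1) A that] unfolding X_def S_def real_sqrt_mult[of sieve_const] .
  have th: "X * L2_set (\<lambda>k. norm (hecke_ext k z - partial_sum J k z)) A \<le> tail_const * S" if "Re z = 3 / 2" for z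
  proof -
    have "sqrt (X * (real J + 1)) \<le> S" unfolding S_def using X by (intro real_sqrt_le_mono mult_right_mono) auto
    then have "tail_const * sqrt (X * (real J + 1)) \<le> tail_const * S" using const_nonneg by (intro mult_left_mono)
    then show ?thesis using tail_L2[OF J(2) A that] unfolding X_def by linarith
  qed
  let ?r = "18 * exp 1 * tail_const + 2 * right_const * sqrt sieve_const" and ?l = "72 * exp 1 * (real q / pi\<^sup>2 * left_const\<^sup>2 * tail_const + 2 * sqrt sieve_const)"
  have rl: "?r \<ge> 0" "?l \<ge> 0" using const_nonneg by auto
  have "L2_set (\<lambda>k. norm (afe_error J s k w)) A \<le> ?r * S \<or> L2_set (\<lambda>k. norm (afe_error J s k w)) A \<le> ?l * S"
  proof (cases "Re w = 1")
    case True
    have re: "Re (s + w) = 3 / 2" "Re (1 - (s + w)) = - (1 / 2)" using s True by auto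
    have "L2_set (\<lambda>k. norm (afe_error J s k w)) A \<le> 18 * exp 1 * X * L2_set (\<lambda>k. norm (hecke_ext k (s + w) - partial_sum J k (s + w))) A
       + right_const * X / (real N)\<^sup>2 * L2_set (\<lambda>k. norm (partial_sum J k (1 - (s + w)))) A"
      unfolding X_def by (intro L2_set_add_mult_le afe_error_right[OF s _ _ N0 _ True] k) (use A const_nonneg in auto)
    also have "\<dots> \<le> 18 * exp 1 * (tail_const * S) + right_const * X / (real N)\<^sup>2 * (X * (2 * (sqrt sieve_const * S)))"
    proof (rule add_mono)
      show "18 * exp 1 * X * L2_set (\<lambda>k. norm (hecke_ext k (s + w) - partial_sum J k (s + w))) A \<le> 18 * exp 1 * (tail_const * S)"
        using mult_left_mono[OF th[OF re(1)], of "18 * exp 1"] by (simp add: mult.assoc)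
      show "right_const * X / (real N)\<^sup>2 * L2_set (\<lambda>k. norm (partial_sum J k (1 - (s + w)))) A \<le> right_const * X / (real N)\<^sup>2 * (X * (2 * (sqrt sieve_const * S)))"
        using X const_nonneg by (intro mult_left_mono mh[OF re(2)]) auto
    qed
    also have "right_const * X / (real N)\<^sup>2 * (X * (2 * (sqrt sieve_const * S))) = (X / real N)\<^sup>2 * (2 * right_const * sqrt sieve_const * S)"
      by (simp add: power_divide power2_eq_square)
    also have "\<dots> \<le> 1 * (2 * right_const * sqrt sieve_const * S)"
      using X const_nonneg S N0 by (intro mult_right_mono) (auto simp: power_le_one)
    finally show ?thesis by (simp add: algebra_simps)
  next
    case False
    then have w1: "Re w = - 1" using w by linarith
    have re: "Re (1 - (s + w)) = 3 / 2" "Re (s + w) = - (1 / 2)" using s w1 by auto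
    let ?c = "real q / (4 * pi\<^sup>2) * left_const\<^sup>2 * (real N)\<^sup>2 / X"
    have "L2_set (\<lambda>k. norm (afe_error J s k w)) A \<le> 72 * exp 1 * ?c * L2_set (\<lambda>k. norm (hecke_ext k (1 - (s + w)) - partial_sum J k (1 - (s + w)))) A
       + 72 * exp 1 * (1 / X) * L2_set (\<lambda>k. norm (partial_sum J k (s + w))) A"
    proof (rule L2_set_add_mult_le)
      fix k assume kA: "k \<in> A"
      then have "k > 0" "k \<le> N" using A by auto
      from afe_error_left[OF s k(2)[OF kA] this w1, of J]
      show "norm (afe_error J s k w) \<le> 72 * exp 1 * ?c * norm (hecke_ext k (1 - (s + w)) - partial_sum J k (1 - (s + w))) + 72 * exp 1 * (1 / X) * norm (partial_sum J k (s + w))"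
        unfolding X_def by (simp only: distrib_left mult.assoc)
    qed (use X in auto)
    also have "\<dots> = 72 * exp 1 * (real q / (4 * pi\<^sup>2) * left_const\<^sup>2 * (real N / X)\<^sup>2 * (X * L2_set (\<lambda>k. norm (hecke_ext k (1 - (s + w)) - partial_sum J k (1 - (s + w)))) A)
       + 1 / X * L2_set (\<lambda>k. norm (partial_sum J k (s + w))) A)"
      using X by (simp add: power_divide power2_eq_square distrib_left)
    also have "\<dots> \<le> 72 * exp 1 * (real q / (4 * pi\<^sup>2) * left_const\<^sup>2 * 4 * (tail_const * S) + 1 / X * (X * (2 * (sqrt sieve_const * S))))"
    proof (intro mult_left_mono add_mono)
      have "(real N / X)\<^sup>2 \<le> 2\<^sup>2" using X by (intro power_mono) (auto simp: divide_le_eq)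
      then have "(real N / X)\<^sup>2 \<le> 4" by simp
      then have a1: "real q / (4 * pi\<^sup>2) * left_const\<^sup>2 * (real N / X)\<^sup>2 \<le> real q / (4 * pi\<^sup>2) * left_const\<^sup>2 * 4"
        by (intro mult_left_mono) auto
      show "real q / (4 * pi\<^sup>2) * left_const\<^sup>2 * (real N / X)\<^sup>2 * (X * L2_set (\<lambda>k. norm (hecke_ext k (1 - (s + w)) - partial_sum J k (1 - (s + w)))) A)
        \<le> real q / (4 * pi\<^sup>2) * left_const\<^sup>2 * 4 * (tail_const * S)"
        by (rule mult_mono[OF a1 th[OF re(1)]]) (use X in auto)
    qed (use X mh[OF re(2)] in auto)
    also have "\<dots> = ?l * S" using X by (simp add: algebra_simps)
    finally show ?thesis by simp
  qed
  moreover have "?r * S \<le> edge_const * S" "?l * S \<le> edge_const * S"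
    using rl S unfolding edge_const_def by (auto intro!: mult_right_mono)
  ultimately show ?thesis unfolding S_def by linarith
qed

lemma shift_quad_nonzero:
  assumes "\<bar>Im s\<bar> \<le> hecke_freq k / 2" "k > 0"
  shows "shift_quad k s \<noteq> 0"
proof -
  have "hecke_freq k > 0" using assms log_unit_pos by (simp add: hecke_freq_def)
  then have "(hecke_freq k)\<^sup>2 / 4 > 0" by simp
  then show ?thesis using shift_quad_lower[OF assms(1)] by auto
qed

text \<open>At \<open>w = 0\<close> the value is the error plus two partial sums, and the second one
  has a coefficient of modulus one on the critical line. The logarithms are \<open>J\<close> from
  adding blocks and \<open>sqrt (J + 1)\<close> from the sieve, rounded up to
  \<open>(J + 1)^2\<close> before squaring.\<close>

lemma sum_hecke_ext_squared_le:
  assumes A: "A \<subseteq> {1..N}" and s: "Re s = 1 / 2" and J: "2 ^ J \<le> N" "N < 2 ^ Suc J"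
    and k: "\<And>k. k \<in> A \<Longrightarrow> real N \<le> 2 * real k" "\<And>k. k \<in> A \<Longrightarrow> \<bar>Im s\<bar> \<le> hecke_freq k / 2"
  shows "(\<Sum>k\<in>A. (norm (hecke_ext k s))\<^sup>2) \<le> (edge_const + 2 * sqrt (2 * sieve_const))\<^sup>2 * real N * (real J + 1) ^ 4"
proof -
  have nz: "shift_quad k s \<noteq> 0" if "k \<in> A" for k using shift_quad_nonzero[OF k(2)[OF that]] A that by auto
  have H: "L2_set (\<lambda>k. norm (afe_error J s k 0)) A \<le> edge_const * sqrt (real N * (real J + 1))"
    by (rule maximum_modulus_strip_L2[OF afe_error_holomorphic[OF s] afe_error_edge[OF A s J k] afe_error_decay[OF s nz]])
  have P: "L2_set (\<lambda>k. norm (partial_sum J k s)) A \<le> real J * sqrt (sieve_const * (2 * real N * (real J + 1)))"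
    "L2_set (\<lambda>k. norm (partial_sum J k (1 - s))) A \<le> real J * sqrt (sieve_const * (2 * real N * (real J + 1)))"
    by (rule partial_sum_L2_half[OF J(1) A], use s in simp)+
  have "L2_set (\<lambda>k. norm (hecke_ext k s)) A \<le> L2_set (\<lambda>k. norm (afe_error J s k 0) + (norm (partial_sum J k s) + norm (partial_sum J k (1 - s)))) A"
  proof (rule L2_set_mono)
    fix k assume kA: "k \<in> A"
    have "hecke_ext k s = afe_error J s k 0 + (partial_sum J k s + chi_quad k s / shift_quad k s * partial_sum J k (1 - s))"
      using afe_error_0[OF nz[OF kA], of J] by simp
    also have "norm \<dots> \<le> norm (afe_error J s k 0) + (norm (partial_sum J k s) + norm (chi_quad k s / shift_quad k s * partial_sum J k (1 - s)))"
      by (intro norm_triangle_le add_mono norm_triangle_ineq order_refl)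
    also have "norm (chi_quad k s / shift_quad k s * partial_sum J k (1 - s)) = norm (partial_sum J k (1 - s))"
      using nz[OF kA] norm_chi_quad_half[OF s, of k] by (simp add: norm_mult norm_divide)
    finally show "norm (hecke_ext k s) \<le> norm (afe_error J s k 0) + (norm (partial_sum J k s) + norm (partial_sum J k (1 - s)))" .
  qed auto
  also have "\<dots> \<le> L2_set (\<lambda>k. norm (afe_error J s k 0)) A + (L2_set (\<lambda>k. norm (partial_sum J k s)) A + L2_set (\<lambda>k. norm (partial_sum J k (1 - s))) A)"
    by (rule order_trans[OF L2_set_triangle_ineq add_left_mono[OF L2_set_triangle_ineq]])
  also have "\<dots> \<le> edge_const * sqrt (real N * (real J + 1)) + (real J * sqrt (sieve_const * (2 * real N * (real J + 1))) + real J * sqrt (sieve_const * (2 * real N * (real J + 1))))"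
    by (intro add_mono H P)
  also have "\<dots> = sqrt (real N) * (edge_const * sqrt (real J + 1) + 2 * sqrt (2 * sieve_const) * (real J * sqrt (real J + 1)))"
  proof -
    have "sieve_const * (2 * real N * (real J + 1)) = real N * ((2 * sieve_const) * (real J + 1))" by simp
    then have e: "sqrt (sieve_const * (2 * real N * (real J + 1))) = sqrt (real N) * (sqrt (2 * sieve_const) * sqrt (real J + 1))"
      by (simp only: real_sqrt_mult)
    have "c * (a * b) + (j * (a * (d * b)) + j * (a * (d * b))) = a * (c * b + 2 * d * (j * b))" for a b c d j :: real
      by (simp add: algebra_simps)
    then show ?thesis unfolding e real_sqrt_mult[of "real N"] .
  qed
  also have "\<dots> \<le> sqrt (real N) * (edge_const * (real J + 1)\<^sup>2 + 2 * sqrt (2 * sieve_const) * (real J + 1)\<^sup>2)"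
  proof (intro mult_left_mono add_mono)
    have j: "sqrt (real J + 1) \<le> real J + 1" by (rule real_le_lsqrt) (auto simp: power2_eq_square algebra_simps)
    have "real J * sqrt (real J + 1) \<le> (real J + 1) * (real J + 1)" using j by (intro mult_mono) auto
    then show "real J * sqrt (real J + 1) \<le> (real J + 1)\<^sup>2" by (simp add: power2_eq_square)
    show "sqrt (real J + 1) \<le> (real J + 1)\<^sup>2" using j self_le_power[of "real J + 1" 2] by simp
  qed (use const_nonneg sieve_const_pos in \<open>auto simp: edge_const_def\<close>)
  finally have "L2_set (\<lambda>k. norm (hecke_ext k s)) A \<le> sqrt (real N) * ((edge_const + 2 * sqrt (2 * sieve_const)) * (real J + 1)\<^sup>2)"
    by (simp add: distrib_right)
  then have "(L2_set (\<lambda>k. norm (hecke_ext k s)) A)\<^sup>2 \<le> (sqrt (real N) * ((edge_const + 2 * sqrt (2 * sieve_const)) * (real J + 1)\<^sup>2))\<^sup>2"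
    by (intro power_mono) auto
  also have "\<dots> = (edge_const + 2 * sqrt (2 * sieve_const))\<^sup>2 * real N * (real J + 1) ^ 4"
    by (simp add: power_mult_distrib flip: power_mult)
  finally show ?thesis by (simp add: L2_set_def sum_nonneg)
qed

text \<open>From \<open>x ^ 4 <= exp (4 * x)\<close>, with \<open>x\<close> chosen so that the right
  side is \<open>(2 ^ (J + 1)) powr \<epsilon>\<close>.\<close>

lemma log_power_bound:
  fixes \<epsilon> K :: real
  assumes e: "\<epsilon> > 0" and J: "2 ^ J \<le> N" and N: "real N \<le> 2 * K"
  shows "(real J + 1) ^ 4 \<le> (4 / (\<epsilon> * ln 2)) ^ 4 * 4 powr \<epsilon> * K powr \<epsilon>"
proof -
  define x where "x = (real J + 1) * (\<epsilon> * ln 2) / 4"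
  have x: "x \<ge> 0" using e by (simp add: x_def)
  have NJ: "2 ^ J \<le> real N" using J by (metis numeral_power_le_of_nat_cancel_iff)
  have K0: "K > 0" using NJ N zero_less_power[of "2::real" J] by linarith
  have "x ^ 4 \<le> (exp x) ^ 4" using x exp_ge_add_one_self[of x] by (intro power_mono) linarith+
  also have "\<dots> = (2 ^ (J + 1)) powr \<epsilon>"
    by (simp add: powr_def x_def ln_mult ln_realpow algebra_simps flip: exp_of_nat_mult)
  also have "\<dots> \<le> (4 * K) powr \<epsilon>"
  proof (rule powr_mono2)
    have "2 ^ J \<le> 2 * K" using NJ N by (rule order_trans)
    then show "2 ^ (J + 1) \<le> 4 * K" by simp
  qed (use e in auto)
  also have "\<dots> = 4 powr \<epsilon> * K powr \<epsilon>" using K0 by (simp add: powr_mult)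
  finally have "(4 / (\<epsilon> * ln 2)) ^ 4 * x ^ 4 \<le> (4 / (\<epsilon> * ln 2)) ^ 4 * (4 powr \<epsilon> * K powr \<epsilon>)"
    using e by (intro mult_left_mono) auto
  moreover have "(4 / (\<epsilon> * ln 2)) ^ 4 * x ^ 4 = (real J + 1) ^ 4"
  proof -
    have "4 / (\<epsilon> * ln 2) * x = real J + 1" unfolding x_def using e by (simp add: field_simps)
    then show ?thesis unfolding power_mult_distrib[symmetric] by simp
  qed
  ultimately show ?thesis by simp
qed

text \<open>The threshold \<open>K1\<close> is where \<open>K powr \<epsilon>\<close> reaches
  \<open>2 * log_unit * B / pi\<close>. Beyond it the bound on \<open>t\<close> implies
  \<open>|t| <= hecke_freq k / 2\<close> for every \<open>k > K\<close>, so the estimate for sums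
  over the family applies.\<close>

lemma mean_square:
  fixes \<epsilon> B :: real
  assumes e: "\<epsilon> > 0" and B: "B > 0"
  shows "\<exists>C>0. \<forall>(K::real) (t::real). K \<ge> 2 \<longrightarrow> \<bar>t\<bar> \<le> B * K powr (1 - \<epsilon>) \<longrightarrow>
    1 / K * (\<Sum>k | K < real k \<and> real k \<le> 2 * K. (norm (hecke_ext k (1 / 2 + \<i> * of_real t)))\<^sup>2) \<le> C * K powr \<epsilon>"
proof -
  \<comment> \<open>for \<open>K < K1\<close> the condition \<open>\<bar>t\<bar> \<le> hecke_freq k / 2\<close> may fail; there a compactness argument suffices\<close>
  define K1 where "K1 = max 2 ((2 * log_unit * B / pi) powr (1 / \<epsilon>))"
  define N1 where "N1 = nat \<lfloor>2 * K1\<rfloor>"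
  define D where "D = (4 / (\<epsilon> * ln 2)) ^ 4 * 4 powr \<epsilon>"
  define C1 where "C1 = (edge_const + 2 * sqrt (2 * sieve_const))\<^sup>2"
  have "\<exists>m. \<forall>t. \<bar>t\<bar> \<le> B * K1 \<longrightarrow> (norm (hecke_ext k (1 / 2 + \<i> * complex_of_real t)))\<^sup>2 \<le> m" for k
  proof -
    have "continuous_on {- (B * K1)..B * K1} (\<lambda>t. (norm (hecke_ext k (1 / 2 + \<i> * complex_of_real t)))\<^sup>2)"
      by (intro continuous_intros continuous_on_compose2[OF holomorphic_on_imp_continuous_on[OF hecke_ext_holomorphic]]) auto
    then have "bounded ((\<lambda>t. (norm (hecke_ext k (1 / 2 + \<i> * complex_of_real t)))\<^sup>2) ` {- (B * K1)..B * K1})"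
      by (intro compact_imp_bounded compact_continuous_image) auto
    then obtain m where "\<forall>x\<in>(\<lambda>t. (norm (hecke_ext k (1 / 2 + \<i> * complex_of_real t)))\<^sup>2) ` {- (B * K1)..B * K1}. norm x \<le> m"
      unfolding bounded_iff by blast
    moreover have "t \<in> {- (B * K1)..B * K1}" if "\<bar>t\<bar> \<le> B * K1" for t
      using that unfolding atLeastAtMost_iff by linarith
    ultimately have "norm ((norm (hecke_ext k (1 / 2 + \<i> * complex_of_real t)))\<^sup>2) \<le> m" if "\<bar>t\<bar> \<le> B * K1" for t
      using that by blast
    then show ?thesis unfolding real_norm_def abs_power2 by blast
  qed
  then obtain m where m: "\<And>k t. \<bar>t\<bar> \<le> B * K1 \<Longrightarrow> (norm (hecke_ext k (1 / 2 + \<i> * complex_of_real t)))\<^sup>2 \<le> m k" by metis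
  have m0: "m k \<ge> 0" for k
  proof -
    have "B * K1 \<ge> 0" using B by (simp add: K1_def)
    then show ?thesis by (intro order_trans[OF zero_le_power2 m[of 0 k]]) simp
  qed
  define Mb where "Mb = (\<Sum>k\<in>{1..N1}. m k)"
  have Mb: "Mb \<ge> 0" unfolding Mb_def by (intro sum_nonneg m0)
  have D0: "D \<ge> 0" using e by (simp add: D_def)
  have C10: "C1 \<ge> 0" by (simp add: C1_def)
  show ?thesis
  proof (intro exI[of _ "2 * C1 * D + Mb + 1"] conjI allI impI)
    show "2 * C1 * D + Mb + 1 > 0" using D0 C10 Mb by (simp add: add_nonneg_pos)
    fix K t :: real assume K: "K \<ge> 2" and t: "\<bar>t\<bar> \<le> B * K powr (1 - \<epsilon>)"
    define A where "A = {k. K < real k \<and> real k \<le> 2 * K}"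
    \<comment> \<open>With \<open>N\<close> the floor of \<open>2 * K\<close>, every
      \<open>k\<close> of the range satisfies \<open>k <= N <= 2 * k\<close>, which makes all
      frequencies comparable with \<open>N\<close>.\<close>
    define N where "N = nat \<lfloor>2 * K\<rfloor>"
    have N: "real N \<le> 2 * K" "2 * K < real N + 1" using K by (auto simp: N_def)
    have A: "A \<subseteq> {1..N}"
    proof
      fix k assume "k \<in> A"
      then have "1 \<le> k" "k \<le> N" using K by (auto simp: A_def N_def le_nat_floor)
      then show "k \<in> {1..N}" by simp
    qed
    have Ke: "K powr \<epsilon> \<ge> 1" using K e by (intro ge_one_powr_ge_zero) auto
    define s where "s = 1 / 2 + \<i> * complex_of_real t"
    have s: "Re s = 1 / 2" "Im s = t" by (simp_all add: s_def)
    have "1 / K * (\<Sum>k\<in>A. (norm (hecke_ext k s))\<^sup>2) \<le> (2 * C1 * D + Mb + 1) * K powr \<epsilon>"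
    proof (cases "K \<ge> K1")
      case True
      have "2 * log_unit * B / pi = ((2 * log_unit * B / pi) powr (1 / \<epsilon>)) powr \<epsilon>"
        using e B log_unit_pos by (simp add: powr_powr)
      also have "\<dots> \<le> K powr \<epsilon>" using True e by (intro powr_mono2) (auto simp: K1_def)
      finally have b: "2 * log_unit * B / pi \<le> K powr \<epsilon>" .
      have "B * K powr (1 - \<epsilon>) = B * K / K powr \<epsilon>" using K by (simp add: powr_diff)
      also have "\<dots> \<le> B * K / (2 * log_unit * B / pi)" using b B K log_unit_pos by (intro divide_left_mono) auto
      also have "\<dots> = pi * K / (2 * log_unit)" using B by simp
      finally have tK: "\<bar>t\<bar> \<le> pi * K / (2 * log_unit)" using t by linarith
      have N0: "N \<ge> 1" using N K by linarith
      then obtain J where J: "2 ^ J \<le> N" "N < 2 ^ Suc J" using ex_power_ivl1[of 2 N] by auto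
      have "(\<Sum>k\<in>A. (norm (hecke_ext k s))\<^sup>2) \<le> C1 * real N * (real J + 1) ^ 4"
        unfolding C1_def
      proof (rule sum_hecke_ext_squared_le[OF A s(1) J])
        fix k assume "k \<in> A"
        then have k: "K < real k" by (simp add: A_def)
        then show "real N \<le> 2 * real k" using N by linarith
        have "pi * K / (2 * log_unit) \<le> hecke_freq k / 2" unfolding hecke_freq_def using k log_unit_pos by (simp add: field_simps)
        then show "\<bar>Im s\<bar> \<le> hecke_freq k / 2" using tK s by linarith
      qed
      also have "\<dots> \<le> C1 * (2 * K) * (D * K powr \<epsilon>)"
        using log_power_bound[OF e J(1) N(1)] N C10 K unfolding D_def by (intro mult_mono mult_left_mono) auto
      finally have "1 / K * (\<Sum>k\<in>A. (norm (hecke_ext k s))\<^sup>2) \<le> 1 / K * (C1 * (2 * K) * (D * K powr \<epsilon>))"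
        using K by (intro mult_left_mono) auto
      also have "\<dots> = 2 * C1 * D * K powr \<epsilon>" using K by simp
      also have "\<dots> \<le> (2 * C1 * D + Mb + 1) * K powr \<epsilon>" using Mb by (intro mult_right_mono) auto
      finally show ?thesis .
    next
      case False
      then have KK: "K < K1" by simp
      have "K powr (1 - \<epsilon>) \<le> K powr 1" using K e by (intro powr_mono) auto
      then have "B * K powr (1 - \<epsilon>) \<le> B * K1" using KK K B by (intro mult_left_mono) auto
      then have tK: "\<bar>t\<bar> \<le> B * K1" using t by linarith
      have "A \<subseteq> {1..N1}"
      proof
        fix k assume "k \<in> A"
        then have "1 \<le> k" "real k \<le> 2 * K1" using K KK by (auto simp: A_def)
        then have "1 \<le> k" "k \<le> N1" by (auto simp: N1_def le_nat_floor)
        then show "k \<in> {1..N1}" by simp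
      qed
      then have "(\<Sum>k\<in>A. (norm (hecke_ext k s))\<^sup>2) \<le> (\<Sum>k\<in>{1..N1}. (norm (hecke_ext k s))\<^sup>2)" by (intro sum_mono2) auto
      also have "\<dots> \<le> Mb" unfolding Mb_def s_def by (intro sum_mono m tK)
      finally have "1 / K * (\<Sum>k\<in>A. (norm (hecke_ext k s))\<^sup>2) \<le> 1 * Mb"
        using K by (intro mult_mono sum_nonneg) auto
      also have "\<dots> \<le> (2 * C1 * D + Mb + 1) * 1" using D0 C10 by simp
      also have "\<dots> \<le> (2 * C1 * D + Mb + 1) * K powr \<epsilon>" using Ke D0 C10 Mb by (intro mult_left_mono) auto
      finally show ?thesis .
    qed
    then show "1 / K * (\<Sum>k | K < real k \<and> real k \<le> 2 * K. (norm (hecke_ext k (1 / 2 + \<i> * of_real t)))\<^sup>2) \<le> (2 * C1 * D + Mb + 1) * K powr \<epsilon>"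
      by (simp add: A_def s_def)
  qed
qed

end


section \<open>Identification with the Hecke L-function\<close>

context real_quad_narrow
begin

sublocale Q: quad_unit q eps
proof
  show "eps > 1" by (rule fundamental_unit_props(1))
  show "\<exists>e. val q e = eps powi j \<and> \<bar>qnorm q e\<bar> = 1" for j by (metis unit_shift)
qed

lemma dirichlet_term_ideal:
  assumes z: "z \<in> fdom q eps"
  shows "hecke_char q k (PIdl\<^bsub>R\<^esub> (val q z)) / of_nat (ideal_norm q (PIdl\<^bsub>R\<^esub> (val q z))) powr s = Q.dirichlet_term k s z"
proof -
  have z0: "z \<noteq> 0" by (rule Q.fdom_nonzero[OF z])
  define n where "n = \<bar>real_of_int (qnorm q z)\<bar>"
  have n: "n \<ge> 1" unfolding n_def by (rule Q.abs_norm_ge_1[OF z0])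
  have "n = real_of_int \<bar>qnorm q z\<bar>" by (simp add: n_def)
  then have "of_nat (nat \<bar>qnorm q z\<bar>) = complex_of_real n" by (simp only: of_real_of_int_eq) simp
  then have "of_nat (ideal_norm q (PIdl\<^bsub>R\<^esub> (val q z))) powr s = exp (s * of_real (ln n))"
    unfolding ideal_norm_PIdl[OF z0] using n by (simp add: powr_def Ln_of_real)
  then show ?thesis
    unfolding hecke_char_PIdl[OF z0] Q.dirichlet_term_theta n_def by (simp add: exp_minus divide_inverse mult.commute)
qed

text \<open>\<open>hecke_ext k\<close> has the defining property of the description, and the
  identity theorem, applied from the half plane \<open>Re s > 1\<close>, shows that it is the only
  such function.\<close>

lemma hecke_L_eq_hecke_ext:
  assumes k: "k > 0"
  shows "hecke_L q k = Q.hecke_ext k"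
proof -
  let ?P = "\<lambda>f. f holomorphic_on UNIV \<and> (\<forall>s. Re s > 1 \<longrightarrow>
        ((\<lambda>I. hecke_char q k I / of_nat (ideal_norm q I) powr s) has_sum f s) (nonzero_ideals q))"
  have hecke_ext: "((\<lambda>I. hecke_char q k I / of_nat (ideal_norm q I) powr s) has_sum Q.hecke_ext k s) (nonzero_ideals q)" if s: "Re s > 1" for s
  proof -
    have "((\<lambda>z. hecke_char q k (PIdl\<^bsub>R\<^esub> (val q z)) / of_nat (ideal_norm q (PIdl\<^bsub>R\<^esub> (val q z))) powr s) has_sum Q.hecke_ext k s) (fdom q eps)"
      by (rule has_sum_cong[THEN iffD2, OF dirichlet_term_ideal Q.hecke_ext_has_sum[OF s k]])
    then show ?thesis by (rule has_sum_reindex_bij_betw[OF bij_betw_fdom_ideals, THEN iffD1])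
  qed
  have "(THE f. ?P f) = Q.hecke_ext k"
  proof (rule the_equality)
    show "?P (Q.hecke_ext k)" using hecke_ext Q.hecke_ext_holomorphic by blast
    fix f assume f: "?P f"
    have eq: "f s = Q.hecke_ext k s" if "s \<in> {s. Re s > 1}" for s
      using f hecke_ext[of s] that has_sum_unique by blast
    show "f = Q.hecke_ext k"
    proof
      fix s
      show "f s = Q.hecke_ext k s"
      proof (rule analytic_continuation_open[of "{s. Re s > 1}" UNIV f "Q.hecke_ext k"])
        show "open {s. Re s > 1}" by (rule open_halfspace_Re_gt)
        have "2 \<in> {s. Re s > 1}" by simp
        then show "{s. Re s > 1} \<noteq> {}" by blast
      qed (use f Q.hecke_ext_holomorphic eq in auto)
    qed
  qed
  then show ?thesis unfolding hecke_L_def .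
qed

end

theorem theorem4:
  fixes q :: nat
  assumes "prime q" and "q > 8" and "q mod 4 = 1"
    and "narrow_class_number q = 1"
  shows "\<exists>K0\<ge>2. \<forall>\<epsilon>>0. \<forall>A>0. \<exists>C>0. \<forall>(K::real) (t::real).
           K \<ge> K0 \<longrightarrow> \<bar>t\<bar> \<le> A * K powr (1 - \<epsilon>) \<longrightarrow>
           1 / K * (\<Sum>k | K < real k \<and> real k \<le> 2 * K.
              (cmod (hecke_L q k (1 / 2 + \<i> * complex_of_real t)))\<^sup>2) \<le> C * K powr \<epsilon>"
proof -
  interpret real_quad_narrow q using assms by unfold_locales
  have eq: "(\<Sum>k | K < real k \<and> real k \<le> 2 * K. (cmod (hecke_L q k s))\<^sup>2) = (\<Sum>k | K < real k \<and> real k \<le> 2 * K. (cmod (Q.hecke_ext k s))\<^sup>2)"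
    if "K \<ge> 2" for K s
  proof (intro sum.cong refl)
    fix k assume "k \<in> {k. K < real k \<and> real k \<le> 2 * K}"
    then have "k > 0" using that by (auto intro: gr0I)
    then show "(cmod (hecke_L q k s))\<^sup>2 = (cmod (Q.hecke_ext k s))\<^sup>2" by (simp add: hecke_L_eq_hecke_ext)
  qed
  have "\<exists>C>0. \<forall>(K::real) (t::real). K \<ge> 2 \<longrightarrow> \<bar>t\<bar> \<le> A * K powr (1 - \<epsilon>) \<longrightarrow>
      1 / K * (\<Sum>k | K < real k \<and> real k \<le> 2 * K. (cmod (hecke_L q k (1 / 2 + \<i> * complex_of_real t)))\<^sup>2) \<le> C * K powr \<epsilon>"
    if e: "\<epsilon> > 0" "A > 0" for \<epsilon> A
  proof -
    obtain C where C: "C > 0" "\<And>K t. K \<ge> 2 \<Longrightarrow> \<bar>t\<bar> \<le> A * K powr (1 - \<epsilon>) \<Longrightarrow>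
      1 / K * (\<Sum>k | K < real k \<and> real k \<le> 2 * K. (cmod (Q.hecke_ext k (1 / 2 + \<i> * complex_of_real t)))\<^sup>2) \<le> C * K powr \<epsilon>"
      using Q.mean_square[OF e] by blast
    show ?thesis by (intro exI[of _ C]) (use C eq in auto)
  qed
  \<comment> \<open>The threshold \<open>2\<close> is uniform in \<open>\<epsilon>\<close>: the
    finite range where \<open>K\<close> is small against \<open>\<epsilon>\<close> and
    \<open>A\<close> has been absorbed into \<open>C\<close>.\<close>
  then show ?thesis by (intro exI[of _ 2]) auto
qed

end
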